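(* Let $N>K\ge2$, let $V\in\mathcal C^{\mathcal G(K)}(\mathbb{R}^N)$ satisfy (V1) and let $f$ satisfy (F1)–(F4). Then either $c_1$ is a critical value of $\mathcal J_1$ (i.e. there is $u\in X_1^{\mathcal G(K)}\setminus\{0\}$ with $\mathcal J_1'(u)=0$ and $\mathcal J_1(u)=c_1$), or $c_1\ge m_{V_\infty}$.
   Context: Throughout, $N>K\ge 2$ are integers, $2^*=\frac{2N}{N-2}$, and points of $\mathbb{R}^N$ are written $x=(y,z)$ with $y\in\mathbb{R}^K$, $z\in\mathbb{R}^{N-K}$. $\mathcal G(K)=\mathcal O(K)\times I_{N-K}\subset\mathcal O(N)$; a function $u$ on $\mathbb{R}^N$ is $\mathcal G(K)$-invariant if $u(Ay,z)=u(y,z)$ for all $A\in\mathcal O(K)$. $\mathcal C^{\mathcal G(K)}(\mathbb{R}^N)$ is the set of continuous $\mathcal G(K)$-invariant functions and $H^1_{\mathcal G(K)}(\mathbb{R}^N)$ the set of $\mathcal G(K)$-invariant functions in $H^1(\mathbb{R}^N)$. Assumptions on $f:\mathbb{R}\to\mathbb{R}$, with $F(u)=\int_0^u f(s)\,ds$: (F1) $f$ is continuous and there is $p\in(2,2^* )$ with $|f(u)|\le C(1+|u|^{p-1})$ for all $u$; (F2) $f(u)=o(u)$ as $u\to0$; (F3) $F(u)/u^2\to+\infty$ as $|u|\to\infty$; (F4) $u\mapsto f(u)/|u|$ is increasing on $(-\infty,0)$ and on $(0,\infty)$. Assumption on $V$: (V1) $V$ is continuous and $0<V_0:=\inf V\le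 V(0)<V_\infty\le\liminf_{|x|\to\infty}V(x)$ for some real number $V_\infty$ (the $\liminf$ may be $+\infty$). $X_1=\{u\in H^1(\mathbb{R}^N):\int\frac{u^2}{|y|^2}+Vu^2\,dx<\infty\}$ with $\|u\|_1^2=\int|\nabla u|^2+\frac{u^2}{|y|^2}+Vu^2\,dx$, $X_1^{\mathcal G(K)}=X_1\cap H^1_{\mathcal G(K)}(\mathbb{R}^N)$; $\mathcal J_1(u)=\frac12\|u\|_1^2-\int F(u)\,dx$; $\mathcal N_1=\{u\in X_1^{\mathcal G(K)}\setminus\{0\}:\|u\|_1^2=\int f(u)u\}$, $c_1=\inf_{\mathcal N_1}\mathcal J_1$. $Y=\{u\in H^1(\mathbb{R}^N):\int\frac{u^2}{|y|^2}<\infty\}$, $Y^{\mathcal G(K)}$ its invariant subspace; for $k>0$: $\Phi_k(u)=\frac12\int|\nabla u|^2+\frac{u^2}{|y|^2}+ku^2\,dx-\int F(u)\,dx$, $\mathcal M_k=\{u\in Y^{\mathcal G(K)}\setminus\{0\}:\int|\nabla u|^2+\frac{u^2}{|y|^2}+ku^2=\int f(u)u\}$, $m_k=\inf_{\mathcal M_k}\Phi_k$. *)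

theory Defs
  imports "HOL-Analysis.Analysis"
begin

text \<open>Points of R^N are pairs (y,z) with y in a K-dimensional and z in an
(N-K)-dimensional Euclidean space.\<close>

definition test_fun :: "('a::euclidean_space \<Rightarrow> real) \<Rightarrow> bool" where
  "test_fun \<phi> \<longleftrightarrow> (\<forall>x. \<phi> differentiable (at x))
     \<and> (\<forall>e\<in>Basis. continuous_on UNIV (\<lambda>x. frechet_derivative \<phi> (at x) e))
     \<and> compact (closure {x. \<phi> x \<noteq> 0})"

definition weak_gradient :: "('a::euclidean_space \<Rightarrow> real) \<Rightarrow> ('a \<Rightarrow> 'a) \<Rightarrow> bool" where
  "weak_gradient u g \<longleftrightarrow> g \<in> borel_measurable lebesgue \<and>
     (\<forall>\<phi>. test_fun \<phi> \<longrightarrow> (\<forall>e\<in>Basis.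
        (LINT x|lebesgue. u x * frechet_derivative \<phi> (at x) e)
          = - (LINT x|lebesgue. (g x \<bullet> e) * \<phi> x)))"

definition H1 :: "('a::euclidean_space \<Rightarrow> real) \<Rightarrow> bool" where
  "H1 u \<longleftrightarrow> u \<in> borel_measurable lebesgue \<and> integrable lebesgue (\<lambda>x. (u x)^2) \<and>
     (\<exists>g. weak_gradient u g \<and> integrable lebesgue (\<lambda>x. (norm (g x))^2))"

definition grad :: "('a::euclidean_space \<Rightarrow> real) \<Rightarrow> ('a \<Rightarrow> 'a)" where
  "grad u = (SOME g. weak_gradient u g \<and> integrable lebesgue (\<lambda>x. (norm (g x))^2))"

definition G_invariant :: "('y::real_inner \<times> 'z \<Rightarrow> 'b) \<Rightarrow> bool" where
  "G_invariant u \<longleftrightarrow> (\<forall>A y z. orthogonal_transformation A \<longrightarrow> u (A y, z) = u (y, z))"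

definition prim :: "(real \<Rightarrow> real) \<Rightarrow> real \<Rightarrow> real" where
  "prim f u = (if 0 \<le> u then integral {0..u} f else - integral {u..0} f)"

definition X1 :: "('y::euclidean_space \<times> 'z::euclidean_space \<Rightarrow> real)
                    \<Rightarrow> ('y \<times> 'z \<Rightarrow> real) \<Rightarrow> bool" where
  "X1 V u \<longleftrightarrow> H1 u \<and>
     integrable lebesgue (\<lambda>x. (u x)^2 / (norm (fst x))^2 + V x * (u x)^2)"

definition X1G :: "('y::euclidean_space \<times> 'z::euclidean_space \<Rightarrow> real)
                    \<Rightarrow> ('y \<times> 'z \<Rightarrow> real) \<Rightarrow> bool" where
  "X1G V u \<longleftrightarrow> X1 V u \<and> G_invariant u"

definition norm1sq :: "('y::euclidean_space \<times> 'z::euclidean_space \<Rightarrow> real)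
                    \<Rightarrow> ('y \<times> 'z \<Rightarrow> real) \<Rightarrow> real" where
  "norm1sq V u = (LINT x|lebesgue. (norm (grad u x))^2 + (u x)^2 / (norm (fst x))^2 + V x * (u x)^2)"

definition J1 :: "('y::euclidean_space \<times> 'z::euclidean_space \<Rightarrow> real) \<Rightarrow> (real \<Rightarrow> real)
                    \<Rightarrow> ('y \<times> 'z \<Rightarrow> real) \<Rightarrow> real" where
  "J1 V f u = norm1sq V u / 2 - (LINT x|lebesgue. prim f (u x))"

definition Nehari1 :: "('y::euclidean_space \<times> 'z::euclidean_space \<Rightarrow> real) \<Rightarrow> (real \<Rightarrow> real)
                    \<Rightarrow> ('y \<times> 'z \<Rightarrow> real) set" where
  "Nehari1 V f = {u. X1G V u \<and> \<not> (AE x in lebesgue. u x = 0)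
                     \<and> norm1sq V u = (LINT x|lebesgue. f (u x) * u x)}"

definition c1 :: "('y::euclidean_space \<times> 'z::euclidean_space \<Rightarrow> real) \<Rightarrow> (real \<Rightarrow> real) \<Rightarrow> real" where
  "c1 V f = Inf (J1 V f ` Nehari1 V f)"

definition J1_critical :: "('y::euclidean_space \<times> 'z::euclidean_space \<Rightarrow> real) \<Rightarrow> (real \<Rightarrow> real)
                    \<Rightarrow> ('y \<times> 'z \<Rightarrow> real) \<Rightarrow> bool" where
  "J1_critical V f u \<longleftrightarrow> (\<forall>\<epsilon>>0. \<exists>\<delta>>0. \<forall>h. X1 V h \<and> sqrt (norm1sq V h) < \<delta> \<longrightarrow>
      \<bar>J1 V f (\<lambda>x. u x + h x) - J1 V f u\<bar> \<le> \<epsilon> * sqrt (norm1sq V h))"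

definition Yspace :: "('y::euclidean_space \<times> 'z::euclidean_space \<Rightarrow> real) \<Rightarrow> bool" where
  "Yspace u \<longleftrightarrow> H1 u \<and> integrable lebesgue (\<lambda>x. (u x)^2 / (norm (fst x))^2)"

definition YG :: "('y::euclidean_space \<times> 'z::euclidean_space \<Rightarrow> real) \<Rightarrow> bool" where
  "YG u \<longleftrightarrow> Yspace u \<and> G_invariant u"

definition Qk :: "real \<Rightarrow> ('y::euclidean_space \<times> 'z::euclidean_space \<Rightarrow> real) \<Rightarrow> real" where
  "Qk k u = (LINT x|lebesgue. (norm (grad u x))^2 + (u x)^2 / (norm (fst x))^2 + k * (u x)^2)"

definition Phi :: "real \<Rightarrow> (real \<Rightarrow> real) \<Rightarrow> ('y::euclidean_space \<times> 'z::euclidean_space \<Rightarrow> real) \<Rightarrow> real" where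
  "Phi k f u = Qk k u / 2 - (LINT x|lebesgue. prim f (u x))"

definition Mk :: "real \<Rightarrow> (real \<Rightarrow> real) \<Rightarrow> ('y::euclidean_space \<times> 'z::euclidean_space \<Rightarrow> real) set" where
  "Mk k f = {u. YG u \<and> \<not> (AE x in lebesgue. u x = 0)
                \<and> Qk k u = (LINT x|lebesgue. f (u x) * u x)}"

definition mk :: "'y::euclidean_space itself \<Rightarrow> 'z::euclidean_space itself
                  \<Rightarrow> real \<Rightarrow> (real \<Rightarrow> real) \<Rightarrow> real" where
  "mk _ _ k f = Inf (Phi k f ` (Mk k f :: ('y \<times> 'z \<Rightarrow> real) set))"

end

theory Submission
  imports Defs "HOL-Complex_Analysis.Great_Picard"
begin

text \<open>
  The functional \<open>Phi k f\<close> is \<open>J1\<close> for the constant potential \<open>k\<close>, so one theory of the Nehari set serves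
  both levels. A minimising sequence on the Nehari set is bounded (by superquadraticity) and almost critical, and up to
  a subsequence it converges weakly, locally in L2 and almost everywhere to some U. If U vanishes, the mass escapes to
  infinity, where the potential is essentially at least Vinf; rescaling the sequence onto the Nehari set of the constant
  potential Vinf does not increase the energy by more than o(1), which gives the second alternative. If U does not
  vanish, it is critical for invariant directions and Fatou's lemma for the nonnegative density f(u)u/2 - F(u) gives
  J1(U) = c1; criticality in all directions follows because the midpoint hull of the orbit of a direction h contains
  near-minimisers of the norm whose weak limit is invariant.

  The subcritical Sobolev inequality and local compactness both come from averages over balls of radius 2^-k:
  the translation estimate for weak gradients bounds u minus its average in L2 by 2^-k times the norm of the gradient,
  while the averages are bounded by a multiple of 2^(k(N/2-1)), so comparing |u| with these levels and summing gives
  the L^q bound exactly for q < 2N/(N-2).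
\<close>

section \<open>Square integrable functions\<close>

text \<open>Since f is merely continuous, the Nehari set need not be a manifold and no flow along it
  is available. Its place is taken by strict monotonicity along rays, made quantitative on the
  region where |u| lies in a compact interval [\<eta>, M]; a lower bound for the mass there
  (\<open>mid_mass\<close>) follows from \<open>Nf u = 0\<close> and a norm bound, and it is not
  lost when mass escapes to infinity. Integrals of f are controlled with an exponent q strictly
  between p and the critical one: then f is o(|u|) at 0 and o(|u|^(q-1)) at infinity, so a.e.
  convergence with bounds in L2 and Lq suffices to pass to the limit against a fixed function. Weak
  convergence is never handled abstractly. X1 is mapped isometrically into an L2 space of triples
  (grad u, u/|y|, sqrt V u); the last two entries converge weakly because they converge a.e. with
  bounded norms, and the gradient needs a Mazur argument. Invariance is demanded at every point, not
  up to null sets. Hence the limit of a minimising sequence is a pointwise \<open>lim\<close>, and a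
  limit known to be invariant only a.e. is replaced by the limit of its ball averages.\<close>

definition L2 :: "('a::euclidean_space \<Rightarrow> 'b::euclidean_space) \<Rightarrow> bool" where
  "L2 g \<longleftrightarrow> g \<in> borel_measurable lebesgue \<and> integrable lebesgue (\<lambda>x. (norm (g x))^2)"

definition n2 :: "('a::euclidean_space \<Rightarrow> 'b::euclidean_space) \<Rightarrow> real" where
  "n2 g = (LINT x|lebesgue. (norm (g x))^2)"

definition ip :: "('a::euclidean_space \<Rightarrow> 'b::euclidean_space) \<Rightarrow> ('a \<Rightarrow> 'b) \<Rightarrow> real" where
  "ip g h = (LINT x|lebesgue. g x \<bullet> h x)"

lemma L2_measurable [measurable_dest]: "L2 g \<Longrightarrow> g \<in> borel_measurable lebesgue"
  by (simp add: L2_def)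

lemma L2_inner_integrable:
  assumes "L2 g" "L2 h" shows "integrable lebesgue (\<lambda>x. g x \<bullet> h x)"
proof (rule Bochner_Integration.integrable_bound)
  show "integrable lebesgue (\<lambda>x. (norm (g x))^2 + (norm (h x))^2)"
    using assms by (auto simp: L2_def)
  have [measurable]: "g \<in> borel_measurable lebesgue" "h \<in> borel_measurable lebesgue"
    using assms by (auto simp: L2_def)
  show "(\<lambda>x. g x \<bullet> h x) \<in> borel_measurable lebesgue" by measurable
  show "AE x in lebesgue. norm (g x \<bullet> h x) \<le> norm ((norm (g x))\<^sup>2 + (norm (h x))\<^sup>2)"
  proof (rule AE_I2)
    fix x
    have "\<bar>g x \<bullet> h x\<bar> \<le> norm (g x) * norm (h x)" by (rule Cauchy_Schwarz_ineq2)
    also have "\<dots> \<le> (norm (g x))\<^sup>2 + (norm (h x))\<^sup>2"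
      using sum_squares_bound[of "norm (g x)" "norm (h x)"] mult_nonneg_nonneg[OF norm_ge_zero[of "g x"] norm_ge_zero[of "h x"]]
      by linarith
    finally show "norm (g x \<bullet> h x) \<le> norm ((norm (g x))\<^sup>2 + (norm (h x))\<^sup>2)" by simp
  qed
qed

lemma n2_ip: "n2 g = ip g g"
  by (simp add: n2_def ip_def power2_norm_eq_inner)

lemma n2_nonneg [simp]: "0 \<le> n2 g"
  by (simp add: n2_def)

lemma ip_commute: "ip g h = ip h g"
  by (simp add: ip_def inner_commute)

lemma L2_add: assumes "L2 g" "L2 h" shows "L2 (\<lambda>x. g x + h x)"
proof -
  have "integrable lebesgue (\<lambda>x. g x \<bullet> g x + 2 * (g x \<bullet> h x) + h x \<bullet> h x)"
    using L2_inner_integrable[OF assms] L2_inner_integrable[OF assms(1,1)] L2_inner_integrable[OF assms(2,2)]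
    by simp
  then show ?thesis using assms
    by (auto simp: L2_def power2_norm_eq_inner inner_add_left inner_add_right inner_commute algebra_simps)
qed

lemma L2_scaleR: assumes "L2 g" shows "L2 (\<lambda>x. c *\<^sub>R g x)"
  using assms by (auto simp: L2_def power_mult_distrib)

lemma L2_cmult: fixes g :: "'a::euclidean_space \<Rightarrow> real" assumes "L2 g" shows "L2 (\<lambda>x. c * g x)"
  using L2_scaleR[OF assms, of c] by simp

lemma L2_minus: assumes "L2 g" shows "L2 (\<lambda>x. - g x)"
  using assms by (auto simp: L2_def)

lemma L2_diff: assumes "L2 g" "L2 h" shows "L2 (\<lambda>x. g x - h x)"
  using L2_add[OF assms(1) L2_minus[OF assms(2)]] by simp

lemma L2_zero [simp]: "L2 (\<lambda>x. 0)"
  by (simp add: L2_def)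

lemma n2_minus_commute: "n2 (\<lambda>x. g x - h x) = n2 (\<lambda>x. h x - g x)"
  by (simp add: n2_def norm_minus_commute)

lemma ip_add_left: "L2 g \<Longrightarrow> L2 g' \<Longrightarrow> L2 h \<Longrightarrow> ip (\<lambda>x. g x + g' x) h = ip g h + ip g' h"
  by (simp add: ip_def inner_add_left L2_inner_integrable)

lemma ip_diff_left: "L2 g \<Longrightarrow> L2 g' \<Longrightarrow> L2 h \<Longrightarrow> ip (\<lambda>x. g x - g' x) h = ip g h - ip g' h"
  by (simp add: ip_def inner_diff_left L2_inner_integrable)

lemma ip_scaleR_left: "ip (\<lambda>x. c *\<^sub>R g x) h = c * ip g h"
  by (simp add: ip_def)

lemma n2_scaleR: "n2 (\<lambda>x. c *\<^sub>R g x) = c^2 * n2 g"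
  by (simp add: n2_def power_mult_distrib)

lemma n2_add: assumes "L2 g" "L2 h"
  shows "n2 (\<lambda>x. g x + h x) = n2 g + 2 * ip g h + n2 h"
  using L2_inner_integrable[OF assms] L2_inner_integrable[OF assms(1,1)] L2_inner_integrable[OF assms(2,2)]
  by (simp add: n2_ip ip_def inner_add_left inner_add_right inner_commute)

lemma n2_diff: assumes "L2 g" "L2 h"
  shows "n2 (\<lambda>x. g x - h x) = n2 g - 2 * ip g h + n2 h"
  using L2_inner_integrable[OF assms] L2_inner_integrable[OF assms(1,1)] L2_inner_integrable[OF assms(2,2)]
  by (simp add: n2_ip ip_def inner_diff_left inner_diff_right inner_commute)

text \<open>The midpoint is kept as a function because its norm is bounded below by the infimum over
  any set closed under midpoints; two near-minimisers are then close in norm.\<close>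

lemma n2_parallelogram: assumes "L2 g" "L2 h"
  shows "n2 (\<lambda>x. g x - h x) = 2 * n2 g + 2 * n2 h - 4 * n2 (\<lambda>x. (1/2) *\<^sub>R (g x + h x))"
  by (simp only: n2_scaleR[of "1/2"] n2_add[OF assms] n2_diff[OF assms]) (simp add: power2_eq_square field_simps)

lemma quadratic_nonneg_imp_discriminant:
  fixes a b c :: real
  assumes "\<And>t. 0 \<le> a + 2 * t * b + t^2 * c" "0 \<le> a" "0 \<le> c"
  shows "\<bar>b\<bar> \<le> sqrt a * sqrt c"
proof (cases "c = 0")
  case True
  have "b = 0"
  proof (rule ccontr)
    assume "b \<noteq> 0"
    \<comment> \<open>For c = 0 this t turns the expression into -1.\<close>
    then show False using assms(1)[of "- (a + 1) / (2 * b)"] True by (simp add: field_simps)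
  qed
  then show ?thesis using assms by simp
next
  case False
  with assms have c: "c > 0" by simp
  \<comment> \<open>The value t = -b/c minimises the quadratic.\<close>
  have "0 \<le> a + 2 * (- b / c) * b + (- b / c)^2 * c" by (rule assms)
  also have "\<dots> = a - b^2 / c" using c by (simp add: field_simps power2_eq_square)
  finally have "b^2 \<le> a * c" using c by (simp add: field_simps)
  then have "sqrt (b^2) \<le> sqrt (a * c)" by (rule real_sqrt_le_mono)
  then show ?thesis by (simp add: real_sqrt_mult)
qed

lemma ip_Cauchy_Schwarz: assumes "L2 g" "L2 h" shows "\<bar>ip g h\<bar> \<le> sqrt (n2 g) * sqrt (n2 h)"
proof (rule quadratic_nonneg_imp_discriminant)
  fix t :: real
  have "0 \<le> n2 (\<lambda>x. g x + t *\<^sub>R h x)" by simp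
  also have "\<dots> = n2 g + 2 * ip g (\<lambda>x. t *\<^sub>R h x) + n2 (\<lambda>x. t *\<^sub>R h x)"
    by (intro n2_add L2_scaleR assms)
  also have "\<dots> = n2 g + 2 * t * ip g h + t^2 * n2 h"
    by (simp add: n2_scaleR ip_commute[of g] ip_scaleR_left)
  finally show "0 \<le> \<dots>" .
qed auto

lemma n2_triangle: assumes "L2 g" "L2 h"
  shows "sqrt (n2 (\<lambda>x. g x + h x)) \<le> sqrt (n2 g) + sqrt (n2 h)"
proof (rule real_le_lsqrt)
  show "n2 (\<lambda>x. g x + h x) \<le> (sqrt (n2 g) + sqrt (n2 h))\<^sup>2"
    using ip_Cauchy_Schwarz[OF assms] by (simp add: n2_add[OF assms] power2_sum)
qed auto

lemma n2_triangle_diff: assumes "L2 g" "L2 h"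
  shows "sqrt (n2 (\<lambda>x. g x - h x)) \<le> sqrt (n2 g) + sqrt (n2 h)"
  using n2_triangle[OF assms(1) L2_minus[OF assms(2)]] by (simp add: n2_def)

lemma n2_add_le: assumes "L2 g" "L2 h" shows "n2 (\<lambda>x. g x + h x) \<le> 2 * n2 g + 2 * n2 h"
  using n2_parallelogram[OF assms] n2_scaleR[of "1/2" "\<lambda>x. g x + h x"] n2_nonneg[of "\<lambda>x. g x - h x"]
  by (simp add: power2_eq_square)

lemma n2_diff_le: assumes "L2 g" "L2 h" shows "n2 (\<lambda>x. g x - h x) \<le> 2 * n2 g + 2 * n2 h"
  using n2_add_le[OF assms(1) L2_minus[OF assms(2)]] by (simp add: n2_def)

lemma n2_mono:
  assumes "L2 h" "AE x in lebesgue. norm (g x) \<le> norm (h x)" shows "n2 g \<le> n2 h"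
  unfolding n2_def
proof (rule integral_mono_AE')
  show "integrable lebesgue (\<lambda>x. (norm (h x))\<^sup>2)" using assms by (simp add: L2_def)
  show "AE x in lebesgue. (norm (g x))\<^sup>2 \<le> (norm (h x))\<^sup>2"
    using assms(2) by (auto intro: power_mono)
qed auto

lemma L2_bound:
  assumes "L2 h" "g \<in> borel_measurable lebesgue" "AE x in lebesgue. norm (g x) \<le> norm (h x)" shows "L2 g"
proof -
  have "integrable lebesgue (\<lambda>x. (norm (g x))^2)"
    by (rule Bochner_Integration.integrable_bound[of _ "\<lambda>x. (norm (h x))^2"])
       (use assms in \<open>auto simp: L2_def intro: power_mono\<close>)
  then show ?thesis using assms by (simp add: L2_def)
qed

lemma L2_AE_cong:
  assumes "L2 g" "h \<in> borel_measurable lebesgue" "AE x in lebesgue. h x = g x" shows "L2 h"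
  using assms(3) by (intro L2_bound[OF assms(1,2)]) auto

text \<open>Completeness of Lebesgue measure. It frees all later a.e. limits and modifications from
  measurability hypotheses.\<close>

lemma AE_measurable_lebesgue:
  fixes g :: "'a::euclidean_space \<Rightarrow> 'b::euclidean_space"
  assumes "g \<in> borel_measurable lebesgue" "AE x in lebesgue. h x = g x"
  shows "h \<in> borel_measurable lebesgue"
proof (rule borel_measurable_AE[OF assms(1)])
  show "AE x in lebesgue. g x = h x" using assms(2) by (simp add: eq_commute)
qed

lemma n2_AE_cong:
  assumes "g \<in> borel_measurable lebesgue" "AE x in lebesgue. h x = g x" shows "n2 h = n2 g"
proof -
  have [measurable]: "h \<in> borel_measurable lebesgue" "g \<in> borel_measurable lebesgue"
    using AE_measurable_lebesgue[OF assms] assms(1) by auto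
  show ?thesis unfolding n2_def by (rule integral_cong_AE) (use assms(2) in auto)
qed

lemma n2_eq_0: assumes "L2 g" "n2 g = 0" shows "AE x in lebesgue. g x = 0"
  using assms integral_nonneg_eq_0_iff_AE[of lebesgue "\<lambda>x. (norm (g x))^2"]
  by (auto simp: L2_def n2_def)

lemma L2_indicator:
  assumes "L2 g" "B \<in> sets lebesgue" shows "L2 (\<lambda>x. indicator B x *\<^sub>R g x)"
proof (rule L2_bound[OF assms(1)])
  have [measurable]: "g \<in> borel_measurable lebesgue" "B \<in> sets lebesgue" using assms by (auto simp: L2_def)
  show "(\<lambda>x. indicat_real B x *\<^sub>R g x) \<in> borel_measurable lebesgue" by measurable
qed (auto simp: indicator_def)

lemma nn_integral_n2: "L2 g \<Longrightarrow> (\<integral>\<^sup>+x. ennreal ((norm (g x))^2) \<partial>lebesgue) = ennreal (n2 g)"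
  by (simp add: L2_def n2_def nn_integral_eq_integral)

lemma L2_I_nn:
  assumes "g \<in> borel_measurable lebesgue" "(\<integral>\<^sup>+x. ennreal ((norm (g x))^2) \<partial>lebesgue) \<le> ennreal C" "0 \<le> C"
  shows "L2 g" "n2 g \<le> C"
proof -
  have "integrable lebesgue (\<lambda>x. (norm (g x))^2)"
    using assms by (intro integrableI_nonneg) (auto intro: le_less_trans)
  then show L: "L2 g" using assms by (simp add: L2_def)
  show "n2 g \<le> C" using assms(2) unfolding nn_integral_n2[OF L] using assms(3) by simp
qed

text \<open>Fatou's lemma for the squared norms: a bound and a.e. convergence already place the
  limit in L2.\<close>

lemma L2_Fatou:
  assumes "\<And>n. L2 (g n)" "\<And>n. n2 (g n) \<le> C" "AE x in lebesgue. (\<lambda>n. g n x) \<longlonglongrightarrow> G x"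
  shows "L2 G" "n2 G \<le> C"
proof -
  have [measurable]: "g n \<in> borel_measurable lebesgue" for n using assms by (auto simp: L2_def)
  \<comment> \<open>The total function \<open>lim\<close> is measurable on the whole space and
    agrees with G a.e., which settles the measurability of G.\<close>
  have "(\<lambda>x. lim (\<lambda>n. g n x)) \<in> borel_measurable lebesgue" by measurable
  moreover have "AE x in lebesgue. G x = lim (\<lambda>n. g n x)"
    using assms(3) by (auto simp: limI)
  ultimately have G[measurable]: "G \<in> borel_measurable lebesgue" by (rule AE_measurable_lebesgue)
  have C: "0 \<le> C" using assms(2)[of 0] n2_nonneg[of "g 0"] by linarith
  have "(\<integral>\<^sup>+x. ennreal ((norm (G x))^2) \<partial>lebesgue) = (\<integral>\<^sup>+x. liminf (\<lambda>n. ennreal ((norm (g n x))^2)) \<partial>lebesgue)"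
  proof (rule nn_integral_cong_AE, use assms(3) in eventually_elim)
    fix x assume "(\<lambda>n. g n x) \<longlonglongrightarrow> G x"
    then have "(\<lambda>n. ennreal ((norm (g n x))^2)) \<longlonglongrightarrow> ennreal ((norm (G x))^2)"
      by (intro tendsto_intros tendsto_ennrealI)
    then show "ennreal ((norm (G x))^2) = liminf (\<lambda>n. ennreal ((norm (g n x))^2))"
      by (intro lim_imp_Liminf[symmetric]) auto
  qed
  also have "\<dots> \<le> liminf (\<lambda>n. \<integral>\<^sup>+x. ennreal ((norm (g n x))^2) \<partial>lebesgue)"
    by (rule nn_integral_liminf) simp
  also have "\<dots> \<le> ennreal C"
    using assms by (intro Liminf_le) (auto simp: nn_integral_n2 intro!: ennreal_leI always_eventually)
  finally show "L2 G" "n2 G \<le> C" using L2_I_nn[OF G _ C] by auto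
qed

text \<open>The weights 2^j leave the sum of the squared norms convergent, so 2^j |d_j(x)|^2 is
  summable for almost every x. Then 2 |d_j| \<le> 2^j |d_j|^2 + 2^-j gives absolute
  summability.\<close>

lemma AE_summable_of_rapid_L2_decay:
  fixes d :: "nat \<Rightarrow> 'a::euclidean_space \<Rightarrow> 'b::euclidean_space"
  assumes "\<And>j. L2 (d j)" "\<And>j. n2 (d j) \<le> C * (1/4)^j"
  shows "AE x in lebesgue. summable (\<lambda>j. norm (d j x))"
proof -
  have [measurable]: "d n \<in> borel_measurable lebesgue" for n using assms by (auto simp: L2_def)
  have C: "0 \<le> C" using order_trans[OF n2_nonneg assms(2)[of 0]] by simp
  have "(\<integral>\<^sup>+x. (\<Sum>j. ennreal (2^j * (norm (d j x))^2)) \<partial>lebesgue) = (\<Sum>j. \<integral>\<^sup>+x. ennreal (2^j * (norm (d j x))^2) \<partial>lebesgue)"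
    by (rule nn_integral_suminf) simp
  also have "\<dots> = (\<Sum>j. ennreal (2^j * n2 (d j)))"
    by (simp add: ennreal_mult' nn_integral_cmult nn_integral_n2 assms(1))
  also have "\<dots> \<le> (\<Sum>j. ennreal (C * (1/2)^j))"
  proof (intro suminf_le ennreal_leI)
    fix j :: nat
    have "2^j * n2 (d j) \<le> 2^j * (C * (1/4)^j)" using assms(2) by (intro mult_left_mono) auto
    also have "\<dots> = C * (1/2)^j" by (simp flip: power_mult_distrib)
    finally show "2^j * n2 (d j) \<le> C * (1/2)^j" .
  qed auto
  also have "\<dots> < \<infinity>"
    using C by (subst suminf_ennreal2) (auto intro!: summable_mult simp: top.not_eq_extremum[symmetric])
  finally have "AE x in lebesgue. (\<Sum>j. ennreal (2^j * (norm (d j x))^2)) \<noteq> \<infinity>"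
    by (intro nn_integral_noteq_infinite) auto
  then show ?thesis
  proof eventually_elim
    fix x assume "(\<Sum>j. ennreal (2^j * (norm (d j x))^2)) \<noteq> \<infinity>"
    then have "summable (\<lambda>j. 2^j * (norm (d j x))^2)"
      by (intro summable_suminf_not_top) auto
    then have "summable (\<lambda>j. 2^j * (norm (d j x))^2 + (1/2)^j)" by (intro summable_add) auto
    then show "summable (\<lambda>j. norm (d j x))"
    proof (rule summable_comparison_test'[where N=0])
      fix j :: nat
      define a where "a = norm (d j x)"
      define b :: real where "b = (1/2)^j"
      have b: "2^j * b = 1" by (simp add: b_def flip: power_mult_distrib)
      have "0 \<le> 2^j * (a - b)^2" by simp
      also have "\<dots> = 2^j * a^2 - 2 * a * (2^j * b) + (2^j * b) * b"
        by (simp add: power2_eq_square algebra_simps)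
      also have "\<dots> = 2^j * a^2 - 2 * a + (1/2)^j" by (simp only: b) (simp add: b_def)
      finally show "norm (norm (d j x)) \<le> 2^j * (norm (d j x))^2 + (1/2)^j"
        using norm_ge_zero[of "d j x"] unfolding a_def real_norm_def abs_norm_cancel by linarith
    qed
  qed
qed

text \<open>Riesz-Fischer: a subsequence with steps at most (1/4)^j in \<open>n2\<close> converges
  a.e., and Fatou along it carries the Cauchy estimate over to the limit.\<close>

lemma L2_complete:
  fixes g :: "nat \<Rightarrow> 'a::euclidean_space \<Rightarrow> 'b::euclidean_space"
  assumes L: "\<And>n. L2 (g n)"
    and Cau: "\<And>e. e > 0 \<Longrightarrow> \<exists>N. \<forall>m\<ge>N. \<forall>n\<ge>N. n2 (\<lambda>x. g m x - g n x) \<le> e"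
  obtains G where "L2 G" "(\<lambda>n. n2 (\<lambda>x. g n x - G x)) \<longlonglongrightarrow> 0"
proof -
  have "\<exists>N. \<forall>j::nat. \<forall>m\<ge>N j. \<forall>n\<ge>N j. n2 (\<lambda>x. g m x - g n x) \<le> (1/4)^j"
    using Cau by (intro choice allI) auto
  then obtain N where N: "\<And>j m n. m \<ge> N j \<Longrightarrow> n \<ge> N j \<Longrightarrow> n2 (\<lambda>x. g m x - g n x) \<le> (1/4)^j"
    by blast
  \<comment> \<open>Cumulative sums make \<open>r j\<close> exceed every threshold
    \<open>N i\<close> with i \<le> j, although N need not be monotone.\<close>
  define r where "r j = (\<Sum>i\<le>j. Suc (N i))" for j
  have rN: "r i \<ge> N j" if "i \<ge> j" for i j
  proof -
    have "N j \<le> Suc (N j)" by simp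
    also have "\<dots> \<le> r i" unfolding r_def using that by (intro member_le_sum) auto
    finally show ?thesis .
  qed
  have "AE x in lebesgue. summable (\<lambda>j. norm (g (r (Suc j)) x - g (r j) x))"
    by (rule AE_summable_of_rapid_L2_decay[where C=1]) (auto intro!: L2_diff L N rN)
  then have cv: "AE x in lebesgue. (\<lambda>j. g (r j) x) \<longlonglongrightarrow> lim (\<lambda>j. g (r j) x)"
  proof eventually_elim
    fix x assume "summable (\<lambda>j. norm (g (r (Suc j)) x - g (r j) x))"
    then have "summable (\<lambda>j. g (r (Suc j)) x - g (r j) x)" by (rule summable_norm_cancel)
    then have "convergent (\<lambda>n. \<Sum>j<n. g (r (Suc j)) x - g (r j) x)" by (simp add: summable_iff_convergent)
    then have "convergent (\<lambda>n. (g (r n) x - g (r 0) x) + g (r 0) x)"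
      by (intro convergent_add convergent_const)
        (simp add: sum_lessThan_telescope[of "\<lambda>j. g (r j) x"])
    then show "(\<lambda>j. g (r j) x) \<longlonglongrightarrow> lim (\<lambda>j. g (r j) x)" by (simp add: convergent_LIMSEQ_iff)
  qed
  define G where "G x = lim (\<lambda>j. g (r j) x)" for x
  have *: "L2 (\<lambda>x. g n x - G x) \<and> n2 (\<lambda>x. g n x - G x) \<le> (1/4)^j" if "n \<ge> N j" for n j
  proof -
    have "AE x in lebesgue. (\<lambda>i. g n x - g (r (i + j)) x) \<longlonglongrightarrow> g n x - G x"
      using cv unfolding G_def by eventually_elim (auto intro!: tendsto_intros LIMSEQ_ignore_initial_segment)
    moreover have "L2 (\<lambda>x. g n x - g (r (i + j)) x)" for i by (intro L2_diff L)
    moreover have "n2 (\<lambda>x. g n x - g (r (i + j)) x) \<le> (1/4)^j" for i using that rN[of j "i + j"] N by simp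
    ultimately show ?thesis
      using L2_Fatou[of "\<lambda>i x. g n x - g (r (i + j)) x" "(1/4)^j" "\<lambda>x. g n x - G x"] by blast
  qed
  show ?thesis
  proof
    show "L2 G" using L2_diff[OF L[of "N 0"] conjunct1[OF *[of 0 "N 0"]]] by simp
    show "(\<lambda>n. n2 (\<lambda>x. g n x - G x)) \<longlonglongrightarrow> 0"
    proof (rule LIMSEQ_I)
      fix e :: real assume "0 < e"
      then obtain j where "(1/4::real)^j < e" using real_arch_pow_inv[of e "1/4"] by auto
      then show "\<exists>no. \<forall>n\<ge>no. norm (n2 (\<lambda>x. g n x - G x) - 0) < e"
        using * by (intro exI[of _ "N j"]) (auto intro: le_less_trans)
    qed
  qed
qed

text \<open>A dyadic convex hull. Midpoints are all that the parallelogram law asks for, and a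
  property stable under midpoints extends to the hull by a two-case induction.\<close>

inductive_set mid_hull :: "('a \<Rightarrow> 'b::real_vector) set \<Rightarrow> ('a \<Rightarrow> 'b) set" for S where
  base: "v \<in> S \<Longrightarrow> v \<in> mid_hull S"
| mid: "v \<in> mid_hull S \<Longrightarrow> w \<in> mid_hull S \<Longrightarrow> (\<lambda>x. (1/2) *\<^sub>R (v x + w x)) \<in> mid_hull S"

lemma mid_hull_mono: "v \<in> mid_hull S \<Longrightarrow> S \<subseteq> T \<Longrightarrow> v \<in> mid_hull T"
  by (induction rule: mid_hull.induct) (blast intro: mid_hull.intros)+

lemma mid_hull_L2: "v \<in> mid_hull S \<Longrightarrow> (\<And>v. v \<in> S \<Longrightarrow> L2 v) \<Longrightarrow> L2 v"
  by (induction rule: mid_hull.induct) (auto intro!: L2_scaleR L2_add)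

text \<open>Near-minimisers of the norm over the midpoint hulls of the tails form a Cauchy sequence by the
  parallelogram law; this replaces weak sequential compactness.\<close>

lemma L2_Mazur:
  fixes g :: "nat \<Rightarrow> 'a::euclidean_space \<Rightarrow> 'b::euclidean_space"
  assumes L: "\<And>n. L2 (g n)" and C: "\<And>n. n2 (g n) \<le> C"
  obtains w G where "\<And>n. w n \<in> mid_hull (g ` {n..})" "L2 G" "(\<lambda>n. n2 (\<lambda>x. w n x - G x)) \<longlonglongrightarrow> 0"
proof -
  define H where "H n = mid_hull (g ` {n..})" for n
  define d where "d n = Inf (n2 ` H n)" for n
  have bdd: "bdd_below (n2 ` H n)" for n by (rule bdd_belowI[of _ 0]) auto
  have HL: "L2 v" if "v \<in> H n" for v n using that mid_hull_L2 L unfolding H_def by fast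
  have Hmono: "H m \<subseteq> H n" if "n \<le> m" for m n
    unfolding H_def using that mid_hull_mono[of _ "g ` {m..}" "g ` {n..}"] by fastforce
  have gH: "g n \<in> H n" for n unfolding H_def by (rule mid_hull.base) auto
  have dle: "d n \<le> n2 v" if "v \<in> H n" for v n
    unfolding d_def using bdd that by (intro cInf_lower) auto
  have dmono: "d n \<le> d m" if "n \<le> m" for n m
    unfolding d_def[of m] using gH[of m] dle Hmono[OF that] by (intro cInf_greatest) auto
  have "convergent d"
  proof (rule Bseq_mono_convergent)
    have "0 \<le> d n" for n unfolding d_def using gH by (intro cInf_greatest) auto
    moreover have "d n \<le> C" for n using dle[OF gH] C by (rule order_trans)
    ultimately show "Bseq d" by (intro BseqI'[of _ C]) auto
  qed (use dmono in auto)
  then have "Cauchy d" by (simp add: Cauchy_convergent_iff)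
  have "\<exists>v\<in>H n. n2 v < d n + 1 / real (Suc n)" for n
  proof -
    have "Inf (n2 ` H n) < d n + 1 / real (Suc n)" by (simp add: d_def)
    then show ?thesis using cInf_lessD[of "n2 ` H n"] gH by blast
  qed
  then obtain w where w: "\<And>n. w n \<in> H n" "\<And>n. n2 (w n) < d n + 1 / real (Suc n)" by metis
  \<comment> \<open>The hulls of the tails decrease, so \<open>w m\<close> also lies in
    \<open>H n\<close> and the midpoint has squared norm at least \<open>d n\<close>; the
    parallelogram law turns this into closeness.\<close>
  have est: "n2 (\<lambda>x. w n x - w m x) \<le> 2 * (d m - d n) + 4 / real (Suc n)" if "n \<le> m" for n m
  proof -
    have wm: "w m \<in> H n" using w(1)[of m] Hmono[OF that] by auto
    then have "(\<lambda>x. (1/2) *\<^sub>R (w n x + w m x)) \<in> H n"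
      using w(1)[of n] unfolding H_def by (intro mid_hull.mid)
    then have "d n \<le> n2 (\<lambda>x. (1/2) *\<^sub>R (w n x + w m x))" by (rule dle)
    moreover have "1 / real (Suc m) \<le> 1 / real (Suc n)" using that by (simp add: field_simps)
    ultimately show ?thesis
      using n2_parallelogram[OF HL[OF w(1)[of n]] HL[OF wm]] w(2)[of n] w(2)[of m] by simp
  qed
  have "\<exists>N. \<forall>m\<ge>N. \<forall>n\<ge>N. n2 (\<lambda>x. w m x - w n x) \<le> e" if "e > 0" for e
  proof -
    obtain N1 where N1: "\<And>m n. m \<ge> N1 \<Longrightarrow> n \<ge> N1 \<Longrightarrow> \<bar>d m - d n\<bar> < e / 4"
      using CauchyD[OF \<open>Cauchy d\<close>, of "e/4"] \<open>e > 0\<close> by auto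
    obtain N2 :: nat where N2: "8 / e < real N2" using reals_Archimedean2 by blast
    have *: "n2 (\<lambda>x. w n x - w m x) \<le> e" if "n \<le> m" "n \<ge> max N1 N2" for n m
    proof -
      have "8 / e < real (Suc n)" using N2 that by simp
      then have "4 / real (Suc n) < e / 2" using \<open>e > 0\<close> by (simp add: field_simps)
      then show ?thesis using est[OF that(1)] N1[of m n] that by (simp add: abs_if split: if_splits)
    qed
    show ?thesis
    proof (intro exI[of _ "max N1 N2"] allI impI)
      fix m n assume "max N1 N2 \<le> m" "max N1 N2 \<le> n"
      then show "n2 (\<lambda>x. w m x - w n x) \<le> e"
        using *[of m n] *[of n m] n2_minus_commute[of "w m" "w n"] by (cases "n \<le> m") auto
    qed
  qed
  then obtain G where "L2 G" "(\<lambda>n. n2 (\<lambda>x. w n x - G x)) \<longlonglongrightarrow> 0"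
    using L2_complete[of w] HL[OF w(1)] by blast
  then show ?thesis using that w(1) unfolding H_def by blast
qed

text \<open>A Vitali-type theorem. The \<open>B n\<close> have bounded integrals but no common
  majorant; it is enough that F n is dominated by a fixed function up to an arbitrarily small
  multiple of \<open>B n\<close>. This fits integrands such as f(u_n) h with u_n merely
  bounded.\<close>

lemma integral_tendsto_0_eps_dominated:
  fixes F :: "nat \<Rightarrow> 'a::euclidean_space \<Rightarrow> real"
  assumes F: "\<And>n. integrable lebesgue (F n)" and cv: "AE x in lebesgue. (\<lambda>n. F n x) \<longlonglongrightarrow> 0"
    and B: "\<And>n. integrable lebesgue (B n)" "\<And>n x. 0 \<le> B n x" "\<And>n. (LINT x|lebesgue. B n x) \<le> K"
    and dom: "\<And>e. e > 0 \<Longrightarrow> \<exists>G. integrable lebesgue G \<and> (\<forall>n. AE x in lebesgue. \<bar>F n x\<bar> \<le> G x + e * B n x)"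
  shows "(\<lambda>n. LINT x|lebesgue. F n x) \<longlonglongrightarrow> 0"
proof (rule LIMSEQ_I)
  fix e :: real assume e: "0 < e"
  have K: "0 \<le> K" using B(2,3)[of 0] by (meson Bochner_Integration.integral_nonneg order_trans)
  define d where "d = e / (2 * (K + 1))"
  have d: "d > 0" using e K by (simp add: d_def)
  obtain G where G: "integrable lebesgue G" "\<And>n. AE x in lebesgue. \<bar>F n x\<bar> \<le> G x + d * B n x"
    using dom[OF d] by blast
  have [measurable]: "F n \<in> borel_measurable lebesgue" "B n \<in> borel_measurable lebesgue" "G \<in> borel_measurable lebesgue" for n
    using F B(1) G(1) by auto
  \<comment> \<open>The excess over d * B n is dominated by |G| and tends to 0 a.e., so dominated
    convergence applies to it; the rest contributes at most d K \<le> e/2.\<close>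
  define W where "W n x = max 0 (\<bar>F n x\<bar> - d * B n x)" for n x
  have "(\<lambda>n. LINT x|lebesgue. W n x) \<longlonglongrightarrow> (LINT x|(lebesgue::'a measure). (0::real))"
  proof (rule integral_dominated_convergence[where w="\<lambda>x. \<bar>G x\<bar>"])
    show "AE x in lebesgue. (\<lambda>n. W n x) \<longlonglongrightarrow> 0" using cv
    proof eventually_elim
      fix x assume "(\<lambda>n. F n x) \<longlonglongrightarrow> 0"
      then have "(\<lambda>n. \<bar>F n x\<bar>) \<longlonglongrightarrow> 0" by (simp add: tendsto_rabs_zero)
      then show "(\<lambda>n. W n x) \<longlonglongrightarrow> 0"
        by (rule tendsto_sandwich[rotated 3]) (use B(2) d in \<open>auto simp: W_def\<close>)
    qed
    show "AE x in lebesgue. norm (W n x) \<le> \<bar>G x\<bar>" for n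
      using G(2)[of n] by eventually_elim (auto simp: W_def)
  qed (use G(1) in \<open>auto simp: W_def[abs_def]\<close>)
  then obtain N where N: "\<And>n. n \<ge> N \<Longrightarrow> \<bar>LINT x|lebesgue. W n x\<bar> < e / 2"
    using LIMSEQ_D[of _ _ "e/2"] e by fastforce
  have "\<bar>LINT x|lebesgue. F n x\<bar> < e" if "n \<ge> N" for n
  proof -
    have W: "integrable lebesgue (W n)"
      by (rule Bochner_Integration.integrable_bound[OF F[of n]]) (use B(2) d in \<open>auto simp: W_def[abs_def]\<close>)
    have "\<bar>LINT x|lebesgue. F n x\<bar> \<le> (LINT x|lebesgue. \<bar>F n x\<bar>)" by (rule integral_abs_bound)
    also have "\<dots> \<le> (LINT x|lebesgue. W n x + d * B n x)"
      by (rule integral_mono) (use F W B in \<open>auto simp: W_def\<close>)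
    also have "\<dots> = (LINT x|lebesgue. W n x) + d * (LINT x|lebesgue. B n x)" using W B(1) by simp
    also have "\<dots> \<le> (LINT x|lebesgue. W n x) + d * K" using B(3) d by simp
    also have "d * K \<le> e / 2" using K e by (simp add: d_def field_simps)
    finally show ?thesis using N[OF that] by linarith
  qed
  then show "\<exists>no. \<forall>n\<ge>no. norm ((LINT x|lebesgue. F n x) - 0) < e" by auto
qed

text \<open>For bounded sequences a.e. convergence implies weak convergence: completing the square
  bounds |d| |h| by e |d|^2 + |h|^2 / (4 e), which is a domination with small factor.\<close>

lemma ip_tendsto_of_AE:
  assumes L: "\<And>n. L2 (g n)" "\<And>n. n2 (g n) \<le> C" "AE x in lebesgue. (\<lambda>n. g n x) \<longlonglongrightarrow> G x" and h: "L2 h"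
  shows "(\<lambda>n. ip (g n) h) \<longlonglongrightarrow> ip G h"
proof -
  have G: "L2 G" "n2 G \<le> C" using L2_Fatou[OF L] by auto
  have "(\<lambda>n. LINT x|lebesgue. (g n x - G x) \<bullet> h x) \<longlonglongrightarrow> 0"
  proof (rule integral_tendsto_0_eps_dominated[where B="\<lambda>n x. (norm (g n x - G x))^2" and K="4 * C"])
    show "integrable lebesgue (\<lambda>x. (g n x - G x) \<bullet> h x)" for n by (intro L2_inner_integrable L2_diff L G h)
    show "AE x in lebesgue. (\<lambda>n. (g n x - G x) \<bullet> h x) \<longlonglongrightarrow> 0"
      using L(3) by eventually_elim (auto intro!: tendsto_eq_intros)
    show "integrable lebesgue (\<lambda>x. (norm (g n x - G x))\<^sup>2)" for n
      using L2_diff[OF L(1) G(1)] by (simp add: L2_def)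
    show "(LINT x|lebesgue. (norm (g n x - G x))\<^sup>2) \<le> 4 * C" for n
      using n2_diff_le[OF L(1)[of n] G(1)] L(2)[of n] G(2) by (simp add: n2_def)
    fix e :: real assume e: "e > 0"
    show "\<exists>Ga. integrable lebesgue Ga \<and> (\<forall>n. AE x in lebesgue. \<bar>(g n x - G x) \<bullet> h x\<bar> \<le> Ga x + e * (norm (g n x - G x))\<^sup>2)"
    proof (intro exI[of _ "\<lambda>x. (1/(4*e)) * (norm (h x))^2"] conjI allI AE_I2)
      show "integrable lebesgue (\<lambda>x. (1/(4*e)) * (norm (h x))^2)" using h by (simp add: L2_def)
      fix n x
      define a b where "a = norm (g n x - G x)" and "b = norm (h x)"
      have "0 \<le> e * (a - b / (2 * e))^2" using e by simp
      also have "\<dots> = e * a^2 - a * b + (1/(4*e)) * b^2" using e by (simp add: power2_eq_square field_simps)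
      finally have "a * b \<le> (1/(4*e)) * b^2 + e * a^2" by simp
      moreover have "\<bar>(g n x - G x) \<bullet> h x\<bar> \<le> a * b" unfolding a_def b_def by (rule Cauchy_Schwarz_ineq2)
      ultimately show "\<bar>(g n x - G x) \<bullet> h x\<bar> \<le> (1/(4*e)) * (norm (h x))^2 + e * (norm (g n x - G x))\<^sup>2"
        unfolding a_def b_def by linarith
    qed
  qed auto
  then have "(\<lambda>n. ip (\<lambda>x. g n x - G x) h) \<longlonglongrightarrow> 0" by (simp add: ip_def)
  then have "(\<lambda>n. ip (g n) h - ip G h) \<longlonglongrightarrow> 0" by (simp add: ip_diff_left L G h)
  then show ?thesis by (simp add: LIM_zero_iff)
qed

section \<open>Measure preserving maps\<close>

text \<open>Phrased for \<open>lborel\<close>, where image measures and products are at hand;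
  \<open>mp_measurable\<close> and \<open>mp_distr\<close> transfer it to the completion.\<close>

definition mp :: "('a::euclidean_space \<Rightarrow> 'a) \<Rightarrow> bool" where
  "mp T \<longleftrightarrow> T \<in> borel_measurable borel \<and> distr lborel borel T = lborel"

lemma mp_translation: "mp (\<lambda>x. x + c)"
  using lborel_distr_plus[of c] by (simp add: mp_def add.commute[of _ c])

lemma mp_null_sets:
  assumes "mp T" "N \<in> null_sets lborel" shows "T -` N \<in> null_sets lborel"
proof -
  have [measurable]: "T \<in> borel_measurable borel" "N \<in> sets borel" using assms by (auto simp: mp_def)
  have "emeasure (distr lborel borel T) N = emeasure lborel (T -` N \<inter> space lborel)"
    by (rule emeasure_distr) auto
  then have "emeasure lborel (T -` N) = 0" using assms by (simp add: mp_def null_sets_def)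
  moreover have "T -` N \<in> sets lborel" using measurable_sets[of T borel borel N] by simp
  ultimately show ?thesis by (simp add: null_sets_def)
qed

lemma mp_AE: assumes "mp T" "AE x in lebesgue. P x" shows "AE x in lebesgue. P (T x)"
proof -
  have "AE x in lborel. P x" using assms by (simp add: AE_completion_iff)
  then obtain N where N: "N \<in> null_sets lborel" "{x. \<not> P x} \<subseteq> N" by (auto simp: eventually_ae_filter)
  have "T -` N \<in> null_sets lborel" by (rule mp_null_sets[OF assms(1) N(1)])
  moreover have "{x. \<not> P (T x)} \<subseteq> T -` N" using N by auto
  ultimately have "AE x in lborel. P (T x)" by (auto simp: eventually_ae_filter)
  then show ?thesis by (simp add: AE_completion_iff)
qed

lemma
  assumes "mp T"
  shows mp_measurable: "T \<in> measurable lebesgue lebesgue" and mp_distr: "distr lebesgue lebesgue T = lebesgue"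
proof -
  have T: "T \<in> measurable lebesgue lborel" using assms by (simp add: mp_def measurable_completion)
  have "distr lebesgue lborel T = distr lborel lborel T" using assms by (intro distr_completion) (simp add: mp_def)
  also have "\<dots> = distr lborel borel T" by (rule distr_cong) auto
  finally have *: "distr lebesgue lborel T = lborel" using assms by (simp add: mp_def)
  show "T \<in> measurable lebesgue lebesgue"
    by (rule completion.measurable_completion2[OF T]) (simp add: *)
  show "distr lebesgue lebesgue T = lebesgue"
    using completion.completion_distr_eq[OF T] by (simp add: *)
qed

lemma mp_comp_measurable:
  assumes "mp T" "u \<in> borel_measurable lebesgue" shows "(\<lambda>x. u (T x)) \<in> borel_measurable lebesgue"
  using measurable_compose[OF mp_measurable[OF assms(1)] assms(2)] .

lemma mp_integral:
  fixes u :: "'a::euclidean_space \<Rightarrow> 'b::euclidean_space"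
  assumes "mp T" "u \<in> borel_measurable lebesgue"
  shows "(LINT x|lebesgue. u (T x)) = (LINT x|lebesgue. u x)"
  using integral_distr[OF mp_measurable[OF assms(1)] assms(2)] by (simp add: mp_distr assms(1))

lemma mp_integrable:
  fixes u :: "'a::euclidean_space \<Rightarrow> 'b::euclidean_space"
  assumes "mp T" "integrable lebesgue u"
  shows "integrable lebesgue (\<lambda>x. u (T x))"
  using integrable_distr_eq[OF mp_measurable[OF assms(1)], of u] assms by (simp add: mp_distr)

lemma L2_mp: assumes "mp T" "L2 u" shows "L2 (\<lambda>x. u (T x))"
  using mp_integrable[OF assms(1), of "\<lambda>x. (norm (u x))^2"] mp_comp_measurable[OF assms(1), of u] assms(2)
  by (auto simp: L2_def)

lemma n2_mp: assumes "mp T" "L2 u" shows "n2 (\<lambda>x. u (T x)) = n2 u"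
  using mp_integral[OF assms(1), of "\<lambda>x. (norm (u x))^2"] assms(2) by (auto simp: L2_def n2_def)

lemma ip_mp: assumes "mp T" "L2 u" "L2 v" shows "ip (\<lambda>x. u (T x)) (\<lambda>x. v (T x)) = ip u v"
  using mp_integral[OF assms(1), of "\<lambda>x. u x \<bullet> v x"] L2_inner_integrable[OF assms(2,3)] by (auto simp: ip_def)

lemma mp_compose: assumes "mp S" "mp T" shows "mp (\<lambda>x. S (T x))"
proof -
  have [measurable]: "S \<in> borel_measurable borel" "T \<in> borel_measurable borel" using assms by (auto simp: mp_def)
  have "distr (distr lborel borel T) borel S = distr lborel borel (S \<circ> T)" by (rule distr_distr) auto
  then show ?thesis using assms by (auto simp: mp_def o_def)
qed

text \<open>Uniqueness of Haar measure by Tonelli, normalised by the ball, which an isometry preserves.\<close>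

lemma mp_orthogonal:
  fixes T :: "'a::euclidean_space \<Rightarrow> 'a"
  assumes "orthogonal_transformation T" shows "mp T"
proof -
  have lin: "linear T" and nT: "\<And>x. norm (T x) = norm x"
    using assms by (auto simp: orthogonal_transformation)
  have [measurable]: "T \<in> borel_measurable borel"
    using lin by (intro borel_measurable_continuous_onI linear_continuous_on) (simp add: linear_conv_bounded_linear)
  define \<nu> where "\<nu> = distr lborel borel T"
  have [simp]: "sets \<nu> = sets borel" "space \<nu> = UNIV" by (auto simp: \<nu>_def)
  have [measurable_cong]: "sets \<nu> = sets borel" by simp
  have bij: "bij T" using assms by (rule orthogonal_transformation_bij)
  define S where "S = inv T"
  have S: "T (S x) = x" "S (T x) = x" for x
    using bij by (auto simp: S_def bij_is_surj surj_f_inv_f bij_is_inj inv_f_f)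
  have nS: "norm (S x) = norm x" for x using nT[of "S x"] by (simp add: S)
  have linS: "S (x - y) = S x - S y" for x y
  proof -
    have "S (x - y) = S (T (S x) - T (S y))" by (simp only: S)
    also have "\<dots> = S (T (S x - S y))" by (simp only: linear_diff[OF lin])
    finally show ?thesis by (simp only: S)
  qed
  have preim: "T -` ball x 1 = ball (S x) 1" for x
  proof -
    have "dist x (T y) = dist (S x) y" for y using nS[of "x - T y"] by (simp add: dist_norm linS S)
    then show ?thesis by (intro set_eqI) (simp only: vimage_eq mem_ball)
  qed
  define \<beta> where "\<beta> = emeasure lborel (ball (0::'a) 1)"
  have ball_l: "emeasure lborel (ball x 1) = \<beta>" for x :: 'a
    by (simp add: \<beta>_def emeasure_ball)
  have ball_n: "emeasure \<nu> (ball x 1) = \<beta>" for x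
    by (simp add: \<nu>_def emeasure_distr preim ball_l)
  have \<beta>: "0 < \<beta>" "\<beta> < \<infinity>" by (simp_all add: \<beta>_def emeasure_ball)
  interpret N: sigma_finite_measure \<nu>
  proof
    show "\<exists>A. countable A \<and> A \<subseteq> sets \<nu> \<and> \<Union> A = space \<nu> \<and> (\<forall>a\<in>A. emeasure \<nu> a \<noteq> \<infinity>)"
    proof (intro exI[of _ "range (\<lambda>n::nat. ball 0 (real n))"] conjI ballI)
      show "\<Union> (range (\<lambda>n::nat. ball 0 (real n))) = space \<nu>"
        by (auto simp: reals_Archimedean2)
      fix a assume "a \<in> range (\<lambda>n. ball (0::'a) (real n))"
      then obtain n where a: "a = ball 0 (real n)" by auto
      have "T -` a = ball 0 (real n)" by (auto simp: a nT)
      then show "emeasure \<nu> a \<noteq> \<infinity>" using emeasure_lborel_ball_finite[of "0::'a" "real n"] by (simp add: \<nu>_def emeasure_distr a)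
    qed auto
  qed
  interpret P: pair_sigma_finite lborel \<nu> by unfold_locales
  have sets_pair: "sets (lborel \<Otimes>\<^sub>M \<nu>) = sets (borel \<Otimes>\<^sub>M borel :: ('a \<times> 'a) measure)"
    by (rule sets_pair_measure_cong) auto
  \<comment> \<open>The image measure is again translation invariant because T is linear;
    surjectivity of T then covers every translation.\<close>
  have tr: "(\<integral>\<^sup>+y. F (y + T c) \<partial>\<nu>) = (\<integral>\<^sup>+y. F y \<partial>\<nu>)" if [measurable]: "F \<in> borel_measurable borel" for F and c
  proof -
    have "(\<integral>\<^sup>+y. F (y + T c) \<partial>\<nu>) = (\<integral>\<^sup>+x. F (T (x + c)) \<partial>lborel)"
      by (simp add: \<nu>_def nn_integral_distr linear_add[OF lin])
    also have "\<dots> = (\<integral>\<^sup>+x. F (T x) \<partial>(distr lborel borel (\<lambda>x. x + c)))" by (simp add: nn_integral_distr)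
    also have "distr lborel borel (\<lambda>x. x + c) = lborel" using mp_translation[of c] by (simp add: mp_def)
    finally show ?thesis by (simp add: \<nu>_def nn_integral_distr)
  qed
  have tr': "(\<integral>\<^sup>+y. F (y + c) \<partial>\<nu>) = (\<integral>\<^sup>+y. F y \<partial>\<nu>)" if "F \<in> borel_measurable borel" for F c
    using tr[OF that, of "S c"] by (simp add: S)
  have trl: "(\<integral>\<^sup>+y. F (y + c) \<partial>lborel) = (\<integral>\<^sup>+y. F y \<partial>lborel)" if "F \<in> borel_measurable borel" for F and c :: 'a
  proof -
    have "distr lborel borel (\<lambda>x. x + c) = lborel" using mp_translation[of c] by (simp add: mp_def)
    then show ?thesis using nn_integral_distr[of "\<lambda>x. x + c" lborel borel F] that by simp
  qed
  have "emeasure \<nu> A = emeasure lborel A" if [measurable]: "A \<in> sets borel" for A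
  proof -
    have [measurable]: "ball (0::'a) 1 \<in> sets borel" by simp
    have [measurable]: "(indicator A :: 'a \<Rightarrow> ennreal) \<in> borel_measurable borel" by (rule borel_measurable_indicator) simp
    \<comment> \<open>The chain evaluates one double integral over \<open>lborel\<close> and \<nu>
      in two ways: a shift in y, by invariance of \<nu>, gives \<beta> times the \<nu>-measure of A;
      a shift in x, by invariance of \<open>lborel\<close>, followed by \<open>ball_n\<close> gives
      \<beta> times its Lebesgue measure.\<close>
    have "\<beta> * emeasure \<nu> A = (\<integral>\<^sup>+x. indicator (ball (0::'a) 1) x * (\<integral>\<^sup>+y. indicator A y \<partial>\<nu>) \<partial>lborel)"
      by (subst nn_integral_multc) (auto simp: \<beta>_def intro!: borel_measurable_indicator)
    also have "\<dots> = (\<integral>\<^sup>+x. (\<integral>\<^sup>+y. indicator (ball 0 1) x * indicator A (y + x) \<partial>\<nu>) \<partial>lborel)"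
    proof (rule nn_integral_cong)
      fix x :: 'a
      have "(\<integral>\<^sup>+y. indicator A (y + x) \<partial>\<nu>) = (\<integral>\<^sup>+y. indicator A y \<partial>\<nu>)"
        by (rule tr') measurable
      then show "indicator (ball 0 1) x * (\<integral>\<^sup>+y. indicator A y \<partial>\<nu>) = (\<integral>\<^sup>+y. indicator (ball 0 1) x * indicator A (y + x) \<partial>\<nu>)"
        by (simp add: nn_integral_cmult)
    qed
    also have "\<dots> = (\<integral>\<^sup>+y. (\<integral>\<^sup>+x. indicator (ball 0 1) x * indicator A (y + x) \<partial>lborel) \<partial>\<nu>)"
    proof (rule P.Fubini'[symmetric], unfold measurable_cong_sets[OF sets_pair refl])
      have [measurable]: "ball (0::'a) 1 \<in> sets borel" by simp
      show "(\<lambda>(x, y). indicator (ball 0 1) x * indicator A (y + x) :: ennreal) \<in> borel_measurable (borel \<Otimes>\<^sub>M borel :: ('a \<times> 'a) measure)"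
        by measurable
    qed
    also have "\<dots> = (\<integral>\<^sup>+y. (\<integral>\<^sup>+x. indicator (ball x 1) y * indicator A x \<partial>lborel) \<partial>\<nu>)"
    proof (rule nn_integral_cong)
      fix y
      have "(\<integral>\<^sup>+x. indicator (ball x 1) y * indicator A x \<partial>lborel) = (\<integral>\<^sup>+x. (\<lambda>x. indicator (ball 0 1) (x - y) * indicator A x) x \<partial>lborel)"
        by (auto intro!: nn_integral_cong simp: indicator_def dist_norm norm_minus_commute)
      also have "\<dots> = (\<integral>\<^sup>+x. (\<lambda>x. indicator (ball 0 1) (x - y) * indicator A x) (x + y) \<partial>lborel)"
        by (rule trl[symmetric]) measurable
      finally show "(\<integral>\<^sup>+x. indicator (ball 0 1) x * indicator A (y + x) \<partial>lborel) = (\<integral>\<^sup>+x. indicator (ball x 1) y * indicator A x \<partial>lborel)"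
        by (simp add: add.commute)
    qed
    also have "\<dots> = (\<integral>\<^sup>+y. (\<integral>\<^sup>+x. indicator {p. dist (fst p) (snd p) < 1} (x, y) * indicator A x \<partial>lborel) \<partial>\<nu>)"
      by (auto intro!: nn_integral_cong simp: indicator_def)
    also have "\<dots> = (\<integral>\<^sup>+x. (\<integral>\<^sup>+y. indicator {p. dist (fst p) (snd p) < 1} (x, y) * indicator A x \<partial>\<nu>) \<partial>lborel)"
    proof (rule P.Fubini', unfold measurable_cong_sets[OF sets_pair refl])
      show "(\<lambda>(x, y). indicator {p. dist (fst p) (snd p) < 1} (x, y) * indicator A x :: ennreal) \<in> borel_measurable (borel \<Otimes>\<^sub>M borel :: ('a \<times> 'a) measure)"
        by measurable
    qed
    also have "\<dots> = (\<integral>\<^sup>+x. (\<integral>\<^sup>+y. indicator (ball x 1) y * indicator A x \<partial>\<nu>) \<partial>lborel)"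
      by (auto intro!: nn_integral_cong simp: indicator_def)
    also have "\<dots> = (\<integral>\<^sup>+x. \<beta> * indicator A x \<partial>lborel)"
    proof (rule nn_integral_cong)
      fix x :: 'a
      have "(\<integral>\<^sup>+y. indicator (ball x 1) y * indicator A x \<partial>\<nu>) = (\<integral>\<^sup>+y. indicator (ball x 1) y \<partial>\<nu>) * indicator A x"
        by (rule nn_integral_multc) (simp add: borel_measurable_indicator)
      then show "(\<integral>\<^sup>+y. indicator (ball x 1) y * indicator A x \<partial>\<nu>) = \<beta> * indicator A x" by (simp add: ball_n)
    qed
    also have "\<dots> = \<beta> * emeasure lborel A" by (simp add: nn_integral_cmult)
    finally show ?thesis using \<beta> by (auto simp: ennreal_mult_cancel_left)
  qed
  then have "\<nu> = lborel" by (intro measure_eqI) auto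
  then show ?thesis by (simp add: mp_def \<nu>_def)
qed

section \<open>Test functions\<close>

text \<open>Continuity is asked of each directional derivative instead of the derivative as an
  operator. In finite dimension this is the same, and it keeps sums, products and compositions
  elementary.\<close>

definition C1 :: "('a::euclidean_space \<Rightarrow> real) \<Rightarrow> bool" where
  "C1 q \<longleftrightarrow> (\<exists>D. (\<forall>x. (q has_derivative D x) (at x)) \<and> (\<forall>v. continuous_on UNIV (\<lambda>x. D x v)))"

lemma C1_continuous: assumes "C1 q" shows "continuous_on UNIV q"
proof -
  obtain D where "\<And>x. (q has_derivative D x) (at x)" using assms unfolding C1_def by blast
  then show ?thesis by (intro continuous_at_imp_continuous_on ballI has_derivative_continuous)
qed

lemma C1_add: assumes "C1 p" "C1 q" shows "C1 (\<lambda>x. p x + q x)"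
proof -
  obtain D E where D: "\<And>x. (p has_derivative D x) (at x)" "\<And>v. continuous_on UNIV (\<lambda>x. D x v)"
    and E: "\<And>x. (q has_derivative E x) (at x)" "\<And>v. continuous_on UNIV (\<lambda>x. E x v)"
    using assms unfolding C1_def by blast
  show ?thesis unfolding C1_def
    by (intro exI[of _ "\<lambda>x v. D x v + E x v"] conjI allI derivative_intros D E continuous_intros)
qed

lemma C1_mult: assumes "C1 p" "C1 q" shows "C1 (\<lambda>x. p x * q x)"
proof -
  obtain D E where D: "\<And>x. (p has_derivative D x) (at x)" "\<And>v. continuous_on UNIV (\<lambda>x. D x v)"
    and E: "\<And>x. (q has_derivative E x) (at x)" "\<And>v. continuous_on UNIV (\<lambda>x. E x v)"
    using assms unfolding C1_def by blast
  show ?thesis unfolding C1_def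
    by (intro exI[of _ "\<lambda>x v. p x * E x v + D x v * q x"] conjI allI has_derivative_mult D E continuous_intros
        C1_continuous assms)
qed

lemma C1_const: "C1 (\<lambda>x. c)"
  unfolding C1_def by (intro exI[of _ "\<lambda>x v. 0"]) auto

lemma C1_linear: "bounded_linear l \<Longrightarrow> C1 l"
  unfolding C1_def by (intro exI[of _ "\<lambda>x. l"]) (auto intro: bounded_linear_imp_has_derivative)

lemma C1_polynomial: "real_polynomial_function p \<Longrightarrow> C1 p"
  by (induction rule: real_polynomial_function.induct) (auto intro: C1_add C1_mult C1_const C1_linear)

text \<open>Squaring makes the positive part continuously differentiable at 0; the explicit bump
  functions below are built from it.\<close>

lemma pos_part_square_derivative: "((\<lambda>s::real. (max 0 s)^2) has_real_derivative 2 * max 0 s) (at s)"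
proof -
  consider "s > 0" | "s < 0" | "s = 0" by linarith
  then show ?thesis
  proof cases
    case 1
    have "((\<lambda>s::real. s^2) has_real_derivative 2 * max 0 s) (at s)"
      using 1 by (auto intro!: derivative_eq_intros)
    then show ?thesis
      by (rule has_field_derivative_transform_within_open[where S="{0<..}"]) (use 1 in auto)
  next
    case 2
    have "((\<lambda>s::real. 0) has_real_derivative 2 * max 0 s) (at s)"
      using 2 by (auto intro!: derivative_eq_intros)
    then show ?thesis
      by (rule has_field_derivative_transform_within_open[where S="{..<0}"]) (use 2 in auto)
  next
    case 3
    have "(\<lambda>h::real. (max 0 h)^2 / h) \<midarrow>0\<rightarrow> 0"
    proof (rule tendsto_norm_zero_cancel, rule tendsto_sandwich[OF _ _ tendsto_const])
      show "\<forall>\<^sub>F h::real in at 0. 0 \<le> norm ((max 0 h)\<^sup>2 / h)" by simp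
      show "\<forall>\<^sub>F h::real in at 0. norm ((max 0 h)\<^sup>2 / h) \<le> \<bar>h\<bar>"
        by (rule always_eventually) (auto simp: max_def power2_eq_square)
      show "((\<lambda>h::real. \<bar>h\<bar>) \<longlongrightarrow> 0) (at 0)" by (auto intro!: tendsto_eq_intros)
    qed
    then show ?thesis using 3 by (simp add: DERIV_def)
  qed
qed

lemma C1_pos_part_square: assumes "C1 q" shows "C1 (\<lambda>x. (max 0 (q x))^2)"
proof -
  obtain D where D: "\<And>x. (q has_derivative D x) (at x)" "\<And>v. continuous_on UNIV (\<lambda>x. D x v)"
    using assms unfolding C1_def by blast
  show ?thesis unfolding C1_def
  proof (intro exI[of _ "\<lambda>x v. D x v * (2 * max 0 (q x))"] conjI allI)
    fix x
    show "((\<lambda>x. (max 0 (q x))\<^sup>2) has_derivative (\<lambda>v. D x v * (2 * max 0 (q x)))) (at x)"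
      using DERIV_compose_FDERIV[OF pos_part_square_derivative D(1)] .
  qed (intro continuous_intros D C1_continuous assms)
qed

lemma C1_frechet:
  assumes "C1 q"
  shows "(q has_derivative frechet_derivative q (at x)) (at x)" "continuous_on UNIV (\<lambda>x. frechet_derivative q (at x) v)"
proof -
  obtain D where D: "\<And>x. (q has_derivative D x) (at x)" "\<And>v. continuous_on UNIV (\<lambda>x. D x v)"
    using assms unfolding C1_def by blast
  have *: "frechet_derivative q (at x) = D x" for x using frechet_derivative_at[OF D(1)] by simp
  show "(q has_derivative frechet_derivative q (at x)) (at x)" "continuous_on UNIV (\<lambda>x. frechet_derivative q (at x) v)"
    using D by (simp_all add: *)
qed

lemma test_fun_C1: assumes "test_fun \<phi>" shows "C1 \<phi>"
  unfolding C1_def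
proof (intro exI[of _ "\<lambda>x. frechet_derivative \<phi> (at x)"] conjI allI)
  show d: "(\<phi> has_derivative frechet_derivative \<phi> (at x)) (at x)" for x
    using assms by (simp add: test_fun_def frechet_derivative_works)
  fix v :: 'a
  have "frechet_derivative \<phi> (at x) v = (\<Sum>e\<in>Basis. (v \<bullet> e) * frechet_derivative \<phi> (at x) e)" for x
  proof -
    interpret linear "frechet_derivative \<phi> (at x)" using d has_derivative_linear by blast
    have "frechet_derivative \<phi> (at x) v = frechet_derivative \<phi> (at x) (\<Sum>e\<in>Basis. (v \<bullet> e) *\<^sub>R e)"
      by (simp add: euclidean_representation)
    then show ?thesis by (simp add: sum scale)
  qed
  then show "continuous_on UNIV (\<lambda>x. frechet_derivative \<phi> (at x) v)"
    using assms by (auto simp: test_fun_def intro!: continuous_intros)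
qed

lemma test_fun_I: assumes "C1 \<phi>" "\<And>x. x \<notin> cball 0 R \<Longrightarrow> \<phi> x = 0" shows "test_fun \<phi>"
  unfolding test_fun_def
proof (intro conjI allI ballI)
  show "\<phi> differentiable (at x)" for x using C1_frechet(1)[OF assms(1)] unfolding differentiable_def by blast
  show "continuous_on UNIV (\<lambda>x. frechet_derivative \<phi> (at x) e)" for e by (rule C1_frechet(2)[OF assms(1)])
  have "{x. \<phi> x \<noteq> 0} \<subseteq> cball 0 R" using assms(2) by blast
  then have "closure {x. \<phi> x \<noteq> 0} \<subseteq> cball 0 R" by (intro closure_minimal) auto
  then show "compact (closure {x. \<phi> x \<noteq> 0})"
    by (metis bounded_cball bounded_subset closed_closure compact_eq_bounded_closed)
qed

lemma test_fun_support:
  assumes "test_fun \<phi>"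
  obtains R where "R > 0" "\<And>x. R \<le> norm x \<Longrightarrow> \<phi> x = 0" "\<And>x v. R \<le> norm x \<Longrightarrow> frechet_derivative \<phi> (at x) v = 0"
proof -
  have "bounded {x. \<phi> x \<noteq> 0}" using assms unfolding test_fun_def
    by (meson bounded_closure_image bounded_subset closure_subset compact_imp_bounded)
  then obtain B where B: "\<And>x. \<phi> x \<noteq> 0 \<Longrightarrow> norm x \<le> B" by (auto simp: bounded_iff)
  \<comment> \<open>The extra 1 leaves a whole neighbourhood of each x with R \<le> norm x on which
    \<phi> vanishes, so that the derivative vanishes there as well.\<close>
  define R where "R = \<bar>B\<bar> + 1"
  have 0: "\<phi> x = 0" if "R - 1 < norm x" for x using B[of x] that by (cases "\<phi> x = 0") (auto simp: R_def)
  have "frechet_derivative \<phi> (at x) v = 0" if "R \<le> norm x" for x v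
  proof -
    have "((\<lambda>x. 0::real) has_derivative (\<lambda>v. 0)) (at x)" by simp
    then have "(\<phi> has_derivative (\<lambda>v. 0)) (at x)"
      by (rule has_derivative_transform_within_open[where s="- cball 0 (R - 1)"]) (use that 0 in auto)
    then show ?thesis using frechet_derivative_at by metis
  qed
  then show ?thesis using 0 by (intro that[of R]) (auto simp: R_def)
qed

lemma L2_compact_support:
  fixes c :: "'a::euclidean_space \<Rightarrow> real"
  assumes "c \<in> borel_measurable lebesgue" "\<And>x. R \<le> norm x \<Longrightarrow> c x = 0" "\<And>x. \<bar>c x\<bar> \<le> M"
  shows "L2 c" "n2 c \<le> M^2 * measure lebesgue (cball (0::'a) R)"
proof -
  have i: "integrable lebesgue (indicat_real (cball (0::'a) R))"
    using lmeasurable_cball[of "0::'a" R] by (simp add: fmeasurable_def)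
  then have "integrable lebesgue (\<lambda>x::'a. M^2 * indicator (cball 0 R) x)" by simp
  moreover have "(\<lambda>x::'a. M^2 * indicator (cball 0 R) x) = (\<lambda>x. (norm (M * indicator (cball 0 R) x))^2)"
    by (auto simp: indicator_def)
  moreover have "(\<lambda>x::'a. M * indicator (cball 0 R) x) \<in> borel_measurable lebesgue"
    using i by simp
  ultimately have "L2 (\<lambda>x::'a. M * indicator (cball 0 R) x)" by (auto simp: L2_def)
  moreover have le: "norm (c x) \<le> norm (M * indicator (cball 0 R) x)" for x
    using assms(2,3)[of x] by (auto simp: indicator_def)
  ultimately show "L2 c" using L2_bound[OF _ assms(1)] by blast
  have "n2 c \<le> n2 (\<lambda>x::'a. M * indicator (cball 0 R) x)"
    using le \<open>L2 (\<lambda>x::'a. M * indicator (cball 0 R) x)\<close> by (intro n2_mono) auto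
  also have "\<dots> = (LINT x|lebesgue. M^2 * indicator (cball (0::'a) R) x)"
    unfolding n2_def by (intro Bochner_Integration.integral_cong) (auto simp: indicator_def)
  also have "\<dots> = M^2 * measure lebesgue (cball (0::'a) R)" by simp
  finally show "n2 c \<le> M^2 * measure lebesgue (cball (0::'a) R)" .
qed

lemma continuous_compact_support_bounded:
  fixes c :: "'a::euclidean_space \<Rightarrow> real"
  assumes "continuous_on UNIV c" "\<And>x. R \<le> norm x \<Longrightarrow> c x = 0"
  obtains M where "M \<ge> 0" "\<And>x. \<bar>c x\<bar> \<le> M"
proof -
  have "compact (c ` cball 0 R)"
    by (intro compact_continuous_image continuous_on_subset[OF assms(1)]) auto
  then have "bounded (c ` cball 0 R)" by (rule compact_imp_bounded)
  then obtain M where "\<forall>y\<in>c ` cball 0 R. norm y \<le> M" unfolding bounded_iff by blast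
  then have M: "\<And>x. x \<in> cball 0 R \<Longrightarrow> \<bar>c x\<bar> \<le> M" by simp
  show ?thesis
  proof
    show "\<bar>c x\<bar> \<le> max 0 M" for x using M[of x] assms(2)[of x] by (cases "norm x \<le> R") auto
  qed auto
qed

lemma continuous_lebesgue_measurable:
  "continuous_on UNIV (c :: 'a::euclidean_space \<Rightarrow> 'b::euclidean_space) \<Longrightarrow> c \<in> borel_measurable lebesgue"
  by (simp add: borel_measurable_continuous_onI measurable_completion)

lemma L2_continuous_compact_support:
  fixes c :: "'a::euclidean_space \<Rightarrow> real"
  assumes "continuous_on UNIV c" "\<And>x. R \<le> norm x \<Longrightarrow> c x = 0"
  shows "L2 c"
proof -
  obtain M where "\<And>x. \<bar>c x\<bar> \<le> M" using continuous_compact_support_bounded[OF assms] by metis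
  then show ?thesis using L2_compact_support(1)[OF continuous_lebesgue_measurable[OF assms(1)] assms(2)] by blast
qed

lemma test_fun_L2: assumes "test_fun \<phi>" shows "L2 \<phi>"
proof (rule test_fun_support[OF assms])
  fix R assume "\<And>x. R \<le> norm x \<Longrightarrow> \<phi> x = 0"
  then show ?thesis by (rule L2_continuous_compact_support[OF C1_continuous[OF test_fun_C1[OF assms]]])
qed

lemma test_fun_derivative_L2:
  assumes "test_fun \<phi>" shows "L2 (\<lambda>x. frechet_derivative \<phi> (at x) v)"
proof (rule test_fun_support[OF assms])
  fix R assume "\<And>x v. R \<le> norm x \<Longrightarrow> frechet_derivative \<phi> (at x) v = 0"
  then show ?thesis by (intro L2_continuous_compact_support[OF C1_frechet(2)[OF test_fun_C1[OF assms]]])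
qed

lemma n2_tendsto_0_dominated:
  fixes d :: "nat \<Rightarrow> 'a::euclidean_space \<Rightarrow> 'b::euclidean_space"
  assumes "\<And>n. d n \<in> borel_measurable lebesgue" "L2 h" "\<And>n. AE x in lebesgue. norm (d n x) \<le> norm (h x)"
    "AE x in lebesgue. (\<lambda>n. d n x) \<longlonglongrightarrow> 0"
  shows "(\<lambda>n. n2 (d n)) \<longlonglongrightarrow> 0"
proof -
  have [measurable]: "d n \<in> borel_measurable lebesgue" for n by fact
  have "(\<lambda>n. LINT x|lebesgue. (norm (d n x))^2) \<longlonglongrightarrow> (LINT x|(lebesgue::'a measure). (0::real))"
  proof (rule integral_dominated_convergence[where w="\<lambda>x. (norm (h x))^2"])
    show "integrable lebesgue (\<lambda>x. (norm (h x))\<^sup>2)" using assms(2) by (simp add: L2_def)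
    show "AE x in lebesgue. (\<lambda>n. (norm (d n x))\<^sup>2) \<longlonglongrightarrow> 0"
      using assms(4) by eventually_elim (auto intro!: tendsto_eq_intros)
    show "AE x in lebesgue. norm ((norm (d n x))\<^sup>2) \<le> (norm (h x))\<^sup>2" for n
      using assms(3)[of n] by eventually_elim (auto intro: power_mono)
  qed auto
  then show ?thesis by (simp add: n2_def)
qed

text \<open>Polynomials lack compact support. So c is divided by a C^1 bump \<psi>, the quotient is
  approximated uniformly on a larger ball by Stone-Weierstrass, and the polynomial is multiplied by
  \<psi> again.\<close>

lemma test_fun_dense_continuous:
  fixes c :: "'a::euclidean_space \<Rightarrow> real"
  assumes c: "continuous_on UNIV c" "\<And>x. R \<le> norm x \<Longrightarrow> c x = 0" and R: "R > 0" and e: "e > 0"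
  obtains \<phi> where "test_fun \<phi>" "n2 (\<lambda>x. c x - \<phi> x) \<le> e"
proof -
  define \<psi> where "\<psi> x = (max 0 ((2*R)^2 - x \<bullet> x))^2" for x :: 'a
  have C\<psi>: "C1 \<psi>"
  proof -
    have "C1 (\<lambda>x::'a. (2*R)^2 - x \<bullet> x)" unfolding C1_def
      by (intro exI[of _ "\<lambda>x v. - (2 * (x \<bullet> v))"] conjI allI)
         (auto intro!: derivative_eq_intros continuous_intros simp: inner_commute)
    then show ?thesis unfolding \<psi>_def by (rule C1_pos_part_square)
  qed
  \<comment> \<open>L = ((2R)^2 - R^2)^2 is a lower bound for \<psi> on the ball of radius R, and S
    = ((2R)^2)^2 an upper bound everywhere. Dividing by \<open>max L (\<psi> x)\<close> keeps the
    quotient continuous where \<psi> vanishes.\<close>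
  define L where "L = (3 * R^2)^2"
  define m where "m = measure lebesgue (cball (0::'a) (2*R))"
  define S where "S = 16 * R^4"
  have m: "m \<ge> 0" by (simp add: m_def)
  have S: "S > 0" using R by (simp add: S_def)
  \<comment> \<open>Chosen so that the squared uniform error (d S)^2 times the volume m is at most
    e.\<close>
  define d where "d = sqrt (e / (m + 1)) / S"
  have d: "d > 0" using e m S by (simp add: d_def)
  have L: "L > 0" using R by (simp add: L_def)
  have \<psi>L: "L \<le> \<psi> x" if "norm x \<le> R" for x
  proof -
    have "x \<bullet> x \<le> R^2" using that by (simp add: power2_norm_eq_inner[symmetric] power_mono)
    then have "3 * R^2 \<le> max 0 ((2*R)^2 - x \<bullet> x)" by (simp add: power_mult_distrib)
    then show ?thesis unfolding L_def \<psi>_def using R by (intro power_mono) auto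
  qed
  have \<psi>0: "\<psi> x = 0" if "2 * R \<le> norm x" for x
  proof -
    have "(2*R)^2 \<le> (norm x)^2" using that R by (intro power_mono) auto
    then have "(2*R)^2 \<le> x \<bullet> x" by (simp only: power2_norm_eq_inner)
    then show ?thesis by (simp add: \<psi>_def)
  qed
  have \<psi>S: "0 \<le> \<psi> x" "\<psi> x \<le> S" for x
  proof -
    have "max 0 ((2*R)^2 - x \<bullet> x) \<le> (2*R)^2" by simp
    then have "\<psi> x \<le> ((2*R)^2)^2" unfolding \<psi>_def by (intro power_mono) auto
    then show "0 \<le> \<psi> x" "\<psi> x \<le> S" by (simp_all add: \<psi>_def S_def power_mult_distrib)
  qed
  have "continuous_on (cball 0 (2*R)) (\<lambda>x. c x / max L (\<psi> x))"
    using L by (intro continuous_intros continuous_on_subset[OF c(1)] continuous_on_subset[OF C1_continuous[OF C\<psi>]]) auto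
  then obtain p where p: "polynomial_function p" "\<And>x. x \<in> cball 0 (2*R) \<Longrightarrow> norm (c x / max L (\<psi> x) - p x) < d"
    using Stone_Weierstrass_polynomial_function[of "cball 0 (2*R)" "\<lambda>x. c x / max L (\<psi> x)" d] d by auto
  define \<phi> where "\<phi> x = p x * \<psi> x" for x
  have "C1 \<phi>" unfolding \<phi>_def using p(1) by (intro C1_mult C\<psi> C1_polynomial) (simp add: real_polynomial_function_eq)
  then have t: "test_fun \<phi>" by (rule test_fun_I[where R="2*R"]) (auto simp: \<phi>_def \<psi>0)
  have eq: "c x = c x / max L (\<psi> x) * \<psi> x" for x
  proof (cases "norm x \<le> R")
    case True
    then show ?thesis using \<psi>L[of x] L by (simp add: max_def)
  qed (use c in auto)
  have b: "\<bar>c x - \<phi> x\<bar> \<le> d * S" for x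
  proof (cases "norm x \<le> 2 * R")
    case True
    have "c x - \<phi> x = (c x / max L (\<psi> x) - p x) * \<psi> x" unfolding \<phi>_def using eq[of x] by (simp add: algebra_simps)
    then have "\<bar>c x - \<phi> x\<bar> = \<bar>c x / max L (\<psi> x) - p x\<bar> * \<psi> x" using \<psi>S by (simp add: abs_mult)
    also have "\<dots> \<le> d * S" using p(2)[of x] True \<psi>S[of x] d by (intro mult_mono) auto
    finally show ?thesis .
  qed (use c(2)[of x] R d S \<psi>0[of x] in \<open>auto simp: \<phi>_def\<close>)
  have "n2 (\<lambda>x. c x - \<phi> x) \<le> (d * S)^2 * m" unfolding m_def
  proof (rule L2_compact_support(2))
    show "(\<lambda>x. c x - \<phi> x) \<in> borel_measurable lebesgue"
      by (intro continuous_lebesgue_measurable continuous_intros c C1_continuous \<open>C1 \<phi>\<close>)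
    show "2 * R \<le> norm x \<Longrightarrow> c x - \<phi> x = 0" for x using c(2)[of x] \<psi>0[of x] R by (simp add: \<phi>_def)
  qed (use b in auto)
  also have "\<dots> = e * (m / (m + 1))" using S e m by (simp add: d_def)
  also have "\<dots> \<le> e * 1" using e m by (intro mult_left_mono) auto
  finally show ?thesis using that t by simp
qed

text \<open>Values and domain are truncated, the truncation is replaced by continuous functions
  converging to it a.e., and those by test functions; each of the three errors is at most sqrt e /
  4.\<close>

lemma test_fun_dense:
  fixes w :: "'a::euclidean_space \<Rightarrow> real"
  assumes w: "L2 w" and e: "e > 0"
  obtains \<phi> where "test_fun \<phi>" "n2 (\<lambda>x. w x - \<phi> x) < e"
proof -
  have [measurable]: "w \<in> borel_measurable lebesgue" using w by (simp add: L2_def)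
  define e1 where "e1 = sqrt e / 4"
  have e1: "e1 > 0" using e by (simp add: e1_def)
  define w1 where "w1 n x = indicator {x. \<bar>w x\<bar> \<le> real n} x * (indicator (cball 0 (real n)) x * w x)" for n x
  have "cball (0::'a) r \<in> sets lebesgue" for r by simp
  note [measurable] = this
  have w1m[measurable]: "w1 n \<in> borel_measurable lebesgue" for n unfolding w1_def[abs_def] by measurable
  have "(\<lambda>n. n2 (\<lambda>x. w x - w1 n x)) \<longlonglongrightarrow> 0"
  proof (rule n2_tendsto_0_dominated[OF _ w])
    show "AE x in lebesgue. (\<lambda>n. w x - w1 n x) \<longlonglongrightarrow> 0"
    proof (rule AE_I2)
      fix x
      obtain N :: nat where "max \<bar>w x\<bar> (norm x) < real N" using reals_Archimedean2 by blast
      then have "\<forall>\<^sub>F n in sequentially. w x - w1 n x = 0"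
        by (intro eventually_sequentiallyI[of N]) (auto simp: w1_def)
      then show "(\<lambda>n. w x - w1 n x) \<longlonglongrightarrow> 0" by (rule tendsto_eventually)
    qed
    show "(\<lambda>x. w x - w1 n x) \<in> borel_measurable lebesgue" for n by measurable
  qed (auto simp: w1_def indicator_def)
  then obtain n where n: "n2 (\<lambda>x. w x - w1 n x) < e1^2"
    using e1 by (metis (no_types, lifting) LIMSEQ_D diff_zero n2_nonneg abs_of_nonneg order_refl real_norm_def zero_less_power)
  define R where "R = real n + 1"
  have L1: "L2 (w1 n)" by (rule L2_bound[OF w]) (auto simp: w1_def indicator_def)
  have "w1 n measurable_on UNIV" by (rule lebesgue_measurable_imp_measurable_on) auto
  then obtain N g where g: "negligible N" "\<And>k. continuous_on UNIV (g k)" "\<And>x. x \<notin> N \<Longrightarrow> (\<lambda>k. g k x) \<longlonglongrightarrow> w1 n x"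
    unfolding measurable_on_def by auto
  \<comment> \<open>Clamping to [-n, n] and multiplying by \<open>cut\<close> leave
    \<open>w1 n\<close> unchanged, so the modified functions still converge to it a.e. and now share
    an L2 majorant.\<close>
  define cut where "cut x = max 0 (min 1 (R - norm x))" for x :: 'a
  define c where "c k x = max (- real n) (min (real n) (g k x)) * cut x" for k x
  have cc: "continuous_on UNIV (c k)" for k unfolding c_def[abs_def] cut_def by (intro continuous_intros g)
  have c0: "R \<le> norm x \<Longrightarrow> c k x = 0" for k x by (simp add: c_def cut_def)
  have cb: "\<bar>c k x\<bar> \<le> real n" for k x
  proof -
    have "\<bar>c k x\<bar> \<le> real n * 1" unfolding c_def abs_mult by (intro mult_mono) (auto simp: cut_def)
    then show ?thesis by simp
  qed
  have w1b: "\<bar>w1 n x\<bar> \<le> real n" "real n < norm x \<Longrightarrow> w1 n x = 0" for x by (auto simp: w1_def indicator_def)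
  have w1_cut: "w1 n x * cut x = w1 n x" for x
    using w1b[of x] by (cases "norm x \<le> real n") (auto simp: cut_def R_def)
  have hL: "L2 (\<lambda>x::'a. 2 * real n * indicator (cball 0 R) x)"
  proof -
    have "(\<lambda>x::'a. 2 * real n * indicator (cball 0 R) x) \<in> borel_measurable lebesgue" by measurable
    then show ?thesis
      by (rule L2_compact_support(1)[where R="R + 1" and M="2 * real n"]) (auto simp: indicator_def)
  qed
  have "(\<lambda>k. n2 (\<lambda>x. w1 n x - c k x)) \<longlonglongrightarrow> 0"
  proof (rule n2_tendsto_0_dominated[OF _ hL])
    show "(\<lambda>x. w1 n x - c k x) \<in> borel_measurable lebesgue" for k
      using continuous_lebesgue_measurable[OF cc[of k]] by measurable
    show "AE x in lebesgue. norm (w1 n x - c k x) \<le> norm (2 * real n * indicator (cball 0 R) x)" for k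
    proof (rule AE_I2)
      fix x
      show "norm (w1 n x - c k x) \<le> norm (2 * real n * indicator (cball 0 R) x)"
        using w1b[of x] cb[of k x] c0[of x k] by (cases "norm x \<le> R") (auto simp: R_def)
    qed
    have "AE x in lebesgue. x \<notin> N" using g(1) by (simp add: negligible_iff_null_sets AE_not_in)
    then show "AE x in lebesgue. (\<lambda>k. w1 n x - c k x) \<longlonglongrightarrow> 0"
    proof eventually_elim
      fix x assume "x \<notin> N"
      then have "(\<lambda>k. w1 n x - c k x) \<longlonglongrightarrow> w1 n x - max (- real n) (min (real n) (w1 n x)) * cut x"
        unfolding c_def by (intro tendsto_intros g(3))
      moreover have "max (- real n) (min (real n) (w1 n x)) = w1 n x" using w1b(1)[of x] by linarith
      ultimately show "(\<lambda>k. w1 n x - c k x) \<longlonglongrightarrow> 0" by (simp add: w1_cut)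
    qed
  qed
  then obtain k where k: "n2 (\<lambda>x. w1 n x - c k x) < e1^2"
    using e1 by (metis (no_types, lifting) LIMSEQ_D diff_zero n2_nonneg abs_of_nonneg order_refl real_norm_def zero_less_power)
  have Lc: "L2 (c k)" using L2_continuous_compact_support[OF cc c0] .
  obtain \<phi> where \<phi>: "test_fun \<phi>" "n2 (\<lambda>x. c k x - \<phi> x) \<le> e1^2"
  proof (rule test_fun_dense_continuous[of "c k" R "e1^2"])
    show "R \<le> norm x \<Longrightarrow> c k x = 0" for x by (rule c0)
  qed (use e1 cc in \<open>auto simp: R_def\<close>)
  have "sqrt (n2 (\<lambda>x. w x - \<phi> x)) = sqrt (n2 (\<lambda>x. (w x - w1 n x) + ((w1 n x - c k x) + (c k x - \<phi> x))))"
    by (simp add: algebra_simps)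
  also have "\<dots> \<le> sqrt (n2 (\<lambda>x. w x - w1 n x)) + sqrt (n2 (\<lambda>x. (w1 n x - c k x) + (c k x - \<phi> x)))"
    by (intro n2_triangle L2_add L2_diff w L1 Lc test_fun_L2 \<phi>)
  also have "sqrt (n2 (\<lambda>x. (w1 n x - c k x) + (c k x - \<phi> x))) \<le> sqrt (n2 (\<lambda>x. w1 n x - c k x)) + sqrt (n2 (\<lambda>x. c k x - \<phi> x))"
    by (intro n2_triangle L2_add L2_diff w L1 Lc test_fun_L2 \<phi>)
  also have "sqrt (n2 (\<lambda>x. w x - w1 n x)) \<le> e1" using n e1 by (intro real_le_lsqrt) auto
  also have "sqrt (n2 (\<lambda>x. w1 n x - c k x)) \<le> e1" using k e1 by (intro real_le_lsqrt) auto
  also have "sqrt (n2 (\<lambda>x. c k x - \<phi> x)) \<le> e1" using \<phi>(2) e1 by (intro real_le_lsqrt) auto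
  finally have "sqrt (n2 (\<lambda>x. w x - \<phi> x)) < sqrt e"
    using real_sqrt_gt_zero[OF e] unfolding e1_def by linarith
  then show ?thesis using that \<phi>(1) by simp
qed

text \<open>Otherwise some test function would be closer to w than 0 is, against Pythagoras.\<close>

lemma L2_orthogonal_test_fun_eq_0:
  fixes w :: "'a::euclidean_space \<Rightarrow> real"
  assumes w: "L2 w" and 0: "\<And>\<phi>. test_fun \<phi> \<Longrightarrow> (LINT x|lebesgue. w x * \<phi> x) = 0"
  shows "AE x in lebesgue. w x = 0"
proof (rule n2_eq_0[OF w], rule ccontr)
  assume "n2 w \<noteq> 0"
  then have pos: "n2 w > 0" using n2_nonneg[of w] by linarith
  obtain \<phi> where \<phi>: "test_fun \<phi>" "n2 (\<lambda>x. w x - \<phi> x) < n2 w" using test_fun_dense[OF w pos] by blast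
  have "ip w \<phi> = 0" using 0[OF \<phi>(1)] by (simp add: ip_def)
  then have "n2 (\<lambda>x. w x - \<phi> x) = n2 w + n2 \<phi>" using n2_diff[OF w test_fun_L2[OF \<phi>(1)]] by simp
  then show False using \<phi>(2) n2_nonneg[of \<phi>] by linarith
qed

section \<open>Weak gradients\<close>

lemma L2_component: assumes "L2 g" shows "L2 (\<lambda>x. g x \<bullet> v)"
proof (rule L2_bound)
  show "L2 (\<lambda>x. norm v *\<^sub>R g x)" by (rule L2_scaleR[OF assms])
  have [measurable]: "g \<in> borel_measurable lebesgue" using assms by (simp add: L2_def)
  show "(\<lambda>x. g x \<bullet> v) \<in> borel_measurable lebesgue" by measurable
  show "AE x in lebesgue. norm (g x \<bullet> v) \<le> norm (norm v *\<^sub>R g x)"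
    using Cauchy_Schwarz_ineq2[of "g x" v for x] by (intro AE_I2) (simp add: mult.commute[of "norm v"])
qed

lemma L2_real_mult_integrable:
  fixes u v :: "'a::euclidean_space \<Rightarrow> real"
  assumes "L2 u" "L2 v" shows "integrable lebesgue (\<lambda>x. u x * v x)"
  using L2_inner_integrable[OF assms] by simp

lemma weak_gradient_test:
  "weak_gradient u g \<Longrightarrow> test_fun \<phi> \<Longrightarrow> e \<in> Basis \<Longrightarrow>
    (LINT x|lebesgue. u x * frechet_derivative \<phi> (at x) e) = - (LINT x|lebesgue. (g x \<bullet> e) * \<phi> x)"
  by (simp add: weak_gradient_def)

lemma weak_gradient_unique:
  assumes "weak_gradient u g" "weak_gradient u g'" "L2 g" "L2 g'"
  shows "AE x in lebesgue. g x = g' x"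
proof -
  have "AE x in lebesgue. (g x - g' x) \<bullet> e = 0" if "e \<in> Basis" for e
  proof (rule L2_orthogonal_test_fun_eq_0)
    show "L2 (\<lambda>x. (g x - g' x) \<bullet> e)" by (intro L2_component L2_diff assms)
    fix \<phi> :: "'a \<Rightarrow> real" assume \<phi>: "test_fun \<phi>"
    have "(LINT x|lebesgue. (g x \<bullet> e) * \<phi> x) = (LINT x|lebesgue. (g' x \<bullet> e) * \<phi> x)"
      using weak_gradient_test[OF assms(1) \<phi> that] weak_gradient_test[OF assms(2) \<phi> that] by simp
    then show "(LINT x|lebesgue. ((g x - g' x) \<bullet> e) * \<phi> x) = 0"
      by (simp add: inner_diff_left left_diff_distrib Bochner_Integration.integral_diff L2_real_mult_integrable
          L2_component assms test_fun_L2[OF \<phi>])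
  qed
  then have "AE x in lebesgue. \<forall>e\<in>Basis. (g x - g' x) \<bullet> e = 0" by (rule AE_finite_allI[OF finite_Basis])
  then show ?thesis
  proof eventually_elim
    fix x assume "\<forall>e\<in>Basis. (g x - g' x) \<bullet> e = 0"
    then have "g x - g' x = 0" unfolding euclidean_all_zero_iff .
    then show "g x = g' x" by simp
  qed
qed

lemma H1_alt: "H1 u \<longleftrightarrow> L2 u \<and> (\<exists>g. weak_gradient u g \<and> L2 g)"
  by (auto simp: H1_def L2_def weak_gradient_def)

lemma H1_grad: assumes "H1 u" shows "weak_gradient u (grad u)" "L2 (grad u)"
proof -
  have "\<exists>g. weak_gradient u g \<and> integrable lebesgue (\<lambda>x. (norm (g x))^2)" using assms by (simp add: H1_def)
  from someI_ex[OF this] have "weak_gradient u (grad u) \<and> integrable lebesgue (\<lambda>x. (norm (grad u x))^2)"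
    unfolding grad_def .
  then show "weak_gradient u (grad u)" "L2 (grad u)" by (auto simp: L2_def weak_gradient_def)
qed

lemma H1_L2: "H1 u \<Longrightarrow> L2 u" by (simp add: H1_alt)

lemma H1_I:
  assumes "L2 u" "weak_gradient u g" "L2 g"
  shows "H1 u" "AE x in lebesgue. grad u x = g x"
proof -
  show H: "H1 u" using assms by (auto simp: H1_alt)
  show "AE x in lebesgue. grad u x = g x"
    by (rule weak_gradient_unique[OF H1_grad(1)[OF H] assms(2) H1_grad(2)[OF H] assms(3)])
qed

text \<open>Linearity in the direction. Rotated basis vectors and arbitrary translation directions
  both occur later.\<close>

lemma weak_gradient_dir:
  assumes "L2 u" "L2 g" "weak_gradient u g" "test_fun \<phi>"
  shows "(LINT x|lebesgue. u x * frechet_derivative \<phi> (at x) v) = - (LINT x|lebesgue. (g x \<bullet> v) * \<phi> x)"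
proof -
  have lin: "frechet_derivative \<phi> (at x) v = (\<Sum>e\<in>Basis. (v \<bullet> e) * frechet_derivative \<phi> (at x) e)" for x
  proof -
    interpret linear "frechet_derivative \<phi> (at x)"
      using C1_frechet(1)[OF test_fun_C1[OF assms(4)]] has_derivative_linear by blast
    have "frechet_derivative \<phi> (at x) v = frechet_derivative \<phi> (at x) (\<Sum>e\<in>Basis. (v \<bullet> e) *\<^sub>R e)"
      by (simp add: euclidean_representation)
    then show ?thesis by (simp add: sum scale)
  qed
  have "(LINT x|lebesgue. u x * frechet_derivative \<phi> (at x) v)
      = (LINT x|lebesgue. (\<Sum>e\<in>Basis. (v \<bullet> e) * (u x * frechet_derivative \<phi> (at x) e)))"
    by (simp add: lin sum_distrib_left mult_ac)
  also have "\<dots> = (\<Sum>e\<in>Basis. (v \<bullet> e) * (LINT x|lebesgue. u x * frechet_derivative \<phi> (at x) e))"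
    by (simp add: Bochner_Integration.integral_sum L2_real_mult_integrable assms(1) test_fun_derivative_L2[OF assms(4)])
  also have "\<dots> = - (\<Sum>e\<in>Basis. (v \<bullet> e) * (LINT x|lebesgue. (g x \<bullet> e) * \<phi> x))"
    by (simp add: weak_gradient_test[OF assms(3,4)] sum_negf)
  also have "(\<Sum>e\<in>Basis. (v \<bullet> e) * (LINT x|lebesgue. (g x \<bullet> e) * \<phi> x))
      = (LINT x|lebesgue. (\<Sum>e\<in>Basis. (v \<bullet> e) * ((g x \<bullet> e) * \<phi> x)))"
    by (simp add: Bochner_Integration.integral_sum L2_real_mult_integrable L2_component assms(2) test_fun_L2[OF assms(4)])
  also have "(\<lambda>x. \<Sum>e\<in>Basis. (v \<bullet> e) * ((g x \<bullet> e) * \<phi> x)) = (\<lambda>x. (g x \<bullet> v) * \<phi> x)"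
  proof
    fix x
    have "(\<Sum>e\<in>Basis. (v \<bullet> e) * ((g x \<bullet> e) * \<phi> x)) = (\<Sum>e\<in>Basis. (g x \<bullet> e) * (v \<bullet> e)) * \<phi> x"
      unfolding sum_distrib_right by (intro sum.cong) auto
    then show "(\<Sum>e\<in>Basis. (v \<bullet> e) * ((g x \<bullet> e) * \<phi> x)) = (g x \<bullet> v) * \<phi> x"
      by (subst euclidean_inner[of "g x" v])
  qed
  finally show ?thesis .
qed

lemma weak_gradient_add:
  fixes u :: "'a::euclidean_space \<Rightarrow> real"
  assumes "L2 u" "L2 g" "weak_gradient u g" "L2 v" "L2 h" "weak_gradient v h"
  shows "weak_gradient (\<lambda>x. u x + v x) (\<lambda>x. g x + h x)"
  unfolding weak_gradient_def
proof (intro conjI allI impI ballI)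
  show "(\<lambda>x. g x + h x) \<in> borel_measurable lebesgue" using L2_add[OF assms(2,5)] by (simp add: L2_def)
  fix \<phi> :: "'a \<Rightarrow> real" and e :: 'a assume \<phi>: "test_fun \<phi>" "e \<in> Basis"
  then show "(LINT x|lebesgue. (u x + v x) * frechet_derivative \<phi> (at x) e) = - (LINT x|lebesgue. ((g x + h x) \<bullet> e) * \<phi> x)"
    using L2_real_mult_integrable[OF assms(1) test_fun_derivative_L2[OF \<phi>(1), of e]]
      L2_real_mult_integrable[OF assms(4) test_fun_derivative_L2[OF \<phi>(1), of e]]
      L2_real_mult_integrable[OF L2_component[OF assms(2)] test_fun_L2[OF \<phi>(1)], of e]
      L2_real_mult_integrable[OF L2_component[OF assms(5)] test_fun_L2[OF \<phi>(1)], of e]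
      weak_gradient_test[OF assms(3) \<phi>] weak_gradient_test[OF assms(6) \<phi>]
    by (simp add: distrib_right inner_add_left)
qed

lemma weak_gradient_scaleR:
  fixes u :: "'a::euclidean_space \<Rightarrow> real"
  assumes "L2 g" "weak_gradient u g"
  shows "weak_gradient (\<lambda>x. c * u x) (\<lambda>x. c *\<^sub>R g x)"
  unfolding weak_gradient_def
proof (intro conjI allI impI ballI)
  show "(\<lambda>x. c *\<^sub>R g x) \<in> borel_measurable lebesgue" using L2_scaleR[OF assms(1), of c] by (simp add: L2_def)
  fix \<phi> :: "'a \<Rightarrow> real" and e :: 'a assume \<phi>: "test_fun \<phi>" "e \<in> Basis"
  then show "(LINT x|lebesgue. (c * u x) * frechet_derivative \<phi> (at x) e) = - (LINT x|lebesgue. ((c *\<^sub>R g x) \<bullet> e) * \<phi> x)"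
    by (simp add: mult.assoc weak_gradient_test[OF assms(2)])
qed

lemma weak_gradient_AE_cong:
  fixes u :: "'a::euclidean_space \<Rightarrow> real"
  assumes "L2 u" "weak_gradient u g" "AE x in lebesgue. u' x = u x"
  shows "weak_gradient u' g"
  unfolding weak_gradient_def
proof (intro conjI allI impI ballI)
  show "g \<in> borel_measurable lebesgue" using assms by (simp add: weak_gradient_def)
  have [measurable]: "u \<in> borel_measurable lebesgue" using assms(1) by (simp add: L2_def)
  have [measurable]: "u' \<in> borel_measurable lebesgue" using AE_measurable_lebesgue[OF _ assms(3)] by simp
  fix \<phi> :: "'a \<Rightarrow> real" and e :: 'a assume \<phi>: "test_fun \<phi>" "e \<in> Basis"
  have [measurable]: "(\<lambda>x. frechet_derivative \<phi> (at x) e) \<in> borel_measurable lebesgue"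
    using test_fun_derivative_L2[OF \<phi>(1)] by (simp add: L2_def)
  have "(LINT x|lebesgue. u' x * frechet_derivative \<phi> (at x) e) = (LINT x|lebesgue. u x * frechet_derivative \<phi> (at x) e)"
    by (rule integral_cong_AE) (use assms(3) in auto)
  then show "(LINT x|lebesgue. u' x * frechet_derivative \<phi> (at x) e) = - (LINT x|lebesgue. (g x \<bullet> e) * \<phi> x)"
    using weak_gradient_test[OF assms(2) \<phi>] by simp
qed

lemma H1_add:
  assumes "H1 u" "H1 v"
  shows "H1 (\<lambda>x. u x + v x)" "AE x in lebesgue. grad (\<lambda>x. u x + v x) x = grad u x + grad v x"
  using H1_I[OF L2_add weak_gradient_add L2_add, of u v "grad u" "grad v"] H1_L2 H1_grad assms by auto

lemma H1_cmult:
  assumes "H1 u"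
  shows "H1 (\<lambda>x. c * u x)" "AE x in lebesgue. grad (\<lambda>x. c * u x) x = c *\<^sub>R grad u x"
  using H1_I[OF L2_cmult[of u c] weak_gradient_scaleR[of "grad u" u c] L2_scaleR[of "grad u" c]] H1_L2 H1_grad assms by auto

lemma H1_AE_cong:
  assumes "H1 u" "AE x in lebesgue. v x = u x"
  shows "H1 v" "AE x in lebesgue. grad v x = grad u x"
proof -
  have L: "L2 v" using L2_AE_cong[OF H1_L2[OF assms(1)] _ assms(2)] AE_measurable_lebesgue[OF _ assms(2)] H1_L2[OF assms(1)]
    by (auto simp: L2_def)
  show "H1 v" "AE x in lebesgue. grad v x = grad u x"
    using H1_I[OF L weak_gradient_AE_cong[OF H1_L2[OF assms(1)] H1_grad(1)[OF assms(1)] assms(2)] H1_grad(2)[OF assms(1)]] by auto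
qed

lemma test_fun_compose_linear:
  assumes \<phi>: "test_fun \<phi>" and S: "bounded_linear S" "\<And>x. norm (S x) = norm x"
  shows "test_fun (\<lambda>x. \<phi> (S x))" "frechet_derivative (\<lambda>x. \<phi> (S x)) (at x) v = frechet_derivative \<phi> (at (S x)) (S v)"
proof -
  have d: "((\<lambda>x. \<phi> (S x)) has_derivative (\<lambda>v. frechet_derivative \<phi> (at (S x)) (S v))) (at x)" for x
    using diff_chain_at[OF bounded_linear_imp_has_derivative[OF S(1)] C1_frechet(1)[OF test_fun_C1[OF \<phi>], of "S x"]]
    by (simp add: o_def)
  show "frechet_derivative (\<lambda>x. \<phi> (S x)) (at x) v = frechet_derivative \<phi> (at (S x)) (S v)"
    using frechet_derivative_at[OF d] by metis
  obtain R where "R > 0" and R: "\<And>x. R \<le> norm x \<Longrightarrow> \<phi> x = 0" "\<And>x v. R \<le> norm x \<Longrightarrow> frechet_derivative \<phi> (at x) v = 0"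
    using test_fun_support[OF \<phi>] by blast
  show "test_fun (\<lambda>x. \<phi> (S x))"
  proof (rule test_fun_I)
    show "C1 (\<lambda>x. \<phi> (S x))" unfolding C1_def
      by (intro exI[of _ "\<lambda>x v. frechet_derivative \<phi> (at (S x)) (S v)"] conjI allI d
          continuous_on_compose2[OF C1_frechet(2)[OF test_fun_C1[OF \<phi>]]] linear_continuous_on S(1)) auto
    show "\<phi> (S x) = 0" if "x \<notin> cball 0 R" for x using that R[of "S x"] by (simp add: S)
  qed
qed

text \<open>A measure preserving change of variables moves T from u to the test function, where the
  chain rule is classical. The adjoint of T is its inverse, whence the form of the gradient.\<close>

lemma weak_gradient_orthogonal:
  fixes T :: "'a::euclidean_space \<Rightarrow> 'a"
  assumes u: "L2 u" "L2 g" "weak_gradient u g" and T: "orthogonal_transformation T"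
  shows "weak_gradient (\<lambda>x. u (T x)) (\<lambda>x. inv T (g (T x)))" "L2 (\<lambda>x. inv T (g (T x)))"
proof -
  define S where "S = inv T"
  have bij: "bij T" using T by (rule orthogonal_transformation_bij)
  have ST: "T (S x) = x" "S (T x) = x" for x
    using bij by (auto simp: S_def bij_is_surj surj_f_inv_f bij_is_inj inv_f_f)
  have S: "orthogonal_transformation S" unfolding S_def using T by (rule orthogonal_transformation_inv)
  have Sl: "bounded_linear S" and Sn: "\<And>x. norm (S x) = norm x"
    using S by (auto simp: orthogonal_transformation linear_conv_bounded_linear)
  have adj: "S a \<bullet> b = a \<bullet> T b" for a b
    using T by (metis ST(1) orthogonal_transformation_def)
  have mT: "mp T" using T by (rule mp_orthogonal)
  have gm: "(\<lambda>x. g (T x)) \<in> borel_measurable lebesgue" using mp_comp_measurable[OF mT] u(2) by (auto simp: L2_def)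
  have m: "(\<lambda>x. S (g (T x))) \<in> borel_measurable lebesgue"
    by (rule measurable_compose[OF gm borel_measurable_continuous_onI]) (rule linear_continuous_on[OF Sl])
  show "L2 (\<lambda>x. inv T (g (T x)))"
    using L2_mp[OF mT u(2)] m by (simp add: L2_def Sn flip: S_def)
  show "weak_gradient (\<lambda>x. u (T x)) (\<lambda>x. inv T (g (T x)))"
    unfolding weak_gradient_def S_def[symmetric]
  proof (intro conjI allI impI ballI m)
    fix \<phi> :: "'a \<Rightarrow> real" and e :: 'a assume \<phi>: "test_fun \<phi>" "e \<in> Basis"
    define \<psi> where "\<psi> x = \<phi> (S x)" for x
    have \<psi>: "test_fun \<psi>" "\<And>x v. frechet_derivative \<psi> (at x) v = frechet_derivative \<phi> (at (S x)) (S v)"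
      unfolding \<psi>_def[abs_def] using test_fun_compose_linear[OF \<phi>(1) Sl Sn] by auto
    have "(LINT x|lebesgue. u (T x) * frechet_derivative \<phi> (at x) e)
        = (LINT x|lebesgue. (\<lambda>x. u x * frechet_derivative \<psi> (at x) (T e)) (T x))"
      by (simp add: \<psi> ST)
    also have "\<dots> = (LINT x|lebesgue. u x * frechet_derivative \<psi> (at x) (T e))"
      by (rule mp_integral[OF mT]) (use L2_real_mult_integrable[OF u(1) test_fun_derivative_L2[OF \<psi>(1)]] in auto)
    also have "\<dots> = - (LINT x|lebesgue. (g x \<bullet> T e) * \<psi> x)"
      by (rule weak_gradient_dir[OF u \<psi>(1)])
    also have "(LINT x|lebesgue. (g x \<bullet> T e) * \<psi> x) = (LINT x|lebesgue. (\<lambda>x. (g x \<bullet> T e) * \<psi> x) (T x))"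
      by (rule mp_integral[OF mT, symmetric]) (use L2_real_mult_integrable[OF L2_component[OF u(2)] test_fun_L2[OF \<psi>(1)]] in auto)
    also have "\<dots> = (LINT x|lebesgue. (S (g (T x)) \<bullet> e) * \<phi> x)" by (simp add: \<psi>_def ST adj)
    finally show "(LINT x|lebesgue. u (T x) * frechet_derivative \<phi> (at x) e) = - (LINT x|lebesgue. (S (g (T x)) \<bullet> e) * \<phi> x)" .
  qed
qed

text \<open>Differentiation under the integral along sequences of increments: the difference
  quotients are bounded by the Lipschitz constant M and live in one common ball.\<close>

lemma test_fun_shift_derivative:
  assumes u: "L2 u" and \<phi>: "test_fun \<phi>"
  shows "((\<lambda>t. LINT x|lebesgue. u x * \<phi> (x + t *\<^sub>R v)) has_real_derivative
      (LINT x|lebesgue. u x * frechet_derivative \<phi> (at (x + t *\<^sub>R v)) v)) (at t)"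
proof -
  note C = test_fun_C1[OF \<phi>]
  obtain R where R: "R > 0" "\<And>x. R \<le> norm x \<Longrightarrow> \<phi> x = 0" "\<And>x v. R \<le> norm x \<Longrightarrow> frechet_derivative \<phi> (at x) v = 0"
    using test_fun_support[OF \<phi>] by blast
  obtain M where M: "M \<ge> 0" "\<And>x. \<bar>frechet_derivative \<phi> (at x) v\<bar> \<le> M"
    using continuous_compact_support_bounded[OF C1_frechet(2)[OF C, of v] R(3)] by blast
  have [measurable]: "u \<in> borel_measurable lebesgue" using u by (simp add: L2_def)
  have \<phi>t: "L2 (\<lambda>x. \<phi> (x + s *\<^sub>R v))" for s using L2_mp[OF mp_translation test_fun_L2[OF \<phi>]] .
  have \<phi>m[measurable]: "(\<lambda>x. \<phi> (x + s *\<^sub>R v)) \<in> borel_measurable lebesgue" for s using \<phi>t[of s] by (simp add: L2_def)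
  have [measurable]: "(\<lambda>x. frechet_derivative \<phi> (at (x + s *\<^sub>R v)) v) \<in> borel_measurable lebesgue" for s
    using L2_mp[OF mp_translation test_fun_derivative_L2[OF \<phi>]] by (auto simp: L2_def)
  have line: "((\<lambda>s. \<phi> (x + s *\<^sub>R v)) has_real_derivative frechet_derivative \<phi> (at (x + s *\<^sub>R v)) v) (at s)" for x s
  proof -
    have "((\<lambda>s. x + s *\<^sub>R v) has_derivative (\<lambda>d. d *\<^sub>R v)) (at s)" by (auto intro!: derivative_eq_intros)
    from diff_chain_at[OF this C1_frechet(1)[OF C]]
    have "((\<lambda>s. \<phi> (x + s *\<^sub>R v)) has_derivative (\<lambda>d. frechet_derivative \<phi> (at (x + s *\<^sub>R v)) (d *\<^sub>R v))) (at s)"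
      by (simp add: o_def)
    moreover have "(\<lambda>d. frechet_derivative \<phi> (at (x + s *\<^sub>R v)) (d *\<^sub>R v)) = (*) (frechet_derivative \<phi> (at (x + s *\<^sub>R v)) v)"
      using linear_scale[OF has_derivative_linear[OF C1_frechet(1)[OF C]]] by (auto simp: mult.commute)
    ultimately show ?thesis by (simp add: has_field_derivative_def)
  qed
  have lip: "\<bar>\<phi> (x + s *\<^sub>R v) - \<phi> (x + t *\<^sub>R v)\<bar> \<le> M * \<bar>s - t\<bar>" for x s
  proof -
    have "norm (\<phi> (x + s *\<^sub>R v) - \<phi> (x + t *\<^sub>R v)) \<le> M * norm (s - t)"
      by (rule field_differentiable_bound[where S=UNIV and f'="\<lambda>s. frechet_derivative \<phi> (at (x + s *\<^sub>R v)) v"])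
         (use line M(2) in auto)
    then show ?thesis by simp
  qed
  show ?thesis unfolding DERIV_def tendsto_at_iff_sequentially
  proof (intro allI impI)
    fix h :: "nat \<Rightarrow> real" assume h: "\<forall>i. h i \<in> UNIV - {0}" and h0: "h \<longlonglongrightarrow> 0"
    obtain B where B: "\<And>n. \<bar>h n\<bar> \<le> B"
      using convergent_imp_Bseq[of h] h0 by (auto simp: convergent_def Bseq_def)
    \<comment> \<open>Increments bounded by B displace the support by at most (B + |t|) norm
      v.\<close>
    define R' where "R' = R + (B + \<bar>t\<bar>) * norm v"
    have out: "\<phi> (x + s *\<^sub>R v) = 0" if "R' \<le> norm x" "\<bar>s\<bar> \<le> B + \<bar>t\<bar>" for x s
    proof -
      have "norm x \<le> norm (x + s *\<^sub>R v) + norm (s *\<^sub>R v)"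
        using norm_triangle_ineq4[of "x + s *\<^sub>R v" "s *\<^sub>R v"] by simp
      moreover have "norm (s *\<^sub>R v) \<le> (B + \<bar>t\<bar>) * norm v" using that(2) by (simp add: mult_right_mono)
      ultimately show ?thesis using that(1) by (intro R(2)) (simp add: R'_def)
    qed
    define dq where "dq n x = (\<phi> (x + (t + h n) *\<^sub>R v) - \<phi> (x + t *\<^sub>R v)) / h n" for n x
    have dqb: "\<bar>dq n x\<bar> \<le> M * indicator (cball 0 R') x" for n x
    proof (cases "norm x \<le> R'")
      case True
      have "\<bar>dq n x\<bar> \<le> M" using lip[of x "t + h n"] h by (simp add: dq_def abs_divide divide_le_eq)
      then show ?thesis using True by simp
    next
      case False
      have "\<bar>t + h n\<bar> \<le> B + \<bar>t\<bar>" "\<bar>t\<bar> \<le> B + \<bar>t\<bar>" using B[of n] by linarith+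
      then show ?thesis using out[of x] False M(1) by (simp add: dq_def)
    qed
    have I: "L2 (\<lambda>x::'a. M * indicator (cball 0 R') x)"
    proof -
      have "(\<lambda>x::'a. M * indicator (cball 0 R') x) \<in> borel_measurable lebesgue"
        by (intro borel_measurable_times borel_measurable_const borel_measurable_indicator) simp
      then show ?thesis
        by (rule L2_compact_support(1)[where R="R' + 1" and M=M]) (use M(1) in \<open>auto simp: indicator_def\<close>)
    qed
    have "(\<lambda>n. LINT x|lebesgue. u x * dq n x) \<longlonglongrightarrow> (LINT x|lebesgue. u x * frechet_derivative \<phi> (at (x + t *\<^sub>R v)) v)"
    proof (rule integral_dominated_convergence[where w="\<lambda>x. \<bar>u x * (M * indicator (cball 0 R') x)\<bar>"])
      show "integrable lebesgue (\<lambda>x. \<bar>u x * (M * indicator (cball 0 R') x)\<bar>)"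
        using L2_real_mult_integrable[OF u I] by (rule integrable_abs)
      show "AE x in lebesgue. norm (u x * dq n x) \<le> \<bar>u x * (M * indicator (cball 0 R') x)\<bar>" for n
      proof (rule AE_I2)
        fix x
        have "\<bar>u x\<bar> * \<bar>dq n x\<bar> \<le> \<bar>u x\<bar> * \<bar>M * indicator (cball 0 R') x\<bar>"
          using dqb[of n x] by (intro mult_left_mono) auto
        then show "norm (u x * dq n x) \<le> \<bar>u x * (M * indicator (cball 0 R') x)\<bar>" by (simp only: real_norm_def abs_mult)
      qed
      show "AE x in lebesgue. (\<lambda>n. u x * dq n x) \<longlonglongrightarrow> u x * frechet_derivative \<phi> (at (x + t *\<^sub>R v)) v"
      proof (rule AE_I2)
        fix x
        have "(\<lambda>n. dq n x) \<longlonglongrightarrow> frechet_derivative \<phi> (at (x + t *\<^sub>R v)) v"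
          using line[of x t] h h0 unfolding DERIV_def tendsto_at_iff_sequentially dq_def by (auto simp: o_def)
        then show "(\<lambda>n. u x * dq n x) \<longlonglongrightarrow> u x * frechet_derivative \<phi> (at (x + t *\<^sub>R v)) v"
          by (intro tendsto_intros)
      qed
    qed (auto simp: dq_def)
    moreover have "(LINT x|lebesgue. u x * dq n x) = ((LINT x|lebesgue. u x * \<phi> (x + (t + h n) *\<^sub>R v)) - (LINT x|lebesgue. u x * \<phi> (x + t *\<^sub>R v))) / h n" for n
    proof -
      have "(LINT x|lebesgue. u x * dq n x) = (LINT x|lebesgue. (u x * \<phi> (x + (t + h n) *\<^sub>R v) - u x * \<phi> (x + t *\<^sub>R v)) / h n)"
        unfolding dq_def by (simp add: right_diff_distrib)
      also have "\<dots> = (LINT x|lebesgue. (u x * \<phi> (x + (t + h n) *\<^sub>R v) - u x * \<phi> (x + t *\<^sub>R v))) / h n"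
        by simp
      finally show ?thesis by (simp add: L2_real_mult_integrable u \<phi>t)
    qed
    ultimately show "((\<lambda>h. ((LINT x|lebesgue. u x * \<phi> (x + (t + h) *\<^sub>R v)) - (LINT x|lebesgue. u x * \<phi> (x + t *\<^sub>R v))) / h) \<circ> h)
      \<longlonglongrightarrow> (LINT x|lebesgue. u x * frechet_derivative \<phi> (at (x + t *\<^sub>R v)) v)"
      by (simp add: o_def)
  qed
qed

section \<open>Translation estimate and ball averages\<close>

lemma test_fun_shift:
  assumes \<phi>: "test_fun \<phi>"
  shows "test_fun (\<lambda>x. \<phi> (x + c))" "frechet_derivative (\<lambda>x. \<phi> (x + c)) (at x) v = frechet_derivative \<phi> (at (x + c)) v"
proof -
  have d: "((\<lambda>x. \<phi> (x + c)) has_derivative (\<lambda>v. frechet_derivative \<phi> (at (x + c)) v)) (at x)" for x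
  proof -
    have "((\<lambda>x. x + c) has_derivative (\<lambda>v. v)) (at x)" by (auto intro!: derivative_eq_intros)
    from diff_chain_at[OF this C1_frechet(1)[OF test_fun_C1[OF \<phi>], of "x + c"]] show ?thesis by (simp add: o_def)
  qed
  show "frechet_derivative (\<lambda>x. \<phi> (x + c)) (at x) v = frechet_derivative \<phi> (at (x + c)) v"
    using frechet_derivative_at[OF d[of x]] by simp
  obtain R where "R > 0" and R: "\<And>x. R \<le> norm x \<Longrightarrow> \<phi> x = 0" "\<And>x v. R \<le> norm x \<Longrightarrow> frechet_derivative \<phi> (at x) v = 0"
    using test_fun_support[OF \<phi>] by blast
  show "test_fun (\<lambda>x. \<phi> (x + c))"
  proof (rule test_fun_I)
    show "C1 (\<lambda>x. \<phi> (x + c))" unfolding C1_def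
      by (intro exI[of _ "\<lambda>x v. frechet_derivative \<phi> (at (x + c)) v"] conjI allI d
          continuous_on_compose2[OF C1_frechet(2)[OF test_fun_C1[OF \<phi>]]] continuous_intros) auto
    show "\<phi> (x + c) = 0" if "x \<notin> cball 0 (R + norm c)" for x
      using that norm_diff_ineq[of x c] by (intro R(1)) simp
  qed
qed

text \<open>Tested against \<phi>, the increment equals D 1 - D 0 for the pairing D of u with
  translates of \<phi>. Moving to the weak gradient bounds the derivative of D by norm h times the
  norms of g and \<phi>.\<close>

lemma translation_estimate:
  assumes u: "L2 u" and g: "L2 g" and ug: "weak_gradient u g"
  shows "n2 (\<lambda>x. u (x + h) - u x) \<le> (norm h)^2 * n2 g"
proof -
  define w where "w x = u (x + h) - u x" for x
  define B where "B = norm h * sqrt (n2 g)"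
  have B: "B \<ge> 0" by (simp add: B_def)
  have uh: "L2 (\<lambda>x. u (x + h))" by (rule L2_mp[OF mp_translation u])
  have w: "L2 w" unfolding w_def[abs_def] by (intro L2_diff uh u)
  have key: "\<bar>ip w \<phi>\<bar> \<le> B * sqrt (n2 \<phi>)" if \<phi>: "test_fun \<phi>" for \<phi>
  proof -
    define D where "D t = (LINT x|lebesgue. u x * \<phi> (x + t *\<^sub>R (- h)))" for t
    define D' where "D' t = (LINT x|lebesgue. u x * frechet_derivative \<phi> (at (x + t *\<^sub>R (- h))) (- h))" for t
    have D: "(D has_real_derivative D' t) (at t)" for t
      unfolding D_def[abs_def] D'_def using test_fun_shift_derivative[OF u \<phi>] .
    have D'b: "\<bar>D' t\<bar> \<le> B * sqrt (n2 \<phi>)" for t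
    proof -
      define \<psi> where "\<psi> x = \<phi> (x + t *\<^sub>R (- h))" for x
      have \<psi>: "test_fun \<psi>" unfolding \<psi>_def[abs_def] by (rule test_fun_shift(1)[OF \<phi>])
      have "D' t = (LINT x|lebesgue. u x * frechet_derivative \<psi> (at x) (- h))"
        unfolding D'_def \<psi>_def by (simp only: test_fun_shift(2)[OF \<phi>])
      also have "\<dots> = - (LINT x|lebesgue. (g x \<bullet> (- h)) * \<psi> x)" by (rule weak_gradient_dir[OF u g ug \<psi>])
      also have "\<dots> = - ip (\<lambda>x. g x \<bullet> (- h)) \<psi>" by (simp add: ip_def)
      finally have "\<bar>D' t\<bar> \<le> sqrt (n2 (\<lambda>x. g x \<bullet> (- h))) * sqrt (n2 \<psi>)"
        using ip_Cauchy_Schwarz[OF L2_component[OF g, of "- h"] test_fun_L2[OF \<psi>]] by simp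
      also have "n2 \<psi> = n2 \<phi>" unfolding \<psi>_def[abs_def] by (rule n2_mp[OF mp_translation test_fun_L2[OF \<phi>]])
      also have "n2 (\<lambda>x. g x \<bullet> (- h)) \<le> n2 (\<lambda>x. norm h *\<^sub>R g x)"
      proof (rule n2_mono[OF L2_scaleR[OF g]], rule AE_I2)
        fix x show "norm (g x \<bullet> - h) \<le> norm (norm h *\<^sub>R g x)"
          using Cauchy_Schwarz_ineq2[of "g x" "- h"] by (simp add: mult.commute[of "norm h"])
      qed
      then have "sqrt (n2 (\<lambda>x. g x \<bullet> (- h))) \<le> sqrt ((norm h)^2 * n2 g)"
        unfolding n2_scaleR by (rule real_sqrt_le_mono)
      then have "sqrt (n2 (\<lambda>x. g x \<bullet> (- h))) \<le> B" by (simp add: B_def real_sqrt_mult)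
      finally show ?thesis using B by (simp add: mult_right_mono)
    qed
    have "norm (D 1 - D 0) \<le> (B * sqrt (n2 \<phi>)) * norm (1 - 0 :: real)"
      by (rule field_differentiable_bound[where S=UNIV and f'=D']) (use D D'b in auto)
    moreover have "ip w \<phi> = D 1 - D 0"
    proof -
      have "(LINT x|lebesgue. u (x + h) * \<phi> x) = (LINT x|lebesgue. (\<lambda>x. u x * \<phi> (x - h)) (x + h))" by simp
      also have "\<dots> = (LINT x|lebesgue. u x * \<phi> (x - h))"
      proof (rule mp_integral[OF mp_translation])
        show "(\<lambda>x. u x * \<phi> (x - h)) \<in> borel_measurable lebesgue"
          using L2_real_mult_integrable[OF u test_fun_L2[OF test_fun_shift(1)[OF \<phi>, of "- h"]]] by auto
      qed
      finally have "(LINT x|lebesgue. u (x + h) * \<phi> x) = D 1" by (simp add: D_def)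
      moreover have "ip w \<phi> = (LINT x|lebesgue. u (x + h) * \<phi> x) - D 0"
        using L2_real_mult_integrable[OF uh test_fun_L2[OF \<phi>]] L2_real_mult_integrable[OF u test_fun_L2[OF \<phi>]]
        by (simp add: ip_def w_def D_def left_diff_distrib)
      ultimately show ?thesis by simp
    qed
    ultimately show ?thesis by simp
  qed
  define a where "a = sqrt (n2 w)"
  have a: "a \<ge> 0" "a^2 = n2 w" by (auto simp: a_def)
  \<comment> \<open>Ideally \<phi> would be w itself, giving a^2 = ip w w \<le> B a; a test function
    within d of w costs an error of at most d (B + a).\<close>
  have "a^2 \<le> B * a"
  proof (rule field_le_epsilon)
    fix e :: real assume e: "e > 0"
    define d where "d = e / (B + a + 1)"
    have d: "d > 0" using e B a by (simp add: d_def)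
    obtain \<phi> where \<phi>: "test_fun \<phi>" "n2 (\<lambda>x. w x - \<phi> x) < d^2" using test_fun_dense[OF w, of "d^2"] d by auto
    have L\<phi>: "L2 \<phi>" by (rule test_fun_L2[OF \<phi>(1)])
    have dd: "sqrt (n2 (\<lambda>x. w x - \<phi> x)) \<le> d" using \<phi>(2) d by (intro real_le_lsqrt) auto
    have "sqrt (n2 \<phi>) = sqrt (n2 (\<lambda>x. w x - (w x - \<phi> x)))" by simp
    also have "\<dots> \<le> a + sqrt (n2 (\<lambda>x. w x - \<phi> x))" unfolding a_def by (intro n2_triangle_diff L2_diff w L\<phi>)
    finally have n\<phi>: "sqrt (n2 \<phi>) \<le> a + d" using dd by linarith
    have "a^2 = ip w \<phi> + ip w (\<lambda>x. w x - \<phi> x)"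
    proof -
      have "ip (\<lambda>x. w x - \<phi> x) w = ip w w - ip \<phi> w" by (rule ip_diff_left[OF w L\<phi> w])
      then show ?thesis
        unfolding a(2) n2_ip[of w] ip_commute[of w "\<lambda>x. w x - \<phi> x"] ip_commute[of w \<phi>] by linarith
    qed
    also have "ip w \<phi> \<le> B * (a + d)"
      using key[OF \<phi>(1)] mult_left_mono[OF n\<phi> B] by linarith
    also have "ip w (\<lambda>x. w x - \<phi> x) \<le> a * d"
      using ip_Cauchy_Schwarz[OF w L2_diff[OF w L\<phi>]] mult_left_mono[OF dd a(1)] unfolding a_def by linarith
    finally have "a^2 \<le> B * a + d * (B + a)" by (simp add: algebra_simps)
    also have "d * (B + a) \<le> e" using e B a by (simp add: d_def field_simps)
    finally show "a^2 \<le> B * a + e" by simp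
  qed
  then have "a \<le> B" using a B by (cases "a = 0") (auto simp: power2_eq_square)
  then have "a^2 \<le> B^2" using a by (intro power_mono) auto
  then show ?thesis using a(2) unfolding w_def B_def by (simp add: power_mult_distrib)
qed

section \<open>Ball averages: Lipschitz bounds, approximation in L2 and commutation\<close>

definition vol :: "'a::euclidean_space itself \<Rightarrow> real \<Rightarrow> real" where
  "vol _ r = measure lebesgue (ball (0::'a) r)"

definition avg :: "real \<Rightarrow> ('a::euclidean_space \<Rightarrow> real) \<Rightarrow> 'a \<Rightarrow> real" where
  "avg r u x = (LINT y|lebesgue. indicator (ball x r) y * u y) / vol TYPE('a) r"

lemma vol_ball: "r \<ge> 0 \<Longrightarrow> measure lborel (ball (x::'a::euclidean_space) r) = vol TYPE('a) r"
  by (simp add: vol_def content_ball)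

lemma vol_eq: "r \<ge> 0 \<Longrightarrow> vol TYPE('a::euclidean_space) r = unit_ball_vol (DIM('a)) * r ^ DIM('a)"
  by (simp add: vol_def content_ball)

lemma vol_pos: "r > 0 \<Longrightarrow> vol TYPE('a::euclidean_space) r > 0"
  by (simp add: vol_eq)

lemma L2_ball:
  fixes x :: "'a::euclidean_space"
  assumes "r \<ge> 0"
  shows "L2 (indicat_real (ball x r))" "n2 (indicat_real (ball x r)) = vol TYPE('a) r"
proof -
  have i: "integrable lebesgue (indicat_real (ball x r))"
    using lmeasurable_ball[of x r] by (simp add: fmeasurable_def)
  have e: "(\<lambda>y. (norm (indicat_real (ball x r) y))^2) = indicat_real (ball x r)"
    by (auto simp: indicator_def)
  show "L2 (indicat_real (ball x r))" using i by (auto simp: L2_def e simp del: real_norm_def)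
  show "n2 (indicat_real (ball x r)) = vol TYPE('a) r" unfolding n2_def e using assms by (simp add: vol_ball)
qed

lemma avg_bound:
  fixes u :: "'a::euclidean_space \<Rightarrow> real"
  assumes "L2 u" "r > 0" shows "\<bar>avg r u x\<bar> \<le> sqrt (n2 u) / sqrt (vol TYPE('a) r)"
proof -
  define v where "v = vol TYPE('a) r"
  have v: "v > 0" unfolding v_def by (rule vol_pos[OF assms(2)])
  have "\<bar>ip (indicat_real (ball x r)) u\<bar> \<le> sqrt v * sqrt (n2 u)"
    using ip_Cauchy_Schwarz[OF L2_ball(1) assms(1), of r x] assms(2) by (simp add: L2_ball v_def)
  then have "\<bar>avg r u x\<bar> \<le> (sqrt v * sqrt (n2 u)) / v"
    using v by (simp add: avg_def ip_def abs_divide divide_right_mono flip: v_def)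
  also have "\<dots> = sqrt (n2 u) / sqrt v" using v by (simp add: field_simps)
  finally show ?thesis by (simp add: v_def)
qed

lemma avg_diff:
  assumes "L2 u" "L2 v" "r \<ge> 0" shows "avg r (\<lambda>y. u y - v y) x = avg r u x - avg r v x"
  using L2_real_mult_integrable[OF L2_ball(1)[OF assms(3), of x] assms(1)]
    L2_real_mult_integrable[OF L2_ball(1)[OF assms(3), of x] assms(2)]
  by (simp add: avg_def right_diff_distrib diff_divide_distrib)

lemma avg_shift:
  assumes "L2 u" "r \<ge> 0" shows "avg r u (x + h) = avg r (\<lambda>y. u (y + h)) x"
proof -
  have "(LINT y|lebesgue. indicator (ball (x + h) r) y * u y) = (LINT y|lebesgue. (\<lambda>y. indicator (ball (x + h) r) y * u y) (y + h))"
    by (rule mp_integral[OF mp_translation, symmetric])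
       (use L2_real_mult_integrable[OF L2_ball(1)[OF assms(2), of "x + h"] assms(1)] in auto)
  also have "\<dots> = (LINT y|lebesgue. indicator (ball x r) y * u (y + h))"
    by (rule Bochner_Integration.integral_cong) (auto simp: indicator_def dist_norm)
  finally show ?thesis by (simp add: avg_def)
qed

text \<open>Averaging commutes with translations, so a difference of two values is the average of an
  increment of u, to which the translation estimate applies.\<close>

lemma avg_Lipschitz:
  fixes u :: "'a::euclidean_space \<Rightarrow> real"
  assumes "L2 u" "L2 g" "weak_gradient u g" "r > 0"
  shows "\<bar>avg r u x - avg r u y\<bar> \<le> norm (x - y) * (sqrt (n2 g) / sqrt (vol TYPE('a) r))"
proof -
  have "avg r u x - avg r u y = avg r (\<lambda>z. u (z + (x - y))) y - avg r u y"
    using avg_shift[OF assms(1), of r y "x - y"] assms(4) by simp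
  also have "\<dots> = avg r (\<lambda>z. u (z + (x - y)) - u z) y"
    using assms by (intro avg_diff[symmetric] L2_mp[OF mp_translation]) auto
  finally have "\<bar>avg r u x - avg r u y\<bar> \<le> sqrt (n2 (\<lambda>z. u (z + (x - y)) - u z)) / sqrt (vol TYPE('a) r)"
    using avg_bound[OF L2_diff[OF L2_mp[OF mp_translation assms(1)] assms(1)] assms(4)] by simp
  also have "sqrt (n2 (\<lambda>z. u (z + (x - y)) - u z)) \<le> sqrt ((norm (x - y))^2 * n2 g)"
    using translation_estimate[OF assms(1-3)] by simp
  also have "\<dots> = norm (x - y) * sqrt (n2 g)" by (simp add: real_sqrt_mult)
  finally show ?thesis using vol_pos[OF assms(4), where 'a='a] by (simp add: divide_right_mono)
qed

lemma avg_continuous: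
  assumes "L2 u" "L2 g" "weak_gradient u g" "r > 0"
  shows "continuous_on UNIV (avg r u)"
proof -
  have "(sqrt (n2 g) / sqrt (vol TYPE('a) r))-lipschitz_on UNIV (avg r u)"
    using avg_Lipschitz[OF assms] vol_pos[OF assms(4), where 'a='a]
    by (intro lipschitz_onI) (auto simp: dist_norm mult.commute)
  then show ?thesis by (rule lipschitz_on_continuous_on)
qed

lemma avg_AE_cong:
  fixes u u' :: "'a::euclidean_space \<Rightarrow> real"
  assumes "L2 u" "AE x in lebesgue. u' x = u x" shows "avg r u' = avg r u"
proof
  fix x :: 'a
  have [measurable]: "u \<in> borel_measurable lebesgue" using assms(1) by (simp add: L2_def)
  have [measurable]: "u' \<in> borel_measurable lebesgue" using AE_measurable_lebesgue[OF _ assms(2)] by simp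
  have [measurable]: "ball x r \<in> sets lebesgue" by simp
  have "(LINT y|lebesgue. indicator (ball x r) y * u' y) = (LINT y|lebesgue. indicator (ball x r) y * u y)"
    by (rule integral_cong_AE) (use assms(2) in auto)
  then show "avg r u' x = avg r u x" by (simp add: avg_def)
qed

text \<open>Tonelli on products of \<open>lborel\<close> needs integrands such as w(x + h) - w(x) to
  be jointly measurable, which Borel representatives provide.\<close>

lemma L2_borel_version:
  fixes u :: "'a::euclidean_space \<Rightarrow> real"
  assumes "L2 u"
  obtains u' where "u' \<in> borel_measurable borel" "L2 u'" "AE x in lebesgue. u' x = u x"
proof -
  obtain u' where u': "u' \<in> borel_measurable lborel" "AE x in lborel. u x = u' x"
    using completion_ex_borel_measurable_real[of u lborel] assms by (auto simp: L2_def)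
  have ae: "AE x in lebesgue. u' x = u x" using u'(2) unfolding AE_completion_iff by eventually_elim simp
  have "u' \<in> borel_measurable lebesgue" using u'(1) by (rule measurable_completion)
  then have "L2 u'" by (rule L2_AE_cong[OF assms _ ae])
  then show ?thesis using u'(1) ae by (intro that[of u']) simp_all
qed

text \<open>By Cauchy-Schwarz the squared distance of u(x) to its average is at most the mean of
  |u(x + h) - u(x)|^2 over norm h < r. Integrating in x and swapping by Tonelli leaves the
  translation estimate for each h.\<close>

lemma avg_L2_estimate:
  fixes u :: "'a::euclidean_space \<Rightarrow> real"
  assumes u: "L2 u" and g: "L2 g" and ug: "weak_gradient u g" and r: "r > 0"
  shows "L2 (\<lambda>x. u x - avg r u x)" "n2 (\<lambda>x. u x - avg r u x) \<le> r^2 * n2 g"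
proof -
  define v where "v = vol TYPE('a) r"
  have v: "v > 0" unfolding v_def by (rule vol_pos[OF r])
  obtain w where w[measurable]: "w \<in> borel_measurable borel" and wL: "L2 w" and wu: "AE x in lebesgue. w x = u x"
    using L2_borel_version[OF u] by blast
  have av: "avg r w = avg r u" by (rule avg_AE_cong[OF u wu])
  have wg: "weak_gradient w g" by (rule weak_gradient_AE_cong[OF u ug wu])
  have [measurable]: "avg r w \<in> borel_measurable borel"
    by (intro borel_measurable_continuous_onI avg_continuous[OF wL g wg r])
  have pt: "ennreal ((norm (w x - avg r w x))^2) \<le> ennreal (1 / v) * (\<integral>\<^sup>+h. indicator (ball 0 r) h * ennreal ((w (x + h) - w x)^2) \<partial>lborel)" for x
  proof -
    define B where "B = indicat_real (ball x r)"
    have B: "L2 B" "n2 B = v" unfolding B_def v_def using L2_ball[of r x] r by auto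
    define d where "d y = B y * (w y - w x)" for y
    have "L2 (\<lambda>y. B y * w y)" using L2_indicator[OF wL, of "ball x r"] by (simp add: B_def)
    moreover have "L2 (\<lambda>y. w x * B y)" by (rule L2_cmult[OF B(1)])
    ultimately have "L2 (\<lambda>y. B y * w y - w x * B y)" by (rule L2_diff)
    then have d: "L2 d" by (simp add: d_def[abs_def] algebra_simps)
    have iB: "integrable lebesgue B"
      using lmeasurable_ball[of x r] by (simp add: fmeasurable_def B_def)
    have "ip B d = (LINT y|lebesgue. B y * w y - w x * B y)"
      unfolding ip_def by (rule Bochner_Integration.integral_cong) (auto simp: d_def B_def indicator_def)
    also have "\<dots> = (LINT y|lebesgue. B y * w y) - w x * v"
      using L2_real_mult_integrable[OF B(1) wL] iB r by (simp add: B_def v_def vol_ball)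
    finally have "avg r w x - w x = ip B d / v" using v by (simp add: avg_def B_def v_def field_simps)
    moreover have "(norm (w x - avg r w x))^2 = (avg r w x - w x)^2" by (simp add: power2_commute)
    ultimately have "(norm (w x - avg r w x))^2 = (ip B d)^2 / v^2" by (simp only: power_divide)
    also have "(ip B d)^2 \<le> (sqrt v * sqrt (n2 d))^2"
      using ip_Cauchy_Schwarz[OF B(1) d] B(2) abs_le_square_iff[of "ip B d" "sqrt v * sqrt (n2 d)"] v by simp
    then have "(ip B d)^2 / v^2 \<le> (v * n2 d) / v^2" using v by (intro divide_right_mono) (auto simp: power_mult_distrib)
    also have "\<dots> = (1 / v) * n2 d" using v by (simp add: power2_eq_square)
    finally have "ennreal ((norm (w x - avg r w x))^2) \<le> ennreal ((1 / v) * n2 d)" by (rule ennreal_leI)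
    also have "\<dots> = ennreal (1 / v) * ennreal (n2 d)" by (rule ennreal_mult') (use v in simp)
    also have "ennreal (n2 d) = (\<integral>\<^sup>+y. ennreal ((norm (d y))^2) \<partial>lebesgue)" using nn_integral_n2[OF d] by simp
    also have "\<dots> = (\<integral>\<^sup>+y. ennreal ((norm (d y))^2) \<partial>lborel)"
      by (simp add: nn_integral_completion)
    also have "\<dots> = (\<integral>\<^sup>+y. indicator (ball 0 r) (y - x) * ennreal ((w y - w x)^2) \<partial>lborel)"
      by (intro nn_integral_cong) (auto simp: d_def B_def indicator_def dist_norm norm_minus_commute)
    also have "\<dots> = (\<integral>\<^sup>+y. indicator (ball 0 r) (y - x) * ennreal ((w y - w x)^2) \<partial>(distr lborel borel ((+) x)))"
      by (simp add: lborel_distr_plus)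
    also have "\<dots> = (\<integral>\<^sup>+h. indicator (ball 0 r) h * ennreal ((w (x + h) - w x)^2) \<partial>lborel)"
    proof -
      have [measurable]: "ball (0::'a) r \<in> sets borel" by simp
      have "(\<lambda>y. indicator (ball 0 r) (y - x) * ennreal ((w y - w x)\<^sup>2)) \<in> borel_measurable borel" by measurable
      then show ?thesis
        using nn_integral_distr[of "(+) x" lborel borel "\<lambda>y. indicator (ball 0 r) (y - x) * ennreal ((w y - w x)^2)"] by simp
    qed
    finally show ?thesis .
  qed
  have [measurable]: "ball (0::'a) r \<in> sets borel" by simp
  have "(\<integral>\<^sup>+x. ennreal ((norm (w x - avg r w x))^2) \<partial>lebesgue) = (\<integral>\<^sup>+x. ennreal ((norm (w x - avg r w x))^2) \<partial>lborel)"
    by (simp add: nn_integral_completion)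
  also have "\<dots> \<le> (\<integral>\<^sup>+x. ennreal (1 / v) * (\<integral>\<^sup>+h. indicator (ball 0 r) h * ennreal ((w (x + h) - w x)^2) \<partial>lborel) \<partial>lborel)"
    by (intro nn_integral_mono pt)
  also have "\<dots> = ennreal (1 / v) * (\<integral>\<^sup>+x. (\<integral>\<^sup>+h. indicator (ball 0 r) h * ennreal ((w (x + h) - w x)^2) \<partial>lborel) \<partial>lborel)"
    by (rule nn_integral_cmult) measurable
  also have "(\<integral>\<^sup>+x. (\<integral>\<^sup>+h. indicator (ball 0 r) h * ennreal ((w (x + h) - w x)^2) \<partial>lborel) \<partial>lborel)
      = (\<integral>\<^sup>+h. (\<integral>\<^sup>+x. indicator (ball 0 r) h * ennreal ((w (x + h) - w x)^2) \<partial>lborel) \<partial>lborel)"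
    by (rule lborel_pair.Fubini'[symmetric]) measurable
  also have "\<dots> \<le> (\<integral>\<^sup>+h. ennreal (r^2 * n2 g) * indicator (ball (0::'a) r) h \<partial>lborel)"
  proof (rule nn_integral_mono)
    fix h :: 'a
    show "(\<integral>\<^sup>+x. indicator (ball 0 r) h * ennreal ((w (x + h) - w x)^2) \<partial>lborel) \<le> ennreal (r^2 * n2 g) * indicator (ball 0 r) h"
    proof (cases "h \<in> ball 0 r")
      case True
      have "(\<integral>\<^sup>+x. ennreal ((w (x + h) - w x)^2) \<partial>lborel) = (\<integral>\<^sup>+x. ennreal ((norm (w (x + h) - w x))^2) \<partial>lebesgue)"
        by (simp add: nn_integral_completion)
      also have "\<dots> = ennreal (n2 (\<lambda>x. w (x + h) - w x))"
        by (intro nn_integral_n2 L2_diff L2_mp[OF mp_translation] wL)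
      also have "\<dots> \<le> ennreal (r^2 * n2 g)"
      proof (rule ennreal_leI, rule order_trans[OF translation_estimate[OF wL g wg]])
        show "(norm h)\<^sup>2 * n2 g \<le> r\<^sup>2 * n2 g" using True by (intro mult_right_mono power_mono) auto
      qed
      finally show ?thesis using True by simp
    qed simp
  qed
  also have "\<dots> = ennreal (r^2 * n2 g) * ennreal v"
    using emeasure_ball[of r "0::'a"] r by (simp add: nn_integral_cmult v_def vol_eq)
  also have "ennreal (1 / v) * (ennreal (r^2 * n2 g) * ennreal v) = ennreal (r^2 * n2 g)"
    using v by (simp flip: ennreal_mult')
  finally have *: "(\<integral>\<^sup>+x. ennreal ((norm (w x - avg r w x))^2) \<partial>lebesgue) \<le> ennreal (r^2 * n2 g)"
    by (simp add: mult_left_mono)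
  have m: "(\<lambda>x. w x - avg r w x) \<in> borel_measurable lebesgue" by (intro measurable_completion) measurable
  note L = L2_I_nn[OF m *]
  have eq: "AE x in lebesgue. u x - avg r u x = w x - avg r w x" using wu by (auto simp: av)
  have m': "(\<lambda>x. u x - avg r u x) \<in> borel_measurable lebesgue" by (rule AE_measurable_lebesgue[OF m eq])
  show "L2 (\<lambda>x. u x - avg r u x)" using L(1) by (intro L2_AE_cong[OF _ m' eq]) simp
  show "n2 (\<lambda>x. u x - avg r u x) \<le> r^2 * n2 g" using n2_AE_cong[OF m eq] L(2) by simp
qed

lemma mp_reflection: "mp (\<lambda>y::'a::euclidean_space. c - y)"
proof -
  have "orthogonal_transformation (uminus :: 'a \<Rightarrow> 'a)"
    by (auto simp: orthogonal_transformation_def intro!: linearI)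
  then have "mp (\<lambda>y::'a. - y + c)" by (intro mp_compose[OF mp_translation mp_orthogonal])
  then show ?thesis by simp
qed

text \<open>After Fubini both sides integrate w(z) against the volume of the intersection of a ball
  about x with one about z; only the two radii are exchanged.\<close>

lemma iterated_ball_integral_commute:
  fixes w :: "'a::euclidean_space \<Rightarrow> real"
  assumes w[measurable]: "w \<in> borel_measurable borel" and wL: "L2 w" and r: "r > 0" and s: "s > 0"
  shows "(LINT y|lborel. LINT z|lborel. indicator (ball x s) y * (indicator (ball y r) z * w z))
       = (LINT y|lborel. LINT z|lborel. indicator (ball x r) y * (indicator (ball y s) z * w z))"
proof -
  define D where "D r = {p::'a \<times> 'a. dist (fst p) (snd p) < r}" for r :: real
  have Dm[measurable]: "D r \<in> sets (borel \<Otimes>\<^sub>M borel)" for r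
    unfolding D_def borel_prod by (intro borel_open open_Collect_less continuous_intros)
  have D: "indicat_real (ball y r) z = indicator (D r) (y, z)" for y z r by (simp add: D_def indicator_def)
  have bm[measurable]: "ball x r \<in> sets borel" for r :: real and x :: 'a by simp
  have swap: "(LINT y|lborel. LINT z|lborel. indicator (ball x s) y * (indicator (ball y r) z * w z))
      = (LINT z|lborel. w z * (LINT y|lborel. indicator (ball x s) y * indicator (ball z r) y))" if "r > 0" "s > 0" for r s
  proof -
    define f where "f y z = indicator (ball x s) y * (indicator (D r) (y, z) * w z)" for y z
    have fm[measurable]: "(\<lambda>(y, z). f y z) \<in> borel_measurable (lborel \<Otimes>\<^sub>M lborel)"
      unfolding f_def by measurable
    have q: "integrable lborel (\<lambda>z. indicat_real (ball x (r + s)) z * w z)"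
    proof -
      have "integrable lebesgue (\<lambda>z. indicat_real (ball x (r + s)) z * w z)"
        using that by (intro L2_real_mult_integrable L2_ball wL) auto
      then show ?thesis by (subst (asm) integrable_completion) auto
    qed
    have fb: "ennreal (norm (f y z)) \<le> indicator (ball x s) y * ennreal (norm (indicator (ball x (r + s)) z * w z))" for y z
    proof (cases "y \<in> ball x s \<and> dist y z < r")
      case True
      then have "z \<in> ball x (r + s)" using dist_triangle[of x z y] by auto
      then show ?thesis using True by (simp add: f_def D_def)
    next
      case False
      then have "f y z = 0" by (auto simp: f_def D_def indicator_def)
      then show ?thesis by simp
    qed
    have "(\<integral>\<^sup>+p. ennreal (norm (case_prod f p)) \<partial>(lborel \<Otimes>\<^sub>M lborel)) = (\<integral>\<^sup>+y. \<integral>\<^sup>+z. ennreal (norm (f y z)) \<partial>lborel \<partial>lborel)"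
      by (subst lborel.nn_integral_fst[symmetric]) auto
    also have "\<dots> \<le> (\<integral>\<^sup>+y. \<integral>\<^sup>+z. indicator (ball x s) y * ennreal (norm (indicator (ball x (r + s)) z * w z)) \<partial>lborel \<partial>lborel)"
      by (intro nn_integral_mono fb)
    also have "\<dots> = emeasure lborel (ball x s) * (\<integral>\<^sup>+z. ennreal (norm (indicator (ball x (r + s)) z * w z)) \<partial>lborel)"
      by (simp add: nn_integral_cmult nn_integral_multc)
    also have "\<dots> < \<infinity>"
      using emeasure_lborel_ball_finite[of x s] q by (simp add: integrable_iff_bounded ennreal_mult_less_top)
    finally have int: "integrable (lborel \<Otimes>\<^sub>M lborel) (\<lambda>(y, z). f y z)"
      by (intro integrableI_bounded) auto
    have "(LINT y|lborel. LINT z|lborel. f y z) = (LINT z|lborel. LINT y|lborel. f y z)"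
      using lborel_pair.Fubini_integral[OF int] by simp
    also have "\<dots> = (LINT z|lborel. LINT y|lborel. w z * (indicator (ball x s) y * indicator (ball z r) y))"
      unfolding f_def by (intro Bochner_Integration.integral_cong refl) (auto simp: D_def indicator_def dist_commute)
    finally show ?thesis by (simp add: f_def D)
  qed
  have inner: "(LINT y|lborel. indicator (ball x s) y * indicator (ball z r) y)
      = (LINT y|lborel. indicator (ball x r) y * indicat_real (ball z s) y)" for z
  proof -
    have "(LINT y|lborel. indicator (ball x s) y * indicat_real (ball z r) y) = (LINT y|lebesgue. indicator (ball x s) y * indicator (ball z r) y)"
      by (rule integral_completion[symmetric]) measurable
    \<comment> \<open>The point reflection y -> x + z - y swaps the centres x and z.\<close>
    also have "\<dots> = (LINT y|lebesgue. (\<lambda>y. indicator (ball x s) y * indicator (ball z r) y) (x + z - y))"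
      by (rule mp_integral[OF mp_reflection, symmetric]) (auto intro!: measurable_completion)
    also have "\<dots> = (LINT y|lebesgue. indicator (ball x r) y * indicator (ball z s) y)"
      by (intro Bochner_Integration.integral_cong refl) (auto simp: indicator_def dist_norm norm_minus_commute)
    also have "\<dots> = (LINT y|lborel. indicator (ball x r) y * indicator (ball z s) y)"
      by (rule integral_completion) measurable
    finally show ?thesis .
  qed
  show ?thesis unfolding swap[OF r s] swap[OF s r] inner ..
qed

text \<open>Commutation provides a single intermediate quantity through which averages at two radii
  can be compared.\<close>

lemma avg_commute:
  fixes u :: "'a::euclidean_space \<Rightarrow> real"
  assumes u: "L2 u" and g: "L2 g" and ug: "weak_gradient u g" and r: "r > 0" and s: "s > 0"
  shows "avg s (avg r u) x = avg r (avg s u) x"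
proof -
  obtain w where w[measurable]: "w \<in> borel_measurable borel" and wL: "L2 w" and wu: "AE x in lebesgue. w x = u x"
    using L2_borel_version[OF u] by blast
  have wg: "weak_gradient w g" by (rule weak_gradient_AE_cong[OF u ug wu])
  have bm[measurable]: "ball x r \<in> sets borel" for r :: real and x :: 'a by simp
  have *: "avg s (avg r w) x = (LINT y|lborel. LINT z|lborel. indicator (ball x s) y * (indicator (ball y r) z * w z)) / (vol TYPE('a) r * vol TYPE('a) s)"
    if "r > 0" "s > 0" for r s
  proof -
    have [measurable]: "avg r w \<in> borel_measurable borel"
      by (intro borel_measurable_continuous_onI avg_continuous[OF wL g wg that(1)])
    have "(LINT y|lebesgue. indicator (ball x s) y * avg r w y) = (LINT y|lborel. indicator (ball x s) y * avg r w y)"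
      by (rule integral_completion) measurable
    also have "\<dots> = (LINT y|lborel. (LINT z|lborel. indicator (ball x s) y * (indicator (ball y r) z * w z)) / vol TYPE('a) r)"
    proof (rule Bochner_Integration.integral_cong[OF refl])
      fix y
      have "(LINT z|lebesgue. indicator (ball y r) z * w z) = (LINT z|lborel. indicator (ball y r) z * w z)"
        by (rule integral_completion) measurable
      then show "indicator (ball x s) y * avg r w y = (LINT z|lborel. indicator (ball x s) y * (indicator (ball y r) z * w z)) / vol TYPE('a) r"
        by (simp add: avg_def)
    qed
    finally show ?thesis by (simp add: avg_def[of s])
  qed
  show ?thesis
    unfolding avg_AE_cong[OF u wu, symmetric] *[OF r s] *[OF s r] iterated_ball_integral_commute[OF w wL r s]
    by (simp add: mult.commute)
qed

lemma avg_bounded_continuous: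
  fixes c :: "'a::euclidean_space \<Rightarrow> real"
  assumes c: "continuous_on UNIV c" and M: "\<And>y. \<bar>c y\<bar> \<le> M" and s: "s > 0"
    and B: "\<And>y. y \<in> ball x s \<Longrightarrow> \<bar>c y - c x\<bar> \<le> B"
  shows "\<bar>avg s c x - c x\<bar> \<le> B"
proof -
  define v where "v = vol TYPE('a) s"
  have v: "v > 0" unfolding v_def by (rule vol_pos[OF s])
  define b where "b = indicat_real (ball x s)"
  have ib: "integrable lebesgue b" using lmeasurable_ball[of x s] by (simp add: fmeasurable_def b_def)
  have [measurable]: "c \<in> borel_measurable lebesgue" by (rule continuous_lebesgue_measurable[OF c])
  have [measurable]: "b \<in> borel_measurable lebesgue" using ib by auto
  have vb: "(LINT y|lebesgue. b y) = v" using s by (simp add: b_def v_def vol_ball)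
  have ic: "integrable lebesgue (\<lambda>y. b y * c y)"
  proof (rule Bochner_Integration.integrable_bound[of _ "\<lambda>y. M * b y"])
    show "AE y in lebesgue. norm (b y * c y) \<le> norm (M * b y)"
    proof (rule AE_I2)
      fix y show "norm (b y * c y) \<le> norm (M * b y)" using M[of y] by (auto simp: b_def indicator_def)
    qed
  qed (use ib in auto)
  have "avg s c x - c x = (LINT y|lebesgue. b y * c y - c x * b y) / v"
    using ic ib v vb by (simp add: avg_def b_def v_def field_simps)
  also have "\<bar>\<dots>\<bar> = \<bar>LINT y|lebesgue. b y * c y - c x * b y\<bar> / v" using v by simp
  also have "\<bar>LINT y|lebesgue. b y * c y - c x * b y\<bar> \<le> (LINT y|lebesgue. B * b y)"
  proof (rule order_trans[OF integral_abs_bound integral_mono])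
    show "integrable lebesgue (\<lambda>y. \<bar>b y * c y - c x * b y\<bar>)" using ic ib by auto
    show "integrable lebesgue (\<lambda>y. B * b y)" using ib by auto
    fix y show "\<bar>b y * c y - c x * b y\<bar> \<le> B * b y" using B[of y] by (auto simp: b_def indicator_def)
  qed
  also have "\<dots> = B * v" by (simp add: vb)
  finally show ?thesis using v by (simp add: divide_right_mono)
qed

text \<open>Both averages are compared with the iterated one, which does not depend on the order:
  averaging an L-Lipschitz function over radius s moves its values by at most s L.\<close>

lemma avg_difference_bound:
  fixes u :: "'a::euclidean_space \<Rightarrow> real"
  assumes u: "L2 u" and g: "L2 g" and ug: "weak_gradient u g" and r: "r > 0" and s: "s > 0"
  shows "\<bar>avg r u x - avg s u x\<bar> \<le> sqrt (n2 g) * (s / sqrt (vol TYPE('a) r) + r / sqrt (vol TYPE('a) s))"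
proof -
  have *: "\<bar>avg s (avg r u) x - avg r u x\<bar> \<le> s * (sqrt (n2 g) / sqrt (vol TYPE('a) r))" if r: "r > 0" and s: "s > 0" for r s
  proof (rule avg_bounded_continuous)
    show "continuous_on UNIV (avg r u)" by (rule avg_continuous[OF u g ug r])
    show "\<bar>avg r u y\<bar> \<le> sqrt (n2 u) / sqrt (vol TYPE('a) r)" for y by (rule avg_bound[OF u r])
    show "s > 0" by fact
    fix y assume "y \<in> ball x s"
    then have "norm (y - x) \<le> s" by (simp add: dist_norm norm_minus_commute)
    then have "norm (y - x) * (sqrt (n2 g) / sqrt (vol TYPE('a) r)) \<le> s * (sqrt (n2 g) / sqrt (vol TYPE('a) r))"
      using vol_pos[OF r, where 'a='a] by (intro mult_right_mono) auto
    then show "\<bar>avg r u y - avg r u x\<bar> \<le> s * (sqrt (n2 g) / sqrt (vol TYPE('a) r))"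
      using avg_Lipschitz[OF u g ug r, of y x] by linarith
  qed
  have "\<bar>avg r u x - avg s u x\<bar> \<le> s * (sqrt (n2 g) / sqrt (vol TYPE('a) r)) + r * (sqrt (n2 g) / sqrt (vol TYPE('a) s))"
    using *[OF r s] *[OF s r] avg_commute[OF u g ug r s, of x] by linarith
  then show ?thesis by (simp add: algebra_simps)
qed

section \<open>The subcritical Sobolev embedding\<close>

text \<open>Telescoping over dyadic radii. With a = 2^(N/2 - 1) the direct L2 bound on an average at
  level k is of order (2a)^k; comparing neighbouring levels through the gradient gains the factor
  2^-k, so each step costs a multiple of a^k, and a > 1 makes the sum geometric.\<close>

lemma avg_dyadic_bound:
  assumes N: "DIM('a::euclidean_space) \<ge> 3"
  obtains C where "C > 0" "\<And>(u::'a \<Rightarrow> real) g k x. L2 u \<Longrightarrow> L2 g \<Longrightarrow> weak_gradient u g \<Longrightarrow> n2 u \<le> 1 \<Longrightarrow> n2 g \<le> 1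
    \<Longrightarrow> \<bar>avg ((1/2)^k) u x\<bar> \<le> C * (2 powr (real DIM('a) / 2 - 1)) ^ k"
proof -
  define a where "a = 2 powr (real DIM('a) / 2 - 1)"
  define c0 where "c0 = 1 / sqrt (unit_ball_vol (real DIM('a)))"
  have c0: "c0 > 0" by (simp add: c0_def)
  have a1: "a > 1" unfolding a_def using N by (intro gr_one_powr) auto
  have a2: "(2 * a)^2 = 2 ^ DIM('a)"
  proof -
    have "2 * a = 2 powr 1 * a" by simp
    also have "\<dots> = 2 powr (real DIM('a) / 2)" unfolding a_def by (subst powr_add[symmetric]) simp
    finally have "2 * a = 2 powr (real DIM('a) / 2)" .
    then have "(2 * a)^2 = 2 powr (real DIM('a) / 2) * 2 powr (real DIM('a) / 2)" by (simp add: power2_eq_square)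
    also have "\<dots> = 2 powr (real DIM('a))" by (subst powr_add[symmetric]) simp
    finally show ?thesis by (simp add: powr_realpow)
  qed
  have v: "1 / sqrt (vol TYPE('a) ((1/2)^k)) = c0 * (2 * a)^k" for k
  proof -
    have "vol TYPE('a) ((1/2)^k) = unit_ball_vol (real DIM('a)) / ((2 * a)^k)^2"
    proof -
      have "((1/2::real)^k)^DIM('a) = 1 / ((2 * a)^2)^k"
        unfolding a2 by (simp add: power_divide mult.commute flip: power_mult)
      also have "((2 * a)^2)^k = ((2 * a)^k)^2" by (simp only: power_mult[symmetric] mult.commute)
      finally show ?thesis by (simp add: vol_eq)
    qed
    then show ?thesis using a1 by (simp add: c0_def real_sqrt_divide)
  qed
  \<comment> \<open>The first entry covers level 0; the second makes C + c0 (2a + 1/2) \<le> C a,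
    the inequality that closes the induction.\<close>
  define C where "C = max c0 (c0 * (2 * a + 1/2) / (a - 1))"
  have C: "C > 0" "c0 \<le> C" using c0 by (auto simp: C_def)
  have C': "C + c0 * (2 * a + 1/2) \<le> C * a"
  proof -
    have "c0 * (2 * a + 1/2) / (a - 1) \<le> C" by (simp add: C_def)
    then show ?thesis using a1 by (simp add: field_simps)
  qed
  show ?thesis
  proof (rule that[OF C(1)])
    fix u :: "'a \<Rightarrow> real" and g k x
    assume u: "L2 u" and g: "L2 g" and ug: "weak_gradient u g" and 1: "n2 u \<le> 1" "n2 g \<le> 1"
    have sg: "sqrt (n2 g) \<le> 1" using 1 by simp
    show "\<bar>avg ((1/2)^k) u x\<bar> \<le> C * (2 powr (real DIM('a) / 2 - 1)) ^ k" unfolding a_def[symmetric]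
    proof (induction k)
      case 0
      have "\<bar>avg 1 u x\<bar> \<le> sqrt (n2 u) * (1 / sqrt (vol TYPE('a) 1))" using avg_bound[OF u, of 1 x] by simp
      also have "\<dots> \<le> 1 * c0" using 1 c0 v[of 0] by (intro mult_mono) auto
      finally show ?case using C by simp
    next
      case (Suc k)
      have "\<bar>avg ((1/2)^Suc k) u x - avg ((1/2)^k) u x\<bar>
          \<le> sqrt (n2 g) * ((1/2)^k / sqrt (vol TYPE('a) ((1/2)^Suc k)) + (1/2)^Suc k / sqrt (vol TYPE('a) ((1/2)^k)))"
        by (rule avg_difference_bound[OF u g ug]) auto
      also have "\<dots> = sqrt (n2 g) * ((1/2)^k * (c0 * (2 * a)^Suc k) + (1/2)^Suc k * (c0 * (2 * a)^k))"
        using v[of k] v[of "Suc k"] by (metis (no_types, opaque_lifting) mult.right_neutral times_divide_eq_right)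
      also have "\<dots> = sqrt (n2 g) * (c0 * (2 * a + 1/2) * a^k)"
        by (simp add: power_mult_distrib power_divide field_simps)
      also have "\<dots> \<le> 1 * (c0 * (2 * a + 1/2) * a^k)" using sg c0 a1 by (intro mult_right_mono) auto
      finally have "\<bar>avg ((1/2)^Suc k) u x\<bar> \<le> c0 * (2 * a + 1/2) * a^k + C * a^k" using Suc.IH by linarith
      also have "\<dots> = (C + c0 * (2 * a + 1/2)) * a^k" by (simp add: algebra_simps)
      also have "\<dots> \<le> C * a * a^k" using C' a1 by (intro mult_right_mono) auto
      finally show ?case by (simp add: mult.assoc)
    qed
  qed
qed

text \<open>A value |u(x)| above \<Lambda> is caught at the last level k whose threshold \<Lambda>
  a^k it exceeds. There the average accounts for at most half of it, so |u(x)| \<le> 2 |d_k(x)| and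
  |u|^q \<le> b_k |d_k|^2. Summing over k needs only that the growth a^(k(q-2)) of b_k is beaten by
  the decay 4^-k of \<open>n2 (d k)\<close>.\<close>

lemma Sobolev_unit_ball:
  assumes N: "DIM('a::euclidean_space) \<ge> 3" and q: "2 < q" "q < 2 * real DIM('a) / (real DIM('a) - 2)"
  obtains C where "C > 0" "\<And>(u::'a \<Rightarrow> real) g. L2 u \<Longrightarrow> L2 g \<Longrightarrow> weak_gradient u g \<Longrightarrow> n2 u \<le> 1 \<Longrightarrow> n2 g \<le> 1
    \<Longrightarrow> integrable lebesgue (\<lambda>x. \<bar>u x\<bar> powr q) \<and> (LINT x|lebesgue. \<bar>u x\<bar> powr q) \<le> C"
proof -
  define a where "a = 2 powr (real DIM('a) / 2 - 1)"
  have a1: "a > 1" unfolding a_def using N by (intro gr_one_powr) auto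
  obtain C2 where C2: "C2 > 0" "\<And>(u::'a \<Rightarrow> real) g k x. L2 u \<Longrightarrow> L2 g \<Longrightarrow> weak_gradient u g \<Longrightarrow> n2 u \<le> 1 \<Longrightarrow> n2 g \<le> 1
    \<Longrightarrow> \<bar>avg ((1/2)^k) u x\<bar> \<le> C2 * a ^ k"
    using avg_dyadic_bound[OF N] unfolding a_def by blast
  define \<Lambda> where "\<Lambda> = 4 * C2"
  have L: "\<Lambda> > 0" using C2 by (simp add: \<Lambda>_def)
  \<comment> \<open>The ratio of the resulting geometric series; \<rho> < 1 says precisely that q is
    below the critical exponent.\<close>
  define \<rho> where "\<rho> = a powr (q - 2) / 4"
  have \<rho>: "0 < \<rho>" "\<rho> < 1"
  proof -
    show "0 < \<rho>" using a1 by (simp add: \<rho>_def)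
    have "(real DIM('a) / 2 - 1) * (q - 2) < 2" using q N by (simp add: field_simps)
    then have "2 powr ((real DIM('a) / 2 - 1) * (q - 2)) < 2 powr 2" by (intro powr_less_mono) auto
    then show "\<rho> < 1" by (simp add: \<rho>_def a_def powr_powr)
  qed
  define K where "K = 4 * (\<Lambda> * a) powr (q - 2)"
  have K: "K > 0" using L a1 by (simp add: K_def)
  define C where "C = \<Lambda> powr (q - 2) + K / (1 - \<rho>)"
  have Cp: "C > 0" using L K \<rho> by (auto simp: C_def intro!: add_pos_pos)
  show ?thesis
  proof (rule that[OF Cp])
    fix u :: "'a \<Rightarrow> real" and g
    assume u: "L2 u" and g: "L2 g" and ug: "weak_gradient u g" and 1: "n2 u \<le> 1" "n2 g \<le> 1"
    define d where "d k x = u x - avg ((1/2)^k) u x" for k x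
    have d: "L2 (d k)" "n2 (d k) \<le> (1/4)^k" for k
    proof -
      show "L2 (d k)" unfolding d_def[abs_def] by (rule avg_L2_estimate[OF u g ug]) simp
      have "n2 (d k) \<le> ((1/2)^k)^2 * n2 g" unfolding d_def[abs_def] by (rule avg_L2_estimate[OF u g ug]) simp
      also have "\<dots> \<le> ((1/2)^k)^2 * 1" using 1 by (intro mult_left_mono) auto
      also have "\<dots> = (1/4)^k" by (simp add: power2_eq_square flip: power_mult_distrib)
      finally show "n2 (d k) \<le> (1/4)^k" .
    qed
    have [measurable]: "u \<in> borel_measurable lebesgue" "d k \<in> borel_measurable lebesgue" for k
      using u d by (auto simp: L2_def)
    define b where "b k = K * (a powr (q - 2))^k" for k :: nat
    have b: "b k \<ge> 0" for k using K by (simp add: b_def)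
    have pt: "ennreal (\<bar>u x\<bar> powr q) \<le> ennreal (\<Lambda> powr (q - 2)) * ennreal ((norm (u x))^2) + (\<Sum>k. ennreal (b k) * ennreal ((norm (d k x))^2))" for x
    proof (cases "\<bar>u x\<bar> \<le> \<Lambda>")
      case True
      have "\<bar>u x\<bar> powr q = \<bar>u x\<bar> powr (q - 2) * (norm (u x))^2"
        by (cases "u x = 0") (auto simp: powr_diff field_simps)
      also have "\<dots> \<le> \<Lambda> powr (q - 2) * (norm (u x))^2" using True q by (intro mult_right_mono powr_mono2) auto
      finally have "ennreal (\<bar>u x\<bar> powr q) \<le> ennreal (\<Lambda> powr (q - 2)) * ennreal ((norm (u x))^2)"
        by (simp add: ennreal_leI flip: ennreal_mult')
      then show ?thesis by (simp add: add_increasing2)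
    next
      case False
      obtain n where "\<bar>u x\<bar> / \<Lambda> < a ^ n" using real_arch_pow[OF a1] by blast
      then have ex: "\<bar>u x\<bar> \<le> \<Lambda> * a ^ n" using L by (simp add: field_simps)
      \<comment> \<open>j is the first level whose threshold is not below |u(x)|. It is not 0 in the
        present case, so its predecessor k has \<Lambda> a^k strictly below |u(x)|.\<close>
      define j where "j = (LEAST n. \<bar>u x\<bar> \<le> \<Lambda> * a ^ n)"
      have j: "\<bar>u x\<bar> \<le> \<Lambda> * a ^ j" unfolding j_def by (rule LeastI[of _ n]) (rule ex)
      have "j \<noteq> 0" using j False by (intro notI) simp
      then obtain k where k: "j = Suc k" by (cases j) auto
      have lk: "\<Lambda> * a ^ k < \<bar>u x\<bar>" using not_less_Least[of k "\<lambda>n. \<bar>u x\<bar> \<le> \<Lambda> * a ^ n"] k by (auto simp: j_def)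
      have "\<bar>avg ((1/2)^k) u x\<bar> \<le> C2 * a ^ k" by (rule C2(2)[OF u g ug 1])
      also have "\<dots> \<le> \<bar>u x\<bar> / 2" using lk by (simp add: \<Lambda>_def)
      finally have "\<bar>u x\<bar> \<le> 2 * \<bar>d k x\<bar>"
        unfolding d_def using abs_triangle_ineq[of "u x - avg ((1/2)^k) u x" "avg ((1/2)^k) u x"] by simp
      then have "\<bar>u x\<bar>^2 \<le> (2 * \<bar>d k x\<bar>)^2" by (intro power_mono) auto
      then have u2: "(norm (u x))^2 \<le> 4 * (norm (d k x))^2" by (simp add: power_mult_distrib)
      have "\<bar>u x\<bar> powr q = \<bar>u x\<bar> powr (q - 2) * (norm (u x))^2"
        by (cases "u x = 0") (auto simp: powr_diff field_simps)
      also have "\<dots> \<le> (\<Lambda> * a ^ Suc k) powr (q - 2) * (4 * (norm (d k x))^2)"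
        using j k q u2 by (intro mult_mono powr_mono2) auto
      also have "(\<Lambda> * a ^ Suc k) powr (q - 2) = (\<Lambda> * a) powr (q - 2) * (a powr (q - 2))^k"
      proof -
        have "(\<Lambda> * a ^ Suc k) powr (q - 2) = ((\<Lambda> * a) * a ^ k) powr (q - 2)" by (simp add: mult_ac)
        also have "\<dots> = (\<Lambda> * a) powr (q - 2) * (a ^ k) powr (q - 2)" using L a1 by (intro powr_mult)
        also have "(a ^ k) powr (q - 2) = (a powr (q - 2))^k"
          using a1 by (simp add: powr_powr mult.commute flip: powr_realpow)
        finally show ?thesis .
      qed
      finally have "\<bar>u x\<bar> powr q \<le> b k * (norm (d k x))^2" by (simp add: b_def K_def mult_ac)
      then have "ennreal (\<bar>u x\<bar> powr q) \<le> ennreal (b k) * ennreal ((norm (d k x))^2)"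
        using b by (simp add: ennreal_leI flip: ennreal_mult')
      also have "\<dots> \<le> (\<Sum>k. ennreal (b k) * ennreal ((norm (d k x))^2))"
        using sum_le_suminf[of "\<lambda>k. ennreal (b k) * ennreal ((norm (d k x))^2)" "{k}"] by simp
      finally show ?thesis by (simp add: add_increasing)
    qed
    have "(\<integral>\<^sup>+x. ennreal (\<bar>u x\<bar> powr q) \<partial>lebesgue)
        \<le> (\<integral>\<^sup>+x. ennreal (\<Lambda> powr (q - 2)) * ennreal ((norm (u x))^2) + (\<Sum>k. ennreal (b k) * ennreal ((norm (d k x))^2)) \<partial>lebesgue)"
      by (intro nn_integral_mono pt)
    also have "\<dots> = ennreal (\<Lambda> powr (q - 2)) * (\<integral>\<^sup>+x. ennreal ((norm (u x))^2) \<partial>lebesgue)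
        + (\<Sum>k. ennreal (b k) * (\<integral>\<^sup>+x. ennreal ((norm (d k x))^2) \<partial>lebesgue))"
      by (simp add: nn_integral_add nn_integral_cmult nn_integral_suminf)
    also have "\<dots> = ennreal (\<Lambda> powr (q - 2)) * ennreal (n2 u) + (\<Sum>k. ennreal (b k) * ennreal (n2 (d k)))"
      by (simp only: nn_integral_n2[OF u] nn_integral_n2[OF d(1)])
    also have "\<dots> \<le> ennreal (\<Lambda> powr (q - 2)) + (\<Sum>k. ennreal (K * \<rho>^k))"
    proof (intro add_mono suminf_le)
      show "ennreal (\<Lambda> powr (q - 2)) * ennreal (n2 u) \<le> ennreal (\<Lambda> powr (q - 2))"
        using 1 mult_left_mono[of "n2 u" 1 "\<Lambda> powr (q - 2)"] by (simp add: ennreal_leI flip: ennreal_mult')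
      fix k
      have "b k * n2 (d k) \<le> b k * (1/4)^k" using b d by (intro mult_left_mono) auto
      also have "\<dots> = K * \<rho>^k" by (simp add: b_def \<rho>_def power_divide)
      finally show "ennreal (b k) * ennreal (n2 (d k)) \<le> ennreal (K * \<rho>^k)"
        using b by (simp add: ennreal_leI flip: ennreal_mult')
    qed auto
    also have "(\<Sum>k. ennreal (K * \<rho>^k)) = ennreal (\<Sum>k. K * \<rho>^k)"
      using K \<rho> by (intro suminf_ennreal2 summable_mult summable_geometric) auto
    also have "(\<Sum>k. K * \<rho>^k) = K / (1 - \<rho>)"
      using \<rho> by (simp add: suminf_mult suminf_geometric summable_geometric)
    also have "ennreal (\<Lambda> powr (q - 2)) + ennreal (K / (1 - \<rho>)) = ennreal C"
      using K \<rho> by (simp add: C_def)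
    finally have *: "(\<integral>\<^sup>+x. ennreal (\<bar>u x\<bar> powr q) \<partial>lebesgue) \<le> ennreal C" .
    have i: "integrable lebesgue (\<lambda>x. \<bar>u x\<bar> powr q)"
      using * by (intro integrableI_nonneg) (auto intro: le_less_trans)
    moreover have "(LINT x|lebesgue. \<bar>u x\<bar> powr q) \<le> C"
      using * Cp unfolding nn_integral_eq_integral[OF i AE_I2[of _ "\<lambda>x. 0 \<le> \<bar>u x\<bar> powr q", OF powr_ge_zero]] by simp
    ultimately show "integrable lebesgue (\<lambda>x. \<bar>u x\<bar> powr q) \<and> (LINT x|lebesgue. \<bar>u x\<bar> powr q) \<le> C" by simp
  qed
qed

text \<open>Homogeneity: scaling by 1/S leads to the unit ball. For S = 0 the function vanishes a.e.
  and is treated apart.\<close>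

theorem Sobolev_subcritical:
  assumes N: "DIM('a::euclidean_space) \<ge> 3" and q: "2 < q" "q < 2 * real DIM('a) / (real DIM('a) - 2)"
  obtains C where "C > 0" "\<And>(u::'a \<Rightarrow> real) S. H1 u \<Longrightarrow> n2 u + n2 (grad u) \<le> S^2 \<Longrightarrow> S \<ge> 0
    \<Longrightarrow> integrable lebesgue (\<lambda>x. \<bar>u x\<bar> powr q) \<and> (LINT x|lebesgue. \<bar>u x\<bar> powr q) \<le> C * S powr q"
proof -
  obtain C where C: "C > 0" "\<And>(u::'a \<Rightarrow> real) g. L2 u \<Longrightarrow> L2 g \<Longrightarrow> weak_gradient u g \<Longrightarrow> n2 u \<le> 1 \<Longrightarrow> n2 g \<le> 1
    \<Longrightarrow> integrable lebesgue (\<lambda>x. \<bar>u x\<bar> powr q) \<and> (LINT x|lebesgue. \<bar>u x\<bar> powr q) \<le> C"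
    using Sobolev_unit_ball[OF N q] by blast
  show ?thesis
  proof (rule that[OF C(1)])
    fix u :: "'a \<Rightarrow> real" and S assume u: "H1 u" and S: "n2 u + n2 (grad u) \<le> S^2" "S \<ge> 0"
    show "integrable lebesgue (\<lambda>x. \<bar>u x\<bar> powr q) \<and> (LINT x|lebesgue. \<bar>u x\<bar> powr q) \<le> C * S powr q"
    proof (cases "S = 0")
      case True
      then have "n2 u = 0" using S n2_nonneg[of u] n2_nonneg[of "grad u"] by (simp del: n2_nonneg)
      then have z: "AE x in lebesgue. u x = 0" by (rule n2_eq_0[OF H1_L2[OF u]])
      have [measurable]: "u \<in> borel_measurable lebesgue" using H1_L2[OF u] by (simp add: L2_def)
      have z': "AE x in lebesgue. \<bar>u x\<bar> powr q = 0" using z by auto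
      have "integrable lebesgue (\<lambda>x. \<bar>u x\<bar> powr q)"
        using integrable_cong_AE[of "\<lambda>x. \<bar>u x\<bar> powr q" lebesgue "\<lambda>x. 0"] z' by simp
      moreover have "(LINT x|lebesgue. \<bar>u x\<bar> powr q) = 0" using z' by (rule integral_eq_zero_AE)
      ultimately show ?thesis using True by simp
    next
      case False
      with S have S0: "S > 0" by simp
      define t where "t = 1 / S"
      have t: "t > 0" using S0 by (simp add: t_def)
      have sc: "n2 (\<lambda>x. t * u x) = t^2 * n2 u" using n2_scaleR[of t u] by simp
      have tS: "t^2 * S^2 = 1" using S0 by (simp add: t_def power_divide)
      have "t^2 * (n2 u + n2 (grad u)) \<le> 1" using mult_left_mono[OF S(1), of "t^2"] tS by simp
      then have le: "t^2 * n2 u + t^2 * n2 (grad u) \<le> 1" by (simp add: distrib_left)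
      have nn: "0 \<le> t^2 * n2 u" "0 \<le> t^2 * n2 (grad u)" by simp_all
      have "integrable lebesgue (\<lambda>x. \<bar>t * u x\<bar> powr q) \<and> (LINT x|lebesgue. \<bar>t * u x\<bar> powr q) \<le> C"
      proof (rule C(2))
        show "L2 (\<lambda>x. t * u x)" by (rule L2_cmult[OF H1_L2[OF u]])
        show "L2 (\<lambda>x. t *\<^sub>R grad u x)" by (rule L2_scaleR[OF H1_grad(2)[OF u]])
        show "weak_gradient (\<lambda>x. t * u x) (\<lambda>x. t *\<^sub>R grad u x)"
          by (rule weak_gradient_scaleR[OF H1_grad(2,1)[OF u]])
        show "n2 (\<lambda>x. t * u x) \<le> 1" "n2 (\<lambda>x. t *\<^sub>R grad u x) \<le> 1"
          unfolding sc n2_scaleR using le nn by linarith+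
      qed
      moreover have "\<bar>t * u x\<bar> powr q = t powr q * \<bar>u x\<bar> powr q" for x using t by (simp add: abs_mult powr_mult)
      ultimately have *: "integrable lebesgue (\<lambda>x. t powr q * \<bar>u x\<bar> powr q)" "t powr q * (LINT x|lebesgue. \<bar>u x\<bar> powr q) \<le> C"
        by auto
      have tp: "t powr q * S powr q = 1" using S0 by (simp add: t_def powr_divide)
      have "(LINT x|lebesgue. \<bar>u x\<bar> powr q) = S powr q * (t powr q * (LINT x|lebesgue. \<bar>u x\<bar> powr q))"
        using tp by (simp add: mult.assoc[symmetric] mult.commute)
      also have "\<dots> \<le> S powr q * C" using *(2) by (intro mult_left_mono) auto
      finally show ?thesis using *(1) t by (simp add: mult.commute)
    qed
  qed
qed

section \<open>Local compactness\<close>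

text \<open>For each radius the averages are bounded and equi-Lipschitz in x, so a diagonal
  subsequence that converges at countably many pairs of a level and a point of a dense set converges
  at every point.\<close>

lemma Rellich_averages:
  fixes u :: "nat \<Rightarrow> 'a::euclidean_space \<Rightarrow> real"
  assumes u: "\<And>n. L2 (u n)" and g: "\<And>n. L2 (g n)" and ug: "\<And>n. weak_gradient (u n) (g n)"
    and M: "\<And>n. n2 (u n) \<le> M" "\<And>n. n2 (g n) \<le> M"
  obtains \<kappa> :: "nat \<Rightarrow> nat" where "strict_mono \<kappa>" "\<And>k x. convergent (\<lambda>n. avg ((1/2)^k) (u (\<kappa> n)) x)"
proof -
  define A where "A k = sqrt M / sqrt (vol TYPE('a) ((1/2)^k))" for k :: nat
  have M0: "M \<ge> 0" using order_trans[OF n2_nonneg M(1)] .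
  have A: "A k \<ge> 0" for k unfolding A_def using M0 vol_pos[of "(1/2)^k", where 'a='a] by simp
  have bd: "\<bar>avg ((1/2)^k) (u n) x\<bar> \<le> A k" for k n x
  proof -
    have "\<bar>avg ((1/2)^k) (u n) x\<bar> \<le> sqrt (n2 (u n)) / sqrt (vol TYPE('a) ((1/2)^k))" by (rule avg_bound[OF u]) simp
    also have "\<dots> \<le> A k" unfolding A_def using M vol_pos[of "(1/2)^k", where 'a='a] by (intro divide_right_mono) auto
    finally show ?thesis .
  qed
  have lip: "\<bar>avg ((1/2)^k) (u n) x - avg ((1/2)^k) (u n) y\<bar> \<le> norm (x - y) * A k" for k n x y
  proof -
    have "\<bar>avg ((1/2)^k) (u n) x - avg ((1/2)^k) (u n) y\<bar> \<le> norm (x - y) * (sqrt (n2 (g n)) / sqrt (vol TYPE('a) ((1/2)^k)))"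
      by (rule avg_Lipschitz[OF u g ug]) simp
    also have "\<dots> \<le> norm (x - y) * A k"
      unfolding A_def using M vol_pos[of "(1/2)^k", where 'a='a] by (intro mult_left_mono divide_right_mono) auto
    finally show ?thesis .
  qed
  obtain Q :: "'a set" where Q: "countable Q" "\<And>U. open U \<Longrightarrow> U \<noteq> {} \<Longrightarrow> \<exists>q\<in>Q. q \<in> U"
    using countable_dense_setE by blast
  \<comment> \<open>Normalised to absolute value at most 1, since the diagonal argument asks for one
    bound valid for all pairs.\<close>
  define F where "F n p = avg ((1/2)^fst p) (u n) (snd p) / (A (fst p) + 1)" for n and p :: "nat \<times> 'a"
  have F1: "norm (F n p) \<le> 1" for n p
  proof -
    have "\<bar>avg ((1/2)^fst p) (u n) (snd p)\<bar> \<le> A (fst p) + 1" using bd[of "fst p" n "snd p"] by linarith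
    then show ?thesis using A[of "fst p"] by (simp add: F_def abs_divide)
  qed
  have cnt: "countable (UNIV \<times> Q :: (nat \<times> 'a) set)" using Q by auto
  obtain \<kappa> where \<kappa>: "strict_mono (\<kappa>::nat\<Rightarrow>nat)" "\<And>p. p \<in> UNIV \<times> Q \<Longrightarrow> \<exists>l. (\<lambda>n. F (\<kappa> n) p) \<longlonglongrightarrow> l"
    by (rule function_convergent_subsequence[OF cnt F1]) (rule that)
  have cQ: "convergent (\<lambda>n. avg ((1/2)^k) (u (\<kappa> n)) q)" if q: "q \<in> Q" for k q
  proof -
    obtain l where "(\<lambda>n. F (\<kappa> n) (k, q)) \<longlonglongrightarrow> l" using \<kappa>(2)[of "(k, q)"] q by auto
    then have "(\<lambda>n. (A k + 1) * F (\<kappa> n) (k, q)) \<longlonglongrightarrow> (A k + 1) * l" by (intro tendsto_intros)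
    moreover have "(A k + 1) * F (\<kappa> n) (k, q) = avg ((1/2)^k) (u (\<kappa> n)) q" for n using A[of k] by (simp add: F_def)
    ultimately show ?thesis by (auto simp: convergent_def)
  qed
  have "convergent (\<lambda>n. avg ((1/2)^k) (u (\<kappa> n)) x)" for k x
  proof -
    have "Cauchy (\<lambda>n. avg ((1/2)^k) (u (\<kappa> n)) x)"
    proof (rule CauchyI)
      fix e :: real assume e: "e > 0"
      define \<delta> where "\<delta> = e / (4 * (A k + 1))"
      have \<delta>: "\<delta> > 0" using e A[of k] by (simp add: \<delta>_def)
      obtain q where q: "q \<in> Q" "q \<in> ball x \<delta>" using Q(2)[of "ball x \<delta>"] \<delta> by auto
      have near: "\<bar>avg ((1/2)^k) (u n) x - avg ((1/2)^k) (u n) q\<bar> \<le> e / 4" for n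
      proof -
        have "norm (x - q) * A k \<le> \<delta> * (A k + 1)" using q A[of k] \<delta> by (intro mult_mono) (auto simp: dist_norm)
        also have "\<dots> = e / 4" using A[of k] by (simp add: \<delta>_def field_simps)
        finally show ?thesis using lip[of k n x q] by linarith
      qed
      have "Cauchy (\<lambda>n. avg ((1/2)^k) (u (\<kappa> n)) q)" using cQ[OF q(1)] by (simp add: Cauchy_convergent_iff)
      then obtain N where N: "\<And>m n. m \<ge> N \<Longrightarrow> n \<ge> N \<Longrightarrow> norm (avg ((1/2)^k) (u (\<kappa> m)) q - avg ((1/2)^k) (u (\<kappa> n)) q) < e / 4"
        using CauchyD[of "\<lambda>n. avg ((1/2)^k) (u (\<kappa> n)) q" "e / 4"] e by auto
      show "\<exists>N. \<forall>m\<ge>N. \<forall>n\<ge>N. norm (avg ((1/2)^k) (u (\<kappa> m)) x - avg ((1/2)^k) (u (\<kappa> n)) x) < e"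
      proof (intro exI[of _ N] allI impI)
        fix m n assume "N \<le> m" "N \<le> n"
        then show "norm (avg ((1/2)^k) (u (\<kappa> m)) x - avg ((1/2)^k) (u (\<kappa> n)) x) < e"
          using N[of m n] near[of "\<kappa> m"] near[of "\<kappa> n"] e unfolding real_norm_def by linarith
      qed
    qed
    then show ?thesis by (simp add: Cauchy_convergent_iff)
  qed
  then show ?thesis using \<kappa>(1) that by blast
qed

definition loc_n2 :: "real \<Rightarrow> ('a::euclidean_space \<Rightarrow> real) \<Rightarrow> real" where
  "loc_n2 R u = n2 (\<lambda>x. indicator (ball 0 R) x *\<^sub>R u x)"

text \<open>The distance to the averages of level k is at most 2^-k sqrt M for all n, and at fixed k
  the averages converge boundedly; so the subsequence is Cauchy in L2 of every ball. The last
  conclusion speaks of any a.e. limit U because the limit is selected only afterwards.\<close>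

lemma Rellich:
  fixes u :: "nat \<Rightarrow> 'a::euclidean_space \<Rightarrow> real"
  assumes u: "\<And>n. L2 (u n)" and g: "\<And>n. L2 (g n)" and ug: "\<And>n. weak_gradient (u n) (g n)"
    and M: "\<And>n. n2 (u n) \<le> M" "\<And>n. n2 (g n) \<le> M"
  obtains \<kappa> :: "nat \<Rightarrow> nat" where "strict_mono \<kappa>" "AE x in lebesgue. convergent (\<lambda>n. u (\<kappa> n) x)"
    "\<And>U R. AE x in lebesgue. (\<lambda>n. u (\<kappa> n) x) \<longlonglongrightarrow> U x \<Longrightarrow> (\<lambda>n. loc_n2 R (\<lambda>x. u (\<kappa> n) x - U x)) \<longlonglongrightarrow> 0"
proof -
  obtain \<kappa> where \<kappa>: "strict_mono (\<kappa>::nat\<Rightarrow>nat)" and cv: "\<And>k x. convergent (\<lambda>n. avg ((1/2)^k) (u (\<kappa> n)) x)"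
    by (rule Rellich_averages[OF u g ug M]) (rule that)
  have M0: "M \<ge> 0" using order_trans[OF n2_nonneg M(1)] .
  have Cau: "\<exists>N. \<forall>m\<ge>N. \<forall>n\<ge>N. loc_n2 R (\<lambda>x. u (\<kappa> m) x - u (\<kappa> n) x) \<le> e" if e: "e > 0" for R e
  proof -
    define e' where "e' = sqrt e / 4"
    have e': "e' > 0" using e by (simp add: e'_def)
    obtain k where k: "(1/2)^k * sqrt M \<le> e'"
    proof -
      have s0: "0 < sqrt M + 1" using M0 by (intro add_nonneg_pos) auto
      then have "0 < e' / (sqrt M + 1)" using e' by (intro divide_pos_pos)
      then obtain k where "(1/2::real)^k < e' / (sqrt M + 1)" using real_arch_pow_inv[of "e' / (sqrt M + 1)" "1/2"] by auto
      then have "(1/2)^k * (sqrt M + 1) < e'" by (simp only: pos_less_divide_eq[OF s0])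
      moreover have "(1/2::real)^k * sqrt M \<le> (1/2)^k * (sqrt M + 1)" by (intro mult_left_mono) auto
      ultimately show ?thesis using that[of k] by linarith
    qed
    define v where "v n x = avg ((1/2)^k) (u (\<kappa> n)) x" for n x
    define V where "V x = lim (\<lambda>n. v n x)" for x
    have vV: "(\<lambda>n. v n x) \<longlonglongrightarrow> V x" for x using cv unfolding v_def V_def by (simp add: convergent_LIMSEQ_iff)
    define A where "A = sqrt M / sqrt (vol TYPE('a) ((1/2)^k))"
    have A: "A \<ge> 0" unfolding A_def using M0 vol_pos[of "(1/2)^k", where 'a='a] by simp
    have bd: "\<bar>v n x\<bar> \<le> A" for n x
    proof -
      have "\<bar>v n x\<bar> \<le> sqrt (n2 (u (\<kappa> n))) / sqrt (vol TYPE('a) ((1/2)^k))" unfolding v_def by (rule avg_bound[OF u]) simp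
      also have "\<dots> \<le> A" unfolding A_def using M vol_pos[of "(1/2)^k", where 'a='a] by (intro divide_right_mono) auto
      finally show ?thesis .
    qed
    have bV: "\<bar>V x\<bar> \<le> A" for x
      using tendsto_rabs[OF vV[of x]] bd by (intro LIMSEQ_le_const2[of "\<lambda>n. \<bar>v n x\<bar>"]) auto
    have vm[measurable]: "v n \<in> borel_measurable lebesgue" for n
      unfolding v_def[abs_def] by (intro continuous_lebesgue_measurable avg_continuous[OF u g ug]) simp
    have Vm[measurable]: "V \<in> borel_measurable lebesgue" unfolding V_def[abs_def] by measurable
    have [measurable]: "ball (0::'a) R \<in> sets lebesgue" by simp
    have hL: "L2 (\<lambda>x::'a. (2 * A) * indicator (ball 0 R) x)"
    proof (rule L2_compact_support(1)[where R=R and M="2 * A"])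
      show "(\<lambda>x::'a. (2 * A) * indicator (ball 0 R) x) \<in> borel_measurable lebesgue" by measurable
    qed (use A in \<open>auto simp: indicator_def\<close>)
    define \<beta> where "\<beta> n x = indicator (ball 0 R) x *\<^sub>R (v n x - V x)" for n x
    have \<beta>b: "norm (\<beta> n x) \<le> norm ((2 * A) * indicator (ball 0 R) x)" for n x
      using bd[of n x] bV[of x] by (auto simp: \<beta>_def indicator_def)
    have \<beta>m[measurable]: "\<beta> n \<in> borel_measurable lebesgue" for n unfolding \<beta>_def[abs_def] by measurable
    have \<beta>L: "L2 (\<beta> n)" for n by (rule L2_bound[OF hL]) (use \<beta>b in auto)
    have "(\<lambda>n. n2 (\<beta> n)) \<longlonglongrightarrow> 0"
    proof (rule n2_tendsto_0_dominated[OF \<beta>m hL])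
      show "AE x in lebesgue. norm (\<beta> n x) \<le> norm ((2 * A) * indicator (ball 0 R) x)" for n using \<beta>b by auto
      show "AE x in lebesgue. (\<lambda>n. \<beta> n x) \<longlonglongrightarrow> 0"
        using vV by (intro AE_I2) (auto simp: \<beta>_def intro!: tendsto_eq_intros)
    qed
    then obtain N where N: "\<And>n. n \<ge> N \<Longrightarrow> n2 (\<beta> n) < e'^2"
      using e' LIMSEQ_D[of "\<lambda>n. n2 (\<beta> n)" 0 "e'^2"] by auto
    define \<alpha> where "\<alpha> n x = indicator (ball 0 R) x *\<^sub>R (u (\<kappa> n) x - v n x)" for n x
    have \<alpha>0: "L2 (\<lambda>x. u (\<kappa> n) x - v n x)" "n2 (\<lambda>x. u (\<kappa> n) x - v n x) \<le> ((1/2)^k)^2 * n2 (g (\<kappa> n))" for n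
      unfolding v_def[abs_def] by (rule avg_L2_estimate[OF u g ug]; simp)+
    have \<alpha>L: "L2 (\<alpha> n)" for n unfolding \<alpha>_def[abs_def] by (rule L2_indicator[OF \<alpha>0(1)]) simp
    have \<alpha>: "sqrt (n2 (\<alpha> n)) \<le> e'" for n
    proof -
      have "n2 (\<alpha> n) \<le> n2 (\<lambda>x. u (\<kappa> n) x - v n x)"
        by (rule n2_mono[OF \<alpha>0(1)]) (auto simp: \<alpha>_def indicator_def)
      also have "\<dots> \<le> ((1/2)^k)^2 * M"
        by (rule order_trans[OF \<alpha>0(2) mult_left_mono[OF M(2)]]) simp
      finally have "sqrt (n2 (\<alpha> n)) \<le> sqrt (((1/2)^k)^2 * M)" by simp
      also have "\<dots> = (1/2)^k * sqrt M" by (simp add: real_sqrt_mult)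
      finally show ?thesis using k by linarith
    qed
    show ?thesis
    proof (intro exI[of _ N] allI impI)
      fix m n assume mn: "N \<le> m" "N \<le> n"
      have sb: "sqrt (n2 (\<beta> n)) \<le> e'" if "N \<le> n" for n using N[OF that] e' by (intro real_le_lsqrt) auto
      have "(\<lambda>x. indicator (ball 0 R) x *\<^sub>R (u (\<kappa> m) x - u (\<kappa> n) x)) = (\<lambda>x. (\<alpha> m x - \<alpha> n x) + (\<beta> m x - \<beta> n x))"
        by (auto simp: \<alpha>_def \<beta>_def algebra_simps)
      then have "sqrt (loc_n2 R (\<lambda>x. u (\<kappa> m) x - u (\<kappa> n) x)) = sqrt (n2 (\<lambda>x. (\<alpha> m x - \<alpha> n x) + (\<beta> m x - \<beta> n x)))"
        by (simp add: loc_n2_def)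
      also have "\<dots> \<le> sqrt (n2 (\<lambda>x. \<alpha> m x - \<alpha> n x)) + sqrt (n2 (\<lambda>x. \<beta> m x - \<beta> n x))"
        by (intro n2_triangle L2_diff \<alpha>L \<beta>L)
      also have "\<dots> \<le> (sqrt (n2 (\<alpha> m)) + sqrt (n2 (\<alpha> n))) + (sqrt (n2 (\<beta> m)) + sqrt (n2 (\<beta> n)))"
        by (intro add_mono n2_triangle_diff \<alpha>L \<beta>L)
      also have "\<dots> \<le> sqrt e" using \<alpha>[of m] \<alpha>[of n] sb[OF mn(1)] sb[OF mn(2)] by (simp add: e'_def)
      finally show "loc_n2 R (\<lambda>x. u (\<kappa> m) x - u (\<kappa> n) x) \<le> e" by simp
    qed
  qed
  have "\<exists>N. \<forall>j::nat. \<forall>m\<ge>N j. \<forall>n\<ge>N j. loc_n2 (real j) (\<lambda>x. u (\<kappa> m) x - u (\<kappa> n) x) \<le> (1/4)^j"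
    using Cau by (intro choice allI) auto
  then obtain N where N: "\<And>j m n. m \<ge> N j \<Longrightarrow> n \<ge> N j \<Longrightarrow> loc_n2 (real j) (\<lambda>x. u (\<kappa> m) x - u (\<kappa> n) x) \<le> (1/4)^j"
    by blast
  define r where "r j = (\<Sum>i\<le>j. Suc (N i))" for j
  have rN: "r i \<ge> N j" if "i \<ge> j" for i j
  proof -
    have "N j \<le> Suc (N j)" by simp
    also have "\<dots> \<le> r i" unfolding r_def using that by (intro member_le_sum) auto
    finally show ?thesis .
  qed
  have r: "strict_mono r" by (rule strict_mono_Suc_iff[THEN iffD2]) (auto simp: r_def)
  \<comment> \<open>The radius grows with j, so a single subsequence converges a.e. on the whole
    space.\<close>
  define d where "d j x = indicator (ball 0 (real j)) x *\<^sub>R (u (\<kappa> (r (Suc j))) x - u (\<kappa> (r j)) x)" for j x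
  have dL: "L2 (d j)" for j unfolding d_def[abs_def] by (intro L2_indicator L2_diff u) simp
  have "n2 (d j) \<le> 1 * (1/4)^j" for j
    using N[of j "r (Suc j)" "r j"] rN[of j "Suc j"] rN[of j j] unfolding loc_n2_def d_def[abs_def] by simp
  then have "AE x in lebesgue. summable (\<lambda>j. norm (d j x))" by (rule AE_summable_of_rapid_L2_decay[OF dL])
  then have conv: "AE x in lebesgue. convergent (\<lambda>j. u (\<kappa> (r j)) x)"
  proof eventually_elim
    fix x assume "summable (\<lambda>j. norm (d j x))"
    then have s: "summable (\<lambda>j. d j x)" by (rule summable_norm_cancel)
    obtain J :: nat where J: "norm x < real J" using reals_Archimedean2 by blast
    have "\<forall>\<^sub>F j in sequentially. d j x = u (\<kappa> (r (Suc j))) x - u (\<kappa> (r j)) x"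
      by (rule eventually_sequentiallyI[of J]) (use J in \<open>auto simp: d_def\<close>)
    then have "summable (\<lambda>j. u (\<kappa> (r (Suc j))) x - u (\<kappa> (r j)) x)"
      using s summable_cong by fastforce
    then have "convergent (\<lambda>n. \<Sum>j<n. u (\<kappa> (r (Suc j))) x - u (\<kappa> (r j)) x)" by (simp add: summable_iff_convergent)
    then have "convergent (\<lambda>n. (u (\<kappa> (r n)) x - u (\<kappa> (r 0)) x) + u (\<kappa> (r 0)) x)"
      by (intro convergent_add convergent_const)
        (simp add: sum_lessThan_telescope[of "\<lambda>j. u (\<kappa> (r j)) x"])
    then show "convergent (\<lambda>j. u (\<kappa> (r j)) x)" by simp
  qed
  show ?thesis
  proof (rule that[of "\<kappa> \<circ> r"])
    show "strict_mono (\<kappa> \<circ> r)" using \<kappa> r by (rule strict_mono_o)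
    show "AE x in lebesgue. convergent (\<lambda>n. u ((\<kappa> \<circ> r) n) x)" using conv by simp
    fix U R assume U: "AE x in lebesgue. (\<lambda>n. u ((\<kappa> \<circ> r) n) x) \<longlonglongrightarrow> U x"
    show "(\<lambda>n. loc_n2 R (\<lambda>x. u ((\<kappa> \<circ> r) n) x - U x)) \<longlonglongrightarrow> 0"
    proof (rule LIMSEQ_I)
      fix e :: real assume e: "e > 0"
      obtain N where N: "\<And>m n. m \<ge> N \<Longrightarrow> n \<ge> N \<Longrightarrow> loc_n2 R (\<lambda>x. u (\<kappa> m) x - u (\<kappa> n) x) \<le> e / 2"
        using Cau[of "e/2" R] e by auto
      have rn: "r n \<ge> n" for n using r by (rule seq_suble)
      \<comment> \<open>Letting the second index of the Cauchy estimate tend to infinity, by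
        Fatou.\<close>
      have "loc_n2 R (\<lambda>x. u ((\<kappa> \<circ> r) n) x - U x) \<le> e / 2" if n: "n \<ge> N" for n
        unfolding loc_n2_def
      proof (rule L2_Fatou(2)[where g="\<lambda>m x. indicator (ball 0 R) x *\<^sub>R (u ((\<kappa> \<circ> r) n) x - u ((\<kappa> \<circ> r) (m + N)) x)"])
        show "L2 (\<lambda>x. indicator (ball 0 R) x *\<^sub>R (u ((\<kappa> \<circ> r) n) x - u ((\<kappa> \<circ> r) (m + N)) x))" for m
          by (intro L2_indicator L2_diff u) simp
        show "n2 (\<lambda>x. indicator (ball 0 R) x *\<^sub>R (u ((\<kappa> \<circ> r) n) x - u ((\<kappa> \<circ> r) (m + N)) x)) \<le> e / 2" for m
          using N[of "r n" "r (m + N)"] rn[of n] rn[of "m + N"] n by (simp add: loc_n2_def)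
        show "AE x in lebesgue. (\<lambda>m. indicator (ball 0 R) x *\<^sub>R (u ((\<kappa> \<circ> r) n) x - u ((\<kappa> \<circ> r) (m + N)) x))
            \<longlonglongrightarrow> indicator (ball 0 R) x *\<^sub>R (u ((\<kappa> \<circ> r) n) x - U x)"
          using U
        proof eventually_elim
          fix x assume "(\<lambda>n. u ((\<kappa> \<circ> r) n) x) \<longlonglongrightarrow> U x"
          then have "(\<lambda>m. u ((\<kappa> \<circ> r) (m + N)) x) \<longlonglongrightarrow> U x" by (rule LIMSEQ_ignore_initial_segment)
          then show "(\<lambda>m. indicator (ball 0 R) x *\<^sub>R (u ((\<kappa> \<circ> r) n) x - u ((\<kappa> \<circ> r) (m + N)) x))
            \<longlonglongrightarrow> indicator (ball 0 R) x *\<^sub>R (u ((\<kappa> \<circ> r) n) x - U x)"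
            by (intro tendsto_intros)
        qed
      qed
      moreover have "0 \<le> loc_n2 R (\<lambda>x. u ((\<kappa> \<circ> r) n) x - U x)" for n by (simp add: loc_n2_def)
      ultimately show "\<exists>no. \<forall>n\<ge>no. norm (loc_n2 R (\<lambda>x. u ((\<kappa> \<circ> r) n) x - U x) - 0) < e"
        using e by (intro exI[of _ N] allI impI) (fastforce intro: le_less_trans)
    qed
  qed
qed

text \<open>Ball averages of a function invariant up to null sets are invariant everywhere.\<close>

lemma AE_invariant_modification:
  fixes w :: "'a::euclidean_space \<Rightarrow> real"
  assumes w: "H1 w" and inv: "\<And>T. T \<in> G \<Longrightarrow> orthogonal_transformation T \<and> (AE x in lebesgue. w (T x) = w x)"
  obtains w' where "AE x in lebesgue. w' x = w x" "\<And>T x. T \<in> G \<Longrightarrow> w' (T x) = w' x"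
proof -
  have L: "L2 w" by (rule H1_L2[OF w])
  have eqv: "avg r w (T x) = avg r w x" if T: "T \<in> G" and r: "r > 0" for T r x
  proof -
    have o: "orthogonal_transformation T" and ae: "AE x in lebesgue. w (T x) = w x" using inv[OF T] by auto
    have iso: "dist (T x) (T y) = dist x y" for x y
      using o by (metis dist_norm linear_diff orthogonal_transformation)
    have [measurable]: "w \<in> borel_measurable lebesgue" using L by (simp add: L2_def)
    have [measurable]: "(\<lambda>x. w (T x)) \<in> borel_measurable lebesgue" using AE_measurable_lebesgue[OF _ ae] by simp
    have [measurable]: "ball x r \<in> sets lebesgue" by simp
    have "(LINT y|lebesgue. indicator (ball (T x) r) y * w y) = (LINT y|lebesgue. (\<lambda>y. indicator (ball (T x) r) y * w y) (T y))"
      by (rule mp_integral[OF mp_orthogonal[OF o], symmetric])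
         (use L2_real_mult_integrable[OF L2_ball(1) L, of r "T x"] r in auto)
    also have "\<dots> = (LINT y|lebesgue. indicator (ball x r) y * w (T y))"
      by (intro Bochner_Integration.integral_cong refl) (auto simp: indicator_def iso)
    also have "\<dots> = (LINT y|lebesgue. indicator (ball x r) y * w y)"
      by (rule integral_cong_AE) (use ae in auto)
    finally show ?thesis by (simp add: avg_def)
  qed
  \<comment> \<open>Even where the averages fail to converge, \<open>lim\<close> returns equal
    values at x and T x, because the two sequences coincide.\<close>
  define w' where "w' x = lim (\<lambda>k. avg ((1/2)^k) w x)" for x
  show ?thesis
  proof (rule that[of w'])
    have "AE x in lebesgue. summable (\<lambda>k. norm (w x - avg ((1/2)^k) w x))"
    proof (rule AE_summable_of_rapid_L2_decay[where C="n2 (grad w)"])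
      fix k :: nat
      show "L2 (\<lambda>x. w x - avg ((1/2)^k) w x)" by (rule avg_L2_estimate[OF L H1_grad(2,1)[OF w]]) simp
      have "n2 (\<lambda>x. w x - avg ((1/2)^k) w x) \<le> ((1/2)^k)^2 * n2 (grad w)"
        by (rule avg_L2_estimate[OF L H1_grad(2,1)[OF w]]) simp
      also have "((1/2::real)^k)^2 = (1/4)^k" by (simp add: power2_eq_square flip: power_mult_distrib)
      finally show "n2 (\<lambda>x. w x - avg ((1/2)^k) w x) \<le> n2 (grad w) * (1/4)^k" by (simp add: mult.commute)
    qed
    then show "AE x in lebesgue. w' x = w x"
    proof eventually_elim
      fix x assume "summable (\<lambda>k. norm (w x - avg ((1/2)^k) w x))"
      then have "(\<lambda>k. w x - avg ((1/2)^k) w x) \<longlonglongrightarrow> 0" by (intro tendsto_norm_zero_cancel[OF summable_LIMSEQ_zero])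
      then have "(\<lambda>k. w x - (w x - avg ((1/2)^k) w x)) \<longlonglongrightarrow> w x - 0" by (intro tendsto_intros)
      then show "w' x = w x" unfolding w'_def by (intro limI) simp
    qed
    show "w' (T x) = w' x" if "T \<in> G" for T x unfolding w'_def using eqv[OF that] by simp
  qed
qed

section \<open>Weak limits of gradients\<close>

lemma norm_fst_le_norm: "norm (fst p) \<le> norm p"
  and norm_snd_le_norm: "norm (snd p) \<le> norm p"
  by (cases p; simp add: norm_fst_le norm_snd_le)+

lemma mid_hull_n2_le:
  assumes "v \<in> mid_hull S" "\<And>v. v \<in> S \<Longrightarrow> L2 v \<and> n2 v \<le> M" shows "L2 v \<and> n2 v \<le> M"
  using assms(1)
proof induction
  case (mid v w)
  then show ?case
    using n2_parallelogram[of v w] n2_nonneg[of "\<lambda>x. v x - w x"] by (auto intro!: L2_scaleR L2_add)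
qed (use assms(2) in auto)

text \<open>Function and gradient form one L2 sequence, so that the midpoints of Mazur's lemma act
  on both at once; the strong limit of the midpoints identifies the gradient of U. Weak convergence
  of the original gradients is then obtained by testing.\<close>

lemma weak_gradient_limit:
  fixes u :: "nat \<Rightarrow> 'a::euclidean_space \<Rightarrow> real"
  assumes u: "\<And>n. L2 (u n)" and g: "\<And>n. L2 (g n)" and ug: "\<And>n. weak_gradient (u n) (g n)"
    and M: "\<And>n. n2 (u n) \<le> M" "\<And>n. n2 (g n) \<le> M" and U: "AE x in lebesgue. (\<lambda>n. u n x) \<longlonglongrightarrow> U x"
  shows "H1 U" "L2 h \<Longrightarrow> (\<lambda>n. ip (g n) h) \<longlonglongrightarrow> ip (grad U) h"
proof -
  have UL: "L2 U" by (rule L2_Fatou(1)[OF u M(1) U])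
  define p where "p n x = (u n x, g n x)" for n x
  have um[measurable]: "u n \<in> borel_measurable lebesgue" "g n \<in> borel_measurable lebesgue" for n
    using u g by (auto simp: L2_def)
  have np: "(norm (p n x))^2 = (norm (u n x))^2 + (norm (g n x))^2" for n x by (simp add: p_def norm_Pair)
  have p: "L2 (p n)" for n
    unfolding L2_def np using u[of n] g[of n] by (auto simp: L2_def p_def[abs_def] intro!: borel_measurable_Pair)
  have pM: "n2 (p n) \<le> 2 * M" for n
    using M(1)[of n] M(2)[of n] u[of n] g[of n] unfolding n2_def np by (subst Bochner_Integration.integral_add) (auto simp: L2_def)
  obtain w G where w: "\<And>n. w n \<in> mid_hull (p ` {n..})" and G: "L2 G" "(\<lambda>n. n2 (\<lambda>x. w n x - G x)) \<longlonglongrightarrow> 0"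
    using L2_Mazur[of p "2 * M", OF p pM] by blast
  have wL: "L2 (w n) \<and> n2 (w n) \<le> 2 * M" for n
    by (rule mid_hull_n2_le[OF w]) (use p pM in auto)
  have hull: "L2 (\<lambda>x. fst (v x)) \<and> L2 (\<lambda>x. snd (v x)) \<and> weak_gradient (\<lambda>x. fst (v x)) (\<lambda>x. snd (v x))"
    if "v \<in> mid_hull (p ` {n..})" for v n
    using that
  proof induction
    case (base v)
    then show ?case using u g ug by (auto simp: p_def)
  next
    case (mid v w)
    have "weak_gradient (\<lambda>x. (1/2) * (fst (v x) + fst (w x))) (\<lambda>x. (1/2) *\<^sub>R (snd (v x) + snd (w x)))"
      by (intro weak_gradient_scaleR weak_gradient_add L2_add) (use mid in auto)
    moreover have "L2 (\<lambda>x. (1/2) *\<^sub>R (fst (v x) + fst (w x)))" "L2 (\<lambda>x. (1/2) *\<^sub>R (snd (v x) + snd (w x)))"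
      by (intro L2_scaleR L2_add; use mid in auto)+
    ultimately show ?case by simp
  qed
  \<comment> \<open>A midpoint of two numbers within e of U x is again within e of it, so midpoints
    of tails keep the pointwise limit.\<close>
  have close: "\<bar>fst (v x) - U x\<bar> \<le> e" if "v \<in> mid_hull (p ` {n..})" "\<And>k. k \<ge> n \<Longrightarrow> \<bar>u k x - U x\<bar> \<le> e" for v n x e
    using that(1)
  proof induction
    case (base v)
    then show ?case using that(2) by (auto simp: p_def)
  next
    case (mid v w)
    then have "fst (v x) \<le> U x + e" "U x - e \<le> fst (v x)" "fst (w x) \<le> U x + e" "U x - e \<le> fst (w x)"
      by (auto simp: abs_le_iff)
    then have "fst (v x) / 2 + fst (w x) / 2 - U x \<le> e" "- e \<le> fst (v x) / 2 + fst (w x) / 2 - U x" by linarith+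
    then have "\<bar>fst (v x) / 2 + fst (w x) / 2 - U x\<bar> \<le> e" by (intro abs_leI) linarith+
    then show ?case by (simp add: add_divide_distrib)
  qed
  have wU: "AE x in lebesgue. (\<lambda>n. fst (w n x)) \<longlonglongrightarrow> U x"
    using U
  proof eventually_elim
    fix x assume U: "(\<lambda>n. u n x) \<longlonglongrightarrow> U x"
    show "(\<lambda>n. fst (w n x)) \<longlonglongrightarrow> U x"
    proof (rule LIMSEQ_I)
      fix e :: real assume e: "e > 0"
      then obtain N where N: "\<And>n. n \<ge> N \<Longrightarrow> \<bar>u n x - U x\<bar> < e / 2"
        using LIMSEQ_D[OF U, of "e/2"] by auto
      have "\<bar>fst (w n x) - U x\<bar> \<le> e / 2" if "n \<ge> N" for n
        using that by (intro close[OF w[of n]]) (use N in \<open>auto intro: less_imp_le\<close>)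
      then show "\<exists>no. \<forall>n\<ge>no. norm (fst (w n x) - U x) < e" using e by (intro exI[of _ N]) fastforce
    qed
  qed
  have fw: "L2 (\<lambda>x. fst (w n x))" "n2 (\<lambda>x. fst (w n x)) \<le> 2 * M" for n
  proof -
    show "L2 (\<lambda>x. fst (w n x))" using hull[OF w[of n]] by simp
    have "n2 (\<lambda>x. fst (w n x)) \<le> n2 (w n)" by (rule n2_mono[OF conjunct1[OF wL] AE_I2[OF norm_fst_le_norm]])
    then show "n2 (\<lambda>x. fst (w n x)) \<le> 2 * M" using wL[of n] by linarith
  qed
  have G2: "L2 (\<lambda>x. snd (G x))"
  proof (rule L2_bound[OF G(1) _ AE_I2[OF norm_snd_le_norm]])
    have "G \<in> borel_measurable lebesgue" using G(1) by (simp add: L2_def)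
    then show "(\<lambda>x. snd (G x)) \<in> borel_measurable lebesgue"
      by (rule measurable_compose) (intro borel_measurable_continuous_onI continuous_intros)
  qed
  have "weak_gradient U (\<lambda>x. snd (G x))"
    unfolding weak_gradient_def
  proof (intro conjI allI impI ballI)
    show "(\<lambda>x. snd (G x)) \<in> borel_measurable lebesgue" using G2 by (simp add: L2_def)
    fix \<phi> :: "'a \<Rightarrow> real" and e :: 'a assume \<phi>: "test_fun \<phi>" and e: "e \<in> Basis"
    \<comment> \<open>With 0 in the first slot, pairing with \<psi> reads off the e-component of the
      gradient part alone.\<close>
    define \<psi> :: "'a \<Rightarrow> real \<times> 'a" where "\<psi> x = (0, \<phi> x *\<^sub>R e)" for x
    have \<phi>m: "\<phi> \<in> borel_measurable lebesgue" using test_fun_L2[OF \<phi>] by (simp add: L2_def)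
    have \<psi>: "L2 \<psi>"
    proof (rule L2_bound[OF test_fun_L2[OF \<phi>]])
      show "\<psi> \<in> borel_measurable lebesgue" unfolding \<psi>_def[abs_def] using \<phi>m by (intro borel_measurable_Pair) auto
      show "AE x in lebesgue. norm (\<psi> x) \<le> norm (\<phi> x)" using e by (auto simp: \<psi>_def norm_Pair)
    qed
    have "(\<lambda>n. ip (\<lambda>x. w n x - G x) \<psi>) \<longlonglongrightarrow> 0"
    proof (rule Lim_null_comparison)
      have "norm (ip (\<lambda>x. w n x - G x) \<psi>) \<le> sqrt (n2 (\<lambda>x. w n x - G x)) * sqrt (n2 \<psi>)" for n
        using ip_Cauchy_Schwarz[OF L2_diff[OF conjunct1[OF wL[of n]] G(1)] \<psi>] by simp
      then show "\<forall>\<^sub>F n in sequentially. norm (ip (\<lambda>x. w n x - G x) \<psi>) \<le> sqrt (n2 (\<lambda>x. w n x - G x)) * sqrt (n2 \<psi>)"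
        by (rule always_eventually[OF allI])
      show "(\<lambda>n. sqrt (n2 (\<lambda>x. w n x - G x)) * sqrt (n2 \<psi>)) \<longlonglongrightarrow> 0"
        by (rule tendsto_mult_left_zero[OF tendsto_real_sqrt[OF G(2), unfolded real_sqrt_zero]])
    qed
    moreover have "ip (\<lambda>x. w n x - G x) \<psi> = ip (w n) \<psi> - ip G \<psi>" for n
      using wL G(1) \<psi> by (intro ip_diff_left) auto
    moreover have "ip G \<psi> = (LINT x|lebesgue. (snd (G x) \<bullet> e) * \<phi> x)"
      by (auto simp: ip_def \<psi>_def inner_prod_def mult.commute)
    moreover have "ip (w n) \<psi> = - (LINT x|lebesgue. fst (w n x) * frechet_derivative \<phi> (at x) e)" for n
      using weak_gradient_test[of "\<lambda>x. fst (w n x)" "\<lambda>x. snd (w n x)" \<phi> e] hull[OF w[of n]] \<phi> e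
      by (auto simp: ip_def \<psi>_def inner_prod_def mult.commute)
    ultimately have a: "(\<lambda>n. - (LINT x|lebesgue. fst (w n x) * frechet_derivative \<phi> (at x) e) - (LINT x|lebesgue. (snd (G x) \<bullet> e) * \<phi> x)) \<longlonglongrightarrow> 0"
      by simp
    have "(\<lambda>n. LINT x|lebesgue. fst (w n x) * frechet_derivative \<phi> (at x) e) \<longlonglongrightarrow> (LINT x|lebesgue. U x * frechet_derivative \<phi> (at x) e)"
      using ip_tendsto_of_AE[OF fw wU test_fun_derivative_L2[OF \<phi>, of e]] by (simp add: ip_def)
    then have b: "(\<lambda>n. - (LINT x|lebesgue. fst (w n x) * frechet_derivative \<phi> (at x) e) - (LINT x|lebesgue. (snd (G x) \<bullet> e) * \<phi> x))
        \<longlonglongrightarrow> - (LINT x|lebesgue. U x * frechet_derivative \<phi> (at x) e) - (LINT x|lebesgue. (snd (G x) \<bullet> e) * \<phi> x)"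
      by (intro tendsto_intros)
    show "(LINT x|lebesgue. U x * frechet_derivative \<phi> (at x) e) = - (LINT x|lebesgue. (snd (G x) \<bullet> e) * \<phi> x)"
      using LIMSEQ_unique[OF a b] by linarith
  qed
  then show HU: "H1 U" using H1_I(1)[OF UL _ G2] by blast
  note gU = H1_grad[OF HU]
  \<comment> \<open>For test functions this is integration by parts and the weak convergence of
    \<open>u n\<close>; density and the common bound on the gradients extend it to all of
    L2.\<close>
  have comp: "(\<lambda>n. ip (\<lambda>x. g n x \<bullet> e) w) \<longlonglongrightarrow> ip (\<lambda>x. grad U x \<bullet> e) w" if e: "e \<in> Basis" and w: "L2 w" for e and w :: "'a \<Rightarrow> real"
  proof (rule LIMSEQ_I)
    fix \<epsilon> :: real assume \<epsilon>: "\<epsilon> > 0"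
    define K where "K = sqrt M + sqrt (n2 (grad U))"
    have M0: "M \<ge> 0" using order_trans[OF n2_nonneg M(1)] .
    have K: "K \<ge> 0" using M0 by (simp add: K_def)
    define d where "d = \<epsilon> / (2 * (K + 1))"
    have d: "d > 0" using \<epsilon> K by (simp add: d_def)
    obtain \<phi> where \<phi>: "test_fun \<phi>" "n2 (\<lambda>x. w x - \<phi> x) < d^2" using test_fun_dense[OF w, of "d^2"] d by auto
    have dd: "sqrt (n2 (\<lambda>x. w x - \<phi> x)) \<le> d" using \<phi>(2) d by (intro real_le_lsqrt) auto
    have L\<phi>: "L2 \<phi>" by (rule test_fun_L2[OF \<phi>(1)])
    have "(\<lambda>n. - ip (u n) (\<lambda>x. frechet_derivative \<phi> (at x) e)) \<longlonglongrightarrow> - ip U (\<lambda>x. frechet_derivative \<phi> (at x) e)"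
      by (intro tendsto_intros ip_tendsto_of_AE[OF u M(1) U] test_fun_derivative_L2 \<phi>)
    then have lim: "(\<lambda>n. ip (\<lambda>x. g n x \<bullet> e) \<phi>) \<longlonglongrightarrow> ip (\<lambda>x. grad U x \<bullet> e) \<phi>"
      using weak_gradient_test[OF ug \<phi>(1) e] weak_gradient_test[OF gU(1) \<phi>(1) e] by (simp add: ip_def)
    obtain N where N: "\<And>n. n \<ge> N \<Longrightarrow> \<bar>ip (\<lambda>x. g n x \<bullet> e) \<phi> - ip (\<lambda>x. grad U x \<bullet> e) \<phi>\<bar> < \<epsilon> / 2"
      using LIMSEQ_D[OF lim, of "\<epsilon>/2"] \<epsilon> by auto
    have comp_le: "\<bar>ip (\<lambda>x. q x \<bullet> e) (\<lambda>x. w x - \<phi> x)\<bar> \<le> sqrt (n2 q) * d" if q: "L2 q" for q :: "'a \<Rightarrow> 'a"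
    proof -
      have "\<bar>ip (\<lambda>x. q x \<bullet> e) (\<lambda>x. w x - \<phi> x)\<bar> \<le> sqrt (n2 (\<lambda>x. q x \<bullet> e)) * sqrt (n2 (\<lambda>x. w x - \<phi> x))"
        by (intro ip_Cauchy_Schwarz L2_component L2_diff q w L\<phi>)
      also have "\<dots> \<le> sqrt (n2 q) * d"
      proof (intro mult_mono dd)
        have "n2 (\<lambda>x. q x \<bullet> e) \<le> n2 q" by (rule n2_mono[OF q]) (use Basis_le_norm[OF e] in auto)
        then show "sqrt (n2 (\<lambda>x. q x \<bullet> e)) \<le> sqrt (n2 q)" by simp
      qed auto
      finally show ?thesis .
    qed
    have "\<bar>ip (\<lambda>x. g n x \<bullet> e) w - ip (\<lambda>x. grad U x \<bullet> e) w\<bar> < \<epsilon>" if n: "n \<ge> N" for n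
    proof -
      have split: "ip (\<lambda>x. q x \<bullet> e) w = ip (\<lambda>x. q x \<bullet> e) \<phi> + ip (\<lambda>x. q x \<bullet> e) (\<lambda>x. w x - \<phi> x)" if q: "L2 q" for q :: "'a \<Rightarrow> 'a"
        using ip_diff_left[OF w L\<phi> L2_component[OF q, of e]]
        by (simp add: ip_commute[of "\<lambda>x. q x \<bullet> e"])
      have "sqrt (n2 (g n)) * d \<le> sqrt M * d" using M(2) d by (intro mult_right_mono) auto
      then have "\<bar>ip (\<lambda>x. g n x \<bullet> e) (\<lambda>x. w x - \<phi> x)\<bar> + \<bar>ip (\<lambda>x. grad U x \<bullet> e) (\<lambda>x. w x - \<phi> x)\<bar> \<le> K * d"
        using comp_le[OF g[of n]] comp_le[OF gU(2)] by (simp add: K_def distrib_right)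
      also have "K * d \<le> \<epsilon> / 2" using K \<epsilon> by (simp add: d_def field_simps)
      finally show ?thesis using N[OF n] split[OF g[of n]] split[OF gU(2)] by linarith
    qed
    then show "\<exists>no. \<forall>n\<ge>no. norm (ip (\<lambda>x. g n x \<bullet> e) w - ip (\<lambda>x. grad U x \<bullet> e) w) < \<epsilon>" by auto
  qed
  show "(\<lambda>n. ip (g n) h) \<longlonglongrightarrow> ip (grad U) h" if h: "L2 h"
  proof -
    have sp: "ip q h = (\<Sum>e\<in>Basis. ip (\<lambda>x. q x \<bullet> e) (\<lambda>x. h x \<bullet> e))" if q: "L2 q" for q :: "'a \<Rightarrow> 'a"
    proof -
      have "ip q h = (LINT x|lebesgue. (\<Sum>e\<in>Basis. (q x \<bullet> e) * (h x \<bullet> e)))"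
        unfolding ip_def by (intro Bochner_Integration.integral_cong refl) (rule euclidean_inner)
      also have "\<dots> = (\<Sum>e\<in>Basis. LINT x|lebesgue. (q x \<bullet> e) * (h x \<bullet> e))"
        by (intro Bochner_Integration.integral_sum L2_real_mult_integrable L2_component q h)
      finally show ?thesis by (simp add: ip_def)
    qed
    show ?thesis unfolding sp[OF g] sp[OF gU(2)] by (intro tendsto_sum comp L2_component h)
  qed
qed

section \<open>The space X1\<close>

lemma ip_AE_cong:
  assumes "L2 g" "L2 h" "AE x in lebesgue. g' x = g x" "AE x in lebesgue. h' x = h x"
  shows "ip g' h' = ip g h"
proof -
  have [measurable]: "g \<in> borel_measurable lebesgue" "h \<in> borel_measurable lebesgue" using assms by (auto simp: L2_def)
  have [measurable]: "g' \<in> borel_measurable lebesgue" "h' \<in> borel_measurable lebesgue"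
    using AE_measurable_lebesgue[OF _ assms(3)] AE_measurable_lebesgue[OF _ assms(4)] by auto
  show ?thesis unfolding ip_def
  proof (rule integral_cong_AE)
    show "AE x in lebesgue. g' x \<bullet> h' x = g x \<bullet> h x" using assms(3,4) by eventually_elim simp
  qed measurable
qed

locale potential =
  fixes V :: "'y::euclidean_space \<times> 'z::euclidean_space \<Rightarrow> real" and V0 :: real
  assumes Vc: "continuous_on UNIV V" and V0: "V0 > 0" and VV0: "\<And>x. V0 \<le> V x"
begin

text \<open>The squared norm of \<open>emb u\<close> is the energy density, so X1 inherits its
  Hilbert space estimates from L2. \<open>grad\<close> is picked by choice, hence \<open>emb\<close>
  is linear only a.e. On the null set y = 0 the quotient takes the default value 0.\<close>

definition emb :: "('y \<times> 'z \<Rightarrow> real) \<Rightarrow> 'y \<times> 'z \<Rightarrow> ('y \<times> 'z) \<times> real \<times> real" where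
  "emb u x = (grad u x, u x / norm (fst x), sqrt (V x) * u x)"

definition E :: "('y \<times> 'z \<Rightarrow> real) \<Rightarrow> ('y \<times> 'z \<Rightarrow> real) \<Rightarrow> real" where
  "E u h = ip (emb u) (emb h)"

definition nrm :: "('y \<times> 'z \<Rightarrow> real) \<Rightarrow> real" where
  "nrm u = sqrt (norm1sq V u)"

lemma V_pos: "V x > 0" using VV0[of x] V0 by linarith

lemma emb_norm: "(norm (emb u x))^2 = (norm (grad u x))^2 + (u x)^2 / (norm (fst x))^2 + V x * (u x)^2"
  using V_pos[of x] by (simp add: emb_def norm_Pair power_divide power_mult_distrib)

lemma norm1sq_n2: "norm1sq V u = n2 (emb u)"
  unfolding norm1sq_def n2_def emb_norm ..

lemma norm_fst_measurable: "(\<lambda>x::'y \<times> 'z. norm (fst x)) \<in> borel_measurable lebesgue"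
  by (intro continuous_lebesgue_measurable continuous_intros)

lemma V_measurable: "V \<in> borel_measurable lebesgue"
  by (rule continuous_lebesgue_measurable[OF Vc])

lemma emb_measurable:
  assumes "u \<in> borel_measurable lebesgue" "grad u \<in> borel_measurable lebesgue"
  shows "emb u \<in> borel_measurable lebesgue"
proof -
  note [measurable] = norm_fst_measurable V_measurable assms
  have [measurable]: "(\<lambda>x. u x / norm (fst x)) \<in> borel_measurable lebesgue"
    by (intro borel_measurable_divide norm_fst_measurable assms)
  have [measurable]: "(\<lambda>x. sqrt (V x) * u x) \<in> borel_measurable lebesgue" by measurable
  show ?thesis unfolding emb_def[abs_def] by (intro borel_measurable_Pair) auto
qed

lemma X1_iff: "X1 V u \<longleftrightarrow> H1 u \<and> L2 (emb u)"
proof (cases "H1 u")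
  case True
  have m: "emb u \<in> borel_measurable lebesgue"
    using H1_L2[OF True] H1_grad(2)[OF True] by (intro emb_measurable) (auto simp: L2_def)
  have g: "integrable lebesgue (\<lambda>x. (norm (grad u x))^2)" using H1_grad(2)[OF True] by (simp add: L2_def)
  have "integrable lebesgue (\<lambda>x. (u x)\<^sup>2 / (norm (fst x))\<^sup>2 + V x * (u x)\<^sup>2) \<longleftrightarrow> integrable lebesgue (\<lambda>x. (norm (emb u x))^2)"
  proof
    assume "integrable lebesgue (\<lambda>x. (u x)\<^sup>2 / (norm (fst x))\<^sup>2 + V x * (u x)\<^sup>2)"
    then show "integrable lebesgue (\<lambda>x. (norm (emb u x))^2)" unfolding emb_norm
      using Bochner_Integration.integrable_add[OF g] by (simp add: add.assoc)
  next
    assume "integrable lebesgue (\<lambda>x. (norm (emb u x))^2)"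
    then have "integrable lebesgue (\<lambda>x. (norm (emb u x))^2 - (norm (grad u x))^2)"
      using g by (rule Bochner_Integration.integrable_diff)
    then show "integrable lebesgue (\<lambda>x. (u x)\<^sup>2 / (norm (fst x))\<^sup>2 + V x * (u x)\<^sup>2)" by (simp add: emb_norm)
  qed
  then show ?thesis using True m by (simp add: X1_def L2_def)
qed (simp add: X1_def)

lemma X1_H1: "X1 V u \<Longrightarrow> H1 u" by (simp add: X1_def)
lemma X1_L2: "X1 V u \<Longrightarrow> L2 u" by (simp add: X1_def H1_L2)
lemma X1_emb: "X1 V u \<Longrightarrow> L2 (emb u)" by (simp add: X1_iff)

lemma emb_add:
  assumes "X1 V u" "X1 V h" shows "AE x in lebesgue. emb (\<lambda>x. u x + h x) x = emb u x + emb h x"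
  using H1_add(2)[OF X1_H1[OF assms(1)] X1_H1[OF assms(2)]]
  by eventually_elim (simp add: emb_def add_divide_distrib distrib_left)

lemma emb_cmult:
  assumes "X1 V u" shows "AE x in lebesgue. emb (\<lambda>x. c * u x) x = c *\<^sub>R emb u x"
  using H1_cmult(2)[OF X1_H1[OF assms], of c] by eventually_elim (simp add: emb_def)

lemma X1_add: assumes "X1 V u" "X1 V h" shows "X1 V (\<lambda>x. u x + h x)"
proof -
  have H: "H1 (\<lambda>x. u x + h x)" by (rule H1_add(1)[OF X1_H1[OF assms(1)] X1_H1[OF assms(2)]])
  have L: "L2 (\<lambda>x. emb u x + emb h x)" by (intro L2_add X1_emb assms)
  have "L2 (emb (\<lambda>x. u x + h x))"
    by (rule L2_AE_cong[OF L AE_measurable_lebesgue[OF L2_measurable[OF L] emb_add[OF assms]] emb_add[OF assms]])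
  then show ?thesis using H by (simp add: X1_iff)
qed

lemma X1_cmult: assumes "X1 V u" shows "X1 V (\<lambda>x. c * u x)"
proof -
  have H: "H1 (\<lambda>x. c * u x)" by (rule H1_cmult(1)[OF X1_H1[OF assms]])
  have L: "L2 (\<lambda>x. c *\<^sub>R emb u x)" by (intro L2_scaleR X1_emb assms)
  have "L2 (emb (\<lambda>x. c * u x))"
    by (rule L2_AE_cong[OF L AE_measurable_lebesgue[OF L2_measurable[OF L] emb_cmult[OF assms]] emb_cmult[OF assms]])
  then show ?thesis using H by (simp add: X1_iff)
qed

lemma X1_diff: assumes "X1 V u" "X1 V h" shows "X1 V (\<lambda>x. u x - h x)"
  using X1_add[OF assms(1) X1_cmult[OF assms(2), of "-1"]] by simp

lemma E_commute: "E u h = E h u" by (simp add: E_def ip_commute)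

lemma E_self: "E u u = norm1sq V u" by (simp add: E_def norm1sq_n2 n2_ip)

lemma norm1sq_nonneg [simp]: "0 \<le> norm1sq V u" by (simp add: norm1sq_n2)

lemma nrm_nonneg [simp]: "0 \<le> nrm u" by (simp add: nrm_def)

lemma nrm_sq: "(nrm u)^2 = norm1sq V u" by (simp add: nrm_def)

lemma E_add_left:
  assumes "X1 V u" "X1 V v" "X1 V h" shows "E (\<lambda>x. u x + v x) h = E u h + E v h"
proof -
  have "E (\<lambda>x. u x + v x) h = ip (\<lambda>x. emb u x + emb v x) (emb h)"
    unfolding E_def by (rule ip_AE_cong[OF L2_add[OF X1_emb[OF assms(1)] X1_emb[OF assms(2)]] X1_emb[OF assms(3)] emb_add[OF assms(1,2)]]) simp
  then show ?thesis using assms by (simp add: E_def ip_add_left X1_emb)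
qed

lemma E_cmult_left:
  assumes "X1 V u" "X1 V h" shows "E (\<lambda>x. c * u x) h = c * E u h"
proof -
  have "E (\<lambda>x. c * u x) h = ip (\<lambda>x. c *\<^sub>R emb u x) (emb h)"
    unfolding E_def by (rule ip_AE_cong[OF L2_scaleR[OF X1_emb[OF assms(1)]] X1_emb[OF assms(2)] emb_cmult[OF assms(1)]]) simp
  then show ?thesis by (simp add: E_def ip_scaleR_left)
qed

lemma E_add_right:
  assumes "X1 V u" "X1 V v" "X1 V h" shows "E h (\<lambda>x. u x + v x) = E h u + E h v"
  using E_add_left[OF assms] by (simp add: E_commute)

lemma E_cmult_right:
  assumes "X1 V u" "X1 V h" shows "E h (\<lambda>x. c * u x) = c * E h u"
  using E_cmult_left[OF assms] by (simp add: E_commute)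

lemma norm1sq_add:
  assumes "X1 V u" "X1 V h" shows "norm1sq V (\<lambda>x. u x + h x) = norm1sq V u + 2 * E u h + norm1sq V h"
  using assms by (simp add: E_self[symmetric] E_add_left E_add_right X1_add E_commute[of h u])

lemma norm1sq_cmult:
  assumes "X1 V u" shows "norm1sq V (\<lambda>x. c * u x) = c^2 * norm1sq V u"
  using assms by (simp add: E_self[symmetric] E_cmult_left E_cmult_right X1_cmult power2_eq_square)

lemma nrm_cmult: assumes "X1 V u" shows "nrm (\<lambda>x. c * u x) = \<bar>c\<bar> * nrm u"
  by (simp add: nrm_def norm1sq_cmult[OF assms] real_sqrt_mult)

lemma E_Cauchy_Schwarz: assumes "X1 V u" "X1 V h" shows "\<bar>E u h\<bar> \<le> nrm u * nrm h"
  using ip_Cauchy_Schwarz[OF X1_emb[OF assms(1)] X1_emb[OF assms(2)]] by (simp add: E_def nrm_def norm1sq_n2)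

lemma nrm_triangle: assumes "X1 V u" "X1 V h" shows "nrm (\<lambda>x. u x + h x) \<le> nrm u + nrm h"
proof -
  have "norm1sq V (\<lambda>x. u x + h x) \<le> (nrm u + nrm h)^2"
    using norm1sq_add[OF assms] E_Cauchy_Schwarz[OF assms] by (simp add: power2_sum nrm_sq)
  then show ?thesis unfolding nrm_def[of "\<lambda>x. u x + h x"] by (intro real_le_lsqrt) auto
qed

lemma X1_AE_cong:
  assumes "X1 V u" "AE x in lebesgue. v x = u x"
  shows "X1 V v" "AE x in lebesgue. emb v x = emb u x"
proof -
  note H = H1_AE_cong[OF X1_H1[OF assms(1)] assms(2)]
  show ae: "AE x in lebesgue. emb v x = emb u x" using H(2) assms(2) by eventually_elim (simp add: emb_def)
  note L = X1_emb[OF assms(1)]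
  have "L2 (emb v)" by (rule L2_AE_cong[OF L AE_measurable_lebesgue[OF L2_measurable[OF L] ae] ae])
  then show "X1 V v" using H(1) by (simp add: X1_iff)
qed

lemma E_AE_cong:
  assumes "X1 V u" "AE x in lebesgue. v x = u x" "X1 V h" shows "E v h = E u h"
  unfolding E_def by (rule ip_AE_cong[OF X1_emb[OF assms(1)] X1_emb[OF assms(3)] X1_AE_cong(2)[OF assms(1,2)]]) simp

lemma n2_le_norm1sq: assumes "X1 V u" shows "V0 * n2 u \<le> norm1sq V u"
proof -
  have "n2 (\<lambda>x. sqrt V0 *\<^sub>R u x) \<le> n2 (emb u)"
  proof (rule n2_mono[OF X1_emb[OF assms]], rule AE_I2)
    fix x
    have "(norm (sqrt V0 *\<^sub>R u x))^2 = V0 * (u x)^2" using V0 by (simp add: power_mult_distrib)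
    also have "\<dots> \<le> V x * (u x)^2" using VV0 by (intro mult_right_mono) auto
    also have "\<dots> \<le> (norm (emb u x))^2" unfolding emb_norm by simp
    finally show "norm (sqrt V0 *\<^sub>R u x) \<le> norm (emb u x)" by (rule power2_le_imp_le) simp
  qed
  then show ?thesis unfolding n2_scaleR norm1sq_n2 using V0 by simp
qed

lemma n2_grad_le_norm1sq: assumes "X1 V u" shows "n2 (grad u) \<le> norm1sq V u"
  unfolding norm1sq_n2 by (rule n2_mono[OF X1_emb[OF assms]]) (auto simp: emb_def norm_fst_le)

lemma nrm_eq_0: assumes "X1 V u" "norm1sq V u = 0" shows "AE x in lebesgue. u x = 0"
proof -
  have "V0 * n2 u \<le> 0" using n2_le_norm1sq[OF assms(1)] assms(2) by simp
  then have "n2 u = 0" using V0 n2_nonneg[of u] by (simp add: mult_le_0_iff)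
  then show ?thesis by (rule n2_eq_0[OF X1_L2[OF assms(1)]])
qed

lemma norm1sq_pos: assumes "X1 V u" "\<not> (AE x in lebesgue. u x = 0)" shows "norm1sq V u > 0"
  using nrm_eq_0[OF assms(1)] assms(2) norm1sq_nonneg[of u] by (metis order_le_less)

lemma norm1sq_AE_0: assumes "X1 V u" "AE x in lebesgue. u x = 0" shows "norm1sq V u = 0"
proof -
  have X0: "X1 V (\<lambda>x. 0 * u x)" by (rule X1_cmult[OF assms(1)])
  have "AE x in lebesgue. u x = 0 * u x" using assms(2) by eventually_elim simp
  then have "E u u = E (\<lambda>x. 0 * u x) u" by (rule E_AE_cong[OF X0 _ assms(1)])
  also have "\<dots> = 0" using E_cmult_left[OF assms(1,1), of 0] by simp
  finally show ?thesis by (simp add: E_self)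
qed

text \<open>Gradient, Hardy and potential parts are separated because their weak limits are found in
  different ways; the Hardy and potential parts are bounded by the full norm.\<close>

lemma E_split:
  assumes "X1 V u" "X1 V h"
  shows "E u h = ip (grad u) (grad h) + (ip (\<lambda>x. u x / norm (fst x)) (\<lambda>x. h x / norm (fst x))
      + ip (\<lambda>x. sqrt (V x) * u x) (\<lambda>x. sqrt (V x) * h x))"
    and "L2 (\<lambda>x. u x / norm (fst x))" "n2 (\<lambda>x. u x / norm (fst x)) \<le> norm1sq V u"
    and "L2 (\<lambda>x. sqrt (V x) * u x)" "n2 (\<lambda>x. sqrt (V x) * u x) \<le> norm1sq V u"
proof -
  have le: "norm (u x / norm (fst x)) \<le> norm (emb u x)" "norm (sqrt (V x) * u x) \<le> norm (emb u x)" for u x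
  proof -
    have "norm (snd (emb u x)) \<le> norm (emb u x)" by (rule norm_snd_le_norm)
    moreover have "norm (fst (snd (emb u x))) \<le> norm (snd (emb u x))" "norm (snd (snd (emb u x))) \<le> norm (snd (emb u x))"
      by (rule norm_fst_le_norm, rule norm_snd_le_norm)
    ultimately show "norm (u x / norm (fst x)) \<le> norm (emb u x)" "norm (sqrt (V x) * u x) \<le> norm (emb u x)"
      by (auto simp: emb_def)
  qed
  have L: "L2 (\<lambda>x. u x / norm (fst x))" "L2 (\<lambda>x. sqrt (V x) * u x)" if u: "X1 V u" for u
  proof -
    have [measurable]: "u \<in> borel_measurable lebesgue" using X1_L2[OF u] by (simp add: L2_def)
    note [measurable] = V_measurable
    show "L2 (\<lambda>x. u x / norm (fst x))"
      by (rule L2_bound[OF X1_emb[OF u]]) (use le(1) in \<open>auto intro!: borel_measurable_divide norm_fst_measurable\<close>)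
    show "L2 (\<lambda>x. sqrt (V x) * u x)"
      by (rule L2_bound[OF X1_emb[OF u]]) (use le(2) in auto)
  qed
  show "L2 (\<lambda>x. u x / norm (fst x))" "L2 (\<lambda>x. sqrt (V x) * u x)" using L[OF assms(1)] by auto
  show "n2 (\<lambda>x. u x / norm (fst x)) \<le> norm1sq V u" unfolding norm1sq_n2 by (rule n2_mono[OF X1_emb[OF assms(1)]]) (use le(1) in auto)
  show "n2 (\<lambda>x. sqrt (V x) * u x) \<le> norm1sq V u" unfolding norm1sq_n2 by (rule n2_mono[OF X1_emb[OF assms(1)]]) (use le(2) in auto)
  have "E u h = (LINT x|lebesgue. grad u x \<bullet> grad h x + ((u x / norm (fst x)) \<bullet> (h x / norm (fst x)) + (sqrt (V x) * u x) \<bullet> (sqrt (V x) * h x)))"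
    unfolding E_def ip_def by (intro Bochner_Integration.integral_cong refl) (simp add: emb_def inner_prod_def)
  also have "\<dots> = ip (grad u) (grad h) + (ip (\<lambda>x. u x / norm (fst x)) (\<lambda>x. h x / norm (fst x))
      + ip (\<lambda>x. sqrt (V x) * u x) (\<lambda>x. sqrt (V x) * h x))"
    unfolding ip_def
    using L2_inner_integrable[OF H1_grad(2)[OF X1_H1[OF assms(1)]] H1_grad(2)[OF X1_H1[OF assms(2)]]]
      L2_inner_integrable[OF L(1)[OF assms(1)] L(1)[OF assms(2)]] L2_inner_integrable[OF L(2)[OF assms(1)] L(2)[OF assms(2)]]
    by (subst Bochner_Integration.integral_add, simp, simp, subst Bochner_Integration.integral_add) simp_all
  finally show "E u h = ip (grad u) (grad h) + (ip (\<lambda>x. u x / norm (fst x)) (\<lambda>x. h x / norm (fst x))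
      + ip (\<lambda>x. sqrt (V x) * u x) (\<lambda>x. sqrt (V x) * h x))" .
qed

text \<open>U is the pointwise \<open>lim\<close> rather than some a.e. limit, so that invariance at
  every point passes from the sequence to it. Only the gradient part of E needs more than a.e.
  convergence with bounded norms.\<close>

lemma X1_compact:
  fixes u :: "nat \<Rightarrow> 'y \<times> 'z \<Rightarrow> real"
  assumes u: "\<And>n. X1 V (u n)" and M: "\<And>n. norm1sq V (u n) \<le> M"
  obtains \<kappa> :: "nat \<Rightarrow> nat" and U where "strict_mono \<kappa>" "U = (\<lambda>x. lim (\<lambda>n. u (\<kappa> n) x))" "X1 V U"
    "AE x in lebesgue. (\<lambda>n. u (\<kappa> n) x) \<longlonglongrightarrow> U x"
    "\<And>R. (\<lambda>n. loc_n2 R (\<lambda>x. u (\<kappa> n) x - U x)) \<longlonglongrightarrow> 0"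
    "\<And>h. X1 V h \<Longrightarrow> (\<lambda>n. E (u (\<kappa> n)) h) \<longlonglongrightarrow> E U h"
proof -
  define K where "K = max M (M / V0)"
  have b1: "n2 (u n) \<le> K" for n
  proof -
    have "V0 * n2 (u n) \<le> M" using n2_le_norm1sq[OF u[of n]] M[of n] by linarith
    then have "n2 (u n) \<le> M / V0" using V0 by (simp add: field_simps)
    then show ?thesis by (simp add: K_def)
  qed
  have b2: "n2 (grad (u n)) \<le> K" for n using n2_grad_le_norm1sq[OF u[of n]] M[of n] by (simp add: K_def)
  note uL = X1_L2[OF u] and uH = X1_H1[OF u]
  obtain \<kappa> where \<kappa>: "strict_mono (\<kappa>::nat\<Rightarrow>nat)" and cv: "AE x in lebesgue. convergent (\<lambda>n. u (\<kappa> n) x)"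
    and loc: "\<And>U R. AE x in lebesgue. (\<lambda>n. u (\<kappa> n) x) \<longlonglongrightarrow> U x \<Longrightarrow> (\<lambda>n. loc_n2 R (\<lambda>x. u (\<kappa> n) x - U x)) \<longlonglongrightarrow> 0"
    by (rule Rellich[OF uL H1_grad(2)[OF uH] H1_grad(1)[OF uH] b1 b2]) (rule that)
  define U where "U x = lim (\<lambda>n. u (\<kappa> n) x)" for x
  have ae: "AE x in lebesgue. (\<lambda>n. u (\<kappa> n) x) \<longlonglongrightarrow> U x"
    using cv unfolding U_def by eventually_elim (simp add: convergent_LIMSEQ_iff)
  note wg = weak_gradient_limit[of "\<lambda>n. u (\<kappa> n)" "\<lambda>n. grad (u (\<kappa> n))" K U, OF uL H1_grad(2)[OF uH] H1_grad(1)[OF uH] b1 b2 ae]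
  have ae2: "AE x in lebesgue. (\<lambda>n. u (\<kappa> n) x / norm (fst x)) \<longlonglongrightarrow> U x / norm (fst x)"
    using ae
  proof eventually_elim
    fix x assume "(\<lambda>n. u (\<kappa> n) x) \<longlonglongrightarrow> U x"
    then show "(\<lambda>n. u (\<kappa> n) x / norm (fst x)) \<longlonglongrightarrow> U x / norm (fst x)"
      unfolding divide_inverse by (intro tendsto_intros)
  qed
  have ae3: "AE x in lebesgue. (\<lambda>n. sqrt (V x) * u (\<kappa> n) x) \<longlonglongrightarrow> sqrt (V x) * U x"
    using ae by eventually_elim (intro tendsto_intros)
  have p2: "L2 (\<lambda>x. u (\<kappa> n) x / norm (fst x))" "n2 (\<lambda>x. u (\<kappa> n) x / norm (fst x)) \<le> M"
    and p3: "L2 (\<lambda>x. sqrt (V x) * u (\<kappa> n) x)" "n2 (\<lambda>x. sqrt (V x) * u (\<kappa> n) x) \<le> M" for n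
    using E_split(2-)[OF u[of "\<kappa> n"] u[of "\<kappa> n"]] M[of "\<kappa> n"] by auto
  have L23: "L2 (\<lambda>x. U x / norm (fst x))" "L2 (\<lambda>x. sqrt (V x) * U x)"
    using L2_Fatou(1)[OF p2 ae2] L2_Fatou(1)[OF p3 ae3] by auto
  have XU: "X1 V U"
  proof -
    have "integrable lebesgue (\<lambda>x. (norm (U x / norm (fst x)))^2 + (norm (sqrt (V x) * U x))^2)"
      using L23 unfolding L2_def by (intro Bochner_Integration.integrable_add) auto
    moreover have "(norm (U x / norm (fst x)))^2 + (norm (sqrt (V x) * U x))^2 = (U x)^2 / (norm (fst x))^2 + V x * (U x)^2" for x
      using V_pos[of x] by (simp add: power_divide power_mult_distrib)
    ultimately show ?thesis using wg(1) by (simp add: X1_def)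
  qed
  show ?thesis
  proof (rule that[OF \<kappa> _ XU ae loc[OF ae]])
    show "U = (\<lambda>x. lim (\<lambda>n. u (\<kappa> n) x))" by (simp add: U_def[abs_def])
    fix h assume h: "X1 V h"
    show "(\<lambda>n. E (u (\<kappa> n)) h) \<longlonglongrightarrow> E U h"
      unfolding E_split(1)[OF u h] E_split(1)[OF XU h]
      by (intro tendsto_add wg(2) ip_tendsto_of_AE[OF p2 ae2] ip_tendsto_of_AE[OF p3 ae3] H1_grad(2) X1_H1 E_split(2,4)[OF h h] h)
  qed
qed

lemma orthogonal_first_factor:
  fixes A :: "'y \<Rightarrow> 'y"
  assumes "orthogonal_transformation A"
  shows "orthogonal_transformation (\<lambda>x::'y \<times> 'z. (A (fst x), snd x))"
proof -
  have l: "linear A" and n: "\<And>x. norm (A x) = norm x" using assms by (auto simp: orthogonal_transformation)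
  show ?thesis unfolding orthogonal_transformation
    by (auto intro!: linearI simp: linear_add[OF l] linear_scale[OF l] norm_Pair n)
qed

text \<open>V and |y| are invariant, T preserves the measure, and the gradient is merely rotated by
  the isometry \<open>inv T\<close>.\<close>

lemma X1_orthogonal:
  fixes A :: "'y \<Rightarrow> 'y"
  assumes Vinv: "G_invariant V" and A: "orthogonal_transformation A"
  defines "T \<equiv> (\<lambda>x::'y \<times> 'z. (A (fst x), snd x))"
  shows "X1 V u \<Longrightarrow> X1 V (\<lambda>x. u (T x))" and "X1 V u \<Longrightarrow> X1 V h \<Longrightarrow> E (\<lambda>x. u (T x)) (\<lambda>x. h (T x)) = E u h"
proof -
  have T: "orthogonal_transformation T" unfolding T_def by (rule orthogonal_first_factor[OF A])
  have mT: "mp T" by (rule mp_orthogonal[OF T])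
  have VT: "V (T x) = V x" for x using Vinv A unfolding G_invariant_def T_def by (metis prod.collapse)
  have nT: "norm (fst (T x)) = norm (fst x)" for x using A by (simp add: T_def orthogonal_transformation)
  have Ti: "orthogonal_transformation (inv T)" by (rule orthogonal_transformation_inv[OF T])
  have dT: "inv T a \<bullet> inv T b = a \<bullet> b" for a b using Ti unfolding orthogonal_transformation_def by blast
  have H: "H1 (\<lambda>x. u (T x)) \<and> (AE x in lebesgue. grad (\<lambda>x. u (T x)) x = inv T (grad u (T x)))" if "H1 u" for u
    using H1_I[OF L2_mp[OF mT H1_L2[OF that]] weak_gradient_orthogonal[OF H1_L2[OF that] H1_grad(2,1)[OF that] T]] by auto
  have ip_eq: "AE x in lebesgue. emb (\<lambda>x. u (T x)) x \<bullet> emb (\<lambda>x. h (T x)) x = emb u (T x) \<bullet> emb h (T x)" if "H1 u" "H1 h" for u h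
    using conjunct2[OF H[OF that(1)]] conjunct2[OF H[OF that(2)]]
    by eventually_elim (simp add: emb_def dT VT nT)
  show X: "X1 V (\<lambda>x. u (T x))" if u: "X1 V u" for u
  proof -
    have m: "emb (\<lambda>x. u (T x)) \<in> borel_measurable lebesgue"
      using H[OF X1_H1[OF u]] H1_L2 H1_grad(2) by (intro emb_measurable L2_measurable) blast+
    have "L2 (emb (\<lambda>x. u (T x)))"
    proof (rule L2_bound[OF L2_mp[OF mT X1_emb[OF u]] m])
      show "AE x in lebesgue. norm (emb (\<lambda>x. u (T x)) x) \<le> norm (emb u (T x))"
        using ip_eq[OF X1_H1[OF u] X1_H1[OF u]] by eventually_elim (simp add: norm_eq_sqrt_inner)
    qed
    then show ?thesis using H[OF X1_H1[OF u]] by (simp add: X1_iff)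
  qed
  show "E (\<lambda>x. u (T x)) (\<lambda>x. h (T x)) = E u h" if u: "X1 V u" and h: "X1 V h"
  proof -
    have "E (\<lambda>x. u (T x)) (\<lambda>x. h (T x)) = ip (\<lambda>x. emb u (T x)) (\<lambda>x. emb h (T x))"
      unfolding E_def ip_def
    proof (rule integral_cong_AE)
      show "AE x in lebesgue. emb (\<lambda>x. u (T x)) x \<bullet> emb (\<lambda>x. h (T x)) x = emb u (T x) \<bullet> emb h (T x)"
        by (rule ip_eq[OF X1_H1[OF u] X1_H1[OF h]])
      show "(\<lambda>x. emb (\<lambda>x. u (T x)) x \<bullet> emb (\<lambda>x. h (T x)) x) \<in> borel_measurable lebesgue"
        using L2_inner_integrable[OF X1_emb[OF X[OF u]] X1_emb[OF X[OF h]]] by auto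
      show "(\<lambda>x. emb u (T x) \<bullet> emb h (T x)) \<in> borel_measurable lebesgue"
        using L2_inner_integrable[OF L2_mp[OF mT X1_emb[OF u]] L2_mp[OF mT X1_emb[OF h]]] by auto
    qed
    then show ?thesis using ip_mp[OF mT X1_emb[OF u] X1_emb[OF h]] by (simp add: E_def)
  qed
qed

end

section \<open>The nonlinearity\<close>

text \<open>A Young-type inequality with constant 1, obtained by replacing both factors by their
  maximum.\<close>

lemma powr_times_le: "a powr (q - 1) * b \<le> a powr q + b powr q" if "0 \<le> a" "0 \<le> b" "1 < q" for a b q :: real
proof -
  have *: "m powr (q - 1) * m = m powr q" if "m \<ge> 0" for m :: real using that by (cases "m = 0") (auto simp: powr_diff)
  have "a powr (q - 1) * b \<le> max a b powr (q - 1) * max a b" using that by (intro mult_mono powr_mono2) auto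
  also have "\<dots> = max a b powr q" using that by (intro *) auto
  also have "\<dots> \<le> a powr q + b powr q" by (auto simp: max_def)
  finally show ?thesis .
qed

text \<open>q lies strictly above the growth exponent of f, so \<open>f_large\<close> can ask for an
  arbitrarily small factor at infinity, matching the one that \<open>f_small\<close> gives at
  0.\<close>

locale nonlinearity =
  fixes f :: "real \<Rightarrow> real" and q :: real
  assumes fc: "continuous_on UNIV f"
    and q2: "2 < q"
    and f_small: "((\<lambda>u. f u / u) \<longlongrightarrow> 0) (at 0)"
    and f_large: "\<And>e. e > 0 \<Longrightarrow> \<exists>M>0. \<forall>a. M \<le> \<bar>a\<bar> \<longrightarrow> \<bar>f a\<bar> \<le> e * \<bar>a\<bar> powr (q - 1)"
    and F_super: "filterlim (\<lambda>u. prim f u / u^2) at_top at_infinity"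
    and f_pos: "strict_mono_on {0<..} (\<lambda>u. f u / \<bar>u\<bar>)"
    and f_neg: "strict_mono_on {..<0} (\<lambda>u. f u / \<bar>u\<bar>)"
begin

lemma f_zero: "f 0 = 0"
proof -
  have "((\<lambda>u. f u / u * u) \<longlongrightarrow> 0 * 0) (at 0)" by (intro tendsto_intros f_small)
  moreover have "\<forall>\<^sub>F u in at 0. f u / u * u = f u" by (auto simp: eventually_at_filter)
  ultimately have "(f \<longlongrightarrow> 0) (at 0)" using Lim_transform_eventually by fastforce
  moreover have "(f \<longlongrightarrow> f 0) (at 0)" using fc by (simp add: continuous_on_eq_continuous_at isCont_def)
  ultimately show ?thesis using tendsto_unique[of "at (0::real)"] by auto
qed

lemma f_small_ex: assumes "e > 0" obtains \<eta> where "\<eta> > 0" "\<And>a. \<bar>a\<bar> \<le> \<eta> \<Longrightarrow> \<bar>f a\<bar> \<le> e * \<bar>a\<bar>"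
proof -
  obtain d where d: "d > 0" "\<And>a. a \<noteq> 0 \<Longrightarrow> \<bar>a\<bar> < d \<Longrightarrow> \<bar>f a / a\<bar> < e"
    using LIM_D[OF f_small assms] by auto
  have "\<bar>f a\<bar> \<le> e * \<bar>a\<bar>" if "\<bar>a\<bar> \<le> d / 2" for a
  proof (cases "a = 0")
    case False
    then have "\<bar>f a / a\<bar> < e" using that d by (intro d(2)) auto
    then show ?thesis using False by (simp add: abs_divide field_simps)
  qed (simp add: f_zero)
  then show ?thesis using d(1) that[of "d/2"] by auto
qed

lemma f_bounded: obtains K where "K > 0" "\<And>a. \<bar>a\<bar> \<le> M \<Longrightarrow> \<bar>f a\<bar> \<le> K"
proof -
  have "compact (f ` {-M..M})" by (intro compact_continuous_image continuous_on_subset[OF fc]) auto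
  then obtain K where K: "\<forall>y\<in>f ` {-M..M}. norm y \<le> K" using compact_imp_bounded bounded_iff by blast
  have "\<bar>f a\<bar> \<le> max K 1" if "\<bar>a\<bar> \<le> M" for a
  proof -
    have "a \<in> {-M..M}" using that by auto
    then show ?thesis using K by force
  qed
  then show ?thesis using that[of "max K 1"] by auto
qed

lemma f_growth: assumes "e > 0" obtains C where "C > 0" "\<And>a. \<bar>f a\<bar> \<le> e * \<bar>a\<bar> + C * \<bar>a\<bar> powr (q - 1)"
proof -
  obtain \<eta> where \<eta>: "\<eta> > 0" "\<And>a. \<bar>a\<bar> \<le> \<eta> \<Longrightarrow> \<bar>f a\<bar> \<le> e * \<bar>a\<bar>" using f_small_ex[OF assms] by blast
  obtain M where M: "M > 0" "\<And>a. M \<le> \<bar>a\<bar> \<Longrightarrow> \<bar>f a\<bar> \<le> 1 * \<bar>a\<bar> powr (q - 1)" using f_large[of 1] by auto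
  obtain K where K: "K > 0" "\<And>a. \<bar>a\<bar> \<le> M \<Longrightarrow> \<bar>f a\<bar> \<le> K" using f_bounded by blast
  \<comment> \<open>The summand 1 serves large |a|; the other one trades the bound K on the compact
    range for a power of |a| \<ge> \<eta>.\<close>
  define C where "C = 1 + K / \<eta> powr (q - 1)"
  have \<eta>p: "\<eta> powr (q - 1) > 0" using \<eta> by simp
  have C: "C \<ge> 1" "C \<ge> K / \<eta> powr (q - 1)" using K \<eta>p by (auto simp: C_def)
  have "\<bar>f a\<bar> \<le> e * \<bar>a\<bar> + C * \<bar>a\<bar> powr (q - 1)" for a
  proof -
    consider "\<bar>a\<bar> \<le> \<eta>" | "M \<le> \<bar>a\<bar>" | "\<eta> \<le> \<bar>a\<bar>" "\<bar>a\<bar> \<le> M" by linarith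
    then show ?thesis
    proof cases
      case 1
      have "0 \<le> C * \<bar>a\<bar> powr (q - 1)" using C by simp
      then show ?thesis using \<eta>(2)[OF 1] by linarith
    next
      case 2
      have "\<bar>f a\<bar> \<le> 1 * \<bar>a\<bar> powr (q - 1)" by (rule M(2)[OF 2])
      also have "\<dots> \<le> C * \<bar>a\<bar> powr (q - 1)" using C by (intro mult_right_mono) auto
      finally show ?thesis using mult_nonneg_nonneg[of e "\<bar>a\<bar>"] assms by linarith
    next
      case 3
      have "\<bar>f a\<bar> \<le> (K / \<eta> powr (q - 1)) * \<eta> powr (q - 1)" using K(2)[OF 3(2)] \<eta>p by simp
      also have "\<dots> \<le> C * \<bar>a\<bar> powr (q - 1)" using C 3 \<eta> q2 K by (intro mult_mono powr_mono2) auto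
      finally show ?thesis using mult_nonneg_nonneg[of e "\<bar>a\<bar>"] assms by linarith
    qed
  qed
  then show ?thesis using that[of C] C by auto
qed

text \<open>Near 0 and near infinity f(a) a is absorbed by the small factor e. Whatever remains sits
  where |a| is in a compact interval away from 0, and this is how a nontrivial amount of
  \<open>mid_mass\<close> is detected.\<close>

lemma f_middle:
  assumes "e > 0"
  obtains \<eta> M C where "\<eta> > 0" "M > \<eta>" "C > 0"
    "\<And>a. \<bar>f a * a\<bar> \<le> e * (a^2 + \<bar>a\<bar> powr q) + C * (indicator {a. \<eta> \<le> \<bar>a\<bar> \<and> \<bar>a\<bar> \<le> M} a * a^2)"
proof -
  obtain \<eta> where \<eta>: "\<eta> > 0" "\<And>a. \<bar>a\<bar> \<le> \<eta> \<Longrightarrow> \<bar>f a\<bar> \<le> e * \<bar>a\<bar>" using f_small_ex[OF assms] by blast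
  obtain M0 where M0: "M0 > 0" "\<And>a. M0 \<le> \<bar>a\<bar> \<Longrightarrow> \<bar>f a\<bar> \<le> e * \<bar>a\<bar> powr (q - 1)" using f_large[OF assms] by blast
  define M where "M = max M0 (\<eta> + 1)"
  have M: "M > \<eta>" "\<And>a. M \<le> \<bar>a\<bar> \<Longrightarrow> \<bar>f a\<bar> \<le> e * \<bar>a\<bar> powr (q - 1)" using M0(2) by (auto simp: M_def)
  obtain K where K: "K > 0" "\<And>a. \<bar>a\<bar> \<le> M \<Longrightarrow> \<bar>f a\<bar> \<le> K" using f_bounded by blast
  have "\<bar>f a * a\<bar> \<le> e * (a^2 + \<bar>a\<bar> powr q) + (K / \<eta>) * (indicator {a. \<eta> \<le> \<bar>a\<bar> \<and> \<bar>a\<bar> \<le> M} a * a^2)" for a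
  proof -
    have n: "0 \<le> e * a^2" "0 \<le> e * \<bar>a\<bar> powr q" "0 \<le> (K / \<eta>) * (indicator {a. \<eta> \<le> \<bar>a\<bar> \<and> \<bar>a\<bar> \<le> M} a * a^2)"
      using assms K \<eta> by (auto simp: indicator_def)
    consider "\<bar>a\<bar> \<le> \<eta>" | "M \<le> \<bar>a\<bar>" | "\<eta> \<le> \<bar>a\<bar>" "\<bar>a\<bar> \<le> M" by linarith
    then show ?thesis
    proof cases
      case 1
      have "\<bar>f a * a\<bar> \<le> (e * \<bar>a\<bar>) * \<bar>a\<bar>" unfolding abs_mult by (intro mult_right_mono \<eta>(2) 1) auto
      also have "\<dots> = e * a^2" by (simp add: power2_eq_square)
      finally show ?thesis using n unfolding distrib_left by linarith
    next
      case 2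
      have "\<bar>f a * a\<bar> \<le> (e * \<bar>a\<bar> powr (q - 1)) * \<bar>a\<bar>" unfolding abs_mult by (intro mult_right_mono M(2) 2) auto
      also have "\<dots> = e * \<bar>a\<bar> powr q" by (cases "a = 0") (auto simp: powr_diff)
      finally show ?thesis using n unfolding distrib_left by linarith
    next
      case 3
      have "\<bar>f a * a\<bar> \<le> K * \<bar>a\<bar>" unfolding abs_mult by (intro mult_right_mono K(2) 3) auto
      also have "\<dots> = (K / \<eta>) * (\<eta> * \<bar>a\<bar>)" using \<eta> by simp
      also have "\<dots> \<le> (K / \<eta>) * (\<bar>a\<bar> * \<bar>a\<bar>)" using 3 K \<eta> by (intro mult_left_mono mult_right_mono) auto
      also have "\<dots> = (K / \<eta>) * (indicator {a. \<eta> \<le> \<bar>a\<bar> \<and> \<bar>a\<bar> \<le> M} a * a^2)" using 3 by (simp add: power2_eq_square)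
      finally show ?thesis using n unfolding distrib_left by linarith
    qed
  qed
  then show ?thesis using that[of \<eta> M "K / \<eta>"] \<eta>(1) M(1) K(1) by auto
qed

text \<open>Split at the ratio of the two arguments: if the increment is comparable to the base point the growth bound
  suffices, otherwise one uses smallness at zero and infinity, and uniform continuity in between.\<close>

lemma f_increment:
  assumes e: "e > 0"
  obtains C where "C > 0" "\<And>a b. \<bar>f (a + b) - f a\<bar> \<le> e * (\<bar>a\<bar> + \<bar>a\<bar> powr (q - 1)) + C * (\<bar>b\<bar> + \<bar>b\<bar> powr (q - 1))"
proof -
  define r where "r = q - 1"
  have r: "r > 1" using q2 by (simp add: r_def)
  define e1 where "e1 = e / 3"
  obtain \<eta> where \<eta>: "\<eta> > 0" "\<And>a. \<bar>a\<bar> \<le> \<eta> \<Longrightarrow> \<bar>f a\<bar> \<le> e1 * \<bar>a\<bar>" using f_small_ex[of e1] e by (auto simp: e1_def)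
  \<comment> \<open>Splits e so that e2 2^r + e2 = e; the factor 2^r comes from |a + b| \<le> 2
    |a|.\<close>
  define e2 where "e2 = e / (2 powr r + 1)"
  have e2: "e2 > 0" using e by (auto simp: e2_def intro!: divide_pos_pos add_pos_pos)
  obtain M where M: "M > 0" "\<And>a. M \<le> \<bar>a\<bar> \<Longrightarrow> \<bar>f a\<bar> \<le> e2 * \<bar>a\<bar> powr r" using f_large[OF e2] unfolding r_def by blast
  have "uniformly_continuous_on {- (4 * M)..4 * M} f"
    by (intro compact_uniformly_continuous continuous_on_subset[OF fc]) auto
  then obtain d where d: "d > 0" "\<And>a b. \<bar>a\<bar> \<le> 4 * M \<Longrightarrow> \<bar>b\<bar> \<le> 4 * M \<Longrightarrow> \<bar>b - a\<bar> < d \<Longrightarrow> \<bar>f b - f a\<bar> < e * (\<eta> / 2)"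
    unfolding uniformly_continuous_on_def using e \<eta>(1)
    by (metis (no_types, opaque_lifting) abs_le_iff atLeastAtMost_iff dist_real_def half_gt_zero minus_le_iff mult_pos_pos)
  \<comment> \<open>The second entry turns relative smallness of b into absolute closeness below d
    as long as |a| \<le> 2 M.\<close>
  define \<delta> where "\<delta> = min (1/2) (d / (4 * M))"
  have \<delta>: "0 < \<delta>" "\<delta> \<le> 1 / 2" "\<delta> * (2 * M) < d" using d M by (auto simp: \<delta>_def min_def field_simps)
  obtain C1 where C1: "C1 > 0" "\<And>a. \<bar>f a\<bar> \<le> 1 * \<bar>a\<bar> + C1 * \<bar>a\<bar> powr (q - 1)" using f_growth[of 1] by auto
  define C0 where "C0 = max 1 C1"
  have C0: "C0 \<ge> 1" "\<bar>f a\<bar> \<le> C0 * (\<bar>a\<bar> + \<bar>a\<bar> powr r)" for a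
  proof -
    show "C0 \<ge> 1" by (simp add: C0_def)
    have "1 * \<bar>a\<bar> + C1 * \<bar>a\<bar> powr r \<le> C0 * \<bar>a\<bar> + C0 * \<bar>a\<bar> powr r"
      by (intro add_mono mult_right_mono) (auto simp: C0_def)
    then show "\<bar>f a\<bar> \<le> C0 * (\<bar>a\<bar> + \<bar>a\<bar> powr r)" using C1(2)[of a] by (simp add: r_def distrib_left)
  qed
  define L where "L = (2 / \<delta>) powr r"
  define C where "C = 2 * C0 * max (2 / \<delta>) L"
  have C: "C > 0" using C0 \<delta> by (auto simp: C_def max_def L_def intro!: mult_pos_pos)
  have "\<bar>f (a + b) - f a\<bar> \<le> e * (\<bar>a\<bar> + \<bar>a\<bar> powr r) + C * (\<bar>b\<bar> + \<bar>b\<bar> powr r)" for a b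
  proof (cases "\<bar>b\<bar> \<ge> \<delta> * \<bar>a\<bar>")
    case True
    have bound: "\<bar>f c\<bar> \<le> C / 2 * (\<bar>b\<bar> + \<bar>b\<bar> powr r)" if c: "\<bar>c\<bar> \<le> (2 / \<delta>) * \<bar>b\<bar>" for c
    proof -
      have "\<bar>c\<bar> powr r \<le> ((2 / \<delta>) * \<bar>b\<bar>) powr r" using c r by (intro powr_mono2) auto
      also have "\<dots> = L * \<bar>b\<bar> powr r" using \<delta> by (subst powr_mult) (auto simp: L_def)
      finally have "\<bar>c\<bar> + \<bar>c\<bar> powr r \<le> (2 / \<delta>) * \<bar>b\<bar> + L * \<bar>b\<bar> powr r" using c by linarith
      also have "\<dots> \<le> max (2 / \<delta>) L * \<bar>b\<bar> + max (2 / \<delta>) L * \<bar>b\<bar> powr r" by (intro add_mono mult_right_mono) auto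
      finally have "C0 * (\<bar>c\<bar> + \<bar>c\<bar> powr r) \<le> C0 * (max (2 / \<delta>) L * (\<bar>b\<bar> + \<bar>b\<bar> powr r))"
        using C0 by (intro mult_left_mono) (auto simp: distrib_left)
      then show ?thesis using C0(2)[of c] by (simp add: C_def mult.assoc)
    qed
    have ab: "\<bar>a\<bar> \<le> (1 / \<delta>) * \<bar>b\<bar>" using True \<delta> by (simp add: field_simps)
    have "1 * \<bar>b\<bar> \<le> (1 / \<delta>) * \<bar>b\<bar>" using \<delta> by (intro mult_right_mono) auto
    moreover have "(2 / \<delta>) * \<bar>b\<bar> = (1 / \<delta>) * \<bar>b\<bar> + (1 / \<delta>) * \<bar>b\<bar>" by (simp add: field_simps)
    ultimately have "\<bar>a + b\<bar> \<le> (2 / \<delta>) * \<bar>b\<bar>" "\<bar>a\<bar> \<le> (2 / \<delta>) * \<bar>b\<bar>" using ab abs_ge_zero[of b] abs_triangle_ineq[of a b] by linarith+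
    then have "\<bar>f (a + b)\<bar> + \<bar>f a\<bar> \<le> C * (\<bar>b\<bar> + \<bar>b\<bar> powr r)"
      using bound[of "a + b"] bound[of a] by simp
    moreover have "0 \<le> e * (\<bar>a\<bar> + \<bar>a\<bar> powr r)" using e by simp
    ultimately show ?thesis by linarith
  next
    case False
    have "\<bar>b\<bar> \<le> 1 / 2 * \<bar>a\<bar>" using False \<delta> mult_right_mono[of \<delta> "1/2" "\<bar>a\<bar>"] by linarith
    then have ab: "\<bar>a + b\<bar> \<le> 2 * \<bar>a\<bar>" "\<bar>a\<bar> / 2 \<le> \<bar>a + b\<bar>" by linarith+
    have nn: "0 \<le> C * (\<bar>b\<bar> + \<bar>b\<bar> powr r)" "0 \<le> e * \<bar>a\<bar>" "0 \<le> e * \<bar>a\<bar> powr r" using C e by auto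
    consider "2 * \<bar>a\<bar> \<le> \<eta>" | "2 * M \<le> \<bar>a\<bar>" | "\<eta> \<le> 2 * \<bar>a\<bar>" "\<bar>a\<bar> \<le> 2 * M" by linarith
    then have "\<bar>f (a + b) - f a\<bar> \<le> e * \<bar>a\<bar> + e * \<bar>a\<bar> powr r"
    proof cases
      case 1
      have "\<bar>f (a + b)\<bar> \<le> e1 * \<bar>a + b\<bar>" "\<bar>f a\<bar> \<le> e1 * \<bar>a\<bar>" using 1 ab \<eta>(1) by (intro \<eta>(2); linarith)+
      moreover have "e1 * \<bar>a + b\<bar> \<le> e1 * (2 * \<bar>a\<bar>)" using ab e by (intro mult_left_mono) (auto simp: e1_def)
      moreover have "e1 * (2 * \<bar>a\<bar>) + e1 * \<bar>a\<bar> = e * \<bar>a\<bar>" by (simp add: e1_def)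
      ultimately show ?thesis using nn by linarith
    next
      case 2
      have "\<bar>f (a + b)\<bar> \<le> e2 * \<bar>a + b\<bar> powr r" "\<bar>f a\<bar> \<le> e2 * \<bar>a\<bar> powr r" using 2 M(1) ab by (intro M(2); linarith)+
      moreover have "e2 * \<bar>a + b\<bar> powr r \<le> e2 * (2 * \<bar>a\<bar>) powr r" using ab e2 r by (intro mult_left_mono powr_mono2) auto
      moreover have "(2 * \<bar>a\<bar>) powr r = 2 powr r * \<bar>a\<bar> powr r" by (simp add: powr_mult)
      moreover have "e2 * (2 powr r * \<bar>a\<bar> powr r) + e2 * \<bar>a\<bar> powr r = e2 * (2 powr r + 1) * \<bar>a\<bar> powr r" by (simp add: algebra_simps)
      moreover have "(2::real) powr r + 1 \<noteq> 0" by (smt (verit) powr_ge_zero)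
      then have "e2 * (2 powr r + 1) = e" by (simp add: e2_def)
      ultimately show ?thesis using nn abs_triangle_ineq4[of "f (a + b)" "f a"] by simp
    next
      case 3
      have "\<delta> * \<bar>a\<bar> \<le> \<delta> * (2 * M)" using 3 \<delta> by (intro mult_left_mono) auto
      then have "\<bar>b\<bar> < d" using False \<delta>(3) by linarith
      then have "\<bar>f (a + b) - f a\<bar> < e * (\<eta> / 2)" using 3 ab M(1) by (intro d(2)) auto
      also have "\<dots> \<le> e * \<bar>a\<bar>" using 3 e by (intro mult_left_mono) auto
      finally show ?thesis using nn by linarith
    qed
    then show ?thesis using nn unfolding distrib_left[of e] by linarith
  qed
  then show ?thesis using that[OF C] by (simp add: r_def)
qed

section \<open>The primitive of f and monotonicity along rays\<close>

lemma prim_derivative: "(prim f has_real_derivative f u) (at u)"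
proof -
  define R where "R = \<bar>u\<bar> + 1"
  have u: "u \<in> {-R<..<R}" by (auto simp: R_def)
  have int: "f integrable_on {a..b}" for a b by (intro integrable_continuous_real continuous_on_subset[OF fc]) auto
  \<comment> \<open>On a symmetric interval the two branches of \<open>prim\<close> are one
    indefinite integral up to a constant, so the derivative at 0 is no special case.\<close>
  have eq: "prim f x = integral {-R..x} f - integral {-R..0} f" if "x \<in> {-R<..<R}" for x
  proof (cases "0 \<le> x")
    case True
    have "integral {-R..0} f + integral {0..x} f = integral {-R..x} f"
      using True by (intro Henstock_Kurzweil_Integration.integral_combine int) (auto simp: R_def)
    then show ?thesis using True by (simp add: prim_def)
  next
    case False
    have "integral {-R..x} f + integral {x..0} f = integral {-R..0} f"
      using False that by (intro Henstock_Kurzweil_Integration.integral_combine int) auto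
    then show ?thesis using False by (simp add: prim_def)
  qed
  have "((\<lambda>x. integral {-R..x} f) has_real_derivative f u) (at u within {-R..R})"
    by (rule integral_has_real_derivative) (use u continuous_on_subset[OF fc] in auto)
  then have "((\<lambda>x. integral {-R..x} f) has_real_derivative f u) (at u)"
    using u at_within_interior[of u "{-R..R}"] by (simp add: interior_atLeastAtMost_real)
  then have "((\<lambda>x. integral {-R..x} f - integral {-R..0} f) has_real_derivative f u - 0) (at u)"
    by (intro derivative_intros)
  then have "((\<lambda>x. integral {-R..x} f - integral {-R..0} f) has_real_derivative f u) (at u)" by simp
  then show ?thesis by (rule has_field_derivative_transform_within_open[OF _ open_greaterThanLessThan u]) (simp add: eq)
qed

lemma prim_zero [simp]: "prim f 0 = 0" by (simp add: prim_def)

lemma prim_continuous: "continuous_on UNIV (prim f)"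
  using prim_derivative by (intro DERIV_continuous_on) (auto intro: has_field_derivative_at_within)

lemma prim_mult_derivative: "((\<lambda>t. prim f (t * a)) has_real_derivative f (t * a) * a) (at t)"
  by (rule DERIV_chain'[OF _ prim_derivative]) (auto intro!: derivative_eq_intros)

lemma prim_increment:
  obtains \<theta> where "0 \<le> \<theta>" "\<theta> \<le> 1" "prim f (a + b) - prim f a = f (a + \<theta> * b) * b"
proof -
  have d: "((\<lambda>t. prim f (a + t * b)) has_real_derivative f (a + t * b) * b) (at t)" for t
    by (rule DERIV_chain'[OF _ prim_derivative]) (auto intro!: derivative_eq_intros)
  obtain z where "0 < z" "z < 1" "prim f (a + 1 * b) - prim f (a + 0 * b) = (1 - 0) * (f (a + z * b) * b)"
    using MVT2[of 0 1 "\<lambda>t. prim f (a + t * b)" "\<lambda>t. f (a + t * b) * b"] d by auto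
  then show ?thesis using that[of z] by simp
qed

text \<open>Multiplying the monotone quotient by a^2 removes the sign of a: both half-lines yield
  the same inequality, in the form in which it gets integrated.\<close>

lemma f_ray_mono:
  assumes "a \<noteq> 0" "0 < s" "s < t" shows "f (s * a) * a / s < f (t * a) * a / t"
proof (cases "a > 0")
  case True
  have "f (s * a) / \<bar>s * a\<bar> < f (t * a) / \<bar>t * a\<bar>"
    by (rule strict_mono_onD[OF f_pos]) (use True assms in auto)
  then have "f (s * a) / \<bar>s * a\<bar> * a^2 < f (t * a) / \<bar>t * a\<bar> * a^2" using assms by (intro mult_strict_right_mono) auto
  then show ?thesis using True assms by (simp add: abs_mult power2_eq_square field_simps)
next
  case False
  then have a: "a < 0" using assms by simp
  have "f (t * a) / \<bar>t * a\<bar> < f (s * a) / \<bar>s * a\<bar>"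
    by (rule strict_mono_onD[OF f_neg]) (use a assms in \<open>auto simp: mult_less_0_iff\<close>)
  then have "f (t * a) / \<bar>t * a\<bar> * a^2 < f (s * a) / \<bar>s * a\<bar> * a^2" using assms by (intro mult_strict_right_mono) auto
  moreover have "f (r * a) / \<bar>r * a\<bar> * a^2 = - (f (r * a) * a / r)" if "r > 0" for r
    using a that by (simp add: abs_mult power2_eq_square field_simps)
  ultimately show ?thesis using assms by simp
qed

text \<open>By monotonicity along the ray f(a) a is at least f(s a) a / s for s < 1, and the latter
  tends to 0 with s because f(u) = o(u).\<close>

lemma f_times_nonneg: "0 \<le> f a * a"
proof (cases "a = 0")
  case False
  have t: "((\<lambda>s. f (s * a) / (s * a) * a^2) \<longlongrightarrow> 0 * a^2) (at_right 0)"
  proof (intro tendsto_intros)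
    have "filterlim (\<lambda>s. s * a) (at 0) (at_right 0)"
      unfolding filterlim_at using False by (auto intro!: tendsto_eq_intros simp: eventually_at_right_less eventually_at_filter)
    then show "((\<lambda>s. f (s * a) / (s * a)) \<longlongrightarrow> 0) (at_right 0)" by (rule filterlim_compose[OF f_small])
  qed
  have "0 * a^2 \<le> f a * a"
  proof (rule tendsto_le[OF _ tendsto_const t])
    show "\<forall>\<^sub>F s in at_right 0. f (s * a) / (s * a) * a\<^sup>2 \<le> f a * a"
      unfolding eventually_at_right_field
    proof (intro exI[of _ 1] conjI allI impI)
      fix s :: real assume s: "s > 0" "s < 1"
      have "f (s * a) * a / s < f (1 * a) * a / 1" by (rule f_ray_mono[OF False s])
      then show "f (s * a) / (s * a) * a\<^sup>2 \<le> f a * a" using False s by (simp add: power2_eq_square)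
    qed simp
  qed simp
  then show ?thesis by simp
qed simp

lemma f_times_pos: assumes "a \<noteq> 0" shows "0 < f a * a"
  using f_ray_mono[OF assms, of "1/2" 1] f_times_nonneg[of "a/2"] by simp

text \<open>The function t -> F(t a) - t^2 f(a) a / 2 decreases up to t = 1 and increases
  afterwards, by monotonicity along rays. Its integrated form says that u maximises the energy on
  its ray.\<close>

lemma prim_ray_ineq:
  assumes "t \<ge> 0" shows "prim f a + (t^2 - 1) / 2 * (f a * a) \<le> prim f (t * a)"
proof (cases "a = 0")
  case False
  define \<psi> where "\<psi> t = prim f (t * a) - t^2 / 2 * (f a * a)" for t
  have d: "(\<psi> has_real_derivative f (t * a) * a - t * (f a * a)) (at t)" for t
    unfolding \<psi>_def[abs_def] using prim_mult_derivative[of a t] by (auto intro!: derivative_eq_intros)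
  have "\<psi> 1 \<le> \<psi> t"
  proof (cases "t \<le> 1")
    case True
    show ?thesis
    proof (rule DERIV_nonpos_imp_nonincreasing[OF True])
      fix x assume x: "t \<le> x" "x \<le> 1"
      have "f (x * a) * a - x * (f a * a) \<le> 0"
      proof (cases "x = 0 \<or> x = 1")
        case True then show ?thesis by (auto simp: f_zero)
      next
        case False
        with x assms have "x > 0" "x < 1" by auto
        then show ?thesis using f_ray_mono[OF \<open>a \<noteq> 0\<close>, of x 1] by (simp add: field_simps)
      qed
      then show "\<exists>y. (\<psi> has_real_derivative y) (at x) \<and> y \<le> 0" using d by blast
    qed
  next
    case gt: False
    show ?thesis
    proof (rule DERIV_nonneg_imp_nondecreasing[where f=\<psi>])
      show "1 \<le> t" using gt by simp
      fix x assume x: "1 \<le> x" "x \<le> t"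
      have "0 \<le> f (x * a) * a - x * (f a * a)"
        using x f_ray_mono[OF \<open>a \<noteq> 0\<close>, of 1 x] by (cases "x = 1") (auto simp: field_simps)
      then show "\<exists>y. (\<psi> has_real_derivative y) (at x) \<and> 0 \<le> y" using d by blast
    qed
  qed
  then show ?thesis by (simp add: \<psi>_def field_simps)
qed simp

lemma prim_le_half: "prim f a \<le> f a * a / 2"
  using prim_ray_ineq[of 0 a] by simp

lemma prim_nonneg: "0 \<le> prim f a"
proof -
  have "prim f (0 * a) \<le> prim f (1 * a)"
  proof (rule DERIV_nonneg_imp_nondecreasing[where f="\<lambda>t. prim f (t * a)"])
    fix x :: real assume "0 \<le> x"
    have "0 \<le> f (x * a) * a"
      using f_times_nonneg[of "x * a"] \<open>0 \<le> x\<close> by (cases "x = 0") (auto simp: f_zero zero_le_mult_iff mult_le_0_iff)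
    then show "\<exists>y. ((\<lambda>t. prim f (t * a)) has_real_derivative y) (at x) \<and> 0 \<le> y" using prim_mult_derivative by blast
  qed simp
  then show ?thesis by simp
qed

lemma prim_superquadratic: obtains T where "T > 0" "\<And>s. T \<le> \<bar>s\<bar> \<Longrightarrow> A * s^2 \<le> prim f s"
proof -
  have "\<forall>\<^sub>F u in at_infinity. A \<le> prim f u / u^2" using F_super by (simp add: filterlim_at_top)
  then obtain b where b: "\<And>s. b \<le> norm s \<Longrightarrow> A \<le> prim f s / s^2" unfolding eventually_at_infinity by blast
  have "A * s^2 \<le> prim f s" if "max b 1 \<le> \<bar>s\<bar>" for s
    using b[of s] that by (cases "s = 0") (auto simp: field_simps)
  then show ?thesis using that[of "max b 1"] by auto
qed

text \<open>Compactness of the range \<eta> \<le> |a| \<le> M makes strict monotonicity along rays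
  quantitative. The case distinction only fixes the sign, so that s < 1 and s > 1 share one
  statement.\<close>

lemma f_gap:
  assumes "s > 0" "s \<noteq> 1" "0 < \<eta>" "\<eta> < M"
  obtains m where "m > 0" "\<And>a. \<eta> \<le> \<bar>a\<bar> \<Longrightarrow> \<bar>a\<bar> \<le> M \<Longrightarrow> m * a^2 \<le> (if s < 1 then f a * a - f (s * a) * a / s else f (s * a) * a / s - f a * a)"
proof -
  define k where "k a = (if s < 1 then f a * a - f (s * a) * a / s else f (s * a) * a / s - f a * a)" for a
  define S where "S = {a::real. \<eta> \<le> \<bar>a\<bar> \<and> \<bar>a\<bar> \<le> M}"
  have "S = {-M..-\<eta>} \<union> {\<eta>..M}" using assms by (auto simp: S_def abs_if split: if_splits)
  then have S: "compact S" by (simp add: compact_Un)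
  have M: "M \<in> S" using assms by (simp add: S_def)
  have "continuous_on S (\<lambda>a. f (s * a))" by (rule continuous_on_compose2[OF fc]) (auto intro!: continuous_intros)
  then have "continuous_on S k" unfolding k_def using assms(1)
    by (cases "s < 1") (auto intro!: continuous_intros continuous_on_subset[OF fc])
  then obtain a0 where a0: "a0 \<in> S" "\<And>a. a \<in> S \<Longrightarrow> k a0 \<le> k a"
    using continuous_attains_inf[OF S] M by (metis empty_iff)
  have "a0 \<noteq> 0" using a0(1) assms by (auto simp: S_def)
  have pos: "k a0 > 0"
    using f_ray_mono[OF \<open>a0 \<noteq> 0\<close>, of s 1] f_ray_mono[OF \<open>a0 \<noteq> 0\<close>, of 1 s] assms(1,2) by (auto simp: k_def)
  have "k a0 / M^2 * a^2 \<le> k a" if "a \<in> S" for a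
  proof -
    have "a^2 \<le> M^2" using that by (intro abs_le_square_iff[THEN iffD1]) (auto simp: S_def)
    then have "k a0 / M^2 * a^2 \<le> k a0 / M^2 * M^2" using pos by (intro mult_left_mono) auto
    also have "\<dots> = k a0" using assms by simp
    finally show ?thesis using a0(2)[OF that] by linarith
  qed
  then show ?thesis using that[of "k a0 / M^2"] pos assms by (auto simp: S_def k_def)
qed

end

section \<open>The energy functional\<close>

locale variational = potential V V0 + nonlinearity f q
  for V :: "'y::euclidean_space \<times> 'z::euclidean_space \<Rightarrow> real" and V0 f q +
  assumes dim3: "3 \<le> DIM('y) + DIM('z)"
    and q_sub: "q < 2 * real (DIM('y) + DIM('z)) / (real (DIM('y) + DIM('z)) - 2)"
begin

lemma X1_measurable: "X1 V u \<Longrightarrow> u \<in> borel_measurable lebesgue"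
  using X1_L2 by (auto simp: L2_def)

lemma f_measurable [measurable]: "f \<in> borel_measurable borel"
  by (rule borel_measurable_continuous_onI[OF fc])

lemma prim_measurable [measurable]: "prim f \<in> borel_measurable borel"
  by (rule borel_measurable_continuous_onI[OF prim_continuous])

lemma Sobolev_X1:
  obtains C where "C > 0" "\<And>u. X1 V u \<Longrightarrow> integrable lebesgue (\<lambda>x. \<bar>u x\<bar> powr q)"
    "\<And>u. X1 V u \<Longrightarrow> (LINT x|lebesgue. \<bar>u x\<bar> powr q) \<le> C * nrm u powr q"
proof -
  have d: "DIM('y \<times> 'z) \<ge> 3" "q < 2 * real DIM('y \<times> 'z) / (real DIM('y \<times> 'z) - 2)" using dim3 q_sub by auto
  obtain C where C: "C > 0" "\<And>(u::'y \<times> 'z \<Rightarrow> real) S. H1 u \<Longrightarrow> n2 u + n2 (grad u) \<le> S^2 \<Longrightarrow> S \<ge> 0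
    \<Longrightarrow> integrable lebesgue (\<lambda>x. \<bar>u x\<bar> powr q) \<and> (LINT x|lebesgue. \<bar>u x\<bar> powr q) \<le> C * S powr q"
    by (rule Sobolev_subcritical[OF d(1) q2 d(2)]) (rule that)
  define k where "k = sqrt (1 + 1 / V0)"
  have k: "k > 0" "k^2 = 1 + 1 / V0" using V0 by (auto simp: k_def add_pos_pos)
  have *: "integrable lebesgue (\<lambda>x. \<bar>u x\<bar> powr q) \<and> (LINT x|lebesgue. \<bar>u x\<bar> powr q) \<le> C * (k * nrm u) powr q" if u: "X1 V u" for u
  proof (rule C(2)[OF X1_H1[OF u]])
    have "n2 u \<le> norm1sq V u / V0" using n2_le_norm1sq[OF u] V0 by (simp add: field_simps)
    then show "n2 u + n2 (grad u) \<le> (k * nrm u)\<^sup>2"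
      using n2_grad_le_norm1sq[OF u] by (simp add: power_mult_distrib k nrm_sq algebra_simps)
  qed (use k in auto)
  show ?thesis
  proof (rule that[of "C * k powr q"])
    show "0 < C * k powr q" using C k by simp
    show "integrable lebesgue (\<lambda>x. \<bar>u x\<bar> powr q)" if "X1 V u" for u using *[OF that] by simp
    show "(LINT x|lebesgue. \<bar>u x\<bar> powr q) \<le> C * k powr q * nrm u powr q" if "X1 V u" for u
      using *[OF that] k by (simp add: powr_mult mult.assoc)
  qed
qed

lemma powr_q_integrable: "X1 V u \<Longrightarrow> integrable lebesgue (\<lambda>x. \<bar>u x\<bar> powr q)"
  by (rule Sobolev_X1)

lemma square_integrable: "X1 V u \<Longrightarrow> integrable lebesgue (\<lambda>x. (u x)^2)"
  using X1_L2 by (auto simp: L2_def)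

lemma square_integral_le: assumes "X1 V u" shows "(LINT x|lebesgue. (u x)^2) \<le> (nrm u)^2 / V0"
  using n2_le_norm1sq[OF assms] V0 by (simp add: n2_def nrm_sq field_simps)

text \<open>The growth profile of f: linear near 0, of power q - 1 at infinity.\<close>

definition gr :: "real \<Rightarrow> real" where "gr a = \<bar>a\<bar> + \<bar>a\<bar> powr (q - 1)"

lemma gr_nonneg [simp]: "0 \<le> gr a" by (simp add: gr_def)

lemma gr_measurable [measurable]: "gr \<in> borel_measurable borel"
  unfolding gr_def[abs_def] by measurable

lemma gr_times_le: "gr a * \<bar>b\<bar> \<le> (a^2 + \<bar>a\<bar> powr q) + (b^2 + \<bar>b\<bar> powr q)"
proof -
  have "\<bar>a\<bar> * \<bar>b\<bar> \<le> a^2 + b^2" using sum_squares_bound[of "\<bar>a\<bar>" "\<bar>b\<bar>"] mult_nonneg_nonneg[OF abs_ge_zero abs_ge_zero, of a b]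
    unfolding power2_abs by linarith
  then show ?thesis using powr_times_le[of "\<bar>a\<bar>" "\<bar>b\<bar>" q] q2 by (simp add: gr_def distrib_right)
qed

lemma gr_integrable:
  assumes "X1 V u" "X1 V h" shows "integrable lebesgue (\<lambda>x. gr (u x) * \<bar>h x\<bar>)"
proof (rule Bochner_Integration.integrable_bound)
  show "integrable lebesgue (\<lambda>x. ((u x)^2 + \<bar>u x\<bar> powr q) + ((h x)^2 + \<bar>h x\<bar> powr q))"
    by (intro Bochner_Integration.integrable_add square_integrable powr_q_integrable assms)
  note [measurable] = X1_measurable[OF assms(1)] X1_measurable[OF assms(2)]
  show "(\<lambda>x. gr (u x) * \<bar>h x\<bar>) \<in> borel_measurable lebesgue" by measurable
  show "AE x in lebesgue. norm (gr (u x) * \<bar>h x\<bar>) \<le> norm (((u x)^2 + \<bar>u x\<bar> powr q) + ((h x)^2 + \<bar>h x\<bar> powr q))"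
    using gr_times_le by (intro AE_I2) (simp add: abs_mult)
qed

text \<open>A constant bound for \<open>nrm h \<le> 1\<close> comes first; homogeneity in h supplies
  the factor \<open>nrm h\<close>, and an h of norm zero vanishes a.e.\<close>

lemma gr_bound:
  assumes R: "R > 0"
  obtains K where "K > 0" "\<And>u h. X1 V u \<Longrightarrow> X1 V h \<Longrightarrow> nrm u \<le> R \<Longrightarrow> (LINT x|lebesgue. gr (u x) * \<bar>h x\<bar>) \<le> K * nrm h"
proof -
  obtain C where "C > 0" "\<And>u. X1 V u \<Longrightarrow> integrable lebesgue (\<lambda>x. \<bar>u x\<bar> powr q)"
    "\<And>u. X1 V u \<Longrightarrow> (LINT x|lebesgue. \<bar>u x\<bar> powr q) \<le> C * nrm u powr q" by (rule Sobolev_X1) (rule that)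
  note C = this(1,3)
  define K where "K = (R^2 / V0 + C * R powr q) + (1 / V0 + C)"
  have K: "K > 0" using R V0 C by (auto simp: K_def intro!: add_pos_pos)
  have one: "(LINT x|lebesgue. gr (u x) * \<bar>h x\<bar>) \<le> K" if u: "X1 V u" and h: "X1 V h" and uR: "nrm u \<le> R" and h1: "nrm h \<le> 1" for u h
  proof -
    have b: "(LINT x|lebesgue. (v x)^2 + \<bar>v x\<bar> powr q) \<le> S^2 / V0 + C * S powr q" if v: "X1 V v" and S: "nrm v \<le> S" for v S
    proof -
      have "(LINT x|lebesgue. (v x)^2 + \<bar>v x\<bar> powr q) = (LINT x|lebesgue. (v x)^2) + (LINT x|lebesgue. \<bar>v x\<bar> powr q)"
        by (intro Bochner_Integration.integral_add square_integrable powr_q_integrable v)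
      also have "\<dots> \<le> (nrm v)^2 / V0 + C * nrm v powr q" by (intro add_mono square_integral_le C(2) v)
      also have "\<dots> \<le> S^2 / V0 + C * S powr q"
        using S V0 C(1) q2 by (intro add_mono divide_right_mono power_mono mult_left_mono powr_mono2) auto
      finally show ?thesis .
    qed
    have i: "integrable lebesgue (\<lambda>x. (v x)^2 + \<bar>v x\<bar> powr q)" if "X1 V v" for v
      by (intro Bochner_Integration.integrable_add square_integrable powr_q_integrable that)
    have "(LINT x|lebesgue. gr (u x) * \<bar>h x\<bar>) \<le> (LINT x|lebesgue. ((u x)^2 + \<bar>u x\<bar> powr q) + ((h x)^2 + \<bar>h x\<bar> powr q))"
      by (intro integral_mono gr_integrable u h Bochner_Integration.integrable_add[OF i i] gr_times_le)
    also have "\<dots> = (LINT x|lebesgue. (u x)^2 + \<bar>u x\<bar> powr q) + (LINT x|lebesgue. (h x)^2 + \<bar>h x\<bar> powr q)"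
      by (rule Bochner_Integration.integral_add[OF i[OF u] i[OF h]])
    also have "\<dots> \<le> K" unfolding K_def using b[OF u uR] b[OF h h1] by simp
    finally show ?thesis .
  qed
  show ?thesis
  proof (rule that[OF K])
    fix u h assume u: "X1 V u" and h: "X1 V h" and uR: "nrm u \<le> R"
    show "(LINT x|lebesgue. gr (u x) * \<bar>h x\<bar>) \<le> K * nrm h"
    proof (cases "nrm h = 0")
      case True
      then have "norm1sq V h = 0" using nrm_sq[of h] by simp
      then have "AE x in lebesgue. h x = 0" by (rule nrm_eq_0[OF h])
      then have "(LINT x|lebesgue. gr (u x) * \<bar>h x\<bar>) = 0" by (intro integral_eq_zero_AE) auto
      then show ?thesis using True by simp
    next
      case False
      then have p: "nrm h > 0" using nrm_nonneg[of h] by linarith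
      have "nrm (\<lambda>x. (1 / nrm h) * h x) = \<bar>1 / nrm h\<bar> * nrm h" by (rule nrm_cmult[OF h])
      also have "\<dots> = 1" using p by simp
      finally have "(LINT x|lebesgue. gr (u x) * \<bar>(1 / nrm h) * h x\<bar>) \<le> K"
        by (intro one[OF u X1_cmult[OF h] uR]) simp
      moreover have "(\<lambda>x. gr (u x) * \<bar>(1 / nrm h) * h x\<bar>) = (\<lambda>x. (1 / nrm h) * (gr (u x) * \<bar>h x\<bar>))"
        using p by (auto simp: abs_mult)
      ultimately have "(1 / nrm h) * (LINT x|lebesgue. gr (u x) * \<bar>h x\<bar>) \<le> K" by simp
      then show ?thesis using p by (simp add: field_simps)
    qed
  qed
qed

lemma gr_scale_le: assumes "0 < d" "d \<le> 1" shows "gr (d * a) \<le> d * gr a"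
proof -
  have "d powr (q - 1) \<le> d powr 1" using assms q2 by (intro powr_mono') auto
  then have "d powr (q - 1) * \<bar>a\<bar> powr (q - 1) \<le> d * \<bar>a\<bar> powr (q - 1)" using assms by (intro mult_right_mono) auto
  then show ?thesis using assms by (simp add: gr_def abs_mult powr_mult distrib_left)
qed

text \<open>The integrated form of \<open>f_increment\<close>: the term with \<open>gr (u x)\<close>
  is small by its factor, the one with \<open>gr (w x)\<close> by the smallness of w. Increments of
  f and of its primitive are both estimated from this bound.\<close>

lemma increment_core:
  assumes R: "R > 0" and e: "e > 0"
  obtains e' C d where "e' > 0" "C > 0" "d > 0" "\<And>a b. \<bar>f (a + b) - f a\<bar> \<le> e' * gr a + C * gr b"
    "\<And>u w h. X1 V u \<Longrightarrow> X1 V w \<Longrightarrow> X1 V h \<Longrightarrow> nrm u \<le> R \<Longrightarrow> nrm w \<le> d \<Longrightarrow>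
      (LINT x|lebesgue. (e' * gr (u x) + C * gr (w x)) * \<bar>h x\<bar>) \<le> e * nrm h"
proof -
  obtain K where K: "K > 0" "\<And>u h. X1 V u \<Longrightarrow> X1 V h \<Longrightarrow> nrm u \<le> R \<Longrightarrow> (LINT x|lebesgue. gr (u x) * \<bar>h x\<bar>) \<le> K * nrm h"
    by (rule gr_bound[OF R]) (rule that)
  obtain K1 where K1: "K1 > 0" "\<And>u h. X1 V u \<Longrightarrow> X1 V h \<Longrightarrow> nrm u \<le> 1 \<Longrightarrow> (LINT x|lebesgue. gr (u x) * \<bar>h x\<bar>) \<le> K1 * nrm h"
    by (rule gr_bound[OF zero_less_one]) (rule that)
  define e' where "e' = e / (2 * K)"
  have e': "e' > 0" using e K by (simp add: e'_def)
  obtain C where C: "C > 0" "\<And>a b. \<bar>f (a + b) - f a\<bar> \<le> e' * gr a + C * gr b"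
    using f_increment[OF e'] unfolding gr_def by blast
  define d where "d = min 1 (e / (2 * C * K1))"
  have d: "d > 0" "d \<le> 1" "d * (C * K1) \<le> e / 2" using e C K1 by (auto simp: d_def min_def field_simps)
  show ?thesis
  proof (rule that[OF e' C(1) d(1) C(2)])
    fix u w h assume u: "X1 V u" and w: "X1 V w" and h: "X1 V h" and n: "nrm u \<le> R" "nrm w \<le> d"
    \<comment> \<open>Rescaling w to norm at most 1 extracts a factor d, since
      \<open>gr (d * a)\<close> is at most \<open>d * gr a\<close>.\<close>
    define w1 where "w1 x = (1 / d) * w x" for x
    have w1: "X1 V w1" unfolding w1_def[abs_def] by (rule X1_cmult[OF w])
    have "nrm w1 = \<bar>1 / d\<bar> * nrm w" unfolding w1_def[abs_def] by (rule nrm_cmult[OF w])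
    then have "nrm w1 = nrm w / d" using d(1) by simp
    then have nw1: "nrm w1 \<le> 1" using n(2) d(1) by (simp add: divide_le_eq)
    have "(LINT x|lebesgue. gr (w x) * \<bar>h x\<bar>) \<le> (LINT x|lebesgue. d * (gr (w1 x) * \<bar>h x\<bar>))"
    proof (intro integral_mono gr_integrable w h integrable_mult_right w1)
      fix x
      have "gr (w x) = gr (d * w1 x)" using d by (simp add: w1_def)
      also have "\<dots> \<le> d * gr (w1 x)" by (rule gr_scale_le[OF d(1,2)])
      finally show "gr (w x) * \<bar>h x\<bar> \<le> d * (gr (w1 x) * \<bar>h x\<bar>)" by (simp add: mult_right_mono mult.assoc[symmetric])
    qed
    also have "\<dots> \<le> d * (K1 * nrm h)" using K1(2)[OF w1 h nw1] d by simp
    finally have bw: "(LINT x|lebesgue. gr (w x) * \<bar>h x\<bar>) \<le> d * (K1 * nrm h)" .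
    have "(LINT x|lebesgue. (e' * gr (u x) + C * gr (w x)) * \<bar>h x\<bar>) = e' * (LINT x|lebesgue. gr (u x) * \<bar>h x\<bar>) + C * (LINT x|lebesgue. gr (w x) * \<bar>h x\<bar>)"
      using gr_integrable[OF u h] gr_integrable[OF w h] by (simp add: distrib_right mult.assoc)
    also have "\<dots> \<le> e' * (K * nrm h) + C * (d * (K1 * nrm h))"
      using e' C(1) K(2)[OF u h n(1)] bw by (intro add_mono mult_left_mono) auto
    also have "\<dots> = (e' * K + d * (C * K1)) * nrm h" by (simp add: algebra_simps)
    also have "\<dots> \<le> e * nrm h" using d(3) K(1) by (intro mult_right_mono) (auto simp: e'_def)
    finally show "(LINT x|lebesgue. (e' * gr (u x) + C * gr (w x)) * \<bar>h x\<bar>) \<le> e * nrm h" .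
  qed
qed

lemma f_dominated: obtains C where "C > 0" "\<And>a. \<bar>f a\<bar> \<le> C * gr a"
proof -
  obtain C1 where C1: "C1 > 0" "\<And>a. \<bar>f a\<bar> \<le> 1 * \<bar>a\<bar> + C1 * \<bar>a\<bar> powr (q - 1)" using f_growth[of 1] by auto
  have "\<bar>f a\<bar> \<le> max 1 C1 * gr a" for a
  proof -
    have "1 * \<bar>a\<bar> + C1 * \<bar>a\<bar> powr (q - 1) \<le> max 1 C1 * \<bar>a\<bar> + max 1 C1 * \<bar>a\<bar> powr (q - 1)"
      by (intro add_mono mult_right_mono) auto
    then show ?thesis using C1(2)[of a] by (simp add: gr_def distrib_left)
  qed
  then show ?thesis using that[of "max 1 C1"] by auto
qed

lemma f_integrable: assumes "X1 V u" "X1 V h" shows "integrable lebesgue (\<lambda>x. f (u x) * h x)"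
proof -
  obtain C where C: "C > 0" "\<And>a. \<bar>f a\<bar> \<le> C * gr a" by (rule f_dominated) (rule that)
  note [measurable] = X1_measurable[OF assms(1)] X1_measurable[OF assms(2)]
  show ?thesis
  proof (rule Bochner_Integration.integrable_bound[OF integrable_mult_right[OF gr_integrable[OF assms], of C]])
    show "(\<lambda>x. f (u x) * h x) \<in> borel_measurable lebesgue" by measurable
    show "AE x in lebesgue. norm (f (u x) * h x) \<le> norm (C * (gr (u x) * \<bar>h x\<bar>))"
    proof (rule AE_I2)
      fix x
      have "\<bar>f (u x)\<bar> * \<bar>h x\<bar> \<le> (C * gr (u x)) * \<bar>h x\<bar>" by (intro mult_right_mono C(2)) auto
      then show "norm (f (u x) * h x) \<le> norm (C * (gr (u x) * \<bar>h x\<bar>))" using C(1) by (simp add: abs_mult mult.assoc)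
    qed
  qed
qed

lemma f_integral_bound:
  assumes "R > 0"
  obtains K where "K > 0" "\<And>u h. X1 V u \<Longrightarrow> X1 V h \<Longrightarrow> nrm u \<le> R \<Longrightarrow> \<bar>LINT x|lebesgue. f (u x) * h x\<bar> \<le> K * nrm h"
proof -
  obtain C where C: "C > 0" "\<And>a. \<bar>f a\<bar> \<le> C * gr a" by (rule f_dominated) (rule that)
  obtain K where K: "K > 0" "\<And>u h. X1 V u \<Longrightarrow> X1 V h \<Longrightarrow> nrm u \<le> R \<Longrightarrow> (LINT x|lebesgue. gr (u x) * \<bar>h x\<bar>) \<le> K * nrm h"
    by (rule gr_bound[OF assms]) (rule that)
  show ?thesis
  proof (rule that[of "C * K"])
    fix u h assume u: "X1 V u" and h: "X1 V h" and n: "nrm u \<le> R"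
    have "\<bar>LINT x|lebesgue. f (u x) * h x\<bar> \<le> (LINT x|lebesgue. \<bar>f (u x) * h x\<bar>)" by (rule integral_abs_bound)
    also have "\<dots> \<le> (LINT x|lebesgue. C * (gr (u x) * \<bar>h x\<bar>))"
    proof (intro integral_mono integrable_abs f_integrable integrable_mult_right gr_integrable u h)
      fix x
      have "\<bar>f (u x)\<bar> * \<bar>h x\<bar> \<le> (C * gr (u x)) * \<bar>h x\<bar>" by (intro mult_right_mono C(2)) auto
      then show "\<bar>f (u x) * h x\<bar> \<le> C * (gr (u x) * \<bar>h x\<bar>)" by (simp add: abs_mult mult.assoc)
    qed
    also have "\<dots> \<le> C * (K * nrm h)" using K(2)[OF u h n] C(1) by simp
    finally show "\<bar>LINT x|lebesgue. f (u x) * h x\<bar> \<le> C * K * nrm h" by (simp add: mult.assoc)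
  qed (use C K in simp)
qed

lemma prim_integrable: assumes "X1 V u" shows "integrable lebesgue (\<lambda>x. prim f (u x))"
proof (rule Bochner_Integration.integrable_bound[OF f_integrable[OF assms assms]])
  note [measurable] = X1_measurable[OF assms]
  show "(\<lambda>x. prim f (u x)) \<in> borel_measurable lebesgue" by measurable
  show "AE x in lebesgue. norm (prim f (u x)) \<le> norm (f (u x) * u x)"
  proof (rule AE_I2)
    fix x show "norm (prim f (u x)) \<le> norm (f (u x) * u x)"
      using prim_le_half[of "u x"] prim_nonneg[of "u x"] f_times_nonneg[of "u x"] by simp
  qed
qed

lemma f_uniform_continuity:
  assumes "R > 0" "e > 0"
  obtains d where "d > 0" "\<And>u w h. X1 V u \<Longrightarrow> X1 V w \<Longrightarrow> X1 V h \<Longrightarrow> nrm u \<le> R \<Longrightarrow> nrm w \<le> d \<Longrightarrow>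
      \<bar>(LINT x|lebesgue. f (u x + w x) * h x) - (LINT x|lebesgue. f (u x) * h x)\<bar> \<le> e * nrm h"
    and "\<And>u w. X1 V u \<Longrightarrow> X1 V w \<Longrightarrow> nrm u \<le> R \<Longrightarrow> nrm w \<le> d \<Longrightarrow>
      \<bar>(LINT x|lebesgue. prim f (u x + w x)) - (LINT x|lebesgue. prim f (u x)) - (LINT x|lebesgue. f (u x) * w x)\<bar> \<le> e * nrm w"
proof -
  obtain e' C d where e': "e' > 0" and C: "C > 0" and d: "d > 0" and key: "\<And>a b. \<bar>f (a + b) - f a\<bar> \<le> e' * gr a + C * gr b"
    and int: "\<And>u w h. X1 V u \<Longrightarrow> X1 V w \<Longrightarrow> X1 V h \<Longrightarrow> nrm u \<le> R \<Longrightarrow> nrm w \<le> d \<Longrightarrow>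
      (LINT x|lebesgue. (e' * gr (u x) + C * gr (w x)) * \<bar>h x\<bar>) \<le> e * nrm h"
    by (rule increment_core[OF assms]) (rule that)
  have i: "integrable lebesgue (\<lambda>x. (e' * gr (u x) + C * gr (w x)) * \<bar>h x\<bar>)" if "X1 V u" "X1 V w" "X1 V h" for u w h
    using gr_integrable[OF that(1,3)] gr_integrable[OF that(2,3)] by (simp add: distrib_right mult.assoc)
  show ?thesis
  proof (rule that[OF d])
    fix u w h assume u: "X1 V u" and w: "X1 V w" and h: "X1 V h" and n: "nrm u \<le> R" "nrm w \<le> d"
    note uw = X1_add[OF u w]
    have eq: "(LINT x|lebesgue. f (u x + w x) * h x) - (LINT x|lebesgue. f (u x) * h x) = (LINT x|lebesgue. f (u x + w x) * h x - f (u x) * h x)"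
      by (rule Bochner_Integration.integral_diff[symmetric, OF f_integrable[OF uw h] f_integrable[OF u h]])
    have "\<bar>LINT x|lebesgue. f (u x + w x) * h x - f (u x) * h x\<bar> \<le> (LINT x|lebesgue. \<bar>f (u x + w x) * h x - f (u x) * h x\<bar>)" by (rule integral_abs_bound)
    also have "\<dots> \<le> (LINT x|lebesgue. (e' * gr (u x) + C * gr (w x)) * \<bar>h x\<bar>)"
    proof (intro integral_mono integrable_abs Bochner_Integration.integrable_diff f_integrable[OF uw h] f_integrable u h i w)
      fix x
      have "\<bar>f (u x + w x) - f (u x)\<bar> * \<bar>h x\<bar> \<le> (e' * gr (u x) + C * gr (w x)) * \<bar>h x\<bar>" by (intro mult_right_mono key) auto
      then show "\<bar>f (u x + w x) * h x - f (u x) * h x\<bar> \<le> (e' * gr (u x) + C * gr (w x)) * \<bar>h x\<bar>"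
        by (simp add: abs_mult left_diff_distrib[symmetric])
    qed
    also have "\<dots> \<le> e * nrm h" by (rule int[OF u w h n])
    finally show "\<bar>(LINT x|lebesgue. f (u x + w x) * h x) - (LINT x|lebesgue. f (u x) * h x)\<bar> \<le> e * nrm h" unfolding eq .
  next
    fix u w assume u: "X1 V u" and w: "X1 V w" and n: "nrm u \<le> R" "nrm w \<le> d"
    note uw = X1_add[OF u w]
    have eq: "(LINT x|lebesgue. prim f (u x + w x)) - (LINT x|lebesgue. prim f (u x)) - (LINT x|lebesgue. f (u x) * w x)
        = (LINT x|lebesgue. prim f (u x + w x) - prim f (u x) - f (u x) * w x)"
      using prim_integrable[OF uw] prim_integrable[OF u] f_integrable[OF u w] by simp
    have "\<bar>LINT x|lebesgue. prim f (u x + w x) - prim f (u x) - f (u x) * w x\<bar> \<le> (LINT x|lebesgue. \<bar>prim f (u x + w x) - prim f (u x) - f (u x) * w x\<bar>)" by (rule integral_abs_bound)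
    also have "\<dots> \<le> (LINT x|lebesgue. (e' * gr (u x) + C * gr (w x)) * \<bar>w x\<bar>)"
    proof (intro integral_mono integrable_abs Bochner_Integration.integrable_diff prim_integrable[OF uw] prim_integrable f_integrable u i w)
      fix x
      \<comment> \<open>By the mean value theorem the remainder is an increment of f at an
        intermediate point, and \<open>gr\<close> only decreases when w x is shortened to \<theta> w
        x.\<close>
      obtain \<theta> where \<theta>: "0 \<le> \<theta>" "\<theta> \<le> 1" "prim f (u x + w x) - prim f (u x) = f (u x + \<theta> * w x) * w x"
        using prim_increment by blast
      have tw: "\<bar>\<theta> * w x\<bar> \<le> \<bar>w x\<bar>" using \<theta>(1,2) mult_right_mono[of \<theta> 1 "\<bar>w x\<bar>"] by (simp add: abs_mult)
      then have "\<bar>\<theta> * w x\<bar> powr (q - 1) \<le> \<bar>w x\<bar> powr (q - 1)" using q2 by (intro powr_mono2) auto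
      then have "gr (\<theta> * w x) \<le> gr (w x)" using tw by (simp add: gr_def)
      then have "C * gr (\<theta> * w x) \<le> C * gr (w x)" using C by simp
      then have "\<bar>f (u x + \<theta> * w x) - f (u x)\<bar> * \<bar>w x\<bar> \<le> (e' * gr (u x) + C * gr (w x)) * \<bar>w x\<bar>"
        using key[of "u x" "\<theta> * w x"] by (intro mult_right_mono) auto
      then show "\<bar>prim f (u x + w x) - prim f (u x) - f (u x) * w x\<bar> \<le> (e' * gr (u x) + C * gr (w x)) * \<bar>w x\<bar>"
        unfolding \<theta>(3) by (simp add: abs_mult left_diff_distrib[symmetric])
    qed
    also have "\<dots> \<le> e * nrm w" by (rule int[OF u w w n])
    finally show "\<bar>(LINT x|lebesgue. prim f (u x + w x)) - (LINT x|lebesgue. prim f (u x)) - (LINT x|lebesgue. f (u x) * w x)\<bar> \<le> e * nrm w" unfolding eq .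
  qed
qed

definition dJ :: "('y \<times> 'z \<Rightarrow> real) \<Rightarrow> ('y \<times> 'z \<Rightarrow> real) \<Rightarrow> real" where
  "dJ u h = E u h - (LINT x|lebesgue. f (u x) * h x)"

text \<open>Frechet differentiability uniformly on bounded sets: the descent argument uses it at all
  multiples s u near u and for all near-minimisers u at once.\<close>

lemma J_expansion:
  assumes "R > 0" "e > 0"
  obtains d where "d > 0" "\<And>u w. X1 V u \<Longrightarrow> X1 V w \<Longrightarrow> nrm u \<le> R \<Longrightarrow> nrm w \<le> d \<Longrightarrow>
      \<bar>J1 V f (\<lambda>x. u x + w x) - J1 V f u - dJ u w\<bar> \<le> e * nrm w"
proof -
  have e2: "e / 2 > 0" using assms by simp
  obtain d where d: "d > 0" and ex: "\<And>u w. X1 V u \<Longrightarrow> X1 V w \<Longrightarrow> nrm u \<le> R \<Longrightarrow> nrm w \<le> d \<Longrightarrow>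
      \<bar>(LINT x|lebesgue. prim f (u x + w x)) - (LINT x|lebesgue. prim f (u x)) - (LINT x|lebesgue. f (u x) * w x)\<bar> \<le> e / 2 * nrm w"
    by (rule f_uniform_continuity[OF assms(1) e2]) (rule that)
  show ?thesis
  \<comment> \<open>\<open>nrm w \<le> e\<close> makes the quadratic remainder at most (e/2) nrm
    w.\<close>
  proof (rule that[of "min d e"])
    fix u w assume u: "X1 V u" and w: "X1 V w" and n: "nrm u \<le> R" "nrm w \<le> min d e"
    have "nrm w * nrm w \<le> e * nrm w" using n by (intro mult_right_mono) auto
    then have "norm1sq V w / 2 \<le> e / 2 * nrm w" using nrm_sq[of w] by (simp add: power2_eq_square)
    moreover have "J1 V f (\<lambda>x. u x + w x) - J1 V f u - dJ u w = norm1sq V w / 2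
        - ((LINT x|lebesgue. prim f (u x + w x)) - (LINT x|lebesgue. prim f (u x)) - (LINT x|lebesgue. f (u x) * w x))"
      unfolding J1_def dJ_def norm1sq_add[OF u w] add_divide_distrib by simp
    moreover have "\<bar>(LINT x|lebesgue. prim f (u x + w x)) - (LINT x|lebesgue. prim f (u x)) - (LINT x|lebesgue. f (u x) * w x)\<bar> \<le> e / 2 * nrm w"
      using n by (intro ex u w) auto
    ultimately show "\<bar>J1 V f (\<lambda>x. u x + w x) - J1 V f u - dJ u w\<bar> \<le> e * nrm w"
      using norm1sq_nonneg[of w] by linarith
  qed (use d assms in auto)
qed

lemma critical_if_dJ_zero:
  assumes u: "X1 V u" and z: "\<And>h. X1 V h \<Longrightarrow> dJ u h = 0" shows "J1_critical V f u"
  unfolding J1_critical_def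
proof (intro allI impI)
  fix e :: real assume e: "e > 0"
  have R: "nrm u + 1 > 0" using nrm_nonneg[of u] by linarith
  obtain d where d: "d > 0" and ex: "\<And>v w. X1 V v \<Longrightarrow> X1 V w \<Longrightarrow> nrm v \<le> nrm u + 1 \<Longrightarrow> nrm w \<le> d \<Longrightarrow>
      \<bar>J1 V f (\<lambda>x. v x + w x) - J1 V f v - dJ v w\<bar> \<le> e * nrm w"
    by (rule J_expansion[OF R e]) (rule that)
  show "\<exists>\<delta>>0. \<forall>h. X1 V h \<and> sqrt (norm1sq V h) < \<delta> \<longrightarrow> \<bar>J1 V f (\<lambda>x. u x + h x) - J1 V f u\<bar> \<le> e * sqrt (norm1sq V h)"
    using ex[OF u] z d by (intro exI[of _ d]) (auto simp: nrm_def)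
qed

end

section \<open>The Nehari manifold\<close>

context variational
begin

definition Nf :: "('y \<times> 'z \<Rightarrow> real) \<Rightarrow> real" where
  "Nf u = norm1sq V u - (LINT x|lebesgue. f (u x) * u x)"

text \<open>The mass where |u| is neither small nor large. Strict monotonicity and superquadratic
  growth are uniform only there, and the quantity does not depend on where in space the mass is
  located.\<close>

definition mid_mass :: "real \<Rightarrow> real \<Rightarrow> ('y \<times> 'z \<Rightarrow> real) \<Rightarrow> real" where
  "mid_mass \<eta> M u = (LINT x|lebesgue. indicator {a. \<eta> \<le> \<bar>a\<bar> \<and> \<bar>a\<bar> \<le> M} (u x) * (u x)^2)"

lemma mid_mass_integrable:
  assumes "X1 V u" shows "integrable lebesgue (\<lambda>x. indicator {a. \<eta> \<le> \<bar>a\<bar> \<and> \<bar>a\<bar> \<le> M} (u x) * (u x)^2)"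
proof (rule Bochner_Integration.integrable_bound[OF square_integrable[OF assms]])
  note [measurable] = X1_measurable[OF assms]
  show "(\<lambda>x. indicator {a. \<eta> \<le> \<bar>a\<bar> \<and> \<bar>a\<bar> \<le> M} (u x) * (u x)^2) \<in> borel_measurable lebesgue" by measurable
qed (auto simp: indicator_def)

lemma dJ_self: "dJ u u = Nf u"
  by (simp add: dJ_def Nf_def E_self)

lemma X1G_X1: "X1G V u \<Longrightarrow> X1 V u" by (simp add: X1G_def)

lemma X1G_add: "X1G V u \<Longrightarrow> X1G V h \<Longrightarrow> X1G V (\<lambda>x. u x + h x)"
  by (auto simp: X1G_def X1_add G_invariant_def)

lemma X1G_cmult: "X1G V u \<Longrightarrow> X1G V (\<lambda>x. c * u x)"
  by (auto simp: X1G_def X1_cmult G_invariant_def)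

lemma Nehari_iff: "u \<in> Nehari1 V f \<longleftrightarrow> X1G V u \<and> \<not> (AE x in lebesgue. u x = 0) \<and> Nf u = 0"
  by (auto simp: Nehari1_def Nf_def)

lemma not_AE_zero_iff: "X1 V u \<Longrightarrow> \<not> (AE x in lebesgue. u x = 0) \<longleftrightarrow> nrm u > 0"
  using norm1sq_pos norm1sq_AE_0 by (force simp: nrm_def)

text \<open>The linear part of f, taken with constant V0/2, uses up at most half of the squared
  norm; the remaining q-th power is of higher order by Sobolev.\<close>

lemma Nf_pos_near_zero:
  obtains \<rho> where "\<rho> > 0" "\<And>w. X1 V w \<Longrightarrow> 0 < nrm w \<Longrightarrow> nrm w < \<rho> \<Longrightarrow> Nf w > 0"
proof -
  obtain CS where "CS > 0" "\<And>u. X1 V u \<Longrightarrow> integrable lebesgue (\<lambda>x. \<bar>u x\<bar> powr q)"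
    "\<And>u. X1 V u \<Longrightarrow> (LINT x|lebesgue. \<bar>u x\<bar> powr q) \<le> CS * nrm u powr q" by (rule Sobolev_X1) (rule that)
  note CS = this(1,3)
  have "V0 / 2 > 0" using V0 by simp
  then obtain C where C: "C > 0" "\<And>a. \<bar>f a\<bar> \<le> V0 / 2 * \<bar>a\<bar> + C * \<bar>a\<bar> powr (q - 1)" by (rule f_growth) (rule that)
  \<comment> \<open>Solves C CS \<rho>^(q-2) = 1/2.\<close>
  define \<rho> where "\<rho> = (1 / (2 * C * CS)) powr (1 / (q - 2))"
  have \<rho>: "\<rho> > 0" "\<rho> powr (q - 2) = 1 / (2 * C * CS)" using C CS q2 by (auto simp: \<rho>_def powr_powr)
  show ?thesis
  proof (rule that[OF \<rho>(1)])
    fix w assume w: "X1 V w" and n: "0 < nrm w" "nrm w < \<rho>"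
    have fw: "f a * a \<le> V0 / 2 * a^2 + C * \<bar>a\<bar> powr q" for a
    proof -
      have "f a * a \<le> \<bar>f a\<bar> * \<bar>a\<bar>" by (simp add: abs_mult[symmetric])
      also have "\<dots> \<le> (V0 / 2 * \<bar>a\<bar> + C * \<bar>a\<bar> powr (q - 1)) * \<bar>a\<bar>" by (intro mult_right_mono C(2)) auto
      also have "\<dots> = V0 / 2 * a^2 + C * (\<bar>a\<bar> powr (q - 1) * \<bar>a\<bar>)" by (simp add: algebra_simps power2_eq_square)
      also have "\<bar>a\<bar> powr (q - 1) * \<bar>a\<bar> = \<bar>a\<bar> powr q" by (cases "a = 0") (auto simp: powr_diff)
      finally show ?thesis .
    qed
    have "(LINT x|lebesgue. f (w x) * w x) \<le> (LINT x|lebesgue. V0 / 2 * (w x)^2 + C * \<bar>w x\<bar> powr q)"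
      by (intro integral_mono f_integrable w Bochner_Integration.integrable_add integrable_mult_right square_integrable powr_q_integrable fw)
    also have "\<dots> = V0 / 2 * (LINT x|lebesgue. (w x)^2) + C * (LINT x|lebesgue. \<bar>w x\<bar> powr q)"
      using square_integrable[OF w] powr_q_integrable[OF w] by simp
    also have "\<dots> \<le> V0 / 2 * ((nrm w)^2 / V0) + C * (CS * nrm w powr q)"
      using V0 C by (intro add_mono mult_left_mono square_integral_le w CS(2)) auto
    also have "nrm w powr q = nrm w powr (q - 2) * (nrm w)^2" using n by (simp add: powr_diff)
    also have "C * (CS * (nrm w powr (q - 2) * (nrm w)^2)) < C * (CS * (1 / (2 * C * CS) * (nrm w)^2))"
      unfolding \<rho>(2)[symmetric] using n C CS q2 by (intro mult_strict_left_mono mult_strict_right_mono powr_less_mono2) auto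
    also have "C * (CS * (1 / (2 * C * CS) * (nrm w)^2)) = (nrm w)^2 / 2" using C CS by simp
    finally have "(LINT x|lebesgue. f (w x) * w x) < (nrm w)^2" using V0 by simp
    then show "Nf w > 0" by (simp add: Nf_def nrm_sq)
  qed
qed

text \<open>Up to e K = \<delta>0 / 2 the integral of f(w) w comes from the middle range, by
  \<open>f_middle\<close>; so that range must supply the other half.\<close>

lemma mid_mass_lower_bound:
  assumes R: "R > 0" and \<delta>0: "\<delta>0 > 0"
  obtains \<eta> M \<delta> where "0 < \<eta>" "\<eta> < M" "\<delta> > 0"
    "\<And>w. X1 V w \<Longrightarrow> nrm w \<le> R \<Longrightarrow> \<delta>0 \<le> (LINT x|lebesgue. f (w x) * w x) \<Longrightarrow> \<delta> \<le> mid_mass \<eta> M w"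
proof -
  obtain CS where "CS > 0" "\<And>u. X1 V u \<Longrightarrow> integrable lebesgue (\<lambda>x. \<bar>u x\<bar> powr q)"
    "\<And>u. X1 V u \<Longrightarrow> (LINT x|lebesgue. \<bar>u x\<bar> powr q) \<le> CS * nrm u powr q" by (rule Sobolev_X1) (rule that)
  note CS = this(1,3)
  define K where "K = R^2 / V0 + CS * R powr q"
  have K: "K > 0" using R V0 CS by (auto simp: K_def intro!: add_pos_pos)
  define e where "e = \<delta>0 / (2 * K)"
  have e: "e > 0" using K \<delta>0 by (simp add: e_def)
  obtain \<eta> M C where \<eta>: "\<eta> > 0" "M > \<eta>" and C: "C > 0"
    "\<And>a. \<bar>f a * a\<bar> \<le> e * (a^2 + \<bar>a\<bar> powr q) + C * (indicator {a. \<eta> \<le> \<bar>a\<bar> \<and> \<bar>a\<bar> \<le> M} a * a^2)"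
    by (rule f_middle[OF e]) (rule that)
  show ?thesis
  proof (rule that[OF \<eta>])
    show "\<delta>0 / (2 * C) > 0" using \<delta>0 C by simp
    fix w assume w: "X1 V w" and n: "nrm w \<le> R" and l: "\<delta>0 \<le> (LINT x|lebesgue. f (w x) * w x)"
    have s: "(LINT x|lebesgue. (w x)^2) + (LINT x|lebesgue. \<bar>w x\<bar> powr q) \<le> K"
    proof -
      have "(LINT x|lebesgue. (w x)^2) + (LINT x|lebesgue. \<bar>w x\<bar> powr q) \<le> (nrm w)^2 / V0 + CS * nrm w powr q"
        by (intro add_mono square_integral_le CS(2) w)
      also have "\<dots> \<le> K" unfolding K_def
        using n V0 CS(1) q2 by (intro add_mono divide_right_mono power_mono mult_left_mono powr_mono2) auto
      finally show ?thesis .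
    qed
    have "\<delta>0 \<le> (LINT x|lebesgue. e * ((w x)^2 + \<bar>w x\<bar> powr q) + C * (indicator {a. \<eta> \<le> \<bar>a\<bar> \<and> \<bar>a\<bar> \<le> M} (w x) * (w x)^2))"
    proof (rule order_trans[OF l integral_mono])
      show "integrable lebesgue (\<lambda>x. f (w x) * w x)" by (rule f_integrable[OF w w])
      show "integrable lebesgue (\<lambda>x. e * ((w x)^2 + \<bar>w x\<bar> powr q) + C * (indicator {a. \<eta> \<le> \<bar>a\<bar> \<and> \<bar>a\<bar> \<le> M} (w x) * (w x)^2))"
        by (intro Bochner_Integration.integrable_add integrable_mult_right square_integrable powr_q_integrable mid_mass_integrable w)
      show "f (w x) * w x \<le> e * ((w x)^2 + \<bar>w x\<bar> powr q) + C * (indicator {a. \<eta> \<le> \<bar>a\<bar> \<and> \<bar>a\<bar> \<le> M} (w x) * (w x)^2)" for x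
        using C(2)[of "w x"] by linarith
    qed
    also have "\<dots> = e * ((LINT x|lebesgue. (w x)^2) + (LINT x|lebesgue. \<bar>w x\<bar> powr q)) + C * mid_mass \<eta> M w"
      using square_integrable[OF w] powr_q_integrable[OF w] mid_mass_integrable[OF w, of \<eta> M]
      unfolding mid_mass_def by simp
    also have "\<dots> \<le> e * K + C * mid_mass \<eta> M w" using s e by simp
    also have "e * K = \<delta>0 / 2" using K by (simp add: e_def)
    finally show "\<delta>0 / (2 * C) \<le> mid_mass \<eta> M w" using C(1) by (simp add: field_simps)
  qed
qed

text \<open>Uniform in w, since only the lower bound on \<open>mid_mass\<close> enters: on the
  middle range t |w| reaches T0 as soon as t \<ge> T0 / \<eta>, and elsewhere the primitive is
  nonnegative.\<close>

lemma prim_integral_superquadratic: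
  assumes "\<eta> > 0" "\<delta> > 0" "A > 0"
  obtains T where "T > 0" "\<And>t w. T \<le> t \<Longrightarrow> X1 V w \<Longrightarrow> \<delta> \<le> mid_mass \<eta> M w \<Longrightarrow> A * t^2 \<le> (LINT x|lebesgue. prim f (t * w x))"
proof -
  obtain T0 where T0: "T0 > 0" "\<And>s. T0 \<le> \<bar>s\<bar> \<Longrightarrow> A / \<delta> * s^2 \<le> prim f s" by (rule prim_superquadratic) (rule that)
  show ?thesis
  proof (rule that[of "T0 / \<eta>"])
    show "T0 / \<eta> > 0" using T0 assms by simp
    fix t w assume t: "T0 / \<eta> \<le> t" and w: "X1 V w" and m: "\<delta> \<le> mid_mass \<eta> M w"
    have t0: "t > 0" using t T0 assms by (smt (verit) divide_pos_pos)
    have "A * t^2 = (A / \<delta> * t^2) * \<delta>" using assms by simp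
    also have "\<dots> \<le> (A / \<delta> * t^2) * mid_mass \<eta> M w" using m assms by (intro mult_left_mono) auto
    also have "\<dots> = (LINT x|lebesgue. (A / \<delta> * t^2) * (indicator {a. \<eta> \<le> \<bar>a\<bar> \<and> \<bar>a\<bar> \<le> M} (w x) * (w x)^2))"
      by (simp add: mid_mass_def)
    also have "\<dots> \<le> (LINT x|lebesgue. prim f (t * w x))"
    proof (intro integral_mono integrable_mult_right mid_mass_integrable w prim_integrable[OF X1_cmult[OF w]])
      fix x
      show "A / \<delta> * t\<^sup>2 * (indicator {a. \<eta> \<le> \<bar>a\<bar> \<and> \<bar>a\<bar> \<le> M} (w x) * (w x)\<^sup>2) \<le> prim f (t * w x)"
      proof (cases "\<eta> \<le> \<bar>w x\<bar> \<and> \<bar>w x\<bar> \<le> M")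
        case True
        have "T0 \<le> t * \<eta>" using t assms by (simp add: field_simps)
        also have "\<dots> \<le> t * \<bar>w x\<bar>" using True t0 by simp
        finally have "T0 \<le> \<bar>t * w x\<bar>" using t0 by (simp add: abs_mult)
        then show ?thesis using T0(2)[of "t * w x"] True by (simp add: power_mult_distrib mult.assoc)
      next
        case False
        then have "indicator {a. \<eta> \<le> \<bar>a\<bar> \<and> \<bar>a\<bar> \<le> M} (w x) = (0::real)" by simp
        then show ?thesis using prim_nonneg[of "t * w x"] by simp
      qed
    qed
    finally show "A * t^2 \<le> (LINT x|lebesgue. prim f (t * w x))" .
  qed
qed

lemma J_cmult: assumes "X1 V u" shows "J1 V f (\<lambda>x. t * u x) = t^2 * norm1sq V u / 2 - (LINT x|lebesgue. prim f (t * u x))"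
  by (simp add: J1_def norm1sq_cmult[OF assms])

text \<open>Integrate \<open>prim_ray_ineq\<close> and replace the integral of f(u) u by the squared
  norm.\<close>

lemma J_ray_le:
  assumes u: "X1 V u" and N: "Nf u = 0" and t: "t \<ge> 0" shows "J1 V f (\<lambda>x. t * u x) \<le> J1 V f u"
proof -
  have "(LINT x|lebesgue. prim f (u x)) + (t^2 - 1) / 2 * (LINT x|lebesgue. f (u x) * u x)
      = (LINT x|lebesgue. prim f (u x) + (t^2 - 1) / 2 * (f (u x) * u x))"
    using prim_integrable[OF u] f_integrable[OF u u] by simp
  also have "\<dots> \<le> (LINT x|lebesgue. prim f (t * u x))"
    by (intro integral_mono Bochner_Integration.integrable_add integrable_mult_right prim_integrable f_integrable u X1_cmult prim_ray_ineq t)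
  finally show ?thesis using N unfolding J_cmult[OF u] unfolding J1_def Nf_def by (simp add: field_simps)
qed

lemma J_nonneg: assumes "X1 V u" "Nf u = 0" shows "0 \<le> J1 V f u"
  using J_ray_le[OF assms, of 0] J_cmult[OF assms(1), of 0] by simp

lemma Nehari_bdd_below: "bdd_below (J1 V f ` Nehari1 V f)"
  by (rule bdd_belowI[of _ 0]) (auto simp: Nehari_iff X1G_def intro: J_nonneg)

lemma c1_le: "u \<in> Nehari1 V f \<Longrightarrow> c1 V f \<le> J1 V f u"
  unfolding c1_def using Nehari_bdd_below by (intro cInf_lower) auto

lemma prim_integral_le_half: assumes "X1 V u" shows "2 * (LINT x|lebesgue. prim f (u x)) \<le> (LINT x|lebesgue. f (u x) * u x)"
proof -
  have "(LINT x|lebesgue. 2 * prim f (u x)) \<le> (LINT x|lebesgue. f (u x) * u x)"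
  proof (intro integral_mono integrable_mult_right prim_integrable f_integrable assms)
    show "2 * prim f (u x) \<le> f (u x) * u x" for x using prim_le_half[of "u x"] by simp
  qed
  then show ?thesis by simp
qed

text \<open>A large u is rescaled to w of norm s with s^2 / 2 = |C| + 1. From J(w) \<le> J(u) \<le>
  C the primitive of w has integral at least 1, so w has middle mass; superquadratic growth along
  the ray back to u then makes J(u) negative.\<close>

lemma Nehari_bounded:
  obtains R where "R > 0" "\<And>u. u \<in> Nehari1 V f \<Longrightarrow> J1 V f u \<le> C \<Longrightarrow> nrm u \<le> R"
proof -
  define s where "s = sqrt (2 * (\<bar>C\<bar> + 1))"
  have s: "s > 0" "s^2 = 2 * (\<bar>C\<bar> + 1)" by (auto simp: s_def)
  obtain \<eta> M \<delta> where \<eta>: "0 < \<eta>" "\<eta> < M" "\<delta> > 0"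
    "\<And>w. X1 V w \<Longrightarrow> nrm w \<le> s \<Longrightarrow> 2 \<le> (LINT x|lebesgue. f (w x) * w x) \<Longrightarrow> \<delta> \<le> mid_mass \<eta> M w"
    by (rule mid_mass_lower_bound[OF s(1) zero_less_numeral]) (rule that)
  have s2: "s^2 > 0" using s by simp
  obtain T where T: "T > 0" "\<And>t w. T \<le> t \<Longrightarrow> X1 V w \<Longrightarrow> \<delta> \<le> mid_mass \<eta> M w \<Longrightarrow> s^2 * t^2 \<le> (LINT x|lebesgue. prim f (t * w x))"
    by (rule prim_integral_superquadratic[OF \<eta>(1,3) s2]) (rule that)
  show ?thesis
  proof (rule that[of "s * T"])
    show "s * T > 0" using s T by simp
    fix u assume uN: "u \<in> Nehari1 V f" and J: "J1 V f u \<le> C"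
    have u: "X1 V u" "Nf u = 0" and nz: "nrm u > 0"
      using uN not_AE_zero_iff by (auto simp: Nehari_iff X1G_def)
    show "nrm u \<le> s * T"
    proof (rule ccontr)
      assume "\<not> nrm u \<le> s * T"
      then have gt: "s * T < nrm u" by simp
      define w where "w x = (s / nrm u) * u x" for x
      have w: "X1 V w" unfolding w_def[abs_def] by (rule X1_cmult[OF u(1)])
      have nw: "nrm w = s" unfolding w_def[abs_def] using nrm_cmult[OF u(1), of "s / nrm u"] nz s by simp
      have "J1 V f w \<le> C" unfolding w_def[abs_def] using J_ray_le[OF u, of "s / nrm u"] nz s J by simp
      moreover have "J1 V f w = (\<bar>C\<bar> + 1) - (LINT x|lebesgue. prim f (w x))"
        unfolding J1_def nrm_sq[symmetric] nw s(2) by simp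
      ultimately have "1 \<le> (LINT x|lebesgue. prim f (w x))" using abs_ge_self[of C] by linarith
      then have "2 \<le> (LINT x|lebesgue. f (w x) * w x)" using prim_integral_le_half[OF w] by linarith
      then have m: "\<delta> \<le> mid_mass \<eta> M w" using \<eta>(4)[OF w] nw by simp
      define t where "t = nrm u / s"
      have t: "T \<le> t" using gt s by (simp add: t_def field_simps)
      have uw: "u x = t * w x" for x using nz s by (simp add: t_def w_def)
      have "s^2 * t^2 \<le> (LINT x|lebesgue. prim f (u x))" using T(2)[OF t w m] by (simp flip: uw)
      moreover have "s^2 * t^2 = (nrm u)^2" using s by (simp add: t_def power_divide)
      ultimately have "J1 V f u \<le> (nrm u)^2 / 2 - (nrm u)^2" unfolding J1_def by (simp add: nrm_sq)
      moreover have "(nrm u)^2 > 0" using nz by simp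
      ultimately show False using J_nonneg[OF u] by linarith
    qed
  qed
qed

lemma Nf_uniform_continuity:
  assumes R: "R > 0" and e: "e > 0"
  obtains d where "d > 0" "\<And>w k. X1 V w \<Longrightarrow> X1 V k \<Longrightarrow> nrm w \<le> R \<Longrightarrow> nrm k \<le> d \<Longrightarrow> \<bar>Nf (\<lambda>x. w x + k x) - Nf w\<bar> \<le> e"
proof -
  have e1: "e / (4 * (R + 1)) > 0" using e R by simp
  obtain d1 where d1: "d1 > 0" "\<And>u w h. X1 V u \<Longrightarrow> X1 V w \<Longrightarrow> X1 V h \<Longrightarrow> nrm u \<le> R \<Longrightarrow> nrm w \<le> d1 \<Longrightarrow>
      \<bar>(LINT x|lebesgue. f (u x + w x) * h x) - (LINT x|lebesgue. f (u x) * h x)\<bar> \<le> e / (4 * (R + 1)) * nrm h"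
    by (rule f_uniform_continuity[OF R e1]) (rule that)
  obtain K where K: "K > 0" "\<And>u h. X1 V u \<Longrightarrow> X1 V h \<Longrightarrow> nrm u \<le> R \<Longrightarrow> \<bar>LINT x|lebesgue. f (u x) * h x\<bar> \<le> K * nrm h"
    by (rule f_integral_bound[OF R]) (rule that)
  \<comment> \<open>Collects the terms linear in d: 2 R from the scalar product, 1 from the
    quadratic term and K from the integral of f(w) k.\<close>
  define B where "B = 2 * R + 1 + K"
  have B: "B > 0" using R K by (simp add: B_def)
  define d where "d = min d1 (min 1 (e / (4 * B)))"
  have "d \<le> e / (4 * B)" by (simp add: d_def)
  then have "d * B \<le> e / 4" using B by (simp add: field_simps)
  moreover have "d > 0" "d \<le> d1" "d \<le> 1" using d1(1) e B by (auto simp: d_def)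
  ultimately have d: "d > 0" "d \<le> d1" "d \<le> 1" "d * B \<le> e / 4" by auto
  show ?thesis
  proof (rule that[OF d(1)])
    fix w k assume w: "X1 V w" and k: "X1 V k" and n: "nrm w \<le> R" "nrm k \<le> d"
    note wk = X1_add[OF w k]
    define i1 where "i1 = (LINT x|lebesgue. f (w x + k x) * (w x + k x))"
    define i2 where "i2 = (LINT x|lebesgue. f (w x) * (w x + k x))"
    have "i2 = (LINT x|lebesgue. f (w x) * w x) + (LINT x|lebesgue. f (w x) * k x)"
      unfolding i2_def using f_integrable[OF w w] f_integrable[OF w k] by (simp add: distrib_left)
    then have eq: "Nf (\<lambda>x. w x + k x) - Nf w = 2 * E w k + norm1sq V k - (i1 - i2) - (LINT x|lebesgue. f (w x) * k x)"
      unfolding Nf_def norm1sq_add[OF w k] i1_def by simp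
    have "nrm (\<lambda>x. w x + k x) \<le> R + 1" using nrm_triangle[OF w k] n d by linarith
    then have "e / (4 * (R + 1)) * nrm (\<lambda>x. w x + k x) \<le> e / (4 * (R + 1)) * (R + 1)"
      using e1 by (intro mult_left_mono) auto
    moreover have "e / (4 * (R + 1)) * (R + 1) = e / 4" using R by (simp add: field_simps)
    ultimately have b1: "\<bar>i1 - i2\<bar> \<le> e / 4"
      using d1(2)[OF w k wk n(1) order_trans[OF n(2) d(2)]] unfolding i1_def i2_def by linarith
    have "\<bar>E w k\<bar> \<le> R * d" using E_Cauchy_Schwarz[OF w k] mult_mono[OF n] R by (smt (verit) nrm_nonneg)
    moreover have "norm1sq V k \<le> 1 * d" using mult_mono[of "nrm k" 1 "nrm k" d] n d nrm_sq[of k] by (simp add: power2_eq_square)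
    moreover have "\<bar>LINT x|lebesgue. f (w x) * k x\<bar> \<le> K * d"
      using K(2)[OF w k n(1)] mult_left_mono[OF n(2), of K] K(1) by linarith
    moreover have "2 * (R * d) + 1 * d + K * d = d * B" by (simp add: B_def algebra_simps)
    ultimately have "\<bar>2 * E w k + norm1sq V k - (i1 - i2) - (LINT x|lebesgue. f (w x) * k x)\<bar> \<le> d * B + e / 4"
      using b1 norm1sq_nonneg[of k] by linarith
    then show "\<bar>Nf (\<lambda>x. w x + k x) - Nf w\<bar> \<le> e" unfolding eq using d(4) e by linarith
  qed
qed

text \<open>The fixed offset h is meant for the curves s u + r h of the descent argument; plain rays
  are the case of a zero offset.\<close>

lemma Nf_ray_continuous:
  assumes u: "X1 V u" and h: "X1 V h" shows "continuous_on UNIV (\<lambda>s. Nf (\<lambda>x. s * u x + h x))"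
proof (rule continuous_at_imp_continuous_on, rule ballI)
  fix s0 :: real
  have w: "X1 V (\<lambda>x. s0 * u x + h x)" by (intro X1_add X1_cmult u h)
  show "isCont (\<lambda>s. Nf (\<lambda>x. s * u x + h x)) s0"
    unfolding continuous_at_eps_delta
  proof (intro allI impI)
    fix e :: real assume e: "e > 0"
    define R where "R = nrm (\<lambda>x. s0 * u x + h x) + 1"
    have R: "R > 0" by (simp add: R_def add_nonneg_pos)
    have e2: "e / 2 > 0" using e by simp
    obtain d where d: "d > 0" "\<And>w k. X1 V w \<Longrightarrow> X1 V k \<Longrightarrow> nrm w \<le> R \<Longrightarrow> nrm k \<le> d \<Longrightarrow> \<bar>Nf (\<lambda>x. w x + k x) - Nf w\<bar> \<le> e / 2"
      by (rule Nf_uniform_continuity[OF R e2]) (rule that)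
    have nu: "nrm u + 1 > 0" using nrm_nonneg[of u] by linarith
    show "\<exists>d>0. \<forall>s. dist s s0 < d \<longrightarrow> dist (Nf (\<lambda>x. s * u x + h x)) (Nf (\<lambda>x. s0 * u x + h x)) < e"
    proof (intro exI[of _ "d / (nrm u + 1)"] conjI allI impI)
      show "d / (nrm u + 1) > 0" using d nu by simp
      fix s assume "dist s s0 < d / (nrm u + 1)"
      then have "\<bar>s - s0\<bar> * (nrm u + 1) < d" using nu by (simp add: dist_real_def pos_less_divide_eq)
      then have "\<bar>s - s0\<bar> * nrm u \<le> d" using abs_ge_zero[of "s - s0"] by (simp add: distrib_left)
      then have "nrm (\<lambda>x. (s - s0) * u x) \<le> d" by (simp add: nrm_cmult[OF u])
      then have "\<bar>Nf (\<lambda>x. (s0 * u x + h x) + (s - s0) * u x) - Nf (\<lambda>x. s0 * u x + h x)\<bar> \<le> e / 2"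
        by (intro d(2) w X1_cmult u) (simp_all add: R_def)
      moreover have "(\<lambda>x. (s0 * u x + h x) + (s - s0) * u x) = (\<lambda>x. s * u x + h x)" by (auto simp: algebra_simps)
      ultimately show "dist (Nf (\<lambda>x. s * u x + h x)) (Nf (\<lambda>x. s0 * u x + h x)) < e" using e by (simp add: dist_real_def)
    qed
  qed
qed

text \<open>The integral of f(v) v is at least twice that of the primitive, which beats B t^2 once t
  is large; T is common to all w with the given bounds.\<close>

lemma Nf_negative_far:
  assumes "\<eta> > 0" "\<delta> > 0" "B > 0"
  obtains T where "T > 0" "\<And>t w. T \<le> t \<Longrightarrow> X1 V w \<Longrightarrow> \<delta> \<le> mid_mass \<eta> M w \<Longrightarrow> norm1sq V w \<le> B \<Longrightarrow> Nf (\<lambda>x. t * w x) < 0"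
proof -
  obtain T where T: "T > 0" "\<And>t w. T \<le> t \<Longrightarrow> X1 V w \<Longrightarrow> \<delta> \<le> mid_mass \<eta> M w \<Longrightarrow> B * t^2 \<le> (LINT x|lebesgue. prim f (t * w x))"
    by (rule prim_integral_superquadratic[OF assms]) (rule that)
  show ?thesis
  proof (rule that[OF T(1)])
    fix t w assume t: "T \<le> t" and w: "X1 V w" and m: "\<delta> \<le> mid_mass \<eta> M w" and n: "norm1sq V w \<le> B"
    have "t^2 * norm1sq V w \<le> t^2 * B" using n by (intro mult_left_mono) auto
    moreover have "2 * (B * t^2) \<le> (LINT x|lebesgue. f (t * w x) * (t * w x))"
      using T(2)[OF t w m] prim_integral_le_half[OF X1_cmult[OF w, of t]] by linarith
    moreover have "B * t^2 > 0" using assms T t by simp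
    ultimately show "Nf (\<lambda>x. t * w x) < 0" unfolding Nf_def norm1sq_cmult[OF w] by (simp add: mult.commute)
  qed
qed

lemma f_integral_pos:
  assumes "X1 V w" "nrm w > 0" shows "0 < (LINT x|lebesgue. f (w x) * w x)"
proof -
  have "(LINT x|lebesgue. f (w x) * w x) \<noteq> 0"
  proof
    assume "(LINT x|lebesgue. f (w x) * w x) = 0"
    then have "AE x in lebesgue. f (w x) * w x = 0"
      using integral_nonneg_eq_0_iff_AE[OF f_integrable[OF assms(1,1)]] f_times_nonneg by simp
    then have "AE x in lebesgue. w x = 0"
    proof eventually_elim
      fix x assume "f (w x) * w x = 0"
      then show "w x = 0" using f_times_pos[of "w x"] by (cases "w x = 0") auto
    qed
    then show False using not_AE_zero_iff[OF assms(1)] assms(2) by simp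
  qed
  moreover have "0 \<le> (LINT x|lebesgue. f (w x) * w x)" using f_times_nonneg by simp
  ultimately show ?thesis by linarith
qed

text \<open>Nf is positive on the ray near 0 and negative far out, so the intermediate value theorem
  gives a zero in between.\<close>

lemma Nehari_projection:
  assumes w: "X1G V w" and nz: "nrm w > 0"
  obtains t where "t > 0" "(\<lambda>x. t * w x) \<in> Nehari1 V f"
proof -
  have wX: "X1 V w" using w by (rule X1G_X1)
  obtain \<rho> where \<rho>: "\<rho> > 0" "\<And>w. X1 V w \<Longrightarrow> 0 < nrm w \<Longrightarrow> nrm w < \<rho> \<Longrightarrow> Nf w > 0" by (rule Nf_pos_near_zero) (rule that)
  obtain \<eta> M \<delta> where \<eta>: "0 < \<eta>" "\<eta> < M" "\<delta> > 0"
    "\<And>v. X1 V v \<Longrightarrow> nrm v \<le> nrm w \<Longrightarrow> (LINT x|lebesgue. f (w x) * w x) \<le> (LINT x|lebesgue. f (v x) * v x) \<Longrightarrow> \<delta> \<le> mid_mass \<eta> M v"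
    by (rule mid_mass_lower_bound[OF nz f_integral_pos[OF wX nz]]) (rule that)
  have m: "\<delta> \<le> mid_mass \<eta> M w" by (rule \<eta>(4)[OF wX]) auto
  have n2: "norm1sq V w > 0" using nz by (simp add: nrm_def)
  obtain T where T: "T > 0" "\<And>t v. T \<le> t \<Longrightarrow> X1 V v \<Longrightarrow> \<delta> \<le> mid_mass \<eta> M v \<Longrightarrow> norm1sq V v \<le> norm1sq V w \<Longrightarrow> Nf (\<lambda>x. t * v x) < 0"
    by (rule Nf_negative_far[OF \<eta>(1,3) n2]) (rule that)
  define t0 where "t0 = min T (\<rho> / (2 * nrm w))"
  have t0: "t0 > 0" "t0 \<le> T" "t0 * nrm w < \<rho>" using T \<rho> nz by (auto simp: t0_def min_def field_simps)
  have "nrm (\<lambda>x. t0 * w x) = t0 * nrm w" using nrm_cmult[OF wX, of t0] t0 by simp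
  then have p: "Nf (\<lambda>x. t0 * w x) > 0" using t0 nz by (intro \<rho>(2) X1_cmult wX) simp_all
  have ng: "Nf (\<lambda>x. T * w x) < 0" by (rule T(2)[OF order_refl wX m order_refl])
  have "continuous_on UNIV (\<lambda>s. Nf (\<lambda>x. s * w x + 0 * w x))" by (rule Nf_ray_continuous[OF wX X1_cmult[OF wX]])
  then have "continuous_on UNIV (\<lambda>s. Nf (\<lambda>x. s * w x))" by simp
  then have c: "continuous_on {t0..T} (\<lambda>s. Nf (\<lambda>x. s * w x))" by (rule continuous_on_subset) simp
  obtain t where t: "t0 \<le> t" "t \<le> T" "Nf (\<lambda>x. t * w x) = 0"
    using IVT2'[of "\<lambda>s. Nf (\<lambda>x. s * w x)" T 0 t0] p ng t0 c by auto
  have "nrm (\<lambda>x. t * w x) > 0" using nrm_cmult[OF wX, of t] t t0 nz by simp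
  then have "(\<lambda>x. t * w x) \<in> Nehari1 V f"
    unfolding Nehari_iff using t(3) X1G_cmult[OF w] not_AE_zero_iff[OF X1_cmult[OF wX]] by auto
  then show ?thesis using that[of t] t t0 by auto
qed

end

section \<open>Minimising sequences are almost critical\<close>

context variational
begin

lemma dJ_cmult: assumes "X1 V u" "X1 V h" shows "dJ u (\<lambda>x. c * h x) = c * dJ u h"
  using E_cmult_right[OF assms(2,1), of c] by (simp add: dJ_def mult.left_commute[of _ c] right_diff_distrib)

lemma dJ_add: assumes "X1 V u" "X1 V h" "X1 V k" shows "dJ u (\<lambda>x. h x + k x) = dJ u h + dJ u k"
  using E_add_right[OF assms(2,3,1)] f_integrable[OF assms(1,2)] f_integrable[OF assms(1,3)]
  by (simp add: dJ_def distrib_left)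

lemma dJ_uniform_continuity:
  assumes R: "R > 0" and e: "e > 0"
  obtains d where "d > 0" "\<And>u w h. X1 V u \<Longrightarrow> X1 V w \<Longrightarrow> X1 V h \<Longrightarrow> nrm u \<le> R \<Longrightarrow> nrm w \<le> d \<Longrightarrow>
      \<bar>dJ (\<lambda>x. u x + w x) h - dJ u h\<bar> \<le> e * nrm h"
proof -
  have e2: "e / 2 > 0" using e by simp
  obtain d where d: "d > 0" "\<And>u w h. X1 V u \<Longrightarrow> X1 V w \<Longrightarrow> X1 V h \<Longrightarrow> nrm u \<le> R \<Longrightarrow> nrm w \<le> d \<Longrightarrow>
      \<bar>(LINT x|lebesgue. f (u x + w x) * h x) - (LINT x|lebesgue. f (u x) * h x)\<bar> \<le> e / 2 * nrm h"
    by (rule f_uniform_continuity[OF R e2]) (rule that)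
  show ?thesis
  proof (rule that[of "min d (e / 2)"])
    fix u w h assume u: "X1 V u" and w: "X1 V w" and h: "X1 V h" and n: "nrm u \<le> R" "nrm w \<le> min d (e / 2)"
    have "nrm w * nrm h \<le> e / 2 * nrm h" using n by (intro mult_right_mono) auto
    then have "\<bar>E w h\<bar> \<le> e / 2 * nrm h" using E_Cauchy_Schwarz[OF w h] by linarith
    moreover have "\<bar>(LINT x|lebesgue. f (u x + w x) * h x) - (LINT x|lebesgue. f (u x) * h x)\<bar> \<le> e / 2 * nrm h"
      using n by (intro d(2) u w h) auto
    ultimately show "\<bar>dJ (\<lambda>x. u x + w x) h - dJ u h\<bar> \<le> e * nrm h"
      unfolding dJ_def E_add_left[OF u w h] by linarith
  qed (use d e in auto)
qed

text \<open>When Nf u = 0, the value at s u is s^2 times the integral of f(u) u - f(s u) u / s,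
  whose sign is that of 1 - s. The middle mass makes this sign quantitative.\<close>

lemma Nf_gap:
  assumes s: "s > 0" "s \<noteq> 1" and \<eta>: "0 < \<eta>" "\<eta> < M" and \<delta>: "\<delta> > 0"
  obtains c where "c > 0" "\<And>u. X1 V u \<Longrightarrow> Nf u = 0 \<Longrightarrow> \<delta> \<le> mid_mass \<eta> M u \<Longrightarrow>
      c \<le> (if s < 1 then Nf (\<lambda>x. s * u x) else - Nf (\<lambda>x. s * u x))"
proof -
  obtain m where m: "m > 0" "\<And>a. \<eta> \<le> \<bar>a\<bar> \<Longrightarrow> \<bar>a\<bar> \<le> M \<Longrightarrow> m * a^2 \<le> (if s < 1 then f a * a - f (s * a) * a / s else f (s * a) * a / s - f a * a)"
    by (rule f_gap[OF s \<eta>]) (rule that)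
  show ?thesis
  proof (rule that[of "s^2 * (m * \<delta>)"])
    show "s^2 * (m * \<delta>) > 0" using s m \<delta> by simp
    fix u assume u: "X1 V u" and N: "Nf u = 0" and d: "\<delta> \<le> mid_mass \<eta> M u"
    note su = X1_cmult[OF u, of s]
    \<comment> \<open>The sign factor lets one computation serve s < 1 and s > 1.\<close>
    define sg where "sg = (if s < 1 then 1 else -1 :: real)"
    have i1: "integrable lebesgue (\<lambda>x. f (u x) * u x)" by (rule f_integrable[OF u u])
    have i2: "integrable lebesgue (\<lambda>x. f (s * u x) * u x)" by (rule f_integrable[OF su u])
    have "Nf (\<lambda>x. s * u x) = s^2 * (LINT x|lebesgue. f (u x) * u x) - s * (LINT x|lebesgue. f (s * u x) * u x)"
      using N unfolding Nf_def norm1sq_cmult[OF u] by (simp add: mult.left_commute[of _ s])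
    also have "\<dots> = s^2 * (LINT x|lebesgue. f (u x) * u x - f (s * u x) * u x / s)"
      using i1 i2 s by (simp add: right_diff_distrib power2_eq_square)
    finally have eq: "sg * Nf (\<lambda>x. s * u x) = s^2 * (LINT x|lebesgue. sg * (f (u x) * u x - f (s * u x) * u x / s))" by simp
    have "m * \<delta> \<le> m * mid_mass \<eta> M u" using d m by simp
    also have "\<dots> = (LINT x|lebesgue. m * (indicator {a. \<eta> \<le> \<bar>a\<bar> \<and> \<bar>a\<bar> \<le> M} (u x) * (u x)^2))" by (simp add: mid_mass_def)
    also have "\<dots> \<le> (LINT x|lebesgue. sg * (f (u x) * u x - f (s * u x) * u x / s))"
    proof (intro integral_mono integrable_mult_right mid_mass_integrable u Bochner_Integration.integrable_diff i1)
      show "integrable lebesgue (\<lambda>x. f (s * u x) * u x / s)" using i2 by simp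
      fix x
      show "m * (indicator {a. \<eta> \<le> \<bar>a\<bar> \<and> \<bar>a\<bar> \<le> M} (u x) * (u x)^2) \<le> sg * (f (u x) * u x - f (s * u x) * u x / s)"
      proof (cases "\<eta> \<le> \<bar>u x\<bar> \<and> \<bar>u x\<bar> \<le> M")
        case True
        then show ?thesis using m(2)[of "u x"] by (simp add: sg_def split: if_splits)
      next
        case False
        have "0 \<le> sg * (f (u x) * u x - f (s * u x) * u x / s)"
          using f_ray_mono[of "u x" s 1] f_ray_mono[of "u x" 1 s] s by (cases "u x = 0") (auto simp: sg_def)
        moreover have "indicator {a. \<eta> \<le> \<bar>a\<bar> \<and> \<bar>a\<bar> \<le> M} (u x) = (0::real)" using False by simp
        ultimately show ?thesis by simp
      qed
    qed
    finally have "s^2 * (m * \<delta>) \<le> sg * Nf (\<lambda>x. s * u x)" unfolding eq by (intro mult_left_mono) auto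
    then show "s^2 * (m * \<delta>) \<le> (if s < 1 then Nf (\<lambda>x. s * u x) else - Nf (\<lambda>x. s * u x))" by (simp add: sg_def split: if_splits)
  qed
qed

text \<open>If the derivative at a near-minimiser u were very negative along h, then J would drop by a fixed amount
  along s u + r h for all s close to 1, and by the sign change of Nf one of these points lies on the Nehari set.\<close>

lemma Nehari_almost_critical:
  assumes \<omega>: "\<omega> > 0"
  obtains \<epsilon>0 where "\<epsilon>0 > 0" "\<And>u h. u \<in> Nehari1 V f \<Longrightarrow> J1 V f u < c1 V f + \<epsilon>0 \<Longrightarrow> X1G V h \<Longrightarrow> nrm h \<le> 1 \<Longrightarrow> - \<omega> \<le> dJ u h"
proof -
  obtain R where R: "R > 0" "\<And>u. u \<in> Nehari1 V f \<Longrightarrow> J1 V f u \<le> c1 V f + 1 \<Longrightarrow> nrm u \<le> R"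
    by (rule Nehari_bounded) (rule that)
  obtain \<rho> where \<rho>: "\<rho> > 0" "\<And>w. X1 V w \<Longrightarrow> 0 < nrm w \<Longrightarrow> nrm w < \<rho> \<Longrightarrow> Nf w > 0" by (rule Nf_pos_near_zero) (rule that)
  have \<rho>2: "\<rho>^2 > 0" using \<rho> by simp
  obtain \<eta> M \<delta> where \<eta>: "0 < \<eta>" "\<eta> < M" and \<delta>: "\<delta> > 0" and
    mm: "\<And>w. X1 V w \<Longrightarrow> nrm w \<le> R \<Longrightarrow> \<rho>^2 \<le> (LINT x|lebesgue. f (w x) * w x) \<Longrightarrow> \<delta> \<le> mid_mass \<eta> M w"
    by (rule mid_mass_lower_bound[OF R(1) \<rho>2]) (rule that)
  have w4: "\<omega> / 4 > 0" using \<omega> by simp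
  obtain d2 where d2: "d2 > 0" "\<And>u w h. X1 V u \<Longrightarrow> X1 V w \<Longrightarrow> X1 V h \<Longrightarrow> nrm u \<le> R \<Longrightarrow> nrm w \<le> d2 \<Longrightarrow>
      \<bar>dJ (\<lambda>x. u x + w x) h - dJ u h\<bar> \<le> \<omega> / 4 * nrm h"
    by (rule dJ_uniform_continuity[OF R(1) w4]) (rule that)
  \<comment> \<open>For |s - 1| \<le> \<tau> the point s u is within d2 of u, so the derivative
    there is still close to the one at u.\<close>
  define \<tau> where "\<tau> = min (1/2) (d2 / R)"
  have \<tau>: "\<tau> > 0" "\<tau> \<le> 1/2" "\<tau> * R \<le> d2" using d2 R by (auto simp: \<tau>_def min_def field_simps)
  have R2: "2 * R > 0" using R by simp
  obtain d3 where d3: "d3 > 0" "\<And>u w. X1 V u \<Longrightarrow> X1 V w \<Longrightarrow> nrm u \<le> 2 * R \<Longrightarrow> nrm w \<le> d3 \<Longrightarrow>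
      \<bar>J1 V f (\<lambda>x. u x + w x) - J1 V f u - dJ u w\<bar> \<le> \<omega> / 4 * nrm w"
    by (rule J_expansion[OF R2 w4]) (rule that)
  have s1: "1 - \<tau> > 0" "1 - \<tau> \<noteq> 1" "1 + \<tau> > 0" "1 + \<tau> \<noteq> 1" using \<tau> by auto
  obtain ca where ca: "ca > 0" "\<And>u. X1 V u \<Longrightarrow> Nf u = 0 \<Longrightarrow> \<delta> \<le> mid_mass \<eta> M u \<Longrightarrow>
      ca \<le> (if 1 - \<tau> < 1 then Nf (\<lambda>x. (1 - \<tau>) * u x) else - Nf (\<lambda>x. (1 - \<tau>) * u x))"
    by (rule Nf_gap[OF s1(1,2) \<eta> \<delta>]) (rule that)
  obtain cb where cb: "cb > 0" "\<And>u. X1 V u \<Longrightarrow> Nf u = 0 \<Longrightarrow> \<delta> \<le> mid_mass \<eta> M u \<Longrightarrow>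
      cb \<le> (if 1 + \<tau> < 1 then Nf (\<lambda>x. (1 + \<tau>) * u x) else - Nf (\<lambda>x. (1 + \<tau>) * u x))"
    by (rule Nf_gap[OF s1(3,4) \<eta> \<delta>]) (rule that)
  \<comment> \<open>Strictly below both gaps: a perturbation that moves Nf by at most c keeps its
    signs at s = 1 - \<tau> and s = 1 + \<tau>.\<close>
  define c where "c = min ca cb / 2"
  have c: "c > 0" "c < ca" "c < cb" using ca(1) cb(1) by (auto simp: c_def)
  obtain d4 where d4: "d4 > 0" "\<And>w k. X1 V w \<Longrightarrow> X1 V k \<Longrightarrow> nrm w \<le> 2 * R \<Longrightarrow> nrm k \<le> d4 \<Longrightarrow> \<bar>Nf (\<lambda>x. w x + k x) - Nf w\<bar> \<le> c"
    by (rule Nf_uniform_continuity[OF R2 c(1)]) (rule that)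
  \<comment> \<open>d3 serves the expansion of J, d4 the signs of Nf, and \<rho> / 4 keeps the new
    point away from 0.\<close>
  define r where "r = min d3 (min d4 (\<rho> / 4))"
  have r: "r > 0" "r \<le> d3" "r \<le> d4" "r \<le> \<rho> / 4" using d3(1) d4(1) \<rho>(1) by (auto simp: r_def)
  define \<epsilon>0 where "\<epsilon>0 = min 1 (r * \<omega> / 2)"
  have \<epsilon>0: "\<epsilon>0 > 0" "\<epsilon>0 \<le> 1" "\<epsilon>0 \<le> r * \<omega> / 2" using r \<omega> by (auto simp: \<epsilon>0_def)
  show ?thesis
  proof (rule that[OF \<epsilon>0(1)])
    fix u h assume uN: "u \<in> Nehari1 V f" and Ju: "J1 V f u < c1 V f + \<epsilon>0" and hG: "X1G V h" and nh: "nrm h \<le> 1"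
    have uG: "X1G V u" and N0: "Nf u = 0" using uN by (auto simp: Nehari_iff)
    have u: "X1 V u" and h: "X1 V h" using uG hG by (auto intro: X1G_X1)
    have nu: "nrm u > 0" using uN not_AE_zero_iff[OF u] by (auto simp: Nehari_iff)
    have uR: "nrm u \<le> R" using R(2)[OF uN] Ju \<epsilon>0 by simp
    have u\<rho>: "\<rho> \<le> nrm u" using \<rho>(2)[OF u nu] N0 by force
    have "(LINT x|lebesgue. f (u x) * u x) = (nrm u)^2" using N0 by (simp add: Nf_def nrm_sq)
    then have mu: "\<delta> \<le> mid_mass \<eta> M u" using mm[OF u uR] power_mono[OF u\<rho>, of 2] \<rho> by simp
    show "- \<omega> \<le> dJ u h"
    proof (rule ccontr)
      assume "\<not> - \<omega> \<le> dJ u h"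
      then have neg: "dJ u h < - \<omega>" by simp
      define k where "k x = r * h x" for x
      have k: "X1 V k" and kG: "X1G V k" unfolding k_def[abs_def] using X1_cmult[OF h] X1G_cmult[OF hG] by auto
      have nk: "nrm k \<le> r" unfolding k_def[abs_def] using nrm_cmult[OF h, of r] r nh mult_left_mono[OF nh, of r] by simp
      have su: "X1 V (\<lambda>x. s * u x)" "nrm (\<lambda>x. s * u x) \<le> 2 * R" if "\<bar>s - 1\<bar> \<le> \<tau>" for s
      proof -
        show "X1 V (\<lambda>x. s * u x)" by (rule X1_cmult[OF u])
        have "\<bar>s\<bar> \<le> 2" using that \<tau> by linarith
        then show "nrm (\<lambda>x. s * u x) \<le> 2 * R" unfolding nrm_cmult[OF u] using uR by (intro mult_mono) auto
      qed
      define g where "g s = Nf (\<lambda>x. s * u x + k x)" for s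
      have gd: "\<bar>g s - Nf (\<lambda>x. s * u x)\<bar> \<le> c" if "\<bar>s - 1\<bar> \<le> \<tau>" for s
        unfolding g_def using that nk r by (intro d4(2) su k) auto
      have "g (1 - \<tau>) > 0" using gd[of "1 - \<tau>"] ca(2)[OF u N0 mu] \<tau> c by (simp split: if_splits)
      moreover have "g (1 + \<tau>) < 0" using gd[of "1 + \<tau>"] cb(2)[OF u N0 mu] \<tau> c by (simp split: if_splits)
      moreover have "continuous_on {1 - \<tau>..1 + \<tau>} g"
        unfolding g_def[abs_def] by (rule continuous_on_subset[OF Nf_ray_continuous[OF u k]]) simp
      ultimately obtain s where s: "1 - \<tau> \<le> s" "s \<le> 1 + \<tau>" "g s = 0"
        using IVT2'[of g "1 + \<tau>" 0 "1 - \<tau>"] \<tau> by auto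
      then have sa: "\<bar>s - 1\<bar> \<le> \<tau>" by linarith
      define w where "w x = s * u x + k x" for x
      have w: "X1 V w" "X1G V w" unfolding w_def[abs_def] using X1_add[OF su(1)[OF sa] k] X1G_add[OF X1G_cmult[OF uG] kG] by auto
      have "(\<lambda>x. s * u x) = (\<lambda>x. w x + (-1) * k x)" by (auto simp: w_def)
      then have "nrm (\<lambda>x. s * u x) \<le> nrm w + nrm (\<lambda>x. (-1) * k x)"
        by (simp only:) (intro nrm_triangle w X1_cmult k)
      moreover have "nrm (\<lambda>x. (-1) * k x) = nrm k" using nrm_cmult[OF k, of "-1"] by simp
      moreover have "nrm (\<lambda>x. s * u x) = s * nrm u" using nrm_cmult[OF u, of s] s \<tau> by simp
      moreover have "1 / 2 * \<rho> \<le> s * nrm u" using s \<tau> u\<rho> \<rho> by (intro mult_mono) auto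
      \<comment> \<open>nrm (s u) is at least \<rho> / 2 while nrm k is at most \<rho> / 4, so the
        zero of g is not the zero function.\<close>
      ultimately have "nrm w > 0" using nk r(4) \<rho>(1) by linarith
      then have "w \<in> Nehari1 V f" unfolding Nehari_iff
        using w not_AE_zero_iff[OF w(1)] s(3) by (simp add: g_def w_def[abs_def])
      then have "c1 V f \<le> J1 V f w" by (rule c1_le)
      moreover have "J1 V f w \<le> J1 V f (\<lambda>x. s * u x) + dJ (\<lambda>x. s * u x) k + \<omega> / 4 * nrm k"
        using d3(2)[OF su(1)[OF sa] k su(2)[OF sa] order_trans[OF nk r(2)]] unfolding w_def[abs_def] by linarith
      moreover have "\<omega> / 4 * nrm k \<le> \<omega> / 4 * r" using nk \<omega> by simp
      moreover have "J1 V f (\<lambda>x. s * u x) \<le> J1 V f u" using s \<tau> by (intro J_ray_le u N0) simp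
      \<comment> \<open>The derivative at s u exceeds the one at u by at most \<omega> / 4; adding
        the expansion error r \<omega> / 4 still leaves a drop of r \<omega> / 2, which is at least
        \<epsilon>0.\<close>
      moreover have "dJ (\<lambda>x. s * u x) k \<le> r * (- \<omega> + \<omega> / 4)"
      proof -
        have "nrm (\<lambda>x. (s - 1) * u x) \<le> d2"
        proof -
          have "\<bar>s - 1\<bar> * nrm u \<le> \<tau> * R" using sa uR \<tau> by (intro mult_mono) auto
          then show ?thesis using \<tau>(3) by (simp add: nrm_cmult[OF u])
        qed
        then have "\<bar>dJ (\<lambda>x. u x + (s - 1) * u x) h - dJ u h\<bar> \<le> \<omega> / 4 * nrm h" by (intro d2(2) u X1_cmult h uR)
        moreover have "(\<lambda>x. u x + (s - 1) * u x) = (\<lambda>x. s * u x)" by (auto simp: algebra_simps)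
        ultimately have "\<bar>dJ (\<lambda>x. s * u x) h - dJ u h\<bar> \<le> \<omega> / 4 * nrm h" by simp
        moreover have "\<omega> / 4 * nrm h \<le> \<omega> / 4 * 1" using nh \<omega> by (intro mult_left_mono) auto
        ultimately have "dJ (\<lambda>x. s * u x) h \<le> - \<omega> + \<omega> / 4" using neg by linarith
        moreover have "dJ (\<lambda>x. s * u x) k = r * dJ (\<lambda>x. s * u x) h" unfolding k_def[abs_def] by (rule dJ_cmult[OF su(1)[OF sa] h])
        ultimately show ?thesis using r(1) by (simp only: mult_left_mono less_imp_le)
      qed
      moreover have "r * (- \<omega> + \<omega> / 4) + \<omega> / 4 * r = - (r * \<omega> / 2)" by (simp add: field_simps)
      ultimately show False using Ju \<epsilon>0(3) by linarith
    qed
  qed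
qed

section \<open>Weak continuity of the nonlinear term\<close>

lemma mult_le_sum_squares: "x * y \<le> x^2 + y^2" for x y :: real
proof -
  have "0 \<le> (x - y)^2 + x^2 + y^2" by simp
  then show ?thesis by (simp add: power2_eq_square algebra_simps)
qed

text \<open>A weighted form of \<open>gr_times_le\<close>: one factor is scaled by t, the other by a
  compensating power of 1/t. The first version puts the small constant on the argument of
  \<open>gr\<close>, the second on the other factor.\<close>

lemma gr_Young:
  assumes "e > 0"
  obtains C where "C > 0" "\<And>a b. gr a * \<bar>b\<bar> \<le> e * (a^2 + \<bar>a\<bar> powr q) + C * (b^2 + \<bar>b\<bar> powr q)"
    "\<And>a b. gr b * \<bar>a\<bar> \<le> e * (a^2 + \<bar>a\<bar> powr q) + C * (b^2 + \<bar>b\<bar> powr q)"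
proof -
  define t where "t = min 1 (sqrt e)"
  have t: "t > 0" "t \<le> 1" using assms by (auto simp: t_def)
  have te: "t^2 \<le> e"
  proof -
    have "t^2 \<le> (sqrt e)^2" using t by (intro power_mono) (auto simp: t_def)
    then show ?thesis using assms by simp
  qed
  have tq: "t powr q \<le> t^2"
  proof -
    have "t powr q \<le> t powr 2" using t q2 by (intro powr_mono') auto
    then show ?thesis using t by simp
  qed
  \<comment> \<open>The exponents in A and B are those for which the inserted powers of t cancel in
    the product.\<close>
  define A where "A = (1 / t powr (q - 1)) powr q"
  define B where "B = (1 / t powr (1 / (q - 1))) powr q"
  define C where "C = max (1 / t^2) (max A B)"
  have C: "C > 0" "1 / t^2 \<le> C" "A \<le> C" "B \<le> C" using t by (auto simp: C_def less_max_iff_disj)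
  have lin: "\<bar>a\<bar> * \<bar>b\<bar> \<le> e * a^2 + C * b^2" for a b :: real
  proof -
    have "\<bar>a\<bar> * \<bar>b\<bar> = (t * \<bar>a\<bar>) * (\<bar>b\<bar> / t)" using t by simp
    also have "\<dots> \<le> (t * \<bar>a\<bar>)^2 + (\<bar>b\<bar> / t)^2"
      by (rule mult_le_sum_squares)
    also have "\<dots> = t^2 * a^2 + (1 / t^2) * b^2" by (simp add: power_mult_distrib power_divide)
    also have "\<dots> \<le> e * a^2 + C * b^2" using te C by (intro add_mono mult_right_mono) auto
    finally show ?thesis .
  qed
  have P: "t powr q * \<bar>a\<bar> powr q + D * \<bar>b\<bar> powr q \<le> e * \<bar>a\<bar> powr q + C * \<bar>b\<bar> powr q" if "D \<le> C" for a b D :: real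
    using that te tq by (intro add_mono mult_right_mono) auto
  show ?thesis
  proof (rule that[OF C(1)])
    fix a b :: real
    have "\<bar>a\<bar> powr (q - 1) * \<bar>b\<bar> = (t * \<bar>a\<bar>) powr (q - 1) * (1 / t powr (q - 1) * \<bar>b\<bar>)" using t by (simp add: powr_mult)
    also have "\<dots> \<le> (t * \<bar>a\<bar>) powr q + (1 / t powr (q - 1) * \<bar>b\<bar>) powr q" using t q2 by (intro powr_times_le) auto
    also have "\<dots> = t powr q * \<bar>a\<bar> powr q + A * \<bar>b\<bar> powr q" using t by (simp add: powr_mult A_def powr_divide)
    also have "\<dots> \<le> e * \<bar>a\<bar> powr q + C * \<bar>b\<bar> powr q" by (rule P[OF C(3)])
    finally show "gr a * \<bar>b\<bar> \<le> e * (a^2 + \<bar>a\<bar> powr q) + C * (b^2 + \<bar>b\<bar> powr q)"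
      using lin[of a b] unfolding gr_def distrib_left distrib_right by linarith
    have "\<bar>b\<bar> powr (q - 1) * \<bar>a\<bar> = (1 / t powr (1 / (q - 1)) * \<bar>b\<bar>) powr (q - 1) * (t * \<bar>a\<bar>)"
      using t q2 by (simp add: powr_mult powr_divide powr_powr)
    also have "\<dots> \<le> (1 / t powr (1 / (q - 1)) * \<bar>b\<bar>) powr q + (t * \<bar>a\<bar>) powr q" using t q2 by (intro powr_times_le) auto
    also have "\<dots> = t powr q * \<bar>a\<bar> powr q + B * \<bar>b\<bar> powr q" using t by (simp add: powr_mult B_def powr_divide)
    also have "\<dots> \<le> e * \<bar>a\<bar> powr q + C * \<bar>b\<bar> powr q" by (rule P[OF C(4)])
    finally show "gr b * \<bar>a\<bar> \<le> e * (a^2 + \<bar>a\<bar> powr q) + C * (b^2 + \<bar>b\<bar> powr q)"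
      using lin[of a b] unfolding gr_def distrib_left distrib_right by (simp add: mult.commute)
  qed
qed

lemma square_powr_integral_bound:
  obtains K where "\<And>u. X1 V u \<Longrightarrow> nrm u \<le> R \<Longrightarrow> (LINT x|lebesgue. (u x)^2 + \<bar>u x\<bar> powr q) \<le> K"
proof -
  obtain CS where "CS > 0" "\<And>u. X1 V u \<Longrightarrow> integrable lebesgue (\<lambda>x. \<bar>u x\<bar> powr q)"
    "\<And>u. X1 V u \<Longrightarrow> (LINT x|lebesgue. \<bar>u x\<bar> powr q) \<le> CS * nrm u powr q" by (rule Sobolev_X1) (rule that)
  note CS = this(1,3)
  show ?thesis
  proof (rule that[of "R^2 / V0 + CS * R powr q"])
    fix u assume u: "X1 V u" and n: "nrm u \<le> R"
    have "(LINT x|lebesgue. (u x)^2 + \<bar>u x\<bar> powr q) = (LINT x|lebesgue. (u x)^2) + (LINT x|lebesgue. \<bar>u x\<bar> powr q)"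
      by (intro Bochner_Integration.integral_add square_integrable powr_q_integrable u)
    also have "\<dots> \<le> (nrm u)^2 / V0 + CS * nrm u powr q" by (intro add_mono square_integral_le CS(2) u)
    also have "\<dots> \<le> R^2 / V0 + CS * R powr q"
      using n V0 CS(1) q2 by (intro add_mono divide_right_mono power_mono mult_left_mono powr_mono2) auto
    finally show "(LINT x|lebesgue. (u x)^2 + \<bar>u x\<bar> powr q) \<le> R^2 / V0 + CS * R powr q" .
  qed
qed

text \<open>h is fixed, so Young's inequality can put the small factor on u_n^2 + |u_n|^q, whose
  integrals are bounded by Sobolev; then \<open>integral_tendsto_0_eps_dominated\<close>
  applies.\<close>

lemma f_integral_tendsto:
  assumes u: "\<And>n. X1 V (u n)" and n: "\<And>n. nrm (u n) \<le> R" and U: "X1 V U" and h: "X1 V h"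
    and ae: "AE x in lebesgue. (\<lambda>n. u n x) \<longlonglongrightarrow> U x"
  shows "(\<lambda>n. LINT x|lebesgue. f (u n x) * h x) \<longlonglongrightarrow> (LINT x|lebesgue. f (U x) * h x)"
proof -
  obtain K where K: "\<And>u. X1 V u \<Longrightarrow> nrm u \<le> R \<Longrightarrow> (LINT x|lebesgue. (u x)^2 + \<bar>u x\<bar> powr q) \<le> K"
    by (rule square_powr_integral_bound) (rule that)
  obtain C where C: "C > 0" "\<And>a. \<bar>f a\<bar> \<le> C * gr a" by (rule f_dominated) (rule that)
  have i: "integrable lebesgue (\<lambda>x. (v x)^2 + \<bar>v x\<bar> powr q)" if "X1 V v" for v
    by (intro Bochner_Integration.integrable_add square_integrable powr_q_integrable that)
  have "(\<lambda>n. LINT x|lebesgue. f (u n x) * h x - f (U x) * h x) \<longlonglongrightarrow> 0"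
  proof (rule integral_tendsto_0_eps_dominated[where B="\<lambda>n x. (u n x)^2 + \<bar>u n x\<bar> powr q" and K=K])
    show "integrable lebesgue (\<lambda>x. f (u n x) * h x - f (U x) * h x)" for n
      by (intro Bochner_Integration.integrable_diff f_integrable u U h)
    show "AE x in lebesgue. (\<lambda>n. f (u n x) * h x - f (U x) * h x) \<longlonglongrightarrow> 0"
      using ae
    proof eventually_elim
      fix x assume "(\<lambda>n. u n x) \<longlonglongrightarrow> U x"
      then have "(\<lambda>n. f (u n x)) \<longlonglongrightarrow> f (U x)"
        using fc by (intro continuous_on_tendsto_compose[where s=UNIV and f=f]) auto
      then have "(\<lambda>n. f (u n x) * h x - f (U x) * h x) \<longlonglongrightarrow> f (U x) * h x - f (U x) * h x" by (intro tendsto_intros)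
      then show "(\<lambda>n. f (u n x) * h x - f (U x) * h x) \<longlonglongrightarrow> 0" by simp
    qed
    show "(LINT x|lebesgue. (u n x)^2 + \<bar>u n x\<bar> powr q) \<le> K" for n by (rule K[OF u assms(2)])
    fix e :: real assume e: "e > 0"
    then have "e / C > 0" using C by simp
    then obtain D where D: "D > 0" "\<And>a b. gr a * \<bar>b\<bar> \<le> e / C * (a^2 + \<bar>a\<bar> powr q) + D * (b^2 + \<bar>b\<bar> powr q)"
      "\<And>a b. gr b * \<bar>a\<bar> \<le> e / C * (a^2 + \<bar>a\<bar> powr q) + D * (b^2 + \<bar>b\<bar> powr q)" by (rule gr_Young) (rule that)
    show "\<exists>G. integrable lebesgue G \<and> (\<forall>n. AE x in lebesgue. \<bar>f (u n x) * h x - f (U x) * h x\<bar> \<le> G x + e * ((u n x)\<^sup>2 + \<bar>u n x\<bar> powr q))"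
    proof (intro exI[of _ "\<lambda>x. C * D * ((h x)^2 + \<bar>h x\<bar> powr q) + \<bar>f (U x) * h x\<bar>"] conjI allI AE_I2)
      show "integrable lebesgue (\<lambda>x. C * D * ((h x)^2 + \<bar>h x\<bar> powr q) + \<bar>f (U x) * h x\<bar>)"
        by (intro Bochner_Integration.integrable_add[OF integrable_mult_right[OF i[OF h]]] integrable_abs f_integrable U h)
      fix n x
      have "\<bar>f (u n x) * h x\<bar> \<le> C * (gr (u n x) * \<bar>h x\<bar>)"
        using mult_right_mono[OF C(2)[of "u n x"], of "\<bar>h x\<bar>"] by (simp add: abs_mult mult.assoc)
      also have "\<dots> \<le> C * (e / C * ((u n x)^2 + \<bar>u n x\<bar> powr q) + D * ((h x)^2 + \<bar>h x\<bar> powr q))"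
        using C(1) D(2) by (intro mult_left_mono) auto
      also have "\<dots> = e * ((u n x)^2 + \<bar>u n x\<bar> powr q) + C * D * ((h x)^2 + \<bar>h x\<bar> powr q)" using C(1) by (simp add: distrib_left)
      finally show "\<bar>f (u n x) * h x - f (U x) * h x\<bar> \<le> C * D * ((h x)^2 + \<bar>h x\<bar> powr q) + \<bar>f (U x) * h x\<bar> + e * ((u n x)\<^sup>2 + \<bar>u n x\<bar> powr q)"
        using abs_triangle_ineq4[of "f (u n x) * h x" "f (U x) * h x"] by linarith
    qed
  qed (use i u in auto)
  moreover have "(LINT x|lebesgue. f (u n x) * h x - f (U x) * h x) = (LINT x|lebesgue. f (u n x) * h x) - (LINT x|lebesgue. f (U x) * h x)" for n
    by (rule Bochner_Integration.integral_diff[OF f_integrable[OF u h] f_integrable[OF U h]])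
  ultimately have "(\<lambda>n. (LINT x|lebesgue. f (u n x) * h x) - (LINT x|lebesgue. f (U x) * h x)) \<longlonglongrightarrow> 0" by simp
  then show ?thesis by (simp add: LIM_zero_iff)
qed

text \<open>Here the direction varies and the argument of f is fixed, so the second version of
  \<open>gr_Young\<close> supplies the domination.\<close>

lemma f_integral_tendsto_right:
  assumes w: "\<And>n. X1 V (w n)" and n: "\<And>n. nrm (w n) \<le> R" and W: "X1 V W" and u: "X1 V u"
    and ae: "AE x in lebesgue. (\<lambda>n. w n x) \<longlonglongrightarrow> W x"
  shows "(\<lambda>n. LINT x|lebesgue. f (u x) * w n x) \<longlonglongrightarrow> (LINT x|lebesgue. f (u x) * W x)"
proof -
  obtain K where K: "\<And>u. X1 V u \<Longrightarrow> nrm u \<le> R \<Longrightarrow> (LINT x|lebesgue. (u x)^2 + \<bar>u x\<bar> powr q) \<le> K"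
    by (rule square_powr_integral_bound) (rule that)
  obtain C where C: "C > 0" "\<And>a. \<bar>f a\<bar> \<le> C * gr a" by (rule f_dominated) (rule that)
  have i: "integrable lebesgue (\<lambda>x. (v x)^2 + \<bar>v x\<bar> powr q)" if "X1 V v" for v
    by (intro Bochner_Integration.integrable_add square_integrable powr_q_integrable that)
  have "(\<lambda>n. LINT x|lebesgue. f (u x) * w n x - f (u x) * W x) \<longlonglongrightarrow> 0"
  proof (rule integral_tendsto_0_eps_dominated[where B="\<lambda>n x. (w n x)^2 + \<bar>w n x\<bar> powr q" and K=K])
    show "integrable lebesgue (\<lambda>x. f (u x) * w n x - f (u x) * W x)" for n
      by (intro Bochner_Integration.integrable_diff f_integrable u w W)
    show "AE x in lebesgue. (\<lambda>n. f (u x) * w n x - f (u x) * W x) \<longlonglongrightarrow> 0"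
      using ae
    proof eventually_elim
      fix x assume "(\<lambda>n. w n x) \<longlonglongrightarrow> W x"
      then have "(\<lambda>n. f (u x) * w n x - f (u x) * W x) \<longlonglongrightarrow> f (u x) * W x - f (u x) * W x" by (intro tendsto_intros)
      then show "(\<lambda>n. f (u x) * w n x - f (u x) * W x) \<longlonglongrightarrow> 0" by simp
    qed
    show "(LINT x|lebesgue. (w n x)^2 + \<bar>w n x\<bar> powr q) \<le> K" for n by (rule K[OF w assms(2)])
    fix e :: real assume e: "e > 0"
    then have "e / C > 0" using C by simp
    then obtain D where D: "D > 0" "\<And>a b. gr a * \<bar>b\<bar> \<le> e / C * (a^2 + \<bar>a\<bar> powr q) + D * (b^2 + \<bar>b\<bar> powr q)"
      "\<And>a b. gr b * \<bar>a\<bar> \<le> e / C * (a^2 + \<bar>a\<bar> powr q) + D * (b^2 + \<bar>b\<bar> powr q)" by (rule gr_Young) (rule that)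
    show "\<exists>G. integrable lebesgue G \<and> (\<forall>n. AE x in lebesgue. \<bar>f (u x) * w n x - f (u x) * W x\<bar> \<le> G x + e * ((w n x)\<^sup>2 + \<bar>w n x\<bar> powr q))"
    proof (intro exI[of _ "\<lambda>x. C * D * ((u x)^2 + \<bar>u x\<bar> powr q) + \<bar>f (u x) * W x\<bar>"] conjI allI AE_I2)
      show "integrable lebesgue (\<lambda>x. C * D * ((u x)^2 + \<bar>u x\<bar> powr q) + \<bar>f (u x) * W x\<bar>)"
        by (intro Bochner_Integration.integrable_add[OF integrable_mult_right[OF i[OF u]]] integrable_abs f_integrable u W)
      fix n x
      have "\<bar>f (u x) * w n x\<bar> \<le> C * (gr (u x) * \<bar>w n x\<bar>)"
        using mult_right_mono[OF C(2)[of "u x"], of "\<bar>w n x\<bar>"] by (simp add: abs_mult mult.assoc)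
      also have "\<dots> \<le> C * (e / C * ((w n x)^2 + \<bar>w n x\<bar> powr q) + D * ((u x)^2 + \<bar>u x\<bar> powr q))"
        using C(1) D(3) by (intro mult_left_mono) auto
      also have "\<dots> = e * ((w n x)^2 + \<bar>w n x\<bar> powr q) + C * D * ((u x)^2 + \<bar>u x\<bar> powr q)" using C(1) by (simp add: distrib_left)
      finally show "\<bar>f (u x) * w n x - f (u x) * W x\<bar> \<le> C * D * ((u x)^2 + \<bar>u x\<bar> powr q) + \<bar>f (u x) * W x\<bar> + e * ((w n x)\<^sup>2 + \<bar>w n x\<bar> powr q)"
        using abs_triangle_ineq4[of "f (u x) * w n x" "f (u x) * W x"] by linarith
    qed
  qed (use i w in auto)
  moreover have "(LINT x|lebesgue. f (u x) * w n x - f (u x) * W x) = (LINT x|lebesgue. f (u x) * w n x) - (LINT x|lebesgue. f (u x) * W x)" for n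
    by (rule Bochner_Integration.integral_diff[OF f_integrable[OF u w] f_integrable[OF u W]])
  ultimately have "(\<lambda>n. (LINT x|lebesgue. f (u x) * w n x) - (LINT x|lebesgue. f (u x) * W x)) \<longlonglongrightarrow> 0" by simp
  then show ?thesis by (simp add: LIM_zero_iff)
qed

end

section \<open>Symmetric criticality\<close>

context variational
begin

lemma dJ_AE_cong:
  assumes u: "X1 V u" and h: "X1 V h" and ae: "AE x in lebesgue. k x = h x" shows "dJ u k = dJ u h"
proof -
  have "E u k = E u h" using E_AE_cong[OF h ae u] by (simp add: E_commute)
  moreover have "(LINT x|lebesgue. f (u x) * k x) = (LINT x|lebesgue. f (u x) * h x)"
  proof (rule integral_cong_AE)
    note [measurable] = X1_measurable[OF u] X1_measurable[OF h] X1_measurable[OF X1_AE_cong(1)[OF h ae]]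
    show "(\<lambda>x. f (u x) * k x) \<in> borel_measurable lebesgue" "(\<lambda>x. f (u x) * h x) \<in> borel_measurable lebesgue" by measurable
    show "AE x in lebesgue. f (u x) * k x = f (u x) * h x" using ae by eventually_elim simp
  qed
  ultimately show ?thesis by (simp add: dJ_def)
qed

text \<open>The hull takes the place of a Haar average over the group. The form \<open>dJ u\<close>
  is linear and unchanged by rotating its argument, hence constant on the hull, and it passes to the
  weak limit; so its value at h is its value at an invariant function, where it vanishes.\<close>

lemma symmetric_criticality:
  assumes Vinv: "G_invariant V" and u: "X1G V u" and z: "\<And>h. X1G V h \<Longrightarrow> dJ u h = 0" and h: "X1 V h"
  shows "dJ u h = 0"
proof -
  have uX: "X1 V u" using u by (rule X1G_X1)
  define T :: "('y \<Rightarrow> 'y) \<Rightarrow> 'y \<times> 'z \<Rightarrow> 'y \<times> 'z" where "T A x = (A (fst x), snd x)" for A x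
  have To: "orthogonal_transformation (T A)" if "orthogonal_transformation A" for A
    unfolding T_def[abs_def] by (rule orthogonal_first_factor[OF that])
  have uT: "u (T A x) = u x" if "orthogonal_transformation A" for A x
    using u that unfolding X1G_def G_invariant_def T_def by (metis prod.collapse)
  have XT: "X1 V (\<lambda>x. v (T A x))" if "orthogonal_transformation A" "X1 V v" for A v
    using X1_orthogonal(1)[OF Vinv that] by (simp add: T_def)
  have ET: "E (\<lambda>x. v (T A x)) (\<lambda>x. w (T A x)) = E v w" if "orthogonal_transformation A" "X1 V v" "X1 V w" for A v w
    using X1_orthogonal(2)[OF Vinv that] by (simp add: T_def)
  have dT: "dJ u (\<lambda>x. v (T A x)) = dJ u v" if A: "orthogonal_transformation A" and v: "X1 V v" for A v
  proof -
    have "E u (\<lambda>x. v (T A x)) = E u v" using ET[OF A uX v] by (simp add: uT[OF A])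
    moreover have "(LINT x|lebesgue. f (u x) * v (T A x)) = (LINT x|lebesgue. (\<lambda>x. f (u x) * v x) (T A x))" by (simp add: uT[OF A])
    moreover have "\<dots> = (LINT x|lebesgue. f (u x) * v x)"
      by (rule mp_integral[OF mp_orthogonal[OF To[OF A]]]) (use f_integrable[OF uX v] in auto)
    ultimately show ?thesis by (simp add: dJ_def)
  qed
  define S where "S = {(\<lambda>x. h (T A x)) | A. orthogonal_transformation A}"
  define H where "H = mid_hull S"
  have H: "X1 V v \<and> dJ u v = dJ u h" if "v \<in> H" for v
    using that unfolding H_def
  proof induction
    case (base v)
    then show ?case using XT[OF _ h] dT[OF _ h] by (auto simp: S_def)
  next
    case (mid v w)
    then have vw: "X1 V v" "X1 V w" "dJ u v = dJ u h" "dJ u w = dJ u h" by auto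
    have "X1 V (\<lambda>x. (1/2) * (v x + w x))" by (intro X1_cmult X1_add vw)
    moreover have "dJ u (\<lambda>x. (1/2) * (v x + w x)) = dJ u h"
      using dJ_cmult[OF uX X1_add[OF vw(1,2)], of "1/2"] dJ_add[OF uX vw(1,2)] vw by simp
    ultimately show ?case by simp
  qed
  have HT: "(\<lambda>x. v (T A x)) \<in> H" if v: "v \<in> H" and A: "orthogonal_transformation A" for v A
    using v unfolding H_def
  proof induction
    case (base v)
    then obtain B where B: "orthogonal_transformation B" "v = (\<lambda>x. h (T B x))" by (auto simp: S_def)
    have "(\<lambda>x. v (T A x)) = (\<lambda>x. h (T (B \<circ> A) x))" by (simp add: B T_def)
    moreover have "orthogonal_transformation (B \<circ> A)" by (rule orthogonal_transformation_compose[OF B(1) A])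
    ultimately show ?case by (intro mid_hull.base) (auto simp: S_def)
  next
    case (mid v w)
    then show ?case using mid_hull.mid[of "\<lambda>x. v (T A x)" S "\<lambda>x. w (T A x)"] by simp
  qed
  have "orthogonal_transformation (id :: 'y \<Rightarrow> 'y)" by (auto simp: orthogonal_transformation_def intro: linear_id)
  then have "(\<lambda>x. h (T id x)) \<in> H" unfolding H_def by (intro mid_hull.base) (auto simp: S_def)
  then have Hne: "H \<noteq> {}" by auto
  define d where "d = Inf (norm1sq V ` H)"
  have bdd: "bdd_below (norm1sq V ` H)" by (rule bdd_belowI[of _ 0]) auto
  have dle: "d \<le> norm1sq V v" if "v \<in> H" for v unfolding d_def using bdd that by (intro cInf_lower) auto
  have "\<exists>v\<in>H. norm1sq V v < d + 1 / real (Suc n)" for n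
  proof -
    have "Inf (norm1sq V ` H) < d + 1 / real (Suc n)" by (simp add: d_def)
    then show ?thesis using cInf_lessD[of "norm1sq V ` H"] Hne by blast
  qed
  then obtain w where w: "\<And>n. w n \<in> H" "\<And>n. norm1sq V (w n) < d + 1 / real (Suc n)" by metis
  have wX: "X1 V (w n)" and wd: "dJ u (w n) = dJ u h" for n using H[OF w(1)] by auto
  have wM: "norm1sq V (w n) \<le> d + 1" for n
  proof -
    have "1 / real (Suc n) \<le> 1" by simp
    then show ?thesis using w(2)[of n] by linarith
  qed
  obtain \<kappa> U where \<kappa>: "strict_mono (\<kappa>::nat\<Rightarrow>nat)" and "U = (\<lambda>x. lim (\<lambda>n. w (\<kappa> n) x))" and UX: "X1 V U"
    and ae: "AE x in lebesgue. (\<lambda>n. w (\<kappa> n) x) \<longlonglongrightarrow> U x"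
    and "\<And>R. (\<lambda>n. loc_n2 R (\<lambda>x. w (\<kappa> n) x - U x)) \<longlonglongrightarrow> 0"
    and wk: "\<And>h. X1 V h \<Longrightarrow> (\<lambda>n. E (w (\<kappa> n)) h) \<longlonglongrightarrow> E U h"
    by (rule X1_compact[OF wX wM]) (rule that)
  have nw: "nrm (w (\<kappa> n)) \<le> sqrt (d + 1)" for n unfolding nrm_def using wM by simp
  have "(\<lambda>n. dJ u (w (\<kappa> n))) \<longlonglongrightarrow> dJ u U"
    unfolding dJ_def E_commute[of u] by (intro tendsto_intros wk uX f_integral_tendsto_right[OF wX nw UX uX ae])
  then have dU: "dJ u U = dJ u h" by (simp add: wd LIMSEQ_const_iff)
  have Uinv: "AE x in lebesgue. U (T A x) = U x" if A: "orthogonal_transformation A" for A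
  proof -
    define g where "g n x = w (\<kappa> n) x - w (\<kappa> n) (T A x)" for n x
    have mT: "mp (T A)" by (rule mp_orthogonal[OF To[OF A]])
    have gX: "X1 V (g n)" for n unfolding g_def[abs_def] by (rule X1_diff[OF wX XT[OF A wX]])
    \<comment> \<open>\<open>w (\<kappa> n)\<close> and its rotated copy lie in the hull and have
      equal norms. Their midpoint has squared norm at least d, so the parallelogram law bounds their
      difference by four times the excess over d.\<close>
    have small: "norm1sq V (g n) \<le> 4 / real (Suc n)" for n
    proof -
      let ?v = "w (\<kappa> n)" and ?t = "\<lambda>x. w (\<kappa> n) (T A x)"
      have t: "X1 V ?t" "?t \<in> H" using XT[OF A wX] HT[OF w(1) A] by auto
      have nt: "norm1sq V ?t = norm1sq V ?v" using ET[OF A wX[of "\<kappa> n"] wX[of "\<kappa> n"]] by (simp only: E_self)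
      have "(\<lambda>x. (1/2) *\<^sub>R (?v x + ?t x)) \<in> H" unfolding H_def using w(1) t(2) by (intro mid_hull.mid) (auto simp: H_def)
      then have "d \<le> norm1sq V (\<lambda>x. (1/2) * (?v x + ?t x))" using dle by force
      also have "\<dots> = (1/2)^2 * (norm1sq V ?v + 2 * E ?v ?t + norm1sq V ?t)"
        unfolding norm1sq_cmult[OF X1_add[OF wX t(1)]] norm1sq_add[OF wX t(1)] ..
      finally have m: "4 * d \<le> norm1sq V ?v + 2 * E ?v ?t + norm1sq V ?t" by (simp add: power2_eq_square)
      have "norm1sq V (g n) = norm1sq V (\<lambda>x. ?v x + (-1) * ?t x)" unfolding g_def[abs_def] by simp
      also have "\<dots> = norm1sq V ?v - 2 * E ?v ?t + norm1sq V ?t"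
        unfolding norm1sq_add[OF wX X1_cmult[OF t(1)]] norm1sq_cmult[OF t(1)] E_cmult_right[OF t(1) wX] by simp
      also have "\<dots> \<le> 4 * norm1sq V ?v - 4 * d" using m nt by linarith
      also have "\<dots> \<le> 4 * (1 / real (Suc (\<kappa> n)))" using w(2)[of "\<kappa> n"] by linarith
      also have "\<dots> \<le> 4 * (1 / real (Suc n))"
        using seq_suble[OF \<kappa>, of n] by (intro mult_left_mono divide_left_mono) auto
      finally show ?thesis by simp
    qed
    have "n2 (\<lambda>x. U x - U (T A x)) \<le> 0"
    proof (rule field_le_epsilon)
      fix e :: real assume e: "e > 0"
      obtain N :: nat where N: "4 / (V0 * e) < real N" using reals_Archimedean2 by blast
      have "n2 (\<lambda>x. U x - U (T A x)) \<le> e"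
      proof (rule L2_Fatou(2)[where g="\<lambda>n. g (n + N)"])
        show "L2 (g (n + N))" for n by (rule X1_L2[OF gX])
        fix n
        have "V0 * n2 (g (n + N)) \<le> 4 / real (Suc (n + N))" using n2_le_norm1sq[OF gX] small by (rule order_trans)
        also have "\<dots> \<le> V0 * e"
        proof -
          have "4 / (V0 * e) \<le> real (Suc (n + N))" using N by simp
          then have "4 \<le> real (Suc (n + N)) * (V0 * e)" using V0 e by (simp add: pos_divide_le_eq)
          then show ?thesis by (simp add: pos_divide_le_eq mult.commute)
        qed
        finally show "n2 (g (n + N)) \<le> e" using V0 by simp
      next
        have "AE x in lebesgue. (\<lambda>n. w (\<kappa> n) (T A x)) \<longlonglongrightarrow> U (T A x)" by (rule mp_AE[OF mT ae])
        with ae show "AE x in lebesgue. (\<lambda>n. g (n + N) x) \<longlonglongrightarrow> U x - U (T A x)"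
        proof eventually_elim
          fix x assume "(\<lambda>n. w (\<kappa> n) x) \<longlonglongrightarrow> U x" "(\<lambda>n. w (\<kappa> n) (T A x)) \<longlonglongrightarrow> U (T A x)"
          then have "(\<lambda>n. g n x) \<longlonglongrightarrow> U x - U (T A x)" unfolding g_def by (intro tendsto_intros)
          then show "(\<lambda>n. g (n + N) x) \<longlonglongrightarrow> U x - U (T A x)" by (rule LIMSEQ_ignore_initial_segment)
        qed
      qed
      then show "n2 (\<lambda>x. U x - U (T A x)) \<le> 0 + e" by simp
    qed
    then have "n2 (\<lambda>x. U x - U (T A x)) = 0" using n2_nonneg[of "\<lambda>x. U x - U (T A x)"] by linarith
    then have "AE x in lebesgue. U x - U (T A x) = 0"
      by (rule n2_eq_0[OF X1_L2[OF X1_diff[OF UX XT[OF A UX]]]])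
    then show ?thesis by eventually_elim simp
  qed
  \<comment> \<open>So far the exceptional null set depends on A; the limit of ball averages is a
    representative invariant under all rotations at every point.\<close>
  obtain U' where U': "AE x in lebesgue. U' x = U x" "\<And>S x. S \<in> T ` {A. orthogonal_transformation A} \<Longrightarrow> U' (S x) = U' x"
  proof (rule AE_invariant_modification[OF X1_H1[OF UX], of "T ` {A. orthogonal_transformation A}"])
    show "\<And>S. S \<in> T ` {A. orthogonal_transformation A} \<Longrightarrow> orthogonal_transformation S \<and> (AE x in lebesgue. U (S x) = U x)"
      using To Uinv by auto
  qed (rule that)
  have "G_invariant U'" unfolding G_invariant_def
  proof (intro allI impI)
    fix A :: "'y \<Rightarrow> 'y" and y z assume "orthogonal_transformation A"
    then show "U' (A y, z) = U' (y, z)" using U'(2)[of "T A" "(y, z)"] by (simp add: T_def)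
  qed
  then have "X1G V U'" using X1_AE_cong(1)[OF UX U'(1)] by (simp add: X1G_def)
  then show ?thesis using z dJ_AE_cong[OF uX UX U'(1)] dU by simp
qed

section \<open>The dichotomy\<close>

text \<open>On the Nehari set the energy loses its gradient term, so Fatou can be applied knowing no
  more than a.e. convergence of the functions.\<close>

lemma J_Nehari_eq:
  assumes "X1 V u" "Nf u = 0" shows "J1 V f u = (LINT x|lebesgue. f (u x) * u x / 2 - prim f (u x))"
  using assms(2) f_integrable[OF assms(1,1)] prim_integrable[OF assms(1)]
  by (simp add: J1_def Nf_def)

lemma nontrivial_limit:
  assumes Vinv: "G_invariant V" and u: "\<And>n. u n \<in> Nehari1 V f" and J: "(\<lambda>n. J1 V f (u n)) \<longlonglongrightarrow> c1 V f"
    and R: "\<And>n. nrm (u n) \<le> R" and UG: "X1G V U" and nz: "\<not> (AE x in lebesgue. U x = 0)"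
    and ae: "AE x in lebesgue. (\<lambda>n. u n x) \<longlonglongrightarrow> U x" and wk: "\<And>h. X1 V h \<Longrightarrow> (\<lambda>n. E (u n) h) \<longlonglongrightarrow> E U h"
  shows "J1_critical V f U \<and> J1 V f U = c1 V f"
proof -
  have uX: "X1 V (u n)" and uN: "Nf (u n) = 0" for n using u[of n] by (auto simp: Nehari_iff X1G_def)
  have UX: "X1 V U" by (rule X1G_X1[OF UG])
  have lim: "(\<lambda>n. dJ (u n) h) \<longlonglongrightarrow> dJ U h" if "X1 V h" for h
    unfolding dJ_def by (intro tendsto_intros wk f_integral_tendsto[OF uX R UX _ ae] that)
  \<comment> \<open>Only a one-sided bound is available, but for every invariant direction of norm
    at most 1; applying it to h and -h yields equality.\<close>
  have half: "0 \<le> dJ U h" if h: "X1G V h" "nrm h \<le> 1" for h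
  proof (rule field_le_epsilon)
    fix \<omega> :: real assume \<omega>: "\<omega> > 0"
    obtain \<epsilon>0 where \<epsilon>0: "\<epsilon>0 > 0" "\<And>u h. u \<in> Nehari1 V f \<Longrightarrow> J1 V f u < c1 V f + \<epsilon>0 \<Longrightarrow> X1G V h \<Longrightarrow> nrm h \<le> 1 \<Longrightarrow> - \<omega> \<le> dJ u h"
      by (rule Nehari_almost_critical[OF \<omega>]) (rule that)
    have "\<forall>\<^sub>F n in sequentially. J1 V f (u n) < c1 V f + \<epsilon>0" using order_tendstoD(2)[OF J] \<epsilon>0(1) by simp
    then have "\<forall>\<^sub>F n in sequentially. - \<omega> \<le> dJ (u n) h" by eventually_elim (rule \<epsilon>0(2)[OF u _ h])
    then have "- \<omega> \<le> dJ U h" by (rule tendsto_lowerbound[OF lim[OF X1G_X1[OF h(1)]]]) simp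
    then show "0 \<le> dJ U h + \<omega>" by simp
  qed
  have zero: "dJ U h = 0" if h: "X1G V h" for h
  proof -
    have hX: "X1 V h" by (rule X1G_X1[OF h])
    define t where "t = 1 / (nrm h + 1)"
    have n1: "nrm h + 1 > 0" by (simp add: add_nonneg_pos)
    then have t: "t > 0" by (simp add: t_def)
    have "t * nrm h \<le> 1" using n1 by (simp add: t_def divide_le_eq)
    then have "\<bar>t\<bar> * nrm h \<le> 1" using t by simp
    then have n: "nrm (\<lambda>x. t * h x) \<le> 1" "nrm (\<lambda>x. (-t) * h x) \<le> 1" unfolding nrm_cmult[OF hX] by simp_all
    have "0 \<le> dJ U (\<lambda>x. t * h x)" "0 \<le> dJ U (\<lambda>x. (-t) * h x)"
      by (rule half[OF X1G_cmult[OF h] n(1)], rule half[OF X1G_cmult[OF h] n(2)])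
    then have "0 \<le> t * dJ U h" "0 \<le> (-t) * dJ U h" unfolding dJ_cmult[OF UX hX] by auto
    then have "t * dJ U h = 0" by linarith
    then show ?thesis using t by simp
  qed
  \<comment> \<open>Criticality in the direction U itself places U on the Nehari set, which gives c1
    \<le> J(U); the converse comes from Fatou.\<close>
  have UN: "Nf U = 0" using zero[OF UG] by (simp add: dJ_self)
  then have "U \<in> Nehari1 V f" using UG nz by (simp add: Nehari_iff)
  then have ge: "c1 V f \<le> J1 V f U" by (rule c1_le)
  define k where "k a = f a * a / 2 - prim f a" for a
  have k0: "0 \<le> k a" for a using prim_le_half[of a] by (simp add: k_def)
  have kc: "continuous_on UNIV k" unfolding k_def by (intro continuous_intros fc prim_continuous) auto
  have [measurable]: "k \<in> borel_measurable borel" by (rule borel_measurable_continuous_onI[OF kc])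
  have ki: "integrable lebesgue (\<lambda>x. k (v x))" if "X1 V v" for v
    unfolding k_def using f_integrable[OF that that] prim_integrable[OF that] by simp
  note [measurable] = X1_measurable[OF uX] X1_measurable[OF UX]
  have kJ: "(\<integral>\<^sup>+x. ennreal (k (v x)) \<partial>lebesgue) = ennreal (J1 V f v)" if "X1 V v" "Nf v = 0" for v
    using nn_integral_eq_integral[OF ki[OF that(1)]] k0 J_Nehari_eq[OF that] by (simp add: k_def)
  have "ennreal (J1 V f U) = (\<integral>\<^sup>+x. ennreal (k (U x)) \<partial>lebesgue)" by (rule kJ[OF UX UN, symmetric])
  also have "\<dots> = (\<integral>\<^sup>+x. liminf (\<lambda>n. ennreal (k (u n x))) \<partial>lebesgue)"
  proof (rule nn_integral_cong_AE, use ae in eventually_elim)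
    fix x assume "(\<lambda>n. u n x) \<longlonglongrightarrow> U x"
    then have "(\<lambda>n. k (u n x)) \<longlonglongrightarrow> k (U x)"
      using kc by (intro continuous_on_tendsto_compose[where s=UNIV and f=k]) auto
    then have "(\<lambda>n. ennreal (k (u n x))) \<longlonglongrightarrow> ennreal (k (U x))" by (rule tendsto_ennrealI)
    then show "ennreal (k (U x)) = liminf (\<lambda>n. ennreal (k (u n x)))" by (intro lim_imp_Liminf[symmetric]) auto
  qed
  also have "\<dots> \<le> liminf (\<lambda>n. \<integral>\<^sup>+x. ennreal (k (u n x)) \<partial>lebesgue)" by (rule nn_integral_liminf) measurable
  also have "\<dots> = liminf (\<lambda>n. ennreal (J1 V f (u n)))" by (simp only: kJ[OF uX uN])
  also have "\<dots> = ennreal (c1 V f)" using J by (intro lim_imp_Liminf tendsto_ennrealI) auto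
  finally have enn: "ennreal (J1 V f U) \<le> ennreal (c1 V f)" .
  \<comment> \<open>\<open>ennreal\<close> sends negative numbers to 0, so returning to reals needs
    c1 \<ge> 0.\<close>
  have le: "J1 V f U \<le> c1 V f"
  proof -
    have "0 \<le> c1 V f" by (rule LIMSEQ_le_const[OF J]) (use J_nonneg[OF uX uN] in auto)
    then show ?thesis using enn by (simp add: ennreal_le_iff)
  qed
  have "J1_critical V f U" by (intro critical_if_dJ_zero UX symmetric_criticality[OF Vinv UG zero])
  then show ?thesis using ge le by simp
qed

end

section \<open>Constant potentials and the comparison with the problem at infinity\<close>

lemma X1_const_iff: "X1 (\<lambda>_. k) u \<longleftrightarrow> Yspace u"
proof (cases "H1 u")
  case True
  have i: "integrable lebesgue (\<lambda>x. k * (u x)^2)" using True by (simp add: H1_def)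
  have "integrable lebesgue (\<lambda>x. (u x)^2 / (norm (fst x))^2 + k * (u x)^2) \<longleftrightarrow> integrable lebesgue (\<lambda>x. (u x)^2 / (norm (fst x))^2)"
  proof
    assume "integrable lebesgue (\<lambda>x. (u x)^2 / (norm (fst x))^2 + k * (u x)^2)"
    from Bochner_Integration.integrable_diff[OF this i] show "integrable lebesgue (\<lambda>x. (u x)^2 / (norm (fst x))^2)" by simp
  next
    assume "integrable lebesgue (\<lambda>x. (u x)^2 / (norm (fst x))^2)"
    from Bochner_Integration.integrable_add[OF this i] show "integrable lebesgue (\<lambda>x. (u x)^2 / (norm (fst x))^2 + k * (u x)^2)" .
  qed
  then show ?thesis by (simp add: X1_def Yspace_def)
qed (simp add: X1_def Yspace_def)

lemma mk_eq_c1: "mk TYPE('y::euclidean_space) TYPE('z::euclidean_space) k f = c1 (\<lambda>_::'y \<times> 'z. k) f"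
proof -
  have "Qk k = norm1sq (\<lambda>_::'y \<times> 'z. k)" by (rule ext) (simp add: Qk_def norm1sq_def)
  then have "Mk k f = Nehari1 (\<lambda>_::'y \<times> 'z. k) f" "Phi k f = J1 (\<lambda>_::'y \<times> 'z. k) f"
    by (auto simp: Mk_def Nehari1_def YG_def X1G_def X1_const_iff Phi_def J1_def fun_eq_iff)
  then show ?thesis by (simp add: mk_def c1_def)
qed

context variational
begin

lemma energy_density_integrable:
  assumes "X1 V u" shows "integrable lebesgue (\<lambda>x. (norm (grad u x))^2 + (u x)^2 / (norm (fst x))^2 + V x * (u x)^2)"
  using X1_emb[OF assms] unfolding L2_def emb_norm by simp

text \<open>If a minimising sequence vanishes locally, the potential may be replaced by its value at infinity.\<close>

lemma vanishing_limit:
  assumes Vi: "Vinf > 0" and Vlim: "\<And>e. e > 0 \<Longrightarrow> \<exists>\<rho>. \<forall>x. \<rho> \<le> norm x \<longrightarrow> Vinf - e \<le> V x"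
    and u: "\<And>n. u n \<in> Nehari1 V f" and J: "(\<lambda>n. J1 V f (u n)) \<longlonglongrightarrow> c1 V f"
    and R: "\<And>n. nrm (u n) \<le> R" and loc: "\<And>\<rho>. (\<lambda>n. loc_n2 \<rho> (u n)) \<longlonglongrightarrow> 0"
  shows "c1 (\<lambda>_::'y \<times> 'z. Vinf) f \<le> c1 V f"
proof -
  interpret W: variational "\<lambda>_::'y \<times> 'z. Vinf" Vinf f q
    by unfold_locales (use Vi dim3 q_sub in auto)
  have uG: "X1G V (u n)" and uX: "X1 V (u n)" and uN: "Nf (u n) = 0" and u0: "\<not> (AE x in lebesgue. u n x = 0)" for n
    using u[of n] by (auto simp: Nehari_iff X1G_def)
  have XW: "X1 (\<lambda>_. Vinf) v" if v: "X1 V v" for v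
  proof -
    have [measurable]: "v \<in> borel_measurable lebesgue" by (rule X1_measurable[OF v])
    have "integrable lebesgue (\<lambda>x. (norm (v x / norm (fst x)))^2)" using E_split(2)[OF v v] by (simp add: L2_def)
    then have "Yspace v" using X1_H1[OF v] by (simp add: Yspace_def power_divide)
    then show ?thesis by (simp add: X1_const_iff)
  qed
  have uW: "X1G (\<lambda>_. Vinf) (u n)" for n using XW[OF uX] uG[of n] by (simp add: X1G_def)
  have R0: "R \<ge> 0" using order_trans[OF nrm_nonneg R] .
  have n2R: "n2 (u n) \<le> R^2 / V0" for n
  proof -
    have "V0 * n2 (u n) \<le> R^2" using n2_le_norm1sq[OF uX] power_mono[OF R nrm_nonneg, of n 2] by (simp add: nrm_sq) (meson order_trans)
    then show ?thesis using V0 by (simp add: field_simps)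
  qed
  \<comment> \<open>Outside the ball of radius \<rho> the potential falls short of Vinf by at most
    e; inside, the loss is at most Vinf times the local mass because V is positive.\<close>
  have cmp: "norm1sq (\<lambda>_. Vinf) v - (e * n2 v + Vinf * loc_n2 \<rho> v) \<le> norm1sq V v"
    if v: "X1 V v" and e: "e > 0" and \<rho>: "\<And>x. \<rho> \<le> norm x \<Longrightarrow> Vinf - e \<le> V x" for v e \<rho>
  proof -
    define b where "b x = indicat_real (ball 0 \<rho>) x * (v x)^2" for x
    have bl: "b x = (norm (indicator (ball 0 \<rho>) x *\<^sub>R v x))^2" for x by (simp add: b_def indicator_def)
    have ib: "integrable lebesgue b"
      unfolding bl[abs_def] using L2_indicator[OF X1_L2[OF v], of "ball 0 \<rho>"] by (simp add: L2_def)
    have lb: "loc_n2 \<rho> v = (LINT x|lebesgue. b x)" unfolding loc_n2_def n2_def bl ..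
    have iv: "integrable lebesgue (\<lambda>x. (v x)^2)" by (rule square_integrable[OF v])
    have i1: "integrable lebesgue (\<lambda>x. (norm (grad v x))^2 + (v x)^2 / (norm (fst x))^2 + Vinf * (v x)^2)"
      by (rule W.energy_density_integrable[OF XW[OF v]])
    have i2: "integrable lebesgue (\<lambda>x. e * (v x)^2 + Vinf * b x)" using ib iv by simp
    have "norm1sq (\<lambda>_. Vinf) v - (e * n2 v + Vinf * loc_n2 \<rho> v)
        = (LINT x|lebesgue. ((norm (grad v x))^2 + (v x)^2 / (norm (fst x))^2 + Vinf * (v x)^2) - (e * (v x)^2 + Vinf * b x))"
      unfolding Bochner_Integration.integral_diff[OF i1 i2] norm1sq_def lb using ib iv by (simp add: n2_def)
    also have "\<dots> \<le> norm1sq V v" unfolding norm1sq_def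
    proof (intro integral_mono Bochner_Integration.integrable_diff i1 i2 energy_density_integrable v)
      fix x
      have "(Vinf - e) * (v x)^2 - Vinf * b x \<le> V x * (v x)^2"
      proof (cases "\<rho> \<le> norm x")
        case True
        have "0 \<le> Vinf * b x" using Vi by (simp add: b_def)
        then show ?thesis using mult_right_mono[OF \<rho>[OF True], of "(v x)^2"] by simp
      next
        case False
        then have "b x = (v x)^2" by (simp add: b_def)
        then have "(Vinf - e) * (v x)^2 - Vinf * b x = - (e * (v x)^2)" by (simp add: algebra_simps)
        also have "\<dots> \<le> 0" using e by simp
        also have "0 \<le> V x * (v x)^2" using V_pos[of x] by simp
        finally show ?thesis .
      qed
      then show "(norm (grad v x))\<^sup>2 + (v x)\<^sup>2 / (norm (fst x))\<^sup>2 + Vinf * (v x)\<^sup>2 - (e * (v x)\<^sup>2 + Vinf * b x)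
          \<le> (norm (grad v x))\<^sup>2 + (v x)\<^sup>2 / (norm (fst x))\<^sup>2 + V x * (v x)\<^sup>2" by (simp add: left_diff_distrib)
    qed
    finally show ?thesis .
  qed
  define B where "B = R^2 + Vinf * (R^2 / V0) + 1"
  have B: "B > 0" using V0 Vi by (simp add: B_def add_nonneg_pos)
  have WB: "norm1sq (\<lambda>_. Vinf) (u n) \<le> B" for n
  proof -
    \<comment> \<open>Radius 0 and e = Vinf reduce the hypothesis on V to V \<ge> 0; the bound is
      crude but uniform in n.\<close>
    have "norm1sq (\<lambda>_. Vinf) (u n) - (Vinf * n2 (u n) + Vinf * loc_n2 0 (u n)) \<le> norm1sq V (u n)"
      using V_pos by (intro cmp uX Vi) (simp add: less_imp_le)
    moreover have "loc_n2 0 (u n) = 0" by (simp add: loc_n2_def n2_def)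
    moreover have "norm1sq V (u n) \<le> R^2" using power_mono[OF R nrm_nonneg, of n 2] by (simp add: nrm_sq)
    moreover have "Vinf * n2 (u n) \<le> Vinf * (R^2 / V0)" using n2R Vi by (intro mult_left_mono) auto
    ultimately show ?thesis unfolding B_def by simp
  qed
  obtain \<rho>0 where \<rho>0: "\<rho>0 > 0" "\<And>w. X1 V w \<Longrightarrow> 0 < nrm w \<Longrightarrow> nrm w < \<rho>0 \<Longrightarrow> Nf w > 0" by (rule Nf_pos_near_zero) (rule that)
  have n0: "nrm (u n) > 0" for n using not_AE_zero_iff[OF uX] u0 by blast
  have lower: "\<rho>0 \<le> nrm (u n)" for n
  proof (rule ccontr)
    assume "\<not> \<rho>0 \<le> nrm (u n)"
    then have "Nf (u n) > 0" by (intro \<rho>0(2) uX n0) simp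
    then show False by (simp add: uN)
  qed
  have Rp: "R > 0" using n0[of 0] R[of 0] by linarith
  have \<rho>2: "\<rho>0^2 > 0" using \<rho>0 by simp
  obtain \<eta> M \<delta> where \<eta>: "0 < \<eta>" "\<eta> < M" and \<delta>: "\<delta> > 0" and
    mm: "\<And>w. X1 V w \<Longrightarrow> nrm w \<le> R \<Longrightarrow> \<rho>0^2 \<le> (LINT x|lebesgue. f (w x) * w x) \<Longrightarrow> \<delta> \<le> mid_mass \<eta> M w"
    by (rule mid_mass_lower_bound[OF Rp \<rho>2]) (rule that)
  \<comment> \<open>The middle mass does not involve the potential, so the bound derived on the
    Nehari set of V serves for the constant potential too.\<close>
  have mu: "\<delta> \<le> W.mid_mass \<eta> M (u n)" for n
  proof -
    have "(LINT x|lebesgue. f (u n x) * u n x) = (nrm (u n))^2" using uN[of n] by (simp add: Nf_def nrm_sq)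
    then have "\<delta> \<le> mid_mass \<eta> M (u n)" using mm[OF uX R] power_mono[OF lower, of 2 n] \<rho>0 by simp
    then show ?thesis unfolding mid_mass_def W.mid_mass_def .
  qed
  obtain T where T: "T > 0" "\<And>t w. T \<le> t \<Longrightarrow> X1 (\<lambda>_. Vinf) w \<Longrightarrow> \<delta> \<le> W.mid_mass \<eta> M w \<Longrightarrow> norm1sq (\<lambda>_. Vinf) w \<le> B \<Longrightarrow> W.Nf (\<lambda>x. t * w x) < 0"
    by (rule W.Nf_negative_far[OF \<eta>(1) \<delta> B]) (rule that)
  have step: "c1 (\<lambda>_::'y \<times> 'z. Vinf) f \<le> J1 V f (u n) + T^2 / 2 * (e * (R^2 / V0) + Vinf * loc_n2 \<rho> (u n))"
    if e: "e > 0" and \<rho>: "\<And>x. \<rho> \<le> norm x \<Longrightarrow> Vinf - e \<le> V x" for e \<rho> n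
  proof -
    have "W.nrm (u n) > 0" using W.not_AE_zero_iff[OF XW[OF uX]] u0 by blast
    then obtain t where t: "t > 0" "(\<lambda>x. t * u n x) \<in> Nehari1 (\<lambda>_. Vinf) f" by (rule W.Nehari_projection[OF uW])
    \<comment> \<open>Beyond T, which is common to all n, Nf for the constant potential is negative,
      so the projection factor cannot exceed T.\<close>
    have tT: "t \<le> T"
    proof (rule ccontr)
      assume "\<not> t \<le> T"
      then have "W.Nf (\<lambda>x. t * u n x) < 0" by (intro T(2) XW uX mu WB) simp
      then show False using t(2) by (simp add: W.Nehari_iff)
    qed
    define D where "D = e * n2 (u n) + Vinf * loc_n2 \<rho> (u n)"
    define D' where "D' = e * (R^2 / V0) + Vinf * loc_n2 \<rho> (u n)"
    have D0: "0 \<le> D" unfolding D_def using e Vi by (simp add: loc_n2_def)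
    have DD: "D \<le> D'" unfolding D_def D'_def by (intro add_mono mult_left_mono n2R) (use e Vi in auto)
    have "c1 (\<lambda>_::'y \<times> 'z. Vinf) f \<le> J1 (\<lambda>_. Vinf) f (\<lambda>x. t * u n x)" by (rule W.c1_le[OF t(2)])
    also have "\<dots> = t^2 * norm1sq (\<lambda>_. Vinf) (u n) / 2 - (LINT x|lebesgue. prim f (t * u n x))" by (rule W.J_cmult[OF XW[OF uX]])
    also have "\<dots> \<le> t^2 * (norm1sq V (u n) + D) / 2 - (LINT x|lebesgue. prim f (t * u n x))"
    proof (intro diff_right_mono divide_right_mono mult_left_mono)
      have "norm1sq (\<lambda>_. Vinf) (u n) - D \<le> norm1sq V (u n)" unfolding D_def by (rule cmp[OF uX e]) (rule \<rho>)
      then show "norm1sq (\<lambda>_. Vinf) (u n) \<le> norm1sq V (u n) + D" by simp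
    qed auto
    also have "\<dots> = J1 V f (\<lambda>x. t * u n x) + t^2 / 2 * D" unfolding J_cmult[OF uX] by (simp add: field_simps)
    \<comment> \<open>For V itself u n maximises the energy on its ray, so the factor t disappears
      from the main term and is needed only to bound the error.\<close>
    also have "\<dots> \<le> J1 V f (u n) + T^2 / 2 * D'"
      using t tT D0 DD by (intro add_mono J_ray_le uX uN mult_mono divide_right_mono power_mono) auto
    finally show ?thesis by (simp add: D'_def)
  qed
  show ?thesis
  proof (rule field_le_epsilon)
    fix \<epsilon> :: real assume \<epsilon>: "\<epsilon> > 0"
    define K where "K = T^2 / 2 * (R^2 / V0)"
    have K: "K > 0" using T Rp V0 by (simp add: K_def)
    define e where "e = \<epsilon> / K"
    have e: "e > 0" using \<epsilon> K by (simp add: e_def)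
    obtain \<rho> where \<rho>: "\<And>x. \<rho> \<le> norm x \<Longrightarrow> Vinf - e \<le> V x" using Vlim[OF e] by blast
    have "(\<lambda>n. J1 V f (u n) + T^2 / 2 * (e * (R^2 / V0) + Vinf * loc_n2 \<rho> (u n))) \<longlonglongrightarrow> c1 V f + T^2 / 2 * (e * (R^2 / V0) + Vinf * 0)"
      by (intro tendsto_intros J loc)
    then have "c1 (\<lambda>_::'y \<times> 'z. Vinf) f \<le> c1 V f + T^2 / 2 * (e * (R^2 / V0) + Vinf * 0)"
      by (rule LIMSEQ_le_const) (use step[OF e \<rho>] in auto)
    also have "T^2 / 2 * (e * (R^2 / V0) + Vinf * 0) = e * K" by (simp add: K_def)
    also have "e * K = \<epsilon>" using K by (simp add: e_def)
    finally show "c1 (\<lambda>_::'y \<times> 'z. Vinf) f \<le> c1 V f + \<epsilon>" .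
  qed
qed

end

text \<open>Integration by parts from translation invariance: shifting \<psi> by t e or \<phi> by -t
  e gives the same integral, and both derivatives at t = 0 are known.\<close>

lemma test_fun_H1: assumes \<phi>: "test_fun \<phi>" shows "H1 \<phi>"
proof -
  define g where "g x = (\<Sum>e\<in>Basis. frechet_derivative \<phi> (at x) e *\<^sub>R e)" for x
  have ge: "g x \<bullet> e = frechet_derivative \<phi> (at x) e" if "e \<in> Basis" for x e
    using that by (simp add: g_def inner_sum_left inner_Basis if_distrib cong: if_cong)
  have L: "L2 (\<lambda>x. frechet_derivative \<phi> (at x) e *\<^sub>R e)" if "e \<in> Basis" for e
  proof (rule L2_bound[OF test_fun_derivative_L2[OF \<phi>, of e]])
    have "(\<lambda>x. frechet_derivative \<phi> (at x) e) \<in> borel_measurable lebesgue" using test_fun_derivative_L2[OF \<phi>] by (simp add: L2_def)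
    then show "(\<lambda>x. frechet_derivative \<phi> (at x) e *\<^sub>R e) \<in> borel_measurable lebesgue" by measurable
    show "AE x in lebesgue. norm (frechet_derivative \<phi> (at x) e *\<^sub>R e) \<le> norm (frechet_derivative \<phi> (at x) e)" using that by simp
  qed
  have "L2 (\<lambda>x. \<Sum>e\<in>B. frechet_derivative \<phi> (at x) e *\<^sub>R e)" if "finite B" "B \<subseteq> Basis" for B
    using that by (induction rule: finite_induct) (auto intro!: L2_add L)
  then have gL: "L2 g" unfolding g_def[abs_def] by simp
  have "weak_gradient \<phi> g" unfolding weak_gradient_def
  proof (intro conjI allI impI ballI)
    show "g \<in> borel_measurable lebesgue" using gL by (simp add: L2_def)
    fix \<psi> :: "'a \<Rightarrow> real" and e :: 'a assume \<psi>: "test_fun \<psi>" and e: "e \<in> Basis"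
    have eq: "(LINT x|lebesgue. \<phi> x * \<psi> (x + t *\<^sub>R e)) = (LINT x|lebesgue. \<psi> x * \<phi> (x + t *\<^sub>R (- e)))" for t
    proof -
      have "(LINT x|lebesgue. \<psi> x * \<phi> (x + t *\<^sub>R (- e))) = (LINT x|lebesgue. (\<lambda>x. \<psi> x * \<phi> (x + t *\<^sub>R (- e))) (x + t *\<^sub>R e))"
        by (rule mp_integral[OF mp_translation, symmetric])
           (use L2_real_mult_integrable[OF test_fun_L2[OF \<psi>] test_fun_L2[OF test_fun_shift(1)[OF \<phi>, of "t *\<^sub>R (- e)"]]] in auto)
      then show ?thesis by (simp add: mult.commute)
    qed
    have "((\<lambda>t. LINT x|lebesgue. \<phi> x * \<psi> (x + t *\<^sub>R e)) has_real_derivative (LINT x|lebesgue. \<phi> x * frechet_derivative \<psi> (at (x + 0 *\<^sub>R e)) e)) (at 0)"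
      by (rule test_fun_shift_derivative[OF test_fun_L2[OF \<phi>] \<psi>])
    moreover have "((\<lambda>t. LINT x|lebesgue. \<psi> x * \<phi> (x + t *\<^sub>R (- e))) has_real_derivative (LINT x|lebesgue. \<psi> x * frechet_derivative \<phi> (at (x + 0 *\<^sub>R (- e))) (- e))) (at 0)"
      by (rule test_fun_shift_derivative[OF test_fun_L2[OF \<psi>] \<phi>])
    ultimately have "(LINT x|lebesgue. \<phi> x * frechet_derivative \<psi> (at (x + 0 *\<^sub>R e)) e) = (LINT x|lebesgue. \<psi> x * frechet_derivative \<phi> (at (x + 0 *\<^sub>R (- e))) (- e))"
      unfolding eq by (rule DERIV_unique)
    moreover have "frechet_derivative \<phi> (at x) (- e) = - frechet_derivative \<phi> (at x) e" for x
      using linear_neg[OF has_derivative_linear[OF C1_frechet(1)[OF test_fun_C1[OF \<phi>]]]] .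
    ultimately show "(LINT x|lebesgue. \<phi> x * frechet_derivative \<psi> (at x) e) = - (LINT x|lebesgue. (g x \<bullet> e) * \<psi> x)"
      by (simp add: ge[OF e] mult.commute)
  qed
  then show ?thesis using H1_I(1)[OF test_fun_L2[OF \<phi>] _ gL] by blast
qed

text \<open>A bump in |y|^2 and |z|^2 is invariant, and supporting it away from y = 0 makes the
  Hardy term finite. It is what keeps the Nehari set from being empty.\<close>

lemma (in potential) X1G_nontrivial:
  obtains u where "X1G V u" "\<not> (AE x in lebesgue. u x = 0)"
proof -
  define a where "a x = fst x \<bullet> fst x" for x :: "'y \<times> 'z"
  define b where "b x = snd x \<bullet> snd x" for x :: "'y \<times> 'z"
  have C1a: "C1 a" unfolding C1_def a_def[abs_def]
    by (intro exI[of _ "\<lambda>x v. 2 * (fst x \<bullet> fst v)"] conjI allI)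
       (auto intro!: derivative_eq_intros continuous_intros simp: inner_commute)
  have C1b: "C1 b" unfolding C1_def b_def[abs_def]
    by (intro exI[of _ "\<lambda>x v. 2 * (snd x \<bullet> snd v)"] conjI allI)
       (auto intro!: derivative_eq_intros continuous_intros simp: inner_commute)
  \<comment> \<open>p = 1 - (|y|^2 - 4)^2 - |z|^2 is positive only if 3 < |y|^2 < 5 and |z| < 1,
    hence inside the ball of radius 3; it equals 1 at |y| = 2, z = 0.\<close>
  define p where "p x = 1 + (-1) * ((a x + (-4)) * (a x + (-4))) + (-1) * b x" for x
  have "C1 p" unfolding p_def[abs_def] by (intro C1_add C1_mult C1_const C1a C1b)
  define \<phi> where "\<phi> x = (max 0 (p x))^2" for x
  have C1\<phi>: "C1 \<phi>" unfolding \<phi>_def[abs_def] by (rule C1_pos_part_square[OF \<open>C1 p\<close>])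
  have supp: "3 \<le> a x \<and> norm x < 3" if "\<phi> x \<noteq> 0" for x
  proof -
    have "p x > 0" using that by (auto simp: \<phi>_def max_def split: if_splits)
    moreover have "b x \<ge> 0" by (simp add: b_def)
    moreover have "p x = 1 - (a x - 4)^2 - b x" by (simp add: p_def power2_eq_square)
    ultimately have "(a x - 4)^2 < 1" and b1: "b x < 1"
      using zero_le_power2[of "a x - 4"] by linarith+
    then have "\<bar>a x - 4\<bar> < 1" using abs_square_less_1 by blast
    then have a35: "3 < a x" "a x < 5" by auto
    have "(norm x)^2 = a x + b x" by (simp add: power2_norm_eq_inner inner_prod_def a_def b_def)
    also have "\<dots> < 3^2" using a35 b1 by simp
    finally have "norm x < 3" by (rule power_less_imp_less_base) simp
    then show ?thesis using a35 by simp
  qed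
  have t: "test_fun \<phi>" by (rule test_fun_I[OF C1\<phi>, of 3]) (use supp in force)
  have \<phi>c: "continuous_on UNIV \<phi>" by (rule C1_continuous[OF C1\<phi>])
  have [measurable]: "\<phi> \<in> borel_measurable lebesgue" by (rule continuous_lebesgue_measurable[OF \<phi>c])
  have "integrable lebesgue (\<lambda>x. (\<phi> x)^2 / (norm (fst x))^2)"
  proof (rule Bochner_Integration.integrable_bound)
    show "integrable lebesgue (\<lambda>x. (\<phi> x)^2)" using test_fun_L2[OF t] by (simp add: L2_def)
    show "(\<lambda>x. (\<phi> x)^2 / (norm (fst x))^2) \<in> borel_measurable lebesgue"
      using norm_fst_measurable by measurable
    show "AE x in lebesgue. norm ((\<phi> x)^2 / (norm (fst x))^2) \<le> norm ((\<phi> x)^2)"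
    proof (rule AE_I2)
      fix x
      show "norm ((\<phi> x)^2 / (norm (fst x))^2) \<le> norm ((\<phi> x)^2)"
      proof (cases "\<phi> x = 0")
        case False
        then have "1 \<le> (norm (fst x))^2" using supp[OF False] by (simp add: a_def power2_norm_eq_inner)
        then have "(\<phi> x)^2 / (norm (fst x))^2 \<le> (\<phi> x)^2 / 1" by (intro divide_left_mono) auto
        then show ?thesis by simp
      qed simp
    qed
  qed
  moreover have "integrable lebesgue (\<lambda>x. V x * (\<phi> x)^2)"
  proof -
    have "L2 (\<lambda>x. sqrt (V x) * \<phi> x)"
      by (rule L2_continuous_compact_support[of _ 3]) (use supp in \<open>force intro!: continuous_intros Vc \<phi>c\<close>)+
    then show ?thesis using V_pos by (simp add: L2_def power_mult_distrib less_imp_le)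
  qed
  ultimately have X: "X1 V \<phi>" using test_fun_H1[OF t] by (simp add: X1_def)
  have "G_invariant \<phi>" unfolding G_invariant_def
  proof (intro allI impI)
    fix A :: "'y \<Rightarrow> 'y" and y z assume "orthogonal_transformation A"
    then have "A y \<bullet> A y = y \<bullet> y" by (simp add: orthogonal_transformation_def)
    then show "\<phi> (A y, z) = \<phi> (y, z)" by (simp add: \<phi>_def p_def a_def b_def)
  qed
  then have G: "X1G V \<phi>" using X by (simp add: X1G_def)
  obtain e :: 'y where e: "e \<in> Basis" using nonempty_Basis by blast
  have "\<phi> (2 *\<^sub>R e, 0) = 1" using e by (simp add: \<phi>_def p_def a_def b_def)
  then have ne: "{x. \<phi> x \<noteq> 0} \<noteq> {}" by (metis (mono_tags, lifting) empty_Collect_eq zero_neq_one)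
  have "open {x. \<phi> x \<noteq> 0}" using \<phi>c by (intro open_Collect_neq continuous_intros)
  then have "\<not> negligible {x. \<phi> x \<noteq> 0}" using ne by (rule open_not_negligible)
  moreover have "negligible {x. \<phi> x \<noteq> 0}" if "AE x in lebesgue. \<phi> x = 0"
    using that unfolding completion.AE_iff_null_sets negligible_iff_null_sets by simp
  ultimately show ?thesis using that G by blast
qed

lemma (in variational) Nehari_dichotomy:
  assumes Vinv: "G_invariant V" and Vi: "Vinf > 0" and Vlim: "\<And>e. e > 0 \<Longrightarrow> \<exists>\<rho>. \<forall>x. \<rho> \<le> norm x \<longrightarrow> Vinf - e \<le> V x"
  shows "(\<exists>u. X1G V u \<and> \<not> (AE x in lebesgue. u x = 0) \<and> J1_critical V f u \<and> J1 V f u = c1 V f)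
    \<or> c1 (\<lambda>_::'y \<times> 'z. Vinf) f \<le> c1 V f"
proof -
  obtain w where w: "X1G V w" "\<not> (AE x in lebesgue. w x = 0)" by (rule X1G_nontrivial) (rule that)
  then have "nrm w > 0" using not_AE_zero_iff[OF X1G_X1] by blast
  then obtain t where "t > 0" "(\<lambda>x. t * w x) \<in> Nehari1 V f" by (rule Nehari_projection[OF w(1)])
  \<comment> \<open>c1 is an \<open>Inf\<close> of reals, so minimising sequences exist only once
    the set is known to be nonempty.\<close>
  then have ne: "J1 V f ` Nehari1 V f \<noteq> {}" by auto
  have "\<exists>u\<in>Nehari1 V f. J1 V f u < c1 V f + 1 / real (Suc n)" for n
    using cInf_lessD[OF ne, of "c1 V f + 1 / real (Suc n)"] by (auto simp: c1_def)
  then obtain v where v: "\<And>n. v n \<in> Nehari1 V f" "\<And>n. J1 V f (v n) < c1 V f + 1 / real (Suc n)" by metis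
  have vJ: "J1 V f (v n) \<le> c1 V f + 1" for n
  proof -
    have "1 / real (Suc n) \<le> 1" by simp
    then show ?thesis using v(2)[of n] by linarith
  qed
  have limJ: "(\<lambda>n. J1 V f (v n)) \<longlonglongrightarrow> c1 V f"
  proof (rule tendsto_sandwich[OF _ _ tendsto_const])
    show "\<forall>\<^sub>F n in sequentially. c1 V f \<le> J1 V f (v n)" using c1_le[OF v(1)] by simp
    show "\<forall>\<^sub>F n in sequentially. J1 V f (v n) \<le> c1 V f + 1 / real (Suc n)" using v(2) by (intro always_eventually allI less_imp_le)
    show "(\<lambda>n. c1 V f + 1 / real (Suc n)) \<longlonglongrightarrow> c1 V f"
      using tendsto_add[OF tendsto_const[of "c1 V f"] LIMSEQ_Suc[OF lim_1_over_n]] by simp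
  qed
  obtain R where R: "R > 0" "\<And>u. u \<in> Nehari1 V f \<Longrightarrow> J1 V f u \<le> c1 V f + 1 \<Longrightarrow> nrm u \<le> R"
    by (rule Nehari_bounded) (rule that)
  have vR: "nrm (v n) \<le> R" for n by (rule R(2)[OF v(1) vJ])
  have vG: "X1G V (v n)" for n using v(1)[of n] by (simp add: Nehari_iff)
  have vM: "norm1sq V (v n) \<le> R^2" for n using power_mono[OF vR nrm_nonneg, of n 2] by (simp add: nrm_sq)
  obtain \<kappa> U where \<kappa>: "strict_mono (\<kappa>::nat\<Rightarrow>nat)" and Ud: "U = (\<lambda>x. lim (\<lambda>n. v (\<kappa> n) x))" and UX: "X1 V U"
    and ae: "AE x in lebesgue. (\<lambda>n. v (\<kappa> n) x) \<longlonglongrightarrow> U x"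
    and loc: "\<And>R. (\<lambda>n. loc_n2 R (\<lambda>x. v (\<kappa> n) x - U x)) \<longlonglongrightarrow> 0"
    and wk: "\<And>h. X1 V h \<Longrightarrow> (\<lambda>n. E (v (\<kappa> n)) h) \<longlonglongrightarrow> E U h"
    by (rule X1_compact[OF X1G_X1[OF vG] vM]) (rule that)
  have kJ: "(\<lambda>n. J1 V f (v (\<kappa> n))) \<longlonglongrightarrow> c1 V f" using LIMSEQ_subseq_LIMSEQ[OF limJ \<kappa>] by (simp add: o_def)
  \<comment> \<open>Each \<open>v n\<close> is invariant at every point, so the sequences defining
    the \<open>lim\<close> agree along orbits, also where they diverge.\<close>
  have UG: "X1G V U" using UX vG unfolding X1G_def G_invariant_def Ud by simp
  show ?thesis
  proof (cases "AE x in lebesgue. U x = 0")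
    case True
    have eq: "loc_n2 \<rho> (v (\<kappa> n)) = loc_n2 \<rho> (\<lambda>x. v (\<kappa> n) x - U x)" for \<rho> n
      unfolding loc_n2_def
    proof (rule n2_AE_cong)
      show "(\<lambda>x. indicator (ball 0 \<rho>) x *\<^sub>R (v (\<kappa> n) x - U x)) \<in> borel_measurable lebesgue"
        by (intro L2_measurable L2_indicator L2_diff X1_L2 X1G_X1 vG UG) simp
      show "AE x in lebesgue. indicator (ball 0 \<rho>) x *\<^sub>R v (\<kappa> n) x = indicator (ball 0 \<rho>) x *\<^sub>R (v (\<kappa> n) x - U x)"
        using True by eventually_elim simp
    qed
    have "c1 (\<lambda>_::'y \<times> 'z. Vinf) f \<le> c1 V f"
      by (rule vanishing_limit[OF Vi Vlim v(1) kJ vR]) (simp_all add: eq loc)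
    then show ?thesis by simp
  next
    case False
    then show ?thesis using nontrivial_limit[OF Vinv v(1) kJ vR UG False ae wk] UG by blast
  qed
qed

text \<open>The gap q - p is converted into an arbitrarily small factor at infinity.\<close>

lemma subcritical_growth:
  fixes p q C :: real
  assumes pq: "1 < p" "p < q" and b: "\<And>u. \<bar>f u\<bar> \<le> C * (1 + \<bar>u\<bar> powr (p - 1))" and e: "e > 0"
  shows "\<exists>M>0. \<forall>a. M \<le> \<bar>a\<bar> \<longrightarrow> \<bar>f a\<bar> \<le> e * \<bar>a\<bar> powr (q - 1)"
proof -
  define D where "D = \<bar>C\<bar> + 1"
  \<comment> \<open>Beyond M one has |a|^(q-p) \<ge> 2 D / e, and |a| \<ge> 1 lets the constant 1 be
    absorbed into the power at the cost of the factor 2.\<close>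
  define M where "M = max 1 ((2 * D / e) powr (1 / (q - p)))"
  have D: "D > 0" by (simp add: D_def)
  have "\<bar>f a\<bar> \<le> e * \<bar>a\<bar> powr (q - 1)" if a: "M \<le> \<bar>a\<bar>" for a
  proof -
    have a1: "1 \<le> \<bar>a\<bar>" using a by (simp add: M_def)
    have "2 * D / e = ((2 * D / e) powr (1 / (q - p))) powr (q - p)" using pq D e by (simp add: powr_powr)
    also have "\<dots> \<le> \<bar>a\<bar> powr (q - p)" using a pq by (intro powr_mono2) (auto simp: M_def)
    finally have De: "2 * D \<le> e * \<bar>a\<bar> powr (q - p)" using e by (simp add: field_simps)
    have "1 \<le> \<bar>a\<bar> powr (p - 1)" using a1 pq by (intro ge_one_powr_ge_zero) auto
    then have s: "1 + \<bar>a\<bar> powr (p - 1) \<le> 2 * \<bar>a\<bar> powr (p - 1)" by simp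
    have "\<bar>f a\<bar> \<le> C * (1 + \<bar>a\<bar> powr (p - 1))" by (rule b)
    also have "\<dots> \<le> D * (1 + \<bar>a\<bar> powr (p - 1))" by (intro mult_right_mono) (auto simp: D_def)
    also have "\<dots> \<le> D * (2 * \<bar>a\<bar> powr (p - 1))" using s D by (intro mult_left_mono) auto
    also have "\<dots> = (2 * D) * \<bar>a\<bar> powr (p - 1)" by simp
    also have "\<dots> \<le> (e * \<bar>a\<bar> powr (q - p)) * \<bar>a\<bar> powr (p - 1)" using De by (intro mult_right_mono) auto
    also have "\<dots> = e * \<bar>a\<bar> powr (q - 1)" by (simp add: mult.assoc flip: powr_add)
    finally show ?thesis .
  qed
  then show ?thesis by (intro exI[of _ M]) (auto simp: M_def)
qed

theorem theorem4p2:
  fixes V :: "'y::euclidean_space \<times> 'z::euclidean_space \<Rightarrow> real"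
    and f :: "real \<Rightarrow> real"
    and Vinf :: real
  defines "N \<equiv> real (DIM('y) + DIM('z))"
  assumes K2: "DIM('y) \<ge> 2"
    and Vcont: "continuous_on UNIV V"
    and Vinv: "G_invariant V"
    and Vbdd: "bdd_below (range V)"
    and V0pos: "0 < (INF x. V x)"
    and V0le: "(INF x. V x) \<le> V 0"
    and Vinf: "V 0 < Vinf"
    and Vliminf: "ereal Vinf \<le> Liminf at_infinity (\<lambda>x. ereal (V x))"
    and F1: "continuous_on UNIV f"
    and F1g: "\<exists>p C. 2 < p \<and> p < 2 * N / (N - 2) \<and> (\<forall>u. \<bar>f u\<bar> \<le> C * (1 + \<bar>u\<bar> powr (p - 1)))"
    and F2: "((\<lambda>u. f u / u) \<longlongrightarrow> 0) (at 0)"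
    and F3: "filterlim (\<lambda>u. prim f u / u^2) at_top at_infinity"
    and F4pos: "strict_mono_on {0<..} (\<lambda>u. f u / \<bar>u\<bar>)"
    and F4neg: "strict_mono_on {..<0} (\<lambda>u. f u / \<bar>u\<bar>)"
  shows "(\<exists>u. X1G V u \<and> \<not> (AE x in lebesgue. u x = 0) \<and> J1_critical V f u \<and> J1 V f u = c1 V f)
         \<or> c1 V f \<ge> mk TYPE('y) TYPE('z) Vinf f"
proof -
  obtain p C where p: "2 < p" "p < 2 * N / (N - 2)" "\<And>u. \<bar>f u\<bar> \<le> C * (1 + \<bar>u\<bar> powr (p - 1))" using F1g by blast
  \<comment> \<open>Any exponent strictly between p and the critical one would do: the gap above p
    gives \<open>f_large\<close>, the gap below the critical exponent gives the Sobolev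
    bound.\<close>
  define q where "q = (p + 2 * N / (N - 2)) / 2"
  have q: "p < q" "q < 2 * N / (N - 2)" "2 < q" using p by (auto simp: q_def)
  \<comment> \<open>K \<ge> 2 and at least one further dimension give N \<ge> 3, so the critical
    exponent is finite.\<close>
  have d3: "3 \<le> DIM('y) + DIM('z)" using K2 DIM_positive[where 'a='z] by linarith
  interpret variational V "INF x. V x" f q
  proof unfold_locales
    show "(INF x. V x) \<le> V x" for x using Vbdd by (intro cINF_lower) auto
    show "\<exists>M>0. \<forall>a. M \<le> \<bar>a\<bar> \<longrightarrow> \<bar>f a\<bar> \<le> e * \<bar>a\<bar> powr (q - 1)" if "e > 0" for e
      using p q by (intro subcritical_growth[where p=p and C=C] that) auto
    show "q < 2 * real (DIM('y) + DIM('z)) / (real (DIM('y) + DIM('z)) - 2)" using q by (simp add: N_def)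
  qed (fact Vcont V0pos F1 q(3) F2 F3 F4pos F4neg d3)+
  have "\<exists>\<rho>. \<forall>x. \<rho> \<le> norm x \<longrightarrow> Vinf - e \<le> V x" if "e > 0" for e
  proof -
    have "ereal (Vinf - e) < Liminf at_infinity (\<lambda>x. ereal (V x))"
      using that by (intro less_le_trans[OF _ Vliminf]) simp
    then have "\<forall>\<^sub>F x in at_infinity. ereal (Vinf - e) < ereal (V x)" by (rule less_LiminfD)
    then show ?thesis unfolding eventually_at_infinity by (auto intro: less_imp_le)
  qed
  moreover have "Vinf > 0" using V0pos V0le Vinf by linarith
  ultimately show ?thesis using Nehari_dichotomy[OF Vinv] unfolding mk_eq_c1 by blast
qed

end
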